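(* Let $Z^\pm\subset S^2$ be a zipper. Then there is a CaTherine wheel $f:S^1\to S^2$ with $Z^+=\bigcup_I Z^+(I)$ and $Z^-=\bigcup_I Z^-(I)$ if and only if $Z^\pm$ is hairy and has the strong landing property.
   Context: A zipper is a pair of nonempty subsets $Z^+,Z^-\subset S^2$ that are disjoint, each dense in $S^2$, each consisting entirely of path cut points, and each a countable increasing union of finite trees. It is hairy if for every closed oriented arc $I$ embedded in $Z^+$ there are nontrivial rays in $Z^+$ starting on $I$, meeting $I$ only at their initial points, lying respectively to the right and to the left of $I$ in $S^2$, and similarly for $Z^-$. It has the strong landing property if every embedded $r:[0,1)\to Z^+$ extends to an embedded $\bar r:[0,1]\to S^2$ with (type 0) $\bar r(1)\in Z^+$, or (type 1) $\bar r(1)\in S^2\setminus(Z^+\cup Z^-)$ and some embedded $s:[0,1)\to Z^-$ extends to $\bar s$ with $\bar s(1)=\bar r(1)$, or (type 2) $\bar r(1)\in Z^-$; and conversely every point of $S^2$ is $\bar r(1)$ for some such $r$; and similarly with $Z^\pm$ exchanged. A CaTherine wheel is a continuous surjection $f:S^1\to S^2$ ($S^1,S^2$ oriented) with $f(I)$ a closed disk and $f(\partial I)\subset\partial f(I)$ for every closed interval $I\subset S^1$ (closed subset homeomorphic to $[0,1]$). For each closed interval $I$, each component $Y$ of $\partial f(I)\setminus f(\partial I)$ has a unique (canonical) orientation making $f:I\cap f^{-1}(Y)\to Y$ monotone increasing (with $I$ oriented from $S^1$); $Z^+(I)$ (resp. $Z^-(I)$) is the component whose canonical orientation agrees (resp.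 disagrees) with its orientation as boundary of the disk $f(I)\subset S^2$, or $\emptyset$ if there is none. *)

theory Defs
  imports "HOL-Complex_Analysis.Complex_Analysis" "HOL-Analysis.Cross3"
begin

text \<open>S^1 is the unit circle in the complex plane, oriented counterclockwise.
  S^2 is the unit sphere in R^3, oriented as the boundary of the unit ball
  (outward normal).\<close>

definition S1 :: "complex set" where "S1 = sphere 0 1"

definition S2 :: "(real^3) set" where "S2 = sphere 0 1"

definition pos_frame :: "real^3 \<Rightarrow> real^3 \<Rightarrow> real^3 \<Rightarrow> bool" where
  "pos_frame b e1 e2 \<longleftrightarrow> b \<in> S2 \<and> e1 \<bullet> e1 = 1 \<and> e2 \<bullet> e2 = 1 \<and> e1 \<bullet> e2 = 0
      \<and> e1 \<bullet> b = 0 \<and> e2 \<bullet> b = 0 \<and> cross3 e1 e2 = b"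

text \<open>Stereographic projection from the point b of S^2 onto the complex plane,
  normalised so that it is orientation preserving (S^2 with outward orientation).\<close>
definition stereo :: "real^3 \<Rightarrow> real^3 \<Rightarrow> real^3 \<Rightarrow> real^3 \<Rightarrow> complex" where
  "stereo b e1 e2 x = Complex (x \<bullet> e1) (- (x \<bullet> e2)) / complex_of_real (1 - x \<bullet> b)"

text \<open>For a Jordan curve J in S^2 (a simple closed path), x lies in the complementary
  component of J on the left of J: after orientation preserving stereographic projection
  from a point b of the other complementary component, J winds once positively around x.\<close>
definition left_region :: "(real \<Rightarrow> real^3) \<Rightarrow> real^3 \<Rightarrow> bool" where
  "left_region J x \<longleftrightarrow> x \<in> S2 \<and> x \<notin> path_image J \<and>
     (\<exists>b e1 e2. pos_frame b e1 e2 \<and> b \<notin> path_image J \<and> b \<noteq> x \<and>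
        winding_number (stereo b e1 e2 \<circ> J) (stereo b e1 e2 x) = 1)"

definition emb_ray :: "(real^3) set \<Rightarrow> (real \<Rightarrow> real^3) \<Rightarrow> bool" where
  "emb_ray Z r \<longleftrightarrow> r ` {0..<1} \<subseteq> Z \<and> (\<exists>g. homeomorphism {0..<1} (r ` {0..<1}) r g)"

text \<open>The ray r starts at an interior point of the oriented arc \<gamma>, meets \<gamma> only at
  its initial point, and (near its initial point) lies to the left of \<gamma>.  The left side is
  determined by closing \<gamma> to a Jordan curve \<gamma> +++ \<sigma> (the answer does not depend
  on \<sigma>, since only a neighbourhood of the initial point matters).\<close>
definition ray_left_of :: "(real \<Rightarrow> real^3) \<Rightarrow> (real \<Rightarrow> real^3) \<Rightarrow> bool" where
  "ray_left_of \<gamma> r \<longleftrightarrow>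
     (\<exists>t0. 0 < t0 \<and> t0 < 1 \<and> r 0 = \<gamma> t0) \<and>
     (\<forall>s\<in>{0<..<1}. r s \<notin> path_image \<gamma>) \<and>
     (\<exists>\<sigma>. arc \<sigma> \<and> path_image \<sigma> \<subseteq> S2 \<and> pathstart \<sigma> = pathfinish \<gamma> \<and>
          pathfinish \<sigma> = pathstart \<gamma> \<and>
          path_image \<sigma> \<inter> path_image \<gamma> = {pathstart \<gamma>, pathfinish \<gamma>} \<and>
          (\<exists>\<epsilon>>0. \<epsilon> < 1 \<and> (\<forall>s\<in>{0<..\<epsilon>}. left_region (\<gamma> +++ \<sigma>) (r s))))"

definition ray_right_of :: "(real \<Rightarrow> real^3) \<Rightarrow> (real \<Rightarrow> real^3) \<Rightarrow> bool" where
  "ray_right_of \<gamma> r \<longleftrightarrow> ray_left_of (reversepath \<gamma>) r"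

definition path_cut_point :: "(real^3) set \<Rightarrow> real^3 \<Rightarrow> bool" where
  "path_cut_point Z x \<longleftrightarrow> x \<in> Z \<and> \<not> path_connected (Z - {x})"

definition finite_tree :: "(real^3) set \<Rightarrow> bool" where
  "finite_tree T \<longleftrightarrow>
     ((\<exists>x. T = {x}) \<or> (\<exists>A. finite A \<and> A \<noteq> {} \<and> T = \<Union>A \<and> (\<forall>a\<in>A. \<exists>g. arc g \<and> a = path_image g)))
     \<and> connected T
     \<and> \<not> (\<exists>c. simple_path c \<and> pathstart c = pathfinish c \<and> path_image c \<subseteq> T)"

definition zipper :: "(real^3) set \<Rightarrow> (real^3) set \<Rightarrow> bool" where
  "zipper Zp Zm \<longleftrightarrow>
     (\<forall>Z\<in>{Zp, Zm}. Z \<noteq> {} \<and> Z \<subseteq> S2 \<and> S2 \<subseteq> closure Z \<and>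
        (\<forall>x\<in>Z. path_cut_point Z x) \<and>
        (\<exists>T::nat \<Rightarrow> (real^3) set. (\<forall>n. finite_tree (T n)) \<and> (\<forall>n. T n \<subseteq> T (Suc n)) \<and>
              Z = (\<Union>n. T n)))
     \<and> Zp \<inter> Zm = {}"

definition hairy_set :: "(real^3) set \<Rightarrow> bool" where
  "hairy_set Z \<longleftrightarrow>
     (\<forall>\<gamma>. arc \<gamma> \<and> path_image \<gamma> \<subseteq> Z \<longrightarrow>
        (\<exists>r. emb_ray Z r \<and> ray_right_of \<gamma> r) \<and> (\<exists>r. emb_ray Z r \<and> ray_left_of \<gamma> r))"

definition hairy :: "(real^3) set \<Rightarrow> (real^3) set \<Rightarrow> bool" where
  "hairy Zp Zm \<longleftrightarrow> hairy_set Zp \<and> hairy_set Zm"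

definition extends_ray :: "(real \<Rightarrow> real^3) \<Rightarrow> (real \<Rightarrow> real^3) \<Rightarrow> bool" where
  "extends_ray r rb \<longleftrightarrow> arc rb \<and> path_image rb \<subseteq> S2 \<and> (\<forall>s\<in>{0..<1}. rb s = r s)"

definition good_landing :: "(real^3) set \<Rightarrow> (real^3) set \<Rightarrow> (real \<Rightarrow> real^3) \<Rightarrow> (real \<Rightarrow> real^3) \<Rightarrow> bool" where
  "good_landing Zp Zm r rb \<longleftrightarrow> extends_ray r rb \<and>
     (rb 1 \<in> Zp
      \<or> (rb 1 \<in> S2 - (Zp \<union> Zm) \<and> (\<exists>s sb. emb_ray Zm s \<and> extends_ray s sb \<and> sb 1 = rb 1))
      \<or> rb 1 \<in> Zm)"

definition strong_landing_half :: "(real^3) set \<Rightarrow> (real^3) set \<Rightarrow> bool" where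
  "strong_landing_half Zp Zm \<longleftrightarrow>
     (\<forall>r. emb_ray Zp r \<longrightarrow> (\<exists>rb. good_landing Zp Zm r rb)) \<and>
     (\<forall>x\<in>S2. \<exists>r rb. emb_ray Zp r \<and> good_landing Zp Zm r rb \<and> rb 1 = x)"

definition strong_landing :: "(real^3) set \<Rightarrow> (real^3) set \<Rightarrow> bool" where
  "strong_landing Zp Zm \<longleftrightarrow> strong_landing_half Zp Zm \<and> strong_landing_half Zm Zp"

definition closed_interval_S1 :: "complex set \<Rightarrow> bool" where
  "closed_interval_S1 I \<longleftrightarrow> I \<subseteq> S1 \<and> closed I \<and> I homeomorphic {0..1::real}"

definition ccw_param :: "complex set \<Rightarrow> real \<Rightarrow> real \<Rightarrow> bool" where
  "ccw_param I a b \<longleftrightarrow> a < b \<and> b < a + 2 * pi \<and> I = cis ` {a..b}"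

definition iv_le :: "complex set \<Rightarrow> complex \<Rightarrow> complex \<Rightarrow> bool" where
  "iv_le I s t \<longleftrightarrow> (\<exists>a b u v. ccw_param I a b \<and> a \<le> u \<and> u \<le> v \<and> v \<le> b \<and> s = cis u \<and> t = cis v)"

definition iv_ends :: "complex set \<Rightarrow> complex set" where
  "iv_ends I = {s. \<exists>a b. ccw_param I a b \<and> (s = cis a \<or> s = cis b)}"

definition closed_disk :: "(real^3) set \<Rightarrow> bool" where
  "closed_disk D \<longleftrightarrow> D homeomorphic cball (0::complex) 1"

definition disk_bdry :: "(real^3) set \<Rightarrow> (real^3) set" where
  "disk_bdry D = (SOME B. \<exists>h k. homeomorphism (cball (0::complex) 1) D h k \<and> B = h ` sphere 0 1)"

definition catherine_wheel :: "(complex \<Rightarrow> real^3) \<Rightarrow> bool" where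
  "catherine_wheel f \<longleftrightarrow> continuous_on S1 f \<and> f ` S1 = S2 \<and>
     (\<forall>I. closed_interval_S1 I \<longrightarrow> closed_disk (f ` I) \<and> f ` iv_ends I \<subseteq> disk_bdry (f ` I))"

definition bdry_loop :: "(complex \<Rightarrow> real^3) \<Rightarrow> complex set \<Rightarrow> (real \<Rightarrow> real^3) \<Rightarrow> bool" where
  "bdry_loop f I g \<longleftrightarrow> simple_path g \<and> pathstart g = pathfinish g \<and>
     path_image g = disk_bdry (f ` I) \<and>
     (\<forall>x \<in> f ` I - disk_bdry (f ` I). left_region g x) \<and> g 0 \<in> f ` iv_ends I"

text \<open>The canonical orientation of Y (the one for which f is monotone increasing on
  I \<inter> f^-1(Y)) agrees (resp. disagrees) with its orientation as part of the
  boundary of the disk f(I).\<close>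
definition canon_agrees :: "(complex \<Rightarrow> real^3) \<Rightarrow> complex set \<Rightarrow> (real^3) set \<Rightarrow> bool" where
  "canon_agrees f I Y \<longleftrightarrow> (\<exists>g. bdry_loop f I g \<and>
     (\<forall>s t u v. s \<in> I \<and> t \<in> I \<and> f s \<in> Y \<and> f t \<in> Y \<and> iv_le I s t \<and>
        u \<in> {0..1} \<and> v \<in> {0..1} \<and> g u = f s \<and> g v = f t \<longrightarrow> u \<le> v))"

definition canon_disagrees :: "(complex \<Rightarrow> real^3) \<Rightarrow> complex set \<Rightarrow> (real^3) set \<Rightarrow> bool" where
  "canon_disagrees f I Y \<longleftrightarrow> (\<exists>g. bdry_loop f I g \<and>
     (\<forall>s t u v. s \<in> I \<and> t \<in> I \<and> f s \<in> Y \<and> f t \<in> Y \<and> iv_le I s t \<and>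
        u \<in> {0..1} \<and> v \<in> {0..1} \<and> g u = f s \<and> g v = f t \<longrightarrow> v \<le> u))"

text \<open>Z^+(I), Z^-(I): the component (if any) of \<partial>f(I) - f(\<partial>I) whose canonical orientation
  agrees (resp. disagrees) with the boundary orientation; written as the union of all such
  components, which is that component or the empty set.\<close>
definition Zplus_of :: "(complex \<Rightarrow> real^3) \<Rightarrow> complex set \<Rightarrow> (real^3) set" where
  "Zplus_of f I = \<Union>{Y \<in> components (disk_bdry (f ` I) - f ` iv_ends I). canon_agrees f I Y}"

definition Zminus_of :: "(complex \<Rightarrow> real^3) \<Rightarrow> complex set \<Rightarrow> (real^3) set" where
  "Zminus_of f I = \<Union>{Y \<in> components (disk_bdry (f ` I) - f ` iv_ends I). canon_disagrees f I Y}"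

end

theory Submission
  imports Defs
begin

text \<open>
  Fix base points \<open>o\<^sup>\<plusminus> \<in> Z\<^sup>\<plusminus>\<close>.  By strong landing every point \<open>x\<close> of the sphere is the transition point \<open>X g\<close> of an arc \<open>g\<close> from \<open>o\<^sup>+\<close> to
  \<open>o\<^sup>-\<close> which runs in \<open>Z\<^sup>+\<close> before \<open>x\<close> and in \<open>Z\<^sup>-\<close> after \<open>x\<close>.  Since \<open>Z\<^sup>\<plusminus>\<close> contain no Jordan curves, two such arcs share an initial
  and a final piece and bound a Jordan curve; winding numbers are additive along these curves, so the left sides \<open>R g h\<close>
  define a cyclic order on the arcs.  A cut of this order is represented by a nested intersection of cells, a continuum which meets the
  complement of \<open>Z\<^sup>+ \<union> Z\<^sup>-\<close> in finitely many points; by Baire a nondegenerate one would contain an arc of \<open>Z\<^sup>\<plusminus>\<close>, and hairs on both sides of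
  such an arc separate it.  So cells shrink to points, the order has no gaps and is a circle, and \<open>g \<mapsto> X g\<close> is the wheel; the image of an
  interval is a closed cell, which is a disk by the Jordan-Schoenflies theorem (proved via boundary values of the Riemann map).

  Conversely, for a wheel disjoint intervals have images with disjoint interiors, and crossing chords show that the wheel is monotone on
  both boundary arcs of the image of an interval.  Excursions from such an arc are hairs, and unique arcs in \<open>Z\<^sup>\<plusminus>\<close> meet the disk of each short
  interval in a connected set, which makes rays converge.
\<close>

text \<open>The wheel is not injective, so points of the sphere cannot be ordered cyclically, but
  the arcs through them can: a point may be the transition point of several arcs, one for each time
  at which the wheel visits it. The order becomes accessible because the loop formed by two arcs has
  as winding number the difference of the winding numbers of the arcs (\<open>wnum_Jc\<close>). For
  three arcs these differences cancel, so the number of the regions \<open>R a b\<close>,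
  \<open>R b c\<close>, \<open>R c a\<close> containing a generic point is constant: 1 for one
  cyclic order and 2 for the other. Much planar geometry is thereby replaced by counting.
  Completeness of the order requires the construction of an arc: when the cells across a gap shrink
  to a point of \<open>Zp\<close>, a tail in \<open>Zm\<close> is threaded through them. The passage
  from the complete order to the circle is an explicit embedding into the reals, a weighted sum of
  distances from a dense sequence. Exchanging \<open>Zp\<close> and \<open>Zm\<close> reverses the
  arcs and with them the cyclic order, so most arguments are carried out for \<open>Zp\<close>
  only.\<close>

abbreviation (input) "pim \<equiv> path_image"
abbreviation (input) "rvp \<equiv> reversepath"
abbreviation (input) "pst \<equiv> pathstart"
abbreviation (input) "pfn \<equiv> pathfinish"
lemmas pim_def = path_image_def and pst_def = pathstart_def and pfn_def = pathfinish_def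


section \<open>Boundary values of Riemann maps and the Jordan-Schoenflies theorem\<close>

text \<open>Lindelof's device: multiply the \<open>m\<close> rotates of \<open>g\<close> about
  \<open>c\<close> and apply the maximum principle on the intersection of the rotated copies of
  \<open>G\<close> with the disk of radius \<open>R\<close>. By \<open>circ\<close> the closure of
  this intersection stays off the circle, so at each of its boundary points some rotate lies on
  \<open>frontier G\<close>; that factor is at most \<open>e\<close>, the others at most
  \<open>M\<close>.\<close>

lemma rotation_product_bound:
 fixes g :: "complex => complex"
 assumes G: "open G" "c:G" and R: "R > 0" and m: "m > 0"
  and hol: "g holomorphic_on G" and M: "!!z. z:G ==> norm (g z)<=M" and e: "e >= 0"
  and circ: "!!z. dist z c = R ==> EX k<m. c + cis (2*pi*real k/real m) * (z - c) ~: closure G"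
  and fro: "!!p. p:frontier G ==> dist p c < R ==> EX d>0. ALL z:G. dist z p < d --> norm (g z)<=e"
 shows "norm (g c) ^ m<=e * M ^ (m - 1)"
proof (rule ccontr)
 assume neg: "~ ?thesis"
 define rot where "rot k z = c + cis (2*pi*real k/real m) * (z - c)" for k z
 define W where "W = ball c R Int (\<Inter>k\<in>{..<m}. rot k -` G)"
 define P where "P z = (\<Prod>k<m. g (rot k z))" for z
 have controt: "continuous_on UNIV (rot k)" for k
  unfolding rot_def by (intro continuous_intros)
 have holrot: "rot k holomorphic_on X" for k X
  unfolding rot_def by (intro holomorphic_intros)
 have rotc: "rot k c = c" for k by (simp add: rot_def)
 have distrot: "dist (rot k z) c = dist z c" for k z
  by (simp add: rot_def dist_norm norm_mult)
 have M0: "M >= 0" using M[OF G(2)] norm_ge_zero order_trans by blast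
 have openW: "open W"
  unfolding W_def using open_vimage[OF G(1) controt] by (intro open_Int open_INT) auto
 have cW: "c:W" using G R by (auto simp: W_def rotc)
 have holP: "P holomorphic_on W"
  unfolding P_def
 proof (rule holomorphic_on_prod)
  fix k assume k: "k:{..<m}"
  have "(g o rot k) holomorphic_on W"
   by (rule holomorphic_on_compose_gen[OF holrot hol]) (use k in \<open>auto simp: W_def\<close>)
  thus "(%x. g (rot k x)) holomorphic_on W" by (simp add: o_def)
 qed
 have PW: "norm (P z)<=norm (g (rot k z)) * M ^ (m - 1)" if "z:W" "k < m" for z k
 proof -
  have "norm (P z) = (\<Prod>k<m. norm (g (rot k z)))" by (simp add: P_def prod_norm)
  also have "\<dots> = norm (g (rot k z)) * (\<Prod>j\<in>{..<m}-{k}. norm (g (rot j z)))"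
   using that by (simp add: prod.remove)
  also have "(\<Prod>j\<in>{..<m}-{k}. norm (g (rot j z)))<=(\<Prod>j\<in>{..<m}-{k}. M)"
   by (rule prod_mono) (use that M in \<open>auto simp: W_def\<close>)
  also have "(\<Prod>j\<in>{..<m}-{k}. M) = M ^ (m - 1)"
   using that by simp
  finally show ?thesis by (simp add: mult_left_mono)
 qed
 define s where "s = norm (P c)"
 have s: "s > e * M ^ (m - 1)"
  using neg by (simp add: s_def P_def rotc norm_power)
 \<comment> \<open>If the bound fails, the superlevel set \<open>S\<close> is closed in the plane,
   so \<open>norm P\<close> attains its maximum over \<open>W\<close> in it. The maximum principle
   then makes the set \<open>Q\<close> of maximum points open, closed, bounded and nonempty, which
   is absurd.\<close>
 define S where "S = {z\<in>W. norm (P z) >= s}"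
 have cS: "c:S" using cW by (simp add: S_def s_def)
 have contP: "continuous_on W P" using holP holomorphic_on_imp_continuous_on by blast
 have "closed S"
 proof (subst closed_sequential_limits, intro allI impI)
  fix f l assume "(ALL n. f n:S) & f \<longlonglongrightarrow> l"
  hence fS: "!!n. f n:S" and fl: "f \<longlonglongrightarrow> l" by auto
  have rl: "(%n. rot k (f n)) \<longlonglongrightarrow> rot k l" for k
   by (rule continuous_on_tendsto_compose[OF controt fl]) auto
  have cl: "rot k l:closure G" if "k < m" for k
   unfolding closure_sequential using rl fS that by (intro exI[of _ "%n. rot k (f n)"]) (auto simp: S_def W_def)
  have "(%n. dist (f n) c) \<longlonglongrightarrow> dist l c" by (intro tendsto_intros fl)
  hence "dist l c<=R"
   by (rule LIMSEQ_le_const2) (use fS in \<open>auto simp: S_def W_def dist_commute intro!: exI[of _ 0] less_imp_le\<close>)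
  moreover have "dist l c ~= R" using circ[of l] cl by (auto simp: rot_def)
  ultimately have dl: "dist l c < R" by simp
  have "rot k l:G" if k: "k < m" for k
  proof (rule ccontr)
   assume "rot k l ~: G"
   hence "rot k l:frontier G" using cl[OF k] G(1) by (simp add: frontier_def interior_open)
   with fro distrot dl obtain d where d: "d > 0" "!!z. z:G ==> dist z (rot k l) < d ==> norm (g z)<=e"
    by metis
   from rl[of k] d(1) have "\<forall>\<^sub>F n in sequentially. dist (rot k (f n)) (rot k l) < d" by (rule tendstoD)
   then obtain n where n: "dist (rot k (f n)) (rot k l) < d" by (auto simp: eventually_sequentially)
   have fW: "f n:W" using fS by (auto simp: S_def)
   hence "norm (g (rot k (f n)))<=e" using d(2) n k by (auto simp: W_def)
   hence "norm (P (f n))<=e * M ^ (m - 1)"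
    using PW[OF fW k] M0 by (meson mult_right_mono order_trans zero_le_power)
   thus False using s fS[of n] by (auto simp: S_def)
  qed
  hence lW: "l:W" using dl by (auto simp: W_def dist_commute)
  have "(%n. P (f n)) \<longlonglongrightarrow> P l"
   by (rule continuous_on_tendsto_compose[OF contP fl lW]) (use fS in \<open>auto simp: S_def\<close>)
  hence "(%n. norm (P (f n))) \<longlonglongrightarrow> norm (P l)" by (rule tendsto_norm)
  hence "s<=norm (P l)"
   by (rule LIMSEQ_le_const) (use fS in \<open>auto simp: S_def\<close>)
  with lW show "l:S" by (simp add: S_def)
 qed
 moreover have "bounded S" unfolding S_def W_def by (rule bounded_subset[OF bounded_ball[of c R]]) auto
 ultimately have "compact S" by (simp add: compact_eq_bounded_closed)
 moreover have "continuous_on S (%z. norm (P z))"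
  by (intro continuous_intros continuous_on_subset[OF contP]) (auto simp: S_def)
 ultimately obtain z0 where z0: "z0:S" "!!z. z:S ==> norm (P z)<=norm (P z0)"
  using continuous_attains_sup[of S "%z. norm (P z)"] cS by auto
 have maxW: "norm (P z)<=norm (P z0)" if "z:W" for z
 proof (cases "z:S")
  case False
  hence "norm (P z) < s" using that by (auto simp: S_def)
  also have "s<=norm (P z0)" using z0 by (auto simp: S_def)
  finally show ?thesis by simp
 qed (use z0 in auto)
 define Q where "Q = {z\<in>S. norm (P z) = norm (P z0)}"
 have "closed Q"
 proof -
  have "closedin (top_of_set S) {z\<in>S. norm (P z) = norm (P z0)}"
   by (rule continuous_closedin_preimage_constant) fact
  thus ?thesis using \<open>closed S\<close> closedin_closed_trans unfolding Q_def by blast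
 qed
 moreover have "open Q"
 proof (subst open_contains_ball, intro ballI)
  fix z assume z: "z:Q"
  hence zW: "z:W" by (auto simp: Q_def S_def)
  then obtain r where r: "r > 0" "ball z r<=W" using openW open_contains_ball by blast
  have "P constant_on ball z r"
   by (rule maximum_modulus_principle[OF holomorphic_on_subset[OF holP r(2)], of "ball z r" z])
     (use z r maxW in \<open>auto simp: Q_def\<close>)
  hence "P w = P z" if "w:ball z r" for w
   using that r(1) unfolding constant_on_def by (metis centre_in_ball)
  hence "ball z r<=Q" using z r(2) by (fastforce simp: Q_def S_def)
  thus "EX e>0. ball z e<=Q" using r(1) by blast
 qed
 moreover have "Q ~= {}" using z0 by (auto simp: Q_def)
 moreover have "bounded Q" by (rule bounded_subset[OF \<open>bounded S\<close>]) (auto simp: Q_def)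
 ultimately show False
  by (metis UNIV_I clopen not_bounded_UNIV)
qed

text \<open>Janiszewski's theorem for the curve and the union \<open>T\<close> of a sphere about
  \<open>p\<close> with the part \<open>J2\<close> of the curve away from \<open>p\<close>. The two
  sets meet exactly in the connected set \<open>J2\<close>, so two inside points close to
  \<open>p\<close>, which neither set separates, are not separated by their union.\<close>

lemma Jordan_inside_locally_connected:
 fixes gb :: "real => complex"
 assumes gb: "simple_path gb" "pfn gb = pst gb" and p: "p:pim gb" and e: "e > 0"
 obtains d where "d > 0"
  "!!w w'. w:inside (pim gb) ==> w':inside (pim gb) ==> dist w p < d ==> dist w' p < d
    ==> connected_component (inside (pim gb) Int ball p e) w w'"
proof -
 obtain a where a: "a:{0..1}" "gb a = p" using p by (auto simp: pim_def)
 define g where "g = shiftpath a gb"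
 have g: "simple_path g" "pfn g = pst g" "pim g = pim gb"
  using gb a by (auto simp: g_def simple_path_shiftpath path_image_shiftpath closed_shiftpath)
 have g0: "g 0 = p" "g 1 = p" using a gb g by (auto simp: g_def shiftpath_def pst_def pfn_def)
 have contg: "continuous_on {0..1} g" using g(1) by (simp add: simple_path_def path_def)
 have "EX d>0. ALL x:{0..1}. dist x 0 < d --> dist (g x) (g 0) < e"
  using contg e unfolding continuous_on_iff by force
 then obtain d0 where d0: "d0 > 0" "!!x. x:{0..1} ==> dist x 0 < d0 ==> dist (g x) p < e"
  using g0 by auto
 have "EX d>0. ALL x:{0..1}. dist x 1 < d --> dist (g x) (g 1) < e"
  using contg e unfolding continuous_on_iff by force
 then obtain d1 where d1: "d1 > 0" "!!x. x:{0..1} ==> dist x 1 < d1 ==> dist (g x) p < e"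
  using g0 by auto
 \<comment> \<open>For parameters within \<open>h\<close> of 0 or 1 the curve stays inside the ball
   of radius \<open>e\<close>, so the sphere meets the curve only in \<open>J2\<close>.\<close>
 define h where "h = min (1/4) (min (d0/2) (d1/2))"
 have h: "0 < h" "h<=1/4" "h < d0" "h < d1" using d0(1) d1(1) by (auto simp: h_def)
 define J2 where "J2 = g ` {h..1-h}"
 have J2: "connected J2" "compact J2" "J2<=pim gb"
 proof -
  have c: "continuous_on {h..1-h} g" using contg by (rule continuous_on_subset) (use h in auto)
  show "connected J2" "compact J2" unfolding J2_def
   by (auto intro: connected_continuous_image[OF c] compact_continuous_image[OF c])
  have "g ` {h..1-h}<=g ` {0..1}" by (rule image_mono) (use h in auto)
  thus "J2<=pim gb" using g(3) by (simp add: J2_def pim_def)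
 qed
 have "p ~: J2"
 proof
  assume "p:J2"
  then obtain x where x: "x:{h..1-h}" "g x = g 0" using g0 by (auto simp: J2_def)
  have "x:{0..1}" using x h by auto
  hence "x = 0 \<or> x = 1"
   using g(1) x unfolding simple_path_def loop_free_def by (metis atLeastAtMost_iff order_refl zero_le_one)
  thus False using x h by auto
 qed
 then obtain d where d: "d > 0" "d < e" "ball p d Int J2 = {}"
 proof -
  have "open (- J2)" using J2 compact_imp_closed by blast
  with \<open>p ~: J2\<close> obtain r where r: "r > 0" "ball p r <= - J2" using open_contains_ball by blast
  have "ball p (min r (e/2))<=ball p r" by (rule subset_ball) simp
  hence "ball p (min r (e/2)) Int J2 = {}" using r(2) by blast
  thus thesis using that[of "min r (e/2)"] r(1) e by auto
 qed
 define T where "T = sphere p e Un J2"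
 have JT: "pim gb Int T = J2"
 proof -
  have "z:J2" if z: "z:pim gb" "z:sphere p e" for z
  proof -
   obtain x where x: "x:{0..1}" "z = g x" using z(1) g(3) by (metis imageE pim_def)
   have dz: "dist z p = e" using z by (simp add: dist_commute)
   have "~ dist x 0 < d0" "~ dist x 1 < d1" using d0(2)[OF x(1)] d1(2)[OF x(1)] x(2) dz by auto
   hence "x:{h..1-h}" using x h by (auto simp: dist_real_def)
   thus ?thesis using x by (auto simp: J2_def)
  qed
  thus ?thesis using J2 by (auto simp: T_def)
 qed
 show thesis
 proof (rule that[OF d(1)])
  fix w w' assume w: "w:inside (pim gb)" "w':inside (pim gb)" "dist w p < d" "dist w' p < d"
  have con: "connected (inside (pim gb))" using Jordan_inside_outside[OF gb] by blast
  have inC: "inside (pim gb) <= - pim gb" by (auto simp: inside_def)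
  have c1: "connected_component (- pim gb) w w'"
   unfolding connected_component_def using con inC w by blast
  have "ball p d <= - T" using d by (auto simp: T_def)
  hence c2: "connected_component (- T) w w'"
   unfolding connected_component_def using w by (metis connected_ball dist_commute mem_ball)
  have "connected_component (- (pim gb Un T)) w w'"
   by (rule Janiszewski[OF _ _ _ c1 c2])
     (use gb J2 JT in \<open>auto simp: T_def compact_simple_path_image intro: closed_Un compact_imp_closed\<close>)
  then obtain C where C: "connected C" "C <= - (pim gb Un T)" "w:C" "w':C"
   unfolding connected_component_def by blast
  have "C<=ball p e"
  proof (rule ccontr)
   assume "~ C<=ball p e"
   hence "C Int - ball p e ~= {}" by blast
   moreover have "C Int ball p e ~= {}" using C w d by (auto simp: dist_commute)
   ultimately have "C Int frontier (ball p e) ~= {}" using connected_Int_frontier[OF C(1)] by (metis Diff_eq)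
   thus False using C e by (auto simp: T_def)
  qed
  moreover have "C<=inside (pim gb)"
  proof (rule ccontr)
   assume "~ ?thesis"
   hence "C - inside (pim gb) ~= {}" by blast
   moreover have "C Int inside (pim gb) ~= {}" using C w by auto
   ultimately have "C Int frontier (inside (pim gb)) ~= {}" using connected_Int_frontier[OF C(1)] by blast
   thus False using C Jordan_inside_outside[OF gb] by auto
  qed
  ultimately show "connected_component (inside (pim gb) Int ball p e) w w'"
   unfolding connected_component_def using C by blast
 qed
qed

text \<open>\<open>t\<close> is the first time with value at least \<open>b\<close>, and
  \<open>s\<close> the last time before \<open>t\<close> with value at most
  \<open>a\<close>.\<close>

lemma crossing_subinterval:
 fixes u :: "real => real"
 assumes u: "continuous_on {0..1} u" and ab: "u 0<=a" "a < b" "b<=u 1"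
 obtains s t where "0<=s" "s < t" "t<=1" "u s = a" "u t = b" "!!x. x:{s..t} ==> a<=u x & u x<=b"
proof -
 define T where "T = {0..1} Int u -` {b..}"
 have "closed T" unfolding T_def by (rule continuous_closed_preimage[OF u]) auto
 hence "compact ({0..1} Int T)" by (rule compact_Int_closed[OF compact_Icc])
 hence "compact T" by (simp add: T_def)
 moreover have "1:T" using ab by (simp add: T_def)
 ultimately  obtain t where t: "t:T" "!!x. x:T ==> t<=x" using compact_attains_inf by (metis empty_iff)
 have t01: "0<=t" "t<=1" "u t >= b" using t by (auto simp: T_def)
 have ut: "continuous_on {0..t} u" by (rule continuous_on_subset[OF u]) (use t01 in auto)
 have utb: "u t = b"
 proof -
  obtain x where x: "0<=x" "x<=t" "u x = b"
   using IVT'[of u 0 b t] ab t01 ut by auto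
  hence "x:T" using t01 by (auto simp: T_def)
  thus ?thesis using t x by force
 qed
 define S where "S = {0..t} Int u -` {..a}"
 have "closed S" unfolding S_def by (rule continuous_closed_preimage[OF ut]) auto
 hence "compact ({0..t} Int S)" by (rule compact_Int_closed[OF compact_Icc])
 hence "compact S" by (simp add: S_def)
 moreover have "0:S" using ab t01 by (simp add: S_def)
 ultimately obtain s where s: "s:S" "!!x. x:S ==> x<=s" using compact_attains_sup by (metis empty_iff)
 have s0: "0<=s" "s<=t" "u s<=a" using s by (auto simp: S_def)
 have us: "u s = a"
 proof -
  have "continuous_on {s..t} u" by (rule continuous_on_subset[OF ut]) (use s0 in auto)
  then obtain x where x: "s<=x" "x<=t" "u x = a"
   using IVT'[of u s a t] ab t01 s0 by auto
  hence "x:S" using s0 by (auto simp: S_def)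
  thus ?thesis using s x by force
 qed
 have "s ~= t" using us utb ab by auto
 hence st: "s < t" using s0 by simp
 have "a<=u x & u x<=b" if x: "x:{s..t}" for x
 proof
  show "a<=u x"
  proof (rule ccontr)
   assume "~ a<=u x"
   hence "x:S" using x s0 by (auto simp: S_def)
   hence "x = s" using s x by force
   thus False using us \<open>~ a<=u x\<close> by simp
  qed
  show "u x<=b"
  proof (rule ccontr)
   assume "~ u x<=b"
   hence "x:T" using x s0 t01 by (auto simp: T_def)
   hence "x = t" using t x by force
   thus False using utb \<open>~ u x<=b\<close> by simp
  qed
 qed
 with that s0 st t01 us utb show thesis by blast
qed

lemma fashoda_complex:
 fixes f g :: "real => complex"
 assumes "path f" "path g"
  and f: "!!z. z:pim f ==> a<=Re z & Re z<=b & c<=Im z & Im z<=d"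
  and g: "!!z. z:pim g ==> a<=Re z & Re z<=b & c<=Im z & Im z<=d"
  and "Re (f 0) = a" "Re (f 1) = b" "Im (g 0) = c" "Im (g 1) = d"
 shows "pim f Int pim g ~= {}"
proof -
 define v :: "complex => real^2" where "v z = Re z *\<^sub>R axis 1 1 + Im z *\<^sub>R axis 2 1" for z
 have vc: "continuous_on UNIV v" unfolding v_def by (intro continuous_intros)
 have v1: "v z $ 1 = Re z" "v z $ 2 = Im z" for z by (auto simp: v_def axis_def)
 have pv: "path (v o h)" if "path h" for h
  by (rule path_continuous_image[OF that continuous_on_subset[OF vc]]) simp
 obtain z where z: "z:pim (v o f)" "z:pim (v o g)"
 proof (rule fashoda[of "v o f" "v o g" "v (Complex a c)" "v (Complex b d)"])
  show "pim (v o f)<=cbox (v (Complex a c)) (v (Complex b d))"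
   using f by (auto simp: pim_def mem_box_cart forall_2 v1)
  show "pim (v o g)<=cbox (v (Complex a c)) (v (Complex b d))"
   using g by (auto simp: pim_def mem_box_cart forall_2 v1)
 qed (use assms pv in \<open>auto simp: pst_def pfn_def v1\<close>)
 have "inj v" by (rule injI) (metis v1 complex_eqI)
 moreover obtain x y where "x:{0..1}" "y:{0..1}" "v (f x) = v (g y)" using z by (auto simp: pim_def)
 ultimately have "f x = g y" by (simp add: inj_def)
 hence "f x:pim f Int pim g"
  using \<open>x:{0..1}\<close> \<open>y:{0..1}\<close> by (metis IntI imageI pim_def)
 thus ?thesis by blast
qed

text \<open>Koebe's lemma in normal position: the arcs near the unit circle are written in
  logarithmic coordinates \<open>Q\<close> and span the arguments from \<open>- db\<close> to
  \<open>db\<close>. Such an arc shields real points slightly below 1 from the circle; the product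
  estimate with four quarter turns then gives the value \<open>p\<close> there, and the identity
  theorem spreads it over the disk.\<close>

lemma Koebe_normalized:
 fixes Ph :: "complex => complex"
 assumes hol: "Ph holomorphic_on ball 0 1" and bdd: "!!z. z:ball 0 1 ==> norm (Ph z)<=M"
  and d: "db > 0"
  and arcs: "!!e. e > 0 ==> EX Q. path Q & Im (Q 0) = - db & Im (Q 1) = db &
    (ALL t:{0..1}. \<bar>Im (Q t)\<bar> <= db & 1 - e < exp (Re (Q t)) & exp (Re (Q t)) < 1 & norm (Ph (exp (Q t)) - p)<=e)"
  and z: "z:ball 0 1"
 shows "Ph z = p"
proof -
 have "isCont Ln 1" by (rule continuous_at_Ln) auto
 then obtain r1 where r1: "r1 > 0" "!!z. dist z 1 < r1 ==> dist (Ln z) (Ln 1) < db"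
  using d unfolding continuous_at by (metis (no_types, lifting) LIM_def isCont_def dist_self)
 define r0 where "r0 = min r1 (1/2)"
 have r0: "r0 > 0" "r0<=1/2" "r0<=r1" using r1 by (auto simp: r0_def)
 have Ln0: "\<bar>Im (Ln z)\<bar> < db" if "dist z 1 < r0" for z
 proof -
  have "norm (Ln z) < db" using r1(2)[of z] that r0 by simp
  thus ?thesis using abs_Im_le_cmod[of "Ln z"] by linarith
 qed
 have nz: "z ~: \<real>\<^sub>\<le>\<^sub>0" if "dist z 1 < r0" for z :: complex
 proof -
  have "\<bar>Re (z - 1)\<bar> < 1/2" using abs_Re_le_cmod[of "z-1"] that r0 by (simp add: dist_norm)
  hence "\<bar>Re z - 1\<bar> < 1/2" by simp
  hence "Re z > 0" by arith
  thus ?thesis by (auto simp: complex_nonpos_Reals_iff)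
 qed
 have main: "Ph (of_real s) = p" if s: "1 - r0/3 < s" "s < 1" for s :: real
 proof -
  define c :: complex where "c = of_real s"
  \<comment> \<open>Points within \<open>R\<close> of \<open>s\<close> have distance below
    \<open>R + (1 - s) < r0\<close> from 1, where the logarithm has imaginary part below
    \<open>db\<close>. The factor 2 makes every point \<open>s + u\<close> with
    \<open>norm u = R\<close> and \<open>Re u > R/2\<close> lie outside the open unit disk.\<close>
  define R where "R = 2*(1-s)"
  have s0: "s > 1/2" using s r0 by auto
  have bR: "dist z 1 < r0" if "dist z c < R" for z
  proof -
   have "dist z 1<=dist z c + dist c 1" by (rule dist_triangle)
   also have "dist c 1 = 1 - s" using s dist_of_real[of s 1, where 'a=complex] by (simp add: c_def dist_real_def)
   finally show ?thesis using that s by (simp add: R_def)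
  qed
  have key: "norm (Ph c - p) ^ 4<=(2*e) * (M + norm p) ^ 3" if e: "e > 0" "e<=1 - s" for e
  proof -
   obtain Q where Q: "path Q" "Im (Q 0) = - db" "Im (Q 1) = db"
    "!!t. t:{0..1} ==> \<bar>Im (Q t)\<bar> <= db" "!!t. t:{0..1} ==> 1 - e < exp (Re (Q t))"
    "!!t. t:{0..1} ==> exp (Re (Q t)) < 1" "!!t. t:{0..1} ==> norm (Ph (exp (Q t)) - p)<=e"
    using arcs[OF e(1)] by blast
   define C where "C = pim (exp o Q)"
   have pC: "path (exp o Q)" using Q(1) by (auto simp: path_def intro!: continuous_intros continuous_on_compose)
   have compC: "compact C" unfolding C_def by (rule compact_path_image[OF pC])
   have C: "1 - e < norm w" "norm w < 1" "norm (Ph w - p)<=e" if "w:C" for w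
    using that Q(5-7) by (auto simp: C_def pim_def)
   have "C ~= {}" by (simp add: C_def)
   then obtain w0 where w0: "w0:C" "!!w. w:C ==> norm w<=norm w0"
    using continuous_attains_sup[OF compC, of norm] continuous_on_norm_id by auto
   define rh where "rh = norm w0"
   have rh: "rh < 1" using C w0 by (simp add: rh_def)
   define U where "U = ball 0 1 Int ball 1 r0 - C"
   define G where "G = connected_component_set U c"
   have openU: "open U" unfolding U_def using compC by (intro open_Diff open_Int) (auto intro: compact_imp_closed)
   have openG: "open G" unfolding G_def by (rule open_connected_component[OF openU])
   have cC: "c ~: C" using C(1)[of c] e s s0 by (auto simp: c_def)
   have cU: "c:U" using cC s s0 bR[of c] by (auto simp: U_def c_def R_def dist_commute)
   have cG: "c:G" using cU by (simp add: G_def)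
   have GU: "G<=U" unfolding G_def by (rule connected_component_subset)
   \<comment> \<open>In logarithmic coordinates a path in \<open>G\<close> from \<open>s\<close>
     past the radius \<open>rh\<close> would cross a rectangle from left to right, while
     \<open>Q\<close> crosses it from bottom to top. They would meet, but \<open>G\<close> avoids
     the arc \<open>C\<close>.\<close>
   have Gle: "norm z<=rh" if zG: "z:G" for z
   proof (rule ccontr)
    assume zr: "~ norm z<=rh"
    have "path_connected G" using openG by (simp add: G_def connected_open_path_connected)
    then obtain P where P: "path P" "pim P<=G" "pst P = c" "pfn P = z"
     using zG cG by (metis path_connected_def)
    have PG: "P t:G" if "t:{0..1}" for t using P that by (auto simp: pim_def)
    have P1: "dist (P t) 1 < r0" if "t:{0..1}" for t using PG[OF that] GU by (auto simp: U_def dist_commute)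
    have P0: "P t ~= 0" if "t:{0..1}" for t using nz[OF P1[OF that]] by auto
    define L where "L t = Ln (P t)" for t
    have contL: "continuous_on {0..1} L" unfolding L_def
     using P(1) nz P1 by (intro continuous_intros) (auto simp: path_def)
    have ReL: "Re (L t) = ln (norm (P t))" if "t:{0..1}" for t using P0[OF that] by (simp add: L_def)
    have z0: "z ~= 0" using zr w0 rh_def by force
    have rho0: "rh > 0" using C(1)[OF w0(1)] e s0 unfolding rh_def by linarith
    have a1: "Re (L 0) = ln s" using ReL[of 0] P(3) s0 by (simp add: pst_def c_def)
    have a2: "Re (L 1) = ln (norm z)" using ReL[of 1] P(4) by (simp add: pfn_def)
    have "s < rh" using C(1)[OF w0(1)] e by (simp add: rh_def)
    hence sz: "s < norm z" using zr by simp
    have "continuous_on {0..1} (%t. Re (L t))" by (intro continuous_intros contL)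
    from crossing_subinterval[OF this, of "ln s" "ln (norm z)"]
    obtain t1 t2 where t: "0<=t1" "t1 < t2" "t2<=1" "Re (L t1) = ln s" "Re (L t2) = ln (norm z)"
     "!!x. x:{t1..t2} ==> ln s<=Re (L x) & Re (L x)<=ln (norm z)"
     using a1 a2 sz s0 z0 by (auto simp: ln_less_cancel_iff)
    define f where "f = subpath t1 t2 L"
    have pf: "path f" unfolding f_def using contL t by (intro path_subpath) (auto simp: path_def)
    have imf: "pim f = L ` {t1..t2}" unfolding f_def using t by (simp add: path_image_subpath)
    have "pim f Int pim Q ~= {}"
    proof (rule fashoda_complex[OF pf Q(1), of "ln s" "ln (norm z)" "-db" db])
     fix w assume "w:pim f"
     then obtain x where x: "x:{t1..t2}" "w = L x" using imf by auto
     have "x:{0..1}" using x t by auto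
     hence "\<bar>Im w\<bar> < db" using Ln0[OF P1] x by (auto simp: L_def)
     thus "ln s<=Re w & Re w<=ln (norm z) & - db<=Im w & Im w<=db" using t(6)[OF x(1)] x by auto
    next
     fix w assume "w:pim Q"
     then obtain x where x: "x:{0..1}" "w = Q x" by (auto simp: pim_def)
     have "exp (Q x):C" using x by (auto simp: C_def pim_def)
     hence "exp (Re w)<=rh" using w0(2)[of "exp (Q x)"] x by (simp add: rh_def)
     hence "exp (Re w)<=norm z" using zr by simp
     hence "Re w<=ln (norm z)" using z0 by (simp add: ln_ge_iff)
     moreover have "s<=exp (Re w)" using Q(5)[OF x(1)] x e by simp
     hence "ln s<=Re w" using s0 by (metis exp_gt_zero exp_le_cancel_iff exp_ln less_trans zero_less_divide_1_iff zero_less_numeral)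
     ultimately show "ln s<=Re w & Re w<=ln (norm z) & - db<=Im w & Im w<=db"
     using Q(4)[OF x(1)] x by (auto simp: abs_le_iff)
    qed (use Q t in \<open>auto simp: f_def subpath_def\<close>)
    then obtain v where "v:L ` {t1..t2}" "v:Q ` {0..1}" using imf unfolding pim_def[of Q] by blast
    then obtain x y where xy: "x:{t1..t2}" "y:{0..1}" "L x = Q y" by (metis imageE)
    have x01: "x:{0..1}" using xy t by auto
    have "P x = exp (L x)" using P0[OF x01] by (simp add: L_def)
    hence "P x:C" using xy by (auto simp: C_def pim_def)
    thus False using PG[OF x01] GU by (auto simp: U_def)
   qed
   have clG: "norm z<=rh" if "z:closure G" for z
   proof -
    have "closure G<=cball 0 rh" by (rule closure_minimal) (use Gle in auto)
    thus ?thesis using that by auto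
   qed
   have GB: "G<=ball 0 1" using GU by (auto simp: U_def)
   have "norm (Ph c - p) ^ 4<=(2*e) * (M + norm p) ^ (4 - 1)"
   proof (rule rotation_product_bound[OF openG cG, of R 4 "%z. Ph z - p"])
    show "R > 0" using s by (simp add: R_def)
    show "(%z. Ph z - p) holomorphic_on G"
     by (intro holomorphic_intros holomorphic_on_subset[OF hol GB])
    show "cmod (Ph z - p)<=M + cmod p" if "z:G" for z
     using norm_triangle_ineq4[of "Ph z" p] bdd[of z] that GB by force
    \<comment> \<open>Not both coordinates of \<open>z - c\<close> are at most \<open>R/2\<close> in
      absolute value, since the squares would then add up to at most half of the square of
      \<open>R\<close>; a quarter turn makes the large coordinate a real part above
      \<open>R/2\<close>.\<close>
    show "EX k<4. c + cis (2 * pi * real k / real 4) * (z - c) ~: closure G" if z: "dist z c = R" for z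
    proof -
     define w where "w = z - c"
     have w: "norm w = R" using z by (simp add: w_def dist_norm)
     have out: "c + u ~: closure G" if u: "norm u = R" "Re u > R/2" for u
     proof
     assume "c + u:closure G"
     hence le: "norm (c + u) < 1" using clG rh by force
     have "(norm (c + u))\<^sup>2 = s\<^sup>2 + 2 * s * Re u + R\<^sup>2"
     proof -
     have "(norm (c + u))\<^sup>2 = (s + Re u)\<^sup>2 + (Im u)\<^sup>2" by (simp add: cmod_power2 c_def)
     also have "\<dots> = s\<^sup>2 + 2 * s * Re u + ((Re u)\<^sup>2 + (Im u)\<^sup>2)" by (simp add: power2_sum)
     also have "(Re u)\<^sup>2 + (Im u)\<^sup>2 = R\<^sup>2" using u by (metis cmod_power2)
     finally show ?thesis .
     qed
     moreover have "2 * s * Re u >= s * R" using u s0 by (simp add: field_simps)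
     moreover have "s\<^sup>2 + s * R + R\<^sup>2 = 1 + 3*(1-s)\<^sup>2"
     by (simp add: R_def power2_eq_square algebra_simps)
     ultimately have "(norm (c + u))\<^sup>2 >= 1" by (smt (verit) zero_le_power2)
     thus False using le by (metis abs_norm_cancel abs_square_less_1 not_le)
     qed
     have "R\<^sup>2 = (Re w)\<^sup>2 + (Im w)\<^sup>2" using w cmod_power2 by metis
     hence "~ (\<bar>Re w\<bar> <= R/2 & \<bar>Im w\<bar> <= R/2)"
     proof -
     have "R > 0" using s by (simp add: R_def)
     have "(Re w)\<^sup>2<=(R/2)\<^sup>2 & (Im w)\<^sup>2<=(R/2)\<^sup>2" if "\<bar>Re w\<bar> <= R/2" "\<bar>Im w\<bar> <= R/2"
     using that \<open>R > 0\<close> by (auto simp: abs_le_square_iff[symmetric])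
     moreover have "(R/2)\<^sup>2 + (R/2)\<^sup>2 = R\<^sup>2 / 2" by (simp add: power_divide)
     moreover have "R\<^sup>2 > 0" using \<open>R > 0\<close> by simp
     ultimately show ?thesis using \<open>R\<^sup>2 = _\<close> by linarith
     qed
     then consider "Re w > R/2" | "Re (- w) > R/2" | "Re (\<i> * w) > R/2" | "Re (- \<i> * w) > R/2" by (auto simp: abs_if split: if_splits)
     thus ?thesis
     proof cases
     case 1 thus ?thesis using out[of w] w by (intro exI[of _ 0]) (auto simp: w_def)
     next
     case 2
     have "cis (2 * pi * real 2 / real 4) = -1" by (simp add: cis.code complex_eq_iff)
     hence "c + cis (2 * pi * real 2 / real 4) * (z - c) = c + - w" by (simp only: w_def) simp
     hence "c + cis (2 * pi * real 2 / real 4) * (z - c) ~: closure G" using 2 out[of "-w"] w by (simp only:) simp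
     moreover have "(2::nat) < 4" by simp
     ultimately show ?thesis by blast
     next
     case 3
     have "cis (2 * pi * real 1 / real 4) = \<i>" by (simp add: cis.code complex_eq_iff)
     thus ?thesis using 3 out[of "\<i> * w"] w by (intro exI[of _ 1]) (auto simp: w_def norm_mult)
     next
     case 4
     have "2 * pi * real 3 / real 4 = pi + pi/2" by simp
     hence "cis (2 * pi * real 3 / real 4) = cis pi * cis (pi/2)" by (simp only: cis_mult)
     hence "c + cis (2 * pi * real 3 / real 4) * (z - c) = c + - \<i> * w" by (simp only: w_def) simp
     hence "c + cis (2 * pi * real 3 / real 4) * (z - c) ~: closure G" using 4 out[of "- \<i> * w"] w by (simp only: norm_mult) simp
     moreover have "(3::nat) < 4" by simp
     ultimately show ?thesis by blast
     qed
    qed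
    show "EX d>0. ALL z:G. dist z q < d --> cmod (Ph z - p)<=2 * e" if q: "q:frontier G" "dist q c < R" for q
    proof -
     have qcl: "q:closure G" and qG: "q ~: G" using q openG by (auto simp: frontier_def interior_open)
     have qB: "q:ball 0 1" using clG[OF qcl] rh by simp
     have "q:C"
     proof (rule ccontr)
     assume "q ~: C"
     hence qU: "q:U" using qB bR[OF q(2)] by (auto simp: U_def dist_commute)
     have "closedin (top_of_set U) G" unfolding G_def by (rule closedin_connected_component)
     then obtain T where T: "closed T" "G = U Int T" unfolding closedin_closed by blast
     hence "closure G<=T" by (intro closure_minimal) auto
     hence "q:G" using T qU qcl by blast
     thus False using qG by blast
     qed
     hence le: "norm (Ph q - p)<=e" using C by blast
     have "isCont Ph q" using hol qB by (metis open_ball holomorphic_on_imp_continuous_on continuous_on_eq_continuous_at)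
     then obtain d where d: "d > 0" "!!z. dist z q < d ==> dist (Ph z) (Ph q) < e"
     using e unfolding continuous_at_eps_delta by blast
     have "norm (Ph z - p)<=2*e" if "dist z q < d" for z
     using norm_triangle_ineq[of "Ph z - Ph q" "Ph q - p"] d(2)[OF that] le by (simp add: dist_norm)
     thus ?thesis using d(1) by blast
    qed
   qed (use e in auto)
   thus ?thesis by simp
  qed
  have "norm (Ph c - p) ^ 4<=0"
  proof (rule field_le_epsilon)
   fix ep :: real assume ep: "ep > 0"
   define K where "K = (M + norm p)^3 + 1"
   have "norm (Ph 0)<=M" by (rule bdd) simp
   hence "M >= 0" using norm_ge_zero order_trans by blast
   hence "(M + norm p)^3 >= 0" by simp
   hence K: "K > 0" "(M + norm p)^3<=K" unfolding K_def by linarith+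
   define e where "e = min (1 - s) (ep / (2*K))"
   have e: "e > 0" "e<=1 - s" "e<=ep / (2*K)" using s ep K by (auto simp: e_def)
   have "norm (Ph c - p) ^ 4<=(2*e) * (M + norm p) ^ 3" by (rule key[OF e(1,2)])
   also have "\<dots> <= (2*e) * K" using K e by (intro mult_left_mono) auto
   also have "\<dots> <= ep" using e(3) K by (simp add: field_simps)
   finally show "norm (Ph c - p) ^ 4<=0 + ep" by simp
  qed
  thus ?thesis by (simp add: c_def)
 qed
 define S :: "complex set" where "S = of_real ` {1 - r0/3<..<1}"
 have "Ph z - p = 0"
 proof (rule analytic_continuation[of "%z. Ph z - p" "ball 0 1" S "of_real (1 - r0/6)"])
  show "(%z. Ph z - p) holomorphic_on ball 0 1" by (intro holomorphic_intros hol)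
  show "S<=ball 0 1" using r0 by (auto simp: S_def)
  show "of_real (1 - r0/6):ball (0::complex) 1" using r0 by (auto simp: dist_norm simp del: of_real_diff)
  show "complex_of_real (1 - r0/6) islimpt S"
   unfolding islimpt_approachable
  proof (intro allI impI)
   fix e :: real assume e: "e > 0"
   define t where "t = 1 - r0/6 + min (e/2) (r0/12)"
   have t: "t:{1 - r0/3<..<1}" "t ~= 1 - r0/6" "\<bar>t - (1 - r0/6)\<bar> < e" using e r0 by (auto simp: t_def min_def)
   have "dist (complex_of_real t) (of_real (1 - r0/6)) = \<bar>t - (1 - r0/6)\<bar>" by (metis dist_of_real dist_real_def)
   thus "EX x':S. x' ~= complex_of_real (1 - r0/6) & dist x' (complex_of_real (1 - r0/6)) < e"
    using t by (intro bexI[of _ "of_real t"]) (auto simp: S_def simp del: of_real_diff)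
  qed
 qed (use z main in \<open>auto simp: S_def\<close>)
 thus ?thesis by simp
qed

lemma norm_cis_diff_le: "norm (cis a - cis b) <= \<bar>a - b\<bar>"
proof -
 have "cis a - cis b = cis b * (cis (a - b) - 1)" by (simp add: right_diff_distrib cis_mult)
 hence "norm (cis a - cis b) = norm (cis (a - b) - 1)" by (simp add: norm_mult)
 also have "\<dots> = 2 * \<bar>sin ((a - b) / 2)\<bar>" unfolding cis_conv_exp by (rule dist_exp_i_1)
 finally have "norm (cis a - cis b) = 2 * \<bar>sin ((a - b) / 2)\<bar>" .
 also have "\<dots> <= 2 * \<bar>(a - b) / 2\<bar>" using abs_sin_x_le_abs_x[of "(a-b)/2"] by linarith
 finally show ?thesis by simp
qed

text \<open>Koebe's lemma in general position. Along the logarithm of \<open>C / zt1\<close> the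
  argument changes by at least \<open>7 * et\<close>, so it crosses the window of half width
  \<open>2 * et\<close> about \<open>3 * et\<close> or about \<open>- 3 * et\<close>. The sign may
  depend on \<open>e\<close>, but condition \<open>A\<close> weakens as \<open>e\<close> grows, so
  one sign serves every \<open>e\<close>; rotation to the centre of its window gives the normal
  position.\<close>

lemma Koebe_boundary_arcs:
 fixes pk :: "complex => complex"
 assumes hol: "pk holomorphic_on ball 0 1" and bdd: "!!z. z:ball 0 1 ==> norm (pk z)<=M"
  and zt: "norm zt1 = 1" "norm zt2 = 1" "zt1 ~= zt2"
  and arcs: "!!e. e > 0 ==> EX C. path C & dist (C 0) zt1 < e & dist (C 1) zt2 < e &
    (ALL t:{0..1}. 1 - e < norm (C t) & norm (C t) < 1 & norm (pk (C t) - p)<=e)"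
  and z: "z:ball 0 1"
 shows "pk z = p"
proof -
 define et where "et = dist zt1 zt2 / 8"
 have "dist zt1 zt2<=2" using dist_triangle[of zt1 zt2 0] zt by simp
 hence et: "et > 0" "et<=1/4" using zt by (auto simp: et_def)
 have z10: "zt1 ~= 0" using zt by auto
 have "isCont Ln 1" by (rule continuous_at_Ln) auto
 then obtain r1 where r1: "r1 > 0" "!!z. dist z 1 < r1 ==> dist (Ln z) (Ln 1) < et"
  using et(1) unfolding continuous_at_eps_delta by blast
 define A where "A sg e \<longleftrightarrow> (EX Q. path Q & Im (Q 0) = - (2*et) & Im (Q 1) = 2*et &
    (ALL t:{0..1}. \<bar>Im (Q t)\<bar> <= 2*et & 1 - e < exp (Re (Q t)) & exp (Re (Q t)) < 1 &
     norm (pk (zt1 * cis (sg*(3*et)) * exp (Q t)) - p)<=e))" for sg e :: real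
 have Amono: "A sg e'" if "A sg e" "e<=e'" for sg e e'
  using that unfolding A_def by fastforce
 have A: "A 1 e0 \<or> A (-1) e0" if e0: "e0 > 0" for e0
 proof -
  define e where "e = min e0 (min r1 (et/4))"
  have e: "e > 0" "e<=e0" "e<=r1" "e<=et/4" using e0 r1 et by (auto simp: e_def)
  obtain C where C: "path C" "dist (C 0) zt1 < e" "dist (C 1) zt2 < e"
   "!!t. t:{0..1} ==> 1 - e < norm (C t)" "!!t. t:{0..1} ==> norm (C t) < 1"
   "!!t. t:{0..1} ==> norm (pk (C t) - p)<=e" using arcs[OF e(1)] by blast
  define w where "w t = C t / zt1" for t
  have pw: "path w" using C(1) z10 unfolding w_def path_def by (intro continuous_intros) auto
  have nw: "norm (w t) = norm (C t)" for t using zt by (simp add: w_def norm_divide)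
  have w0: "w t ~= 0" if "t:{0..1}" for t using nw[of t] C(4)[OF that] e et by auto
  hence "0 ~: pim w" by (auto simp: pim_def)
  from winding_number_as_continuous_log[OF pw this] obtain q' where q': "path q'" "!!t. t:{0..1} ==> w t = 0 + exp (q' t)"
   by metis
  define q where "q t = q' t - q' 0 + Ln (w 0)" for t
  have contq: "continuous_on {0..1} q" using q'(1) unfolding q_def path_def by (intro continuous_intros)
  have q: "exp (q t) = w t" if "t:{0..1}" for t
   using q'(2)[OF that] q'(2)[of 0] w0[of 0] by (simp add: q_def exp_add exp_diff)
  have "dist (w 0) 1 = dist (C 0) zt1"
  proof -
   have "w 0 - 1 = (C 0 - zt1) / zt1" using z10 by (simp add: w_def diff_divide_distrib)
   thus ?thesis using zt by (simp add: dist_norm norm_divide)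
  qed
  hence "norm (q 0) < et" using r1(2)[of "w 0"] C(2) e by (simp add: q_def)
  hence q0: "\<bar>Im (q 0)\<bar> < et" using abs_Im_le_cmod[of "q 0"] by linarith
  have expq: "norm (exp (q t) - cis (Im (q t))) < e" if "t:{0..1}" for t
  proof -
   have "exp (q t) - cis (Im (q t)) = of_real (exp (Re (q t)) - 1) * cis (Im (q t))"
    by (simp add: exp_eq_polar algebra_simps)
   hence "norm (exp (q t) - cis (Im (q t))) = \<bar>exp (Re (q t)) - 1\<bar>" by (simp only: norm_mult norm_of_real norm_cis) simp
   moreover have "exp (Re (q t)) = norm (C t)" using q[OF that] nw[of t] by (metis norm_exp_eq_Re)
   ultimately show ?thesis using C(4,5)[OF that] by simp
  qed
  have "8 * et = norm (zt1 - zt2)" by (simp add: et_def dist_norm)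
  also have "\<dots> <= norm (zt1 - C 0) + norm (C 0 - C 1) + norm (C 1 - zt2)"
   using norm_triangle_ineq[of "zt1 - C 0" "C 0 - C 1"] norm_triangle_ineq[of "zt1 - C 1" "C 1 - zt2"] by simp
  also have "norm (C 0 - C 1) = norm (exp (q 0) - exp (q 1))"
   using zt by (simp add: q w_def norm_divide flip: diff_divide_distrib)
  also have "\<dots> <= e + \<bar>Im (q 0) - Im (q 1)\<bar> + e"
   using norm_triangle_ineq[of "exp (q 0) - cis (Im (q 0))" "cis (Im (q 0)) - cis (Im (q 1))"]
    norm_triangle_ineq[of "exp (q 0) - cis (Im (q 1))" "cis (Im (q 1)) - exp (q 1)"]
    norm_cis_diff_le[of "Im (q 0)" "Im (q 1)"] expq[of 0] expq[of 1] by (simp add: norm_minus_commute)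
  finally have big: "\<bar>Im (q 0) - Im (q 1)\<bar> >= 7 * et"
   using C(2,3) e by (simp add: dist_norm norm_minus_commute)
  have concl: "A sg e" if sg: "sg = 1 \<or> sg = -1" and st: "{s,t}<={0..1}" "s ~= t" "Im (q s) = sg*(3*et) - 2*et" "Im (q t) = sg*(3*et) + 2*et"
    and btw: "!!x. x:closed_segment s t ==> \<bar>Im (q x) - sg*(3*et)\<bar> <= 2*et" for sg s t
   unfolding A_def
  proof (intro exI[of _ "%x. subpath s t q x - \<i> * of_real (sg*(3*et))"] conjI ballI)
   have "path (subpath s t q)" by (rule path_subpath) (use contq st in \<open>auto simp: path_def\<close>)
   thus "path (%x. subpath s t q x - \<i> * of_real (sg*(3*et)))" unfolding path_def by (intro continuous_intros)
   fix x :: real assume x: "x:{0..1}"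
   define y where "y = (t - s) * x + s"
   have "y:closed_segment s t" using x by (auto simp: y_def in_segment algebra_simps)
   moreover have "closed_segment s t<={0..1}" using st by (auto simp: closed_segment_eq_real_ivl)
   ultimately have y: "y:closed_segment s t" "y:{0..1}" by auto
   have sub: "subpath s t q x = q y" by (simp add: subpath_def y_def)
   have eR: "exp (Re (q y)) = norm (C y)" using q[OF y(2)] nw[of y] by (metis norm_exp_eq_Re)
   have eC: "zt1 * cis (sg*(3*et)) * exp (q y - \<i> * of_real (sg*(3*et))) = C y"
   proof -
    have "cis (sg*(3*et)) * exp (q y - \<i> * of_real (sg*(3*et))) = exp (q y)"
     by (simp add: cis_conv_exp flip: exp_add)
    thus ?thesis using q[OF y(2)] z10 by (simp add: w_def mult.assoc)
   qed
   show "\<bar>Im (subpath s t q x - \<i> * of_real (sg*(3*et)))\<bar> <= 2*et" using btw[OF y(1)] by (simp add: sub)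
   show "1 - e < exp (Re (subpath s t q x - \<i> * of_real (sg*(3*et))))" "exp (Re (subpath s t q x - \<i> * of_real (sg*(3*et)))) < 1"
    using C(4,5)[OF y(2)] eR by (simp_all add: sub)
   show "cmod (pk (zt1 * cis (sg*(3*et)) * exp (subpath s t q x - \<i> * of_real (sg*(3*et)))) - p)<=e"
    using C(6)[OF y(2)] eC by (simp add: sub)
  qed (use st in \<open>auto simp: subpath_def\<close>)
  have "A 1 e \<or> A (-1) e"
  proof (cases "Im (q 1) >= Im (q 0)")
   case True
   have "continuous_on {0..1} (%t. Im (q t))" by (intro continuous_intros contq)
   then obtain s t where st: "0<=s" "s < t" "t<=1" "Im (q s) = et" "Im (q t) = 5*et" "!!x. x:{s..t} ==> et<=Im (q x) & Im (q x)<=5*et"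
    using crossing_subinterval[of "%t. Im (q t)" et "5*et"] q0 big True et by (smt (verit, ccfv_threshold))
   have "A 1 e" by (rule concl[of 1 s t]) (use st st(6) in \<open>auto simp: closed_segment_eq_real_ivl abs_le_iff algebra_simps\<close>)
   thus ?thesis by blast
  next
   case False
   have "continuous_on {0..1} (%t. - Im (q t))" by (intro continuous_intros contq)
   then obtain s t where st: "0<=s" "s < t" "t<=1" "- Im (q s) = et" "- Im (q t) = 5*et" "!!x. x:{s..t} ==> et <= - Im (q x) & - Im (q x)<=5*et"
    using crossing_subinterval[of "%t. - Im (q t)" et "5*et"] q0 big False et by (smt (verit, ccfv_threshold))
   have "A (-1) e" by (rule concl[of "-1" t s]) (use st st(6) in \<open>auto simp: closed_segment_eq_real_ivl abs_le_iff algebra_simps\<close>)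
   thus ?thesis by blast
  qed
  thus ?thesis using Amono e(2) by blast
 qed
 obtain sg where sg: "!!e. e > 0 ==> A sg e"
 proof (cases "ALL e>0. A 1 e")
  case True thus ?thesis using that by blast
 next
  case False
  then obtain e1 where e1: "e1 > 0" "~ A 1 e1" by blast
  have "A (-1) e" if "e > 0" for e
  proof -
   have "A 1 (min e e1) \<or> A (-1) (min e e1)" using A[of "min e e1"] that e1 by simp
   thus ?thesis using Amono[of _ "min e e1"] e1 by (meson min.cobounded1 min.cobounded2)
  qed
  thus ?thesis using that by blast
 qed
 define ow where "ow = zt1 * cis (sg*(3*et))"
 have ow: "norm ow = 1" using zt by (simp add: ow_def norm_mult)
 have "(%z. pk (ow * z)) (z / ow) = p"
 proof (rule Koebe_normalized[of "%z. pk (ow * z)" M "2*et" p "z / ow"])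
  have "(pk o (%z. ow * z)) holomorphic_on ball 0 1"
   by (rule holomorphic_on_compose_gen[OF _ hol]) (use ow in \<open>auto simp: norm_mult intro!: holomorphic_intros\<close>)
  thus "(%z. pk (ow * z)) holomorphic_on ball 0 1" by (simp add: o_def)
  show "cmod (pk (ow * z))<=M" if "z:ball 0 1" for z using that ow by (intro bdd) (auto simp: norm_mult)
  show "EX Q. path Q & Im (Q 0) = - (2*et) & Im (Q 1) = 2*et & (ALL t:{0..1}. \<bar>Im (Q t)\<bar> <= 2*et & 1 - e < exp (Re (Q t)) & exp (Re (Q t)) < 1 & cmod (pk (ow * exp (Q t)) - p)<=e)" if "e > 0" for e
   using sg[OF that] unfolding A_def ow_def .
  show "z / ow:ball 0 1" using z ow by (simp add: norm_divide)
 qed (use et in auto)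
 thus ?thesis using ow by (cases "ow = 0") auto
qed

lemma closed_Un_inside:
 fixes S :: "'a::{real_normed_vector,perfect_space} set"
 assumes "closed S" shows "closed (S Un inside S)"
proof -
 have "S Un inside S = S Un closure (inside S)"
  using closure_inside_subset[OF assms] closure_subset[of "inside S"] by blast
 thus ?thesis using assms by (metis closed_Un closed_closure)
qed

text \<open>The crosscut \<open>X\<close> splits the inside into two parts, one bordering on
  \<open>u\<close> and the other on \<open>d\<close>. A connected set that meets both
  \<open>u\<close> and \<open>d\<close> but misses \<open>X\<close> would be disconnected by the two
  closed parts.\<close>

lemma crosscuts_meet:
 fixes gb u d X :: "real => complex"
 assumes u: "arc u" "pst u = a" "pfn u = b" and d: "arc d" "pst d = b" "pfn d = a"
  and ud: "pim u Int pim d = {a,b}"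
  and X: "arc X" "pst X = a" "pfn X = b"
  and Xin: "pim X - {a,b}<=inside (pim u Un pim d)"
  and Y: "connected Y" "Y<=inside (pim u Un pim d) Un pim u Un pim d"
  and XY: "Y Int pim X = {}" and Yu: "Y Int pim u ~= {}" and Yd: "Y Int pim d ~= {}"
 shows False
proof -
 define J where "J = pim u Un pim d"
 have ab: "a ~= b" using u arc_distinct_ends by blast
 have inJ: "inside J Int J = {}" by (auto simp: inside_def)
 have abX: "a:pim X" "b:pim X" using X by auto
 have abu: "a:pim u" "b:pim u" "a:pim d" "b:pim d" using u d by (metis pathfinish_in_path_image pathstart_in_path_image)+
 have uX: "pim u Int pim X = {a,b}" using Xin inJ abX abu unfolding J_def by blast
 have dX: "pim d Int pim X = {a,b}" using Xin inJ abX abu unfolding J_def by blast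
 have midX: "X (1/2):pim X - {a,b}"
 proof -
  have "inj_on X {0..1}" using X by (simp add: arc_def)
  hence "X (1/2) ~= X 0" "X (1/2) ~= X 1" by (simp_all add: inj_on_eq_iff)
  thus ?thesis using X by (auto simp: pst_def pfn_def pim_def)
 qed
 obtain sp: "inside (pim u Un pim X) Int inside (pim (rvp d) Un pim X) = {}"
   "inside (pim u Un pim X) Un inside (pim (rvp d) Un pim X) Un (pim X - {a,b})
    = inside (pim u Un pim (rvp d))"
 proof (rule split_inside_simple_closed_curve[of u a b "rvp d" X])
  show "pim X Int inside (pim u Un pim (rvp d)) ~= {}" using midX Xin by (auto simp: J_def)
 qed (use u d X ud uX dX ab in \<open>auto intro: arc_imp_simple_path simp: arc_reversepath\<close>)
 define P where "P = inside (pim u Un pim X)"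
 define Q where "Q = inside (pim d Un pim X)"
 have sp': "P Int Q = {}" "P Un Q Un (pim X - {a,b}) = inside J" using sp by (auto simp: P_def Q_def J_def)
 have closedP: "closed (pim u Un pim X Un P)" unfolding P_def
  by (intro closed_Un_inside closed_Un closed_path_image) (use u X in \<open>auto intro: arc_imp_path\<close>)
 have closedQ: "closed (pim d Un pim X Un Q)" unfolding Q_def
  by (intro closed_Un_inside closed_Un closed_path_image) (use d X in \<open>auto intro: arc_imp_path\<close>)
 have "Y<=(pim u Un pim X Un P) Un (pim d Un pim X Un Q)"
  using Y(2) sp'(2) by (auto simp: J_def)
 moreover have "(pim u Un pim X Un P) Int (pim d Un pim X Un Q) Int Y = {}"
 proof -
  have "P Int pim d = {}" using sp'(2) inJ unfolding J_def by blast
  moreover have "Q Int pim u = {}" using sp'(2) inJ unfolding J_def by blast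
  moreover have "pim u Int pim d Int Y = {}" using ud abX XY by auto
  ultimately show ?thesis using XY sp'(1) by blast
 qed
 ultimately show False
  using connected_closedD[OF Y(1), of "pim u Un pim X Un P" "pim d Un pim X Un Q"] closedP closedQ Yu Yd by blast
qed

text \<open>The argument of \<open>b/a\<close> is rounded down to a multiple of
  \<open>2*pi/m\<close>.\<close>

lemma cis_rotation_close:
 fixes a b :: complex
 assumes m: "m > 0" and ab: "norm a = norm b" "a ~= 0"
 shows "EX k<m. norm (cis (2*pi*real k/real m) * a - b)<=norm a * (2*pi/real m)"
proof -
 define t where "t = Arg2pi (b/a)"
 have t: "0<=t" "t < 2*pi" using Arg2pi[of "b/a"] by (auto simp: t_def)
 have "b ~= 0" using ab by auto
 hence "b/a = cis t" using Arg2pi[of "b/a"] ab by (simp add: t_def norm_divide cis_conv_exp is_Arg_def)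
 hence b: "b = cis t * a" using ab by (simp add: field_simps)
 define k where "k = nat \<lfloor>t * m / (2*pi)\<rfloor>"
 have k: "real k<=t * m / (2*pi)" "t * m / (2*pi) < real k + 1" using t by (auto simp: k_def)
 have "t * m / (2*pi) < m" using t m by (simp add: field_simps)
 hence km: "k < m" using k by linarith
 have "2*pi*real k/real m<=t" "t<=2*pi*real k/real m + 2*pi/real m" using k m by (auto simp: field_simps)
 hence "\<bar>2*pi*real k/real m - t\<bar> <= 2*pi/real m" by linarith
 hence "norm (cis (2*pi*real k/real m) - cis t)<=2*pi/real m" using norm_cis_diff_le order_trans by blast
 hence "norm a * norm (cis (2*pi*real k/real m) - cis t)<=norm a * (2*pi/real m)" by (intro mult_left_mono) auto
 moreover have "cis (2*pi*real k/real m) * a - b = (cis (2*pi*real k/real m) - cis t) * a" by (simp add: b left_diff_distrib)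
 ultimately have "norm (cis (2*pi*real k/real m) * a - b)<=norm a * (2*pi/real m)"
  by (simp only: norm_mult mult.commute)
 thus ?thesis using km by blast
qed

locale jordan_riemann =
 fixes gb :: "real => complex" and pj pk :: "complex => complex"
 assumes gb: "simple_path gb" "pfn gb = pst gb"
  and holpj: "pj holomorphic_on inside (pim gb)" and holpk: "pk holomorphic_on ball 0 1"
  and pj: "!!z. z:inside (pim gb) ==> pj z:ball 0 1 & pk (pj z) = z"
  and pk: "!!z. z:ball 0 1 ==> pk z:inside (pim gb) & pj (pk z) = z"
begin

definition "Om = inside (pim gb)"
definition "J = pim gb"

lemma basic: "open Om" "connected Om" "Om ~= {}" "bounded Om" "frontier Om = J" "closure Om = Om Un J" "Om Int J = {}"
  "compact (closure Om)" "compact J" "frontier (outside J) = J" "open (outside J)" "outside J Int closure Om = {}"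
proof -
 note * = Jordan_inside_outside[OF gb]
 show 1: "open Om" "connected Om" "Om ~= {}" "bounded Om" "frontier Om = J" "frontier (outside J) = J" "open (outside J)"
  using * by (auto simp: Om_def J_def)
 show 2: "Om Int J = {}" by (auto simp: Om_def J_def inside_def)
 show 3: "closure Om = Om Un J" using 1 closure_Un_frontier by auto
 show "compact (closure Om)" using 1 by (simp add: compact_closure)
 show "compact J" unfolding J_def by (rule compact_simple_path_image[OF gb(1)])
 have "outside J Int Om = {}" using * unfolding Om_def J_def by blast
 moreover have "outside J Int J = {}" by (auto simp: outside_def)
 ultimately show "outside J Int closure Om = {}" using 3 by blast
qed

lemma cont: "continuous_on Om pj" "continuous_on (ball 0 1) pk"
 using holpj holpk holomorphic_on_imp_continuous_on by (auto simp: Om_def)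

text \<open>A limit inside the disk would be carried by the continuous \<open>pk\<close> to a point
  of \<open>Om\<close>, but \<open>pk (pj (w n)) = w n\<close> tends to the boundary.\<close>

lemma boundary_limit_norm:
 assumes w: "!!n::nat. w n:Om" "w \<longlonglongrightarrow> p" "p:J" and z: "(%n. pj (w n)) \<longlonglongrightarrow> zt"
 shows "norm zt = 1"
proof -
 have "(%n. norm (pj (w n))) \<longlonglongrightarrow> norm zt" by (rule tendsto_norm[OF z])
 moreover have "norm (pj (w n)) < 1" for n using pj w(1) by (auto simp: Om_def)
 ultimately have le: "norm zt<=1" by (meson LIMSEQ_le_const2 less_imp_le)
 have "~ norm zt < 1"
 proof
  assume "norm zt < 1"
  hence zb: "zt:ball 0 1" by simp
  have "(%n. pk (pj (w n))) \<longlonglongrightarrow> pk zt"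
   by (rule continuous_on_tendsto_compose[OF cont(2) z zb]) (use pj w(1) in \<open>auto simp: Om_def\<close>)
  moreover have "pk (pj (w n)) = w n" for n using pj w(1) by (auto simp: Om_def)
  ultimately have "w \<longlonglongrightarrow> pk zt" by simp
  hence "p = pk zt" using w(2) LIMSEQ_unique by blast
  thus False using pk[OF zb] w(3) basic(7) by (auto simp: Om_def)
 qed
 thus ?thesis using le by simp
qed

text \<open>Local connectedness of the inside at \<open>p\<close> joins \<open>x n\<close> to
  \<open>y n\<close> within a small ball. The images of these connections under \<open>pj\<close>
  run close to the circle from near \<open>zt1\<close> to near \<open>zt2\<close>, and
  \<open>pk\<close> is nearly \<open>p\<close> on them, so Koebe's lemma makes \<open>pk\<close>
  constant.\<close>

lemma no_two_limits:
 assumes x: "!!n::nat. x n:Om" "x \<longlonglongrightarrow> p" and y: "!!n::nat. y n:Om" "y \<longlonglongrightarrow> p" and p: "p:J"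
  and zx: "(%n. pj (x n)) \<longlonglongrightarrow> zt1" and zy: "(%n. pj (y n)) \<longlonglongrightarrow> zt2"
 shows "zt1 = zt2"
proof (rule ccontr)
 assume ne: "zt1 ~= zt2"
 have n1: "norm zt1 = 1" "norm zt2 = 1" using boundary_limit_norm x y p zx zy by blast+
 obtain M where M: "!!z. z:Om ==> norm z<=M" using basic(4) bounded_iff by blast
 have "pk 0 = p"
 proof (rule Koebe_boundary_arcs[OF holpk _ n1 ne])
  show "cmod (pk z)<=M" if "z:ball 0 1" for z using M pk[OF that] by (simp add: Om_def)
  fix e :: real assume e: "e > 0"
  \<comment> \<open>A ball about \<open>p\<close> that misses the image \<open>K\<close> of a
    smaller disk forces the connecting arc to have modulus above \<open>1 - e\<close>.\<close>
  define K where "K = pk ` cball 0 (1 - min e (1/2))"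
  have sub: "cball 0 (1 - min e (1/2))<=ball (0::complex) 1" using e by auto
  have "compact K" unfolding K_def
   by (intro compact_continuous_image continuous_on_subset[OF cont(2) sub]) auto
  moreover have "p ~: K" using pk sub p basic(7) unfolding K_def Om_def by blast
  ultimately obtain e1 where e1: "e1 > 0" "ball p e1 <= - K"
   using compact_imp_closed open_contains_ball by (metis ComplI open_Compl)
  define e' where "e' = min e1 e"
  have e': "e' > 0" "e'<=e" "ball p e' Int K = {}" using e1 e by (auto simp: e'_def)
  obtain d where d: "d > 0" "!!w w'. w:Om ==> w':Om ==> dist w p < d ==> dist w' p < d
    ==> connected_component (Om Int ball p e') w w'"
   using Jordan_inside_locally_connected[OF gb _ e'(1)] p unfolding Om_def J_def by metis
  have "\<forall>\<^sub>F n in sequentially. dist (x n) p < d & dist (y n) p < d & dist (pj (x n)) zt1 < e & dist (pj (y n)) zt2 < e"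
   using x y zx zy d(1) e by (intro eventually_conj tendstoD) auto
  then obtain n where n: "dist (x n) p < d" "dist (y n) p < d" "dist (pj (x n)) zt1 < e" "dist (pj (y n)) zt2 < e"
   by (auto simp: eventually_sequentially)
  have "connected_component (Om Int ball p e') (x n) (y n)" using d(2) x y n by blast
  hence "path_component (Om Int ball p e') (x n) (y n)"
   using basic(1) by (simp add: open_path_connected_component open_Int)
  then obtain h where h: "path h" "pim h<=Om Int ball p e'" "pst h = x n" "pfn h = y n"
   unfolding path_component_def by blast
  have ht: "h t:Om" "dist (h t) p < e'" if "t:{0..1}" for t
   using h(2) imageI[OF that, of h] by (auto simp: pim_def dist_commute subset_iff)
  show "EX C. path C & dist (C 0) zt1 < e & dist (C 1) zt2 < e &
    (ALL t:{0..1}. 1 - e < norm (C t) & norm (C t) < 1 & norm (pk (C t) - p)<=e)"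
  proof (intro exI[of _ "pj o h"] conjI ballI)
   show "path (pj o h)" by (rule path_continuous_image[OF h(1) continuous_on_subset[OF cont(1)]]) (use h in auto)
   show "dist ((pj o h) 0) zt1 < e" "dist ((pj o h) 1) zt2 < e" using n h by (auto simp: pst_def pfn_def)
   fix t :: real assume t: "t:{0..1}"
   have ps: "pj (h t):ball 0 1" "pk (pj (h t)) = h t" using pj ht[OF t] by (auto simp: Om_def)
   show "norm ((pj o h) t) < 1" using ps by simp
   show "norm (pk ((pj o h) t) - p)<=e" using ps ht(2)[OF t] e' by (simp add: dist_norm)
   show "1 - e < norm ((pj o h) t)"
   proof (rule ccontr)
    assume "~ ?thesis"
    hence "pj (h t):cball 0 (1 - min e (1/2))" by (simp add: min_def)
    hence "h t:K" unfolding K_def using ps(2) by (metis imageI)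
    thus False using ht(2)[OF t] e'(3) by (auto simp: dist_commute)
   qed
  qed
 qed simp
 thus False using pk[of 0] p basic(7) by (auto simp: Om_def)
qed

text \<open>By compactness, sequences violating uniform continuity would converge to one point with
  two different limits of \<open>pj\<close>. Continuity excludes this inside,
  \<open>no_two_limits\<close> on the boundary.\<close>

lemma uniformly_continuous_pj: "uniformly_continuous_on Om pj"
proof (rule ccontr)
 assume "~ ?thesis"
 then obtain e where e: "e > 0" "ALL d>0. EX x:Om. EX x':Om. dist x' x < d & ~ dist (pj x') (pj x) < e"
  unfolding uniformly_continuous_on_def by meson
 have "ALL n::nat. EX x x'. x:Om & x':Om & dist x' x < 1 / real (Suc n) & dist (pj x') (pj x) >= e"
  using e(2) by (metis not_le zero_less_divide_1_iff of_nat_0_less_iff zero_less_Suc)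
 then obtain x y where xy: "!!n::nat. x n:Om" "!!n. y n:Om" "!!n. dist (y n) (x n) < 1 / real (Suc n)" "!!n. dist (pj (y n)) (pj (x n)) >= e"
  by metis
 define T where "T n = (x n, pj (x n), pj (y n))" for n
 have "compact (closure Om \<times> cball (0::complex) 1 \<times> cball (0::complex) 1)"
  by (intro compact_Times basic compact_cball)
 moreover have "T n:closure Om \<times> cball 0 1 \<times> cball 0 1" for n
  using xy(1,2)[of n] pj[of "x n"] pj[of "y n"] closure_subset[of Om] by (auto simp: T_def Om_def)
 ultimately obtain l r where lr: "l:closure Om \<times> cball (0::complex) 1 \<times> cball (0::complex) 1" "strict_mono r" "(T o r) \<longlonglongrightarrow> l"
  unfolding compact_def by metis
 obtain p zt1 zt2 where l: "l = (p, zt1, zt2)" by (metis prod.collapse)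
 have lx: "(%n. x (r n)) \<longlonglongrightarrow> p" and l1: "(%n. pj (x (r n))) \<longlonglongrightarrow> zt1" and l2: "(%n. pj (y (r n))) \<longlonglongrightarrow> zt2"
  using lr(3) tendsto_fst[OF lr(3)] tendsto_fst[OF tendsto_snd[OF lr(3)]] tendsto_snd[OF tendsto_snd[OF lr(3)]]
  by (auto simp: l T_def o_def)
 have "(%n. 1 / real (Suc (r n))) \<longlonglongrightarrow> 0"
  using LIMSEQ_subseq_LIMSEQ[OF LIMSEQ_Suc[OF lim_1_over_n] lr(2)] by (simp add: o_def)
 hence "(%n. dist (y (r n)) (x (r n))) \<longlonglongrightarrow> 0"
  by (rule Lim_null_comparison[rotated]) (use xy(3) less_imp_le in \<open>auto intro!: always_eventually\<close>)
 hence ly: "(%n. y (r n)) \<longlonglongrightarrow> p"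
  using lx tendsto_add[OF lx, of "%n. y (r n) - x (r n)" 0] by (simp add: dist_norm tendsto_norm_zero_iff)
 have "(%n. dist (pj (y (r n))) (pj (x (r n)))) \<longlonglongrightarrow> dist zt2 zt1" by (intro tendsto_dist l1 l2)
 hence "e<=dist zt2 zt1" by (rule LIMSEQ_le_const) (use xy(4) in auto)
 hence ne: "zt1 ~= zt2" using e by auto
 have "p:closure Om" using lr(1) l by auto
 then consider "p:Om" | "p:J" using basic(6) by blast
 thus False
 proof cases
  case 1
  have "(%n. pj (x (r n))) \<longlonglongrightarrow> pj p" by (rule continuous_on_tendsto_compose[OF cont(1) lx 1]) (use xy in auto)
  moreover have "(%n. pj (y (r n))) \<longlonglongrightarrow> pj p" by (rule continuous_on_tendsto_compose[OF cont(1) ly 1]) (use xy in auto)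
  ultimately show False using ne l1 l2 LIMSEQ_unique by blast
 next
  case 2
  show False using no_two_limits[OF _ lx _ ly 2 l1 l2] xy ne by blast
 qed
qed

text \<open>Rotate about an interior point \<open>c\<close> near \<open>p0\<close>, on the circle
  through an exterior point \<open>q\<close> near \<open>p0\<close>. For large \<open>m\<close>
  every point of the circle has a rotate close to \<open>q\<close>, hence outside. The product
  estimate then forces \<open>pj c = zt\<close>, a value of modulus 1.\<close>

lemma const_arc_impossible:
 assumes contPs: "continuous_on (closure Om) Ps" and eq: "!!z. z:Om ==> Ps z = pj z"
  and p0: "p0:J" and r: "r > 0" and zt: "norm zt = 1" and const: "!!z. z:J ==> dist z p0 < r ==> Ps z = zt"
 shows False
proof -
 have "p0:closure Om" "p0:closure (outside J)" using p0 basic(6) basic(10) by (auto simp: frontier_def)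
 then obtain c q where c: "c:Om" "dist c p0 < r/4" and q: "q:outside J" "dist q p0 < r/4"
  using r by (metis closure_approachable zero_less_divide_iff zero_less_numeral)
 define R where "R = dist c q"
 have "c ~= q" using c q basic(12) closure_subset[of Om] by blast
 hence R: "R > 0" "R < r/2" using dist_triangle2[of c q p0] c q by (auto simp: R_def dist_commute)
 obtain e0 where e0: "e0 > 0" "ball q e0<=outside J" using basic(11) q open_contains_ball by blast
 obtain m :: nat where m: "m > 0" "R * (2*pi/real m) < e0"
 proof -
  obtain m :: nat where "R * (2*pi) / e0 < real m" using reals_Archimedean2 by blast
  hence "R * (2*pi) / e0 < real (Suc m)" by simp
  hence "R * (2*pi/real (Suc m)) < e0" using e0 by (simp add: field_simps)
  thus thesis using that by blast
 qed
 have le: "norm (pj c - zt) ^ m<=e * 2 ^ (m - 1)" if e: "e > 0" for e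
 proof (rule rotation_product_bound[OF basic(1) c(1) R(1) m(1), of "%z. pj z - zt"])
  show "(%z. pj z - zt) holomorphic_on Om" using holpj unfolding Om_def by (intro holomorphic_intros)
  show "norm (pj z - zt)<=2" if "z:Om" for z
   using norm_triangle_ineq4[of "pj z" zt] pj[of z] that zt by (simp add: Om_def)
  show "EX k<m. c + cis (2*pi*real k/real m) * (z - c) ~: closure Om" if z: "dist z c = R" for z
  proof -
   have "norm (z - c) = norm (q - c)" "z - c ~= 0" using z R by (auto simp: R_def dist_norm norm_minus_commute)
   from cis_rotation_close[OF m(1) this] obtain k where k: "k < m" "norm (cis (2*pi*real k/real m) * (z - c) - (q - c))<=norm (z - c) * (2*pi/real m)"
    by blast
   hence "dist (c + cis (2*pi*real k/real m) * (z - c)) q < e0"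
    using m(2) z by (simp add: dist_norm algebra_simps)
   hence "c + cis (2*pi*real k/real m) * (z - c):outside J" using e0 by (auto simp: dist_commute)
   thus ?thesis using k basic(12) by blast
  qed
  show "EX d>0. ALL z:Om. dist z p < d --> norm (pj z - zt)<=e" if p: "p:frontier Om" "dist p c < R" for p
  proof -
   have pJ: "p:J" using p basic(5) by simp
   have "dist p p0 < r" using dist_triangle[of p p0 c] p c R by simp
   hence "Ps p = zt" using const pJ by blast
   moreover have "p:closure Om" using pJ basic(6) by blast
   ultimately obtain d where "d > 0" "!!z. z:closure Om ==> dist z p < d ==> dist (Ps z) zt < e"
    using contPs e unfolding continuous_on_iff by metis
   thus ?thesis using eq closure_subset[of Om] by (metis dist_norm less_imp_le subsetD)
  qed
 qed (use e in auto)
 have "norm (pj c - zt) ^ m<=0"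
 proof (rule field_le_epsilon)
  fix e :: real assume e: "e > 0"
  show "norm (pj c - zt) ^ m<=0 + e" using le[of "e / 2^(m-1)"] e by simp
 qed
 hence "pj c = zt" using m by (metis norm_eq_zero norm_ge_zero order_antisym_conv power_eq_0_iff right_minus_eq zero_le_power)
 thus False using pj[of c] c zt by (auto simp: Om_def)
qed

end

context jordan_riemann
begin

text \<open>The straight segment from an interior point to a nearest boundary point stays inside up
  to its end.\<close>

lemma accessible_near:
 assumes p: "p:J" and db: "db > 0"
 obtains w p' where "w:Om" "p':J" "closed_segment w p' - {p'}<=Om" "!!z. z:closed_segment w p' ==> dist z p < db"
proof -
 have "p:closure Om" using p basic(6) by blast
 then obtain w where w: "w:Om" "dist w p < db/2" using db by (metis closure_approachable half_gt_zero)
 obtain p' where p': "p':J" "!!y. y:J ==> dist w p'<=dist w y"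
  using distance_attains_inf[of J w] basic(9) p compact_imp_closed by blast
 have "w ~: J" using w basic(7) by blast
 hence wp: "dist w p' > 0" using p' by auto
 have "ball w (dist w p')<=Om"
 proof (rule ccontr)
  assume "~ ?thesis"
  hence "ball w (dist w p') - Om ~= {}" by blast
  moreover have "ball w (dist w p') Int Om ~= {}" using w wp by (metis IntI centre_in_ball empty_iff)
  ultimately have "ball w (dist w p') Int J ~= {}"
   using connected_Int_frontier[of "ball w (dist w p')" Om] basic(5) connected_ball by blast
  thus False using p'(2) by fastforce
 qed
 moreover have "z:ball w (dist w p')" if "z:closed_segment w p'" "z ~= p'" for z
  using dist_in_closed_segment[of z w p'] that dist_decreases_open_segment[of z w p' w] wp
  by (cases "z = w") (auto simp: dist_commute open_segment_def)
 moreover have "dist z p < db" if "z:closed_segment w p'" for z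
 proof -
  have "dist z w<=dist w p'" using dist_in_closed_segment[OF that] by (simp add: dist_commute)
  also have "\<dots> <= dist w p" using p' p by blast
  finally show ?thesis using dist_triangle[of z p w] w by simp
 qed
 ultimately show thesis using that[of w p'] w p' by blast
qed

text \<open>Interlacing survives the small moves made by \<open>accessible_near\<close>. The new
  ends lie in disjoint small pieces \<open>Np\<close>, \<open>Nq\<close> of the curve. The middle
  pieces \<open>A1\<close>, \<open>A2\<close> are connected and miss them, so each lies in one of
  the new arcs; if both lay in the same one, the other arc would connect \<open>Np\<close> to
  \<open>Nq\<close> inside their disjoint union.\<close>

lemma interlaced_near:
 assumes u: "arc u" "pst u = p" "pfn u = q" and d: "arc d" "pst d = q" "pfn d = p"
  and ud: "pim u Int pim d = {p,q}" "pim u Un pim d = J"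
  and s: "0 < s1" "s1 < 1" "0 < s2" "s2 < 1"
 obtains db where "db > 0" "!!p' q' p1 q1 u' d'. {p',q',p1,q1}<=J ==> dist p' p < db ==> dist q' q < db ==> dist p1 (u s1) < db ==> dist q1 (d s2) < db
   ==> connected (pim u') ==> connected (pim d') ==> closed (pim u') ==> closed (pim d')
   ==> {p',q'}<=pim u' ==> {p',q'}<=pim d'
   ==> pim u' Int pim d' = {p',q'} ==> pim u' Un pim d' = J
   ==> (p1:pim u' & q1:pim d') \<or> (p1:pim d' & q1:pim u')"
proof -
 define h where "h = min (min (s1/2) ((1-s1)/2)) (min (s2/2) ((1-s2)/2))"
 have h: "0 < h" "h < s1" "s1 < 1 - h" "h < s2" "s2 < 1 - h" "h < 1/2" using s by (auto simp: h_def min_def field_simps)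
 have iu: "inj_on u {0..1}" and cu: "continuous_on {0..1} u" using u by (auto simp: arc_def path_def)
 have id: "inj_on d {0..1}" and cd: "continuous_on {0..1} d" using d by (auto simp: arc_def path_def)
 have u0: "u 0 = p" "u 1 = q" and d0: "d 0 = q" "d 1 = p" using u d by (auto simp: pst_def pfn_def)
 define A1 where "A1 = u ` {h..1-h}"
 define A2 where "A2 = d ` {h..1-h}"
 define Np where "Np = u ` {0..h} Un d ` {1-h..1}"
 define Nq where "Nq = u ` {1-h..1} Un d ` {0..h}"
 have comp: "compact (u ` {a..b})" "connected (u ` {a..b})" "compact (d ` {a..b})" "connected (d ` {a..b})" if "0<=a" "b<=1" for a b
 proof -
  have c: "continuous_on {a..b} u" "continuous_on {a..b} d"
   using that by (auto intro: continuous_on_subset[OF cu] continuous_on_subset[OF cd])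
  show "compact (u ` {a..b})" "connected (u ` {a..b})" "compact (d ` {a..b})" "connected (d ` {a..b})"
   using c by (auto intro: compact_continuous_image connected_continuous_image)
 qed
 have cA: "connected A1" "connected A2" "compact A1" "compact A2" "compact Np" "compact Nq"
  unfolding A1_def A2_def Np_def Nq_def using comp h by (auto intro!: compact_Un)
 have cover: "J = A1 Un A2 Un Np Un Nq"
 proof -
  have "{0..1} = {h..1-h} Un {0..h} Un {1-h..1}" using h by auto
  hence "u ` {0..1} = A1 Un u ` {0..h} Un u ` {1-h..1}" "d ` {0..1} = A2 Un d ` {0..h} Un d ` {1-h..1}"
   unfolding A1_def A2_def by (simp_all only: image_Un)
  thus ?thesis using ud(2) by (auto simp: pim_def Np_def Nq_def)
 qed
 have udeq: "u x = d y ==> x:{0..1} ==> y:{0..1} ==> (x = 0 & y = 1) \<or> (x = 1 & y = 0)" for x y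
 proof -
  assume a: "u x = d y" "x:{0..1}" "y:{0..1}"
  hence "u x:{p,q}" using ud(1) unfolding pim_def by blast
  hence "u x = u 0 & d y = d 1 \<or> u x = u 1 & d y = d 0" using u0 d0 a by auto
  thus ?thesis using inj_on_eq_iff[OF iu a(2), of 0] inj_on_eq_iff[OF iu a(2), of 1]
    inj_on_eq_iff[OF id a(3), of 0] inj_on_eq_iff[OF id a(3), of 1] by auto
 qed
 have ueq: "u x = u y ==> x:{0..1} ==> y:{0..1} ==> x = y" and deq: "d x = d y ==> x:{0..1} ==> y:{0..1} ==> x = y" for x y
  by (auto dest: inj_onD[OF iu] inj_onD[OF id])
 have NpNq: "Np Int Nq = {}"
 proof -
  have "False" if "x:{0..h}" "y:{1-h..1}" "u x = u y" for x y using ueq[OF that(3)] that h by auto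
  moreover have "False" if "x:{0..h}" "y:{0..h}" "u x = d y" for x y using udeq[OF that(3)] that h by auto
  moreover have "False" if "x:{1-h..1}" "y:{1-h..1}" "u x = d y" for x y using udeq[OF that(3)] that h by auto
  moreover have "False" if "x:{1-h..1}" "y:{0..h}" "d x = d y" for x y using deq[OF that(3)] that h by auto
  ultimately show ?thesis unfolding Np_def Nq_def by (smt (verit) Int_iff Un_iff disjoint_iff imageE)
 qed
 have uu: "u x:u ` {a..b} \<longleftrightarrow> x:{a..b}" if "x:{0..1}" "0<=a" "b<=1" for x a b
  by (rule inj_on_image_mem_iff[OF iu]) (use that in auto)
 have dd: "d x:d ` {a..b} \<longleftrightarrow> x:{a..b}" if "x:{0..1}" "0<=a" "b<=1" for x a b
  by (rule inj_on_image_mem_iff[OF id]) (use that in auto)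
 have udn: "u x ~: d ` {a..b}" "d x ~: u ` {a..b}" if "0 < x" "x < 1" "0<=a" "b<=1" for x a b
 proof -
  have "u x ~= d y" "d x ~= u y" if "y:{a..b}" for y
   using udeq[of x y] udeq[of y x] that \<open>0 < x\<close> \<open>x < 1\<close> \<open>0<=a\<close> \<open>b<=1\<close> by force+
  thus "u x ~: d ` {a..b}" "d x ~: u ` {a..b}" by blast+
 qed
 have pn: "p ~: A1 Un A2 Un Nq"
  using uu[of 0 h "1-h"] uu[of 0 "1-h" 1] dd[of 1 h "1-h"] dd[of 1 0 h] h u0 d0 by (simp add: A1_def A2_def Nq_def)
 have qn: "q ~: A1 Un A2 Un Np"
  using uu[of 1 h "1-h"] uu[of 1 0 h] dd[of 0 h "1-h"] dd[of 0 "1-h" 1] h u0 d0 by (simp add: A1_def A2_def Np_def)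
 have p1n: "u s1 ~: A2 Un Np Un Nq"
  using uu[of s1 0 h] uu[of s1 "1-h" 1] udn(1)[of s1] s h by (simp add: A2_def Np_def Nq_def)
 have q1n: "d s2 ~: A1 Un Np Un Nq"
  using dd[of s2 0 h] dd[of s2 "1-h" 1] udn(2)[of s2] s h by (simp add: A1_def Np_def Nq_def)
 have sep: "EX r>0. ALL y. dist y x < r --> y ~: K" if "compact K" "x ~: K" for x K
 proof -
  have "open (- K)" "x:- K" using that compact_imp_closed by auto
  then obtain r where "r > 0" "ball x r <= - K" using open_contains_ball by blast
  thus ?thesis by (metis ComplD dist_commute mem_ball subsetD)
 qed
 obtain r1 where r1: "r1 > 0" "!!y. dist y p < r1 ==> y ~: A1 Un A2 Un Nq" using sep[OF _ pn] cA by (auto intro: compact_Un)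
 obtain r2 where r2: "r2 > 0" "!!y. dist y q < r2 ==> y ~: A1 Un A2 Un Np" using sep[OF _ qn] cA by (auto intro: compact_Un)
 obtain r3 where r3: "r3 > 0" "!!y. dist y (u s1) < r3 ==> y ~: A2 Un Np Un Nq" using sep[OF _ p1n] cA by (auto intro: compact_Un)
 obtain r4 where r4: "r4 > 0" "!!y. dist y (d s2) < r4 ==> y ~: A1 Un Np Un Nq" using sep[OF _ q1n] cA by (auto intro: compact_Un)
 define db where "db = min (min r1 r2) (min r3 r4)"
 show thesis
 proof (rule that[of db])
  show "db > 0" using r1 r2 r3 r4 by (auto simp: db_def)
  fix p' q' p1 q1 u' d'
  assume a: "{p',q',p1,q1}<=J" "dist p' p < db" "dist q' q < db" "dist p1 (u s1) < db" "dist q1 (d s2) < db"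
   and c: "connected (pim u')" "connected (pim d')" "closed (pim u')" "closed (pim d')"
   and e: "{p',q'}<=pim u'" "{p',q'}<=pim d'"
   and i: "pim u' Int pim d' = {p',q'}" "pim u' Un pim d' = J"
  have n: "p' ~: A1 Un A2 Un Nq" "q' ~: A1 Un A2 Un Np" "p1 ~: A2 Un Np Un Nq" "q1 ~: A1 Un Np Un Nq"
   using r1(2) r2(2) r3(2) r4(2) a(2-5) by (auto simp: db_def)
  have m: "p':Np" "q':Nq" "p1:A1" "q1:A2" using n a(1) cover by blast+
  have split: "A<=pim u' - {p',q'} \<or> A<=pim d' - {p',q'}"
   if "connected A" "A<=J" "p' ~: A" "q' ~: A" for A
  proof -
   have "pim u' Int A = {} \<or> pim d' Int A = {}"
    using connected_closedD[OF that(1), of "pim u'" "pim d'"] c i that by auto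
   thus ?thesis using that i by blast
  qed
  have s1: "A1<=pim u' - {p',q'} \<or> A1<=pim d' - {p',q'}" by (rule split) (use cA cover n in auto)
  have s2: "A2<=pim u' - {p',q'} \<or> A2<=pim d' - {p',q'}" by (rule split) (use cA cover n in auto)
  have no: False if "connected B" "{p',q'}<=B" "B<=J" "B Int (A1 Un A2) = {}" for B
  proof -
   have "B<=Np Un Nq" using that cover by blast
   moreover have "Np Int Nq Int B = {}" using NpNq by blast
   ultimately have "Np Int B = {} \<or> Nq Int B = {}"
    using connected_closedD[OF that(1), of Np Nq] cA compact_imp_closed by blast
   thus False using m that by blast
  qed
  have f1: "~ (A1<=pim u' - {p',q'} & A2<=pim u' - {p',q'})"
   using no[of "pim d'"] c e i by blast
  have f2: "~ (A1<=pim d' - {p',q'} & A2<=pim d' - {p',q'})"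
   using no[of "pim u'"] c e i by blast
  show "(p1:pim u' & q1:pim d') \<or> (p1:pim d' & q1:pim u')"
   using s1 s2 f1 f2 m by blast
 qed
qed

text \<open>If \<open>p\<close> and \<open>q\<close> had the same image \<open>zt\<close>, both arcs
  between them would contain a point with another image. A chord joining these two images stays off
  a neighbourhood of \<open>zt\<close>, and \<open>p\<close>, \<open>q\<close> are nearly joined
  inside this neighbourhood. Pulled back, these give disjoint crosscuts with interlaced ends,
  against \<open>crosscuts_meet\<close>.\<close>

lemma extension_injective:
 assumes contPs: "continuous_on (closure Om) Ps" and eq: "!!z. z:Om ==> Ps z = pj z"
  and unit: "!!z. z:J ==> norm (Ps z) = 1"
 shows "inj_on Ps J"
proof (rule inj_onI, rule ccontr)
 fix p q assume pq: "p:J" "q:J" "Ps p = Ps q" "p ~= q"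
 define zt where "zt = Ps p"
 obtain u d where u: "arc u" "pst u = p" "pfn u = q" and d: "arc d" "pst d = q" "pfn d = p"
  and ud: "pim u Int pim d = {p,q}" "pim u Un pim d = J"
  using exists_double_arc[OF gb] pq unfolding J_def by metis
 have nonconst: "EX s. 0 < s & s < 1 & Ps (v s) ~= zt"
  if v: "arc v" "pim v Un pim v' = J" "arc v'" "pim v Int pim v' = {v 0, v 1}" for v v'
 proof (rule ccontr)
  assume c: "~ ?thesis"
  have iv: "inj_on v {0..1}" using v by (simp add: arc_def)
  have v2: "v (1/2) ~: pim v'"
  proof
   assume "v (1/2):pim v'"
   moreover have "v (1/2):pim v" by (auto simp: pim_def)
   ultimately have "v (1/2):{v 0, v 1}" using v(4) by blast
   thus False using iv by (auto simp: inj_on_eq_iff)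
  qed
  have "closed (pim v')" using v by (simp add: closed_arc_image)
  then obtain r where r: "r > 0" "ball (v (1/2)) r Int pim v' = {}"
   using v2 by (metis ComplI open_Compl open_contains_ball disjoint_eq_subset_Compl)
  have vJ: "v (1/2):J" using v(2) by (auto simp: pim_def)
  show False
  proof (rule const_arc_impossible[OF contPs eq vJ r(1)])
   show "norm zt = 1" using unit pq by (simp add: zt_def)
   fix z assume z: "z:J" "dist z (v (1/2)) < r"
   hence "z:pim v" "z ~: pim v'" using r v(2) by (auto simp: dist_commute)
   then obtain s where s: "s:{0..1}" "z = v s" by (auto simp: pim_def)
   have "s ~= 0" "s ~= 1" using \<open>z ~: pim v'\<close> v(4) s by auto
   thus "Ps z = zt" using c s by auto
  qed
 qed
 obtain s1 where s1: "0 < s1" "s1 < 1" "Ps (u s1) ~= zt"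
  using nonconst[of u d] u d ud by (auto simp: pst_def pfn_def)
 obtain s2 where s2: "0 < s2" "s2 < 1" "Ps (d s2) ~= zt"
  using nonconst[of d u] u d ud by (auto simp: pst_def pfn_def Un_commute Int_commute insert_commute)
 define zt1 zt2 where "zt1 = Ps (u s1)" and "zt2 = Ps (d s2)"
 have inJ: "u s1:J" "d s2:J" using s1 s2 ud by (auto simp: pim_def)
 have n1: "norm zt = 1" "norm zt1 = 1" "norm zt2 = 1" using unit inJ pq by (auto simp: zt_def zt1_def zt2_def)
 \<comment> \<open>Points of the unit circle are extreme in the disk, so a chord contains no third
   one.\<close>
 have "zt ~: closed_segment zt1 zt2"
 proof
  assume a: "zt:closed_segment zt1 zt2"
  hence "zt:open_segment zt1 zt2" using s1 s2 by (auto simp: open_segment_def zt1_def zt2_def)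
  hence "dist 0 zt < dist 0 zt1 \<or> dist 0 zt < dist 0 zt2" by (rule dist_decreases_open_segment[rule_format])
  thus False using n1 by simp
 qed
 then obtain r3 where r3: "r3 > 0" "ball zt r3 Int closed_segment zt1 zt2 = {}"
  by (metis ComplI open_Compl closed_segment open_contains_ball disjoint_eq_subset_Compl)
 define r where "r = r3/2"
 have r: "r > 0" using r3 by (simp add: r_def)
 have far: "dist z zt >= r" if ab: "a:ball zt1 r" "b:ball zt2 r" "z:closed_segment a b" for a b z
 proof -
  obtain t where t: "0<=t" "t<=1" "z = (1-t) *\<^sub>R a + t *\<^sub>R b" using ab(3) by (auto simp: in_segment)
  define z' where "z' = (1-t) *\<^sub>R zt1 + t *\<^sub>R zt2"
  have "z':closed_segment zt1 zt2" using t by (auto simp: z'_def in_segment)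
  hence "dist zt z' >= r3" using r3 by (meson disjoint_iff mem_ball not_le)
  moreover have "dist z z' < r"
  proof -
   have "z - z' = (1-t) *\<^sub>R (a - zt1) + t *\<^sub>R (b - zt2)" by (simp add: t z'_def algebra_simps)
   hence "norm (z - z')<=(1-t) * norm (a - zt1) + t * norm (b - zt2)"
    using norm_triangle_ineq[of "(1-t) *\<^sub>R (a - zt1)" "t *\<^sub>R (b - zt2)"] t by simp
   also have "\<dots> < r" using convex_bound_lt[of "norm (a - zt1)" r "norm (b - zt2)" "1-t" t] ab t by (simp add: dist_norm norm_minus_commute)
   finally show ?thesis by (simp add: dist_norm)
  qed
  ultimately show ?thesis using dist_triangle[of zt z' z] by (simp add: r_def dist_commute)
 qed
 obtain db0 where db0: "db0 > 0" "!!p' q' p1 q1 u' d'. {p',q',p1,q1}<=J ==> dist p' p < db0 ==> dist q' q < db0 ==> dist p1 (u s1) < db0 ==> dist q1 (d s2) < db0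
   ==> connected (pim u') ==> connected (pim d') ==> closed (pim u') ==> closed (pim d')
   ==> {p',q'}<=pim u' ==> {p',q'}<=pim d'
   ==> pim u' Int pim d' = {p',q'} ==> pim u' Un pim d' = J
   ==> (p1:pim u' & q1:pim d') \<or> (p1:pim d' & q1:pim u')"
  using interlaced_near[OF u d ud s1(1,2) s2(1,2)] by metis
 have JOm: "J<=closure Om" "Om<=closure Om" using basic(6) by auto
 have mod: "EX e>0. ALL z:closure Om. dist z y < e --> Ps z:ball (Ps y) r" if "y:J" for y
  using contPs r that JOm unfolding continuous_on_iff by (metis dist_commute mem_ball subsetD)
 obtain e1 where e1: "e1 > 0" "!!z. z:closure Om ==> dist z p < e1 ==> Ps z:ball zt r" using mod[OF pq(1)] zt_def by blast
 obtain e2 where e2: "e2 > 0" "!!z. z:closure Om ==> dist z q < e2 ==> Ps z:ball zt r" using mod[OF pq(2)] pq(3) zt_def by metis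
 obtain e3 where e3: "e3 > 0" "!!z. z:closure Om ==> dist z (u s1) < e3 ==> Ps z:ball zt1 r" using mod[OF inJ(1)] zt1_def by blast
 obtain e4 where e4: "e4 > 0" "!!z. z:closure Om ==> dist z (d s2) < e4 ==> Ps z:ball zt2 r" using mod[OF inJ(2)] zt2_def by blast
 define db where "db = min db0 (min (min e1 e2) (min e3 (min e4 (dist p q / 2))))"
 have db: "db > 0" "db<=db0" "db<=e1" "db<=e2" "db<=e3" "db<=e4" "db<=dist p q / 2" using db0 e1 e2 e3 e4 pq by (auto simp: db_def)
 obtain w p' where w: "w:Om" "p':J" "closed_segment w p' - {p'}<=Om" "!!z. z:closed_segment w p' ==> dist z p < db"
  using accessible_near[OF pq(1) db(1)] by metis
 obtain v q' where v: "v:Om" "q':J" "closed_segment v q' - {q'}<=Om" "!!z. z:closed_segment v q' ==> dist z q < db"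
  using accessible_near[OF pq(2) db(1)] by metis
 obtain w1 p1 where w1: "w1:Om" "p1:J" "closed_segment w1 p1 - {p1}<=Om" "!!z. z:closed_segment w1 p1 ==> dist z (u s1) < db"
  using accessible_near[OF inJ(1) db(1)] by metis
 obtain v1 q1 where v1: "v1:Om" "q1:J" "closed_segment v1 q1 - {q1}<=Om" "!!z. z:closed_segment v1 q1 ==> dist z (d s2) < db"
  using accessible_near[OF inJ(2) db(1)] by metis
 have segcl: "closed_segment a b<=closure Om" if "closed_segment a b - {b}<=Om" "b:J" for a b using that JOm by blast
 \<comment> \<open>A segment from the accessible point \<open>p'\<close>, the pullback of a chord of
   the disk, and a segment to the accessible point \<open>q'\<close>.\<close>
 define X0 where "X0 = (linepath p' w +++ (pk o linepath (pj w) (pj v))) +++ linepath v q'"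
 have segb: "closed_segment (pj a) (pj b)<=ball 0 1" if "a:Om" "b:Om" for a b
  using pj that by (intro closed_segment_subset convex_ball) (auto simp: Om_def)
 have pmid: "path (pk o linepath (pj a) (pj b))" if "a:Om" "b:Om" for a b
  by (rule path_continuous_image[OF path_linepath continuous_on_subset[OF cont(2)]]) (use segb[OF that] in auto)
 have immid: "pim (pk o linepath (pj a) (pj b)) = pk ` closed_segment (pj a) (pj b)" for a b
  by (simp add: path_image_compose)
 have midin: "pk ` closed_segment (pj a) (pj b)<=Om" if "a:Om" "b:Om" for a b
  using segb[OF that] pk by (auto simp: Om_def)
 have ends: "pst (pk o linepath (pj a) (pj b)) = a" "pfn (pk o linepath (pj a) (pj b)) = b" if "a:Om" "b:Om" for a b
  using pj that by (auto simp: Om_def pst_def pfn_def linepath_def)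
 have pX0: "path X0" "pst X0 = p'" "pfn X0 = q'"
  unfolding X0_def using pmid[OF w(1) v(1)] ends[OF w(1) v(1)] by auto
 have imX0: "pim X0 = closed_segment p' w Un pk ` closed_segment (pj w) (pj v) Un closed_segment v q'"
  unfolding X0_def using pmid[OF w(1) v(1)] ends[OF w(1) v(1)] immid by (simp add: path_image_join)
 have p'q': "p' ~= q'"
 proof
  assume "p' = q'"
  hence "dist p' p < db" "dist p' q < db" using w(4)[of p'] v(4)[of q'] by auto
  thus False using dist_triangle2[of p q p'] db(7) by (simp add: dist_commute)
 qed
 obtain X where X: "arc X" "pim X<=pim X0" "pst X = p'" "pfn X = q'"
  using path_contains_arc[OF pX0 p'q'] by blast
 have PsX: "Ps z:ball zt r" if zX: "z:pim X0" for z
 proof -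
  consider "z:closed_segment w p'" | "z:pk ` closed_segment (pj w) (pj v)" | "z:closed_segment v q'"
   using zX imX0 by (auto simp: closed_segment_commute)
  thus ?thesis
  proof cases
   case 1 thus ?thesis using e1(2) segcl[OF w(3,2)] w(4) db by force
  next
   case 3 thus ?thesis using e2(2) segcl[OF v(3,2)] v(4) db by force
  next
   case 2
   then obtain y where y: "y:closed_segment (pj w) (pj v)" "z = pk y" by blast
   have yb: "y:ball 0 1" using y segb[OF w(1) v(1)] by blast
   have "Ps z = y" using y pk[OF yb] eq by (simp add: Om_def)
   moreover have "pj w:ball zt r" "pj v:ball zt r"
    using e1(2)[of w] e2(2)[of v] w(1,4) v(1,4) JOm(2) eq db by force+
   ultimately show ?thesis using y(1) closed_segment_subset[OF _ _ convex_ball] by blast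
  qed
 qed
 define Y where "Y = closed_segment w1 p1 Un pk ` closed_segment (pj w1) (pj v1) Un closed_segment v1 q1"
 have PsY: "Ps z ~: ball zt r" if zY: "z:Y" for z
 proof -
  consider "z:closed_segment w1 p1" | "z:pk ` closed_segment (pj w1) (pj v1)" | "z:closed_segment v1 q1"
   using zY by (auto simp: Y_def)
  thus ?thesis
  proof cases
   case 1
   hence "Ps z:ball zt1 r" using e3(2) segcl[OF w1(3,2)] w1(4) db by force
   thus ?thesis using far[of "Ps z" zt2 "Ps z"] r by (auto simp: dist_commute)
  next
   case 3
   hence "Ps z:ball zt2 r" using e4(2) segcl[OF v1(3,2)] v1(4) db by force
   thus ?thesis using far[of zt1 "Ps z" "Ps z"] r by (auto simp: dist_commute)
  next
   case 2
   then obtain y where y: "y:closed_segment (pj w1) (pj v1)" "z = pk y" by blast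
   have yb: "y:ball 0 1" using y segb[OF w1(1) v1(1)] by blast
   have "Ps z = y" using y pk[OF yb] eq by (simp add: Om_def)
   moreover have "pj w1:ball zt1 r" "pj v1:ball zt2 r"
    using e3(2)[of w1] e4(2)[of v1] w1(1,4) v1(1,4) JOm(2) eq db by force+
   ultimately show ?thesis using far[OF _ _ y(1)] by (auto simp: dist_commute)
  qed
 qed
 obtain u' d' where u': "arc u'" "pst u' = p'" "pfn u' = q'" and d': "arc d'" "pst d' = q'" "pfn d' = p'"
  and ud': "pim u' Int pim d' = {p',q'}" "pim u' Un pim d' = J"
  using exists_double_arc[OF gb] w(2) v(2) p'q' unfolding J_def by metis
 have inter: "(p1:pim u' & q1:pim d') \<or> (p1:pim d' & q1:pim u')"
 proof (rule db0(2)[OF _ _ _ _ _ _ _ _ _ _ _ ud'])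
  show "{p', q', p1, q1}<=J" using w v w1 v1 by auto
  show "dist p' p < db0" "dist q' q < db0" "dist p1 (u s1) < db0" "dist q1 (d s2) < db0"
   using w(4)[of p'] v(4)[of q'] w1(4)[of p1] v1(4)[of q1] db by auto
  show "{p',q'}<=pim u'" "{p',q'}<=pim d'" using ud'(1) by auto
 qed (use u' d' in \<open>auto intro: connected_arc_image closed_arc_image\<close>)
 have insJ: "inside (pim u' Un pim d') = Om" using ud' by (simp add: Om_def J_def)
 show False
 proof (rule crosscuts_meet[OF u' d' ud'(1) X(1,3,4), of Y])
  show "pim X - {p', q'}<=inside (pim u' Un pim d')"
   unfolding insJ using X(2) imX0 w(3) v(3) midin[OF w(1) v(1)] closed_segment_commute[of p' w] by blast
  have "connected (pk ` closed_segment (pj w1) (pj v1))"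
   by (rule connected_continuous_image[OF continuous_on_subset[OF cont(2) segb[OF w1(1) v1(1)]]]) auto
  moreover have "w1:pk ` closed_segment (pj w1) (pj v1)" "v1:pk ` closed_segment (pj w1) (pj v1)"
   using pj[of w1] pj[of v1] w1(1) v1(1) unfolding Om_def by (metis ends_in_segment imageI)+
  ultimately show "connected Y" unfolding Y_def by (intro connected_Un) auto
  show "Y<=inside (pim u' Un pim d') Un pim u' Un pim d'"
   using w1(2,3) v1(2,3) midin[OF w1(1) v1(1)] ud' insJ by (auto simp: Y_def)
  show "Y Int pim X = {}" using PsX PsY X(2) by blast
  show "Y Int pim u' ~= {}" "Y Int pim d' ~= {}" using inter by (auto simp: Y_def)
 qed
qed

end

text \<open>The Riemann map extends by uniform continuity and stays injective by
  \<open>extension_injective\<close>; its image is closed and contains the open disk, hence is the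
  closed disk.\<close>

theorem Jordan_Schoenflies:
 fixes gb :: "real => complex"
 assumes gb: "simple_path gb" "pfn gb = pst gb"
 shows "(pim gb Un inside (pim gb)) homeomorphic cball (0::complex) 1"
proof -
 note * = Jordan_inside_outside[OF gb]
 have "open (inside (pim gb)) & simply_connected (inside (pim gb))"
  using * simply_connected_inside_simple_path[OF gb(1)] by blast
 moreover have "inside (pim gb) ~= {}" "inside (pim gb) ~= UNIV" using * by auto
 ultimately obtain pj pk where "pj holomorphic_on inside (pim gb)" "pk holomorphic_on ball 0 1"
   "ALL z:inside (pim gb). pj z:ball 0 1 & pk (pj z) = z" "ALL z:ball 0 1. pk z:inside (pim gb) & pj (pk z) = z"
  unfolding Riemann_mapping_theorem by blast
 then interpret jordan_riemann gb pj pk by unfold_locales (use gb in auto)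
 obtain Ps where uc: "uniformly_continuous_on (closure Om) Ps" and eq: "!!x. x:Om ==> pj x = Ps x"
  using uniformly_continuous_on_extension_on_closure[OF uniformly_continuous_pj] by metis
 have c: "continuous_on (closure Om) Ps" using uc uniformly_continuous_imp_continuous by blast
 have unit: "norm (Ps z) = 1" if "z:J" for z
 proof -
  have zc: "z:closure Om" using that basic(6) by blast
  then obtain w where w: "!!n. w n:Om" "w \<longlonglongrightarrow> z" using closure_sequential by blast
  have "(%n. Ps (w n)) \<longlonglongrightarrow> Ps z" by (rule continuous_on_tendsto_compose[OF c w(2) zc]) (use w(1) closure_subset in \<open>auto intro!: always_eventually\<close>)
  hence "(%n. pj (w n)) \<longlonglongrightarrow> Ps z" using eq w(1) by simp
  thus ?thesis using boundary_limit_norm w that by blast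
 qed
 have injJ: "inj_on Ps J" by (rule extension_injective[OF c]) (use eq unit in auto)
 have inj: "inj_on Ps (closure Om)"
 proof (rule inj_onI)
  fix x y assume xy: "x:closure Om" "y:closure Om" "Ps x = Ps y"
  have lt: "norm (Ps z) < 1" "pk (Ps z) = z" if "z:Om" for z using eq[OF that] pj[of z] that by (auto simp: Om_def)
  consider "x:Om" "y:Om" | "x:J" "y:J" | "x:Om" "y:J" | "x:J" "y:Om" using xy basic(6) by blast
  thus "x = y"
  proof cases
   case 1 thus ?thesis using lt(2) xy(3) by metis
  next
   case 2 thus ?thesis using injJ xy(3) by (auto simp: inj_on_def)
  next
   case 3 thus ?thesis using lt(1)[of x] unit[of y] xy(3) by auto
  next
   case 4 thus ?thesis using lt(1)[of y] unit[of x] xy(3) by auto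
  qed
 qed
 have im: "Ps ` closure Om = cball 0 1"
 proof
  show "Ps ` closure Om<=cball 0 1" using basic(6) unit eq pj by (force simp: Om_def)
  have "ball 0 1<=Ps ` closure Om"
  proof
   fix z :: complex assume z: "z:ball 0 1"
   have "pk z:Om" "Ps (pk z) = z" using pk[OF z] eq by (auto simp: Om_def)
   thus "z:Ps ` closure Om" using closure_subset by force
  qed
  moreover have "closed (Ps ` closure Om)" by (intro compact_imp_closed compact_continuous_image c basic)
  ultimately have "closure (ball 0 1)<=Ps ` closure Om" by (rule closure_minimal)
  thus "cball 0 1<=Ps ` closure Om" by simp
 qed
 have "closure Om homeomorphic cball (0::complex) 1"
  using homeomorphic_compact[OF basic(8) c im inj] .
 thus ?thesis using basic(6) by (simp add: Om_def J_def Un_commute)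
qed

section \<open>Stereographic charts\<close>

lemma pos_frame_exists:
 assumes "b:S2" obtains e1 e2 where "pos_frame b e1 e2"
proof -
 have nb: "norm b = 1" using assms by (simp add: S2_def)
 obtain v :: "real^3" where v: "v ~= 0" "orthogonal b v"
  using orthogonal_to_vector_exists[of b] by auto
 define e1 where "e1 = v /\<^sub>R norm v"
 define e2 where "e2 = cross3 b e1"
 have e1: "e1 \<bullet> e1 = 1" "e1 \<bullet> b = 0" "b \<bullet> e1 = 0"
  using v by (auto simp: e1_def orthogonal_def inner_commute dot_square_norm power2_eq_square)
 have bb: "b \<bullet> b = 1" using nb by (simp add: dot_square_norm)
 have "e2 \<bullet> e2 = 1" using e1 bb by (simp add: e2_def dot_cross)
 moreover have "e1 \<bullet> e2 = 0" "e2 \<bullet> b = 0" by (auto simp: e2_def dot_cross_self inner_commute)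
 moreover have "cross3 e1 e2 = b" using e1 by (simp add: e2_def Lagrange)
 ultimately show thesis using that[of e1 e2] assms e1 by (simp add: pos_frame_def)
qed

lemma frame_facts:
 assumes "pos_frame b e1 e2"
 shows "e1 \<bullet> e1 = 1" "e2 \<bullet> e2 = 1" "b \<bullet> b = 1" "e1 \<bullet> e2 = 0" "e2 \<bullet> e1 = 0" "e1 \<bullet> b = 0" "b \<bullet> e1 = 0" "e2 \<bullet> b = 0" "b \<bullet> e2 = 0"
  "cross3 e1 e2 = b" "cross3 e2 b = e1" "cross3 b e1 = e2"
proof -
 show i: "e1 \<bullet> e1 = 1" "e2 \<bullet> e2 = 1" "e1 \<bullet> e2 = 0" "e1 \<bullet> b = 0" "e2 \<bullet> b = 0" and c: "cross3 e1 e2 = b"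
  using assms by (auto simp: pos_frame_def)
 show "b \<bullet> b = 1" using assms by (simp add: pos_frame_def S2_def dot_square_norm)
 show i': "e2 \<bullet> e1 = 0" "b \<bullet> e1 = 0" "b \<bullet> e2 = 0" using i inner_commute by metis+
 show "cross3 e2 b = e1" unfolding c[symmetric] by (simp add: Lagrange i i')
 have "cross3 b e1 = - cross3 e1 b" by (rule cross_skew)
 also have "\<dots> = e2" unfolding c[symmetric] by (simp add: Lagrange i i')
 finally show "cross3 b e1 = e2" .
qed

lemma frame_expansion:
 assumes "pos_frame b e1 e2"
 shows "(y::real^3) = (y \<bullet> e1) *\<^sub>R e1 + (y \<bullet> e2) *\<^sub>R e2 + (y \<bullet> b) *\<^sub>R b"
proof -
 note f = frame_facts[OF assms]
 define z where "z = y - ((y \<bullet> e1) *\<^sub>R e1 + (y \<bullet> e2) *\<^sub>R e2 + (y \<bullet> b) *\<^sub>R b)"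
 have z: "z \<bullet> e1 = 0" "z \<bullet> e2 = 0" "z \<bullet> b = 0"
  using f by (simp_all add: z_def inner_diff_left inner_add_left)
 have "cross3 z (cross3 e1 e2) = 0" using z by (simp add: Lagrange)
 hence "cross3 z b = 0" using f by simp
 hence "z = 0" using z(3) f(3) norm_and_cross_eq_0[of z b] by (metis inner_zero_left zero_neq_one)
 thus ?thesis by (simp add: z_def)
qed

lemma frame_sq:
 assumes "pos_frame b e1 e2" "y:S2"
 shows "(y \<bullet> e1)\<^sup>2 + (y \<bullet> e2)\<^sup>2 + (y \<bullet> b)\<^sup>2 = 1"
proof -
 have "y \<bullet> y = 1" using assms by (simp add: S2_def dot_square_norm)
 moreover have "y \<bullet> y = y \<bullet> ((y \<bullet> e1) *\<^sub>R e1 + (y \<bullet> e2) *\<^sub>R e2 + (y \<bullet> b) *\<^sub>R b)"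
  using frame_expansion[OF assms(1), of y] by simp
 ultimately show ?thesis by (simp add: inner_add_right power2_eq_square)
qed

lemma S2_inner_neq_1:
 assumes "x:S2" "b:S2" "x ~= b" shows "1 - x \<bullet> b > 0"
proof -
 have "(x - b) \<bullet> (x - b) = 2 * (1 - x \<bullet> b)"
 proof -
  have "x \<bullet> x = 1" "b \<bullet> b = 1" using assms by (auto simp: S2_def dot_square_norm)
  thus ?thesis by (simp add: inner_diff_left inner_diff_right inner_commute[of b x])
 qed
 moreover have "(x - b) \<bullet> (x - b) > 0" using assms by simp
 ultimately show ?thesis by simp
qed

definition unstereo :: "real^3 => real^3 => real^3 => complex => real^3" where
 "unstereo b e1 e2 w = ((2 * Re w) *\<^sub>R e1 - (2 * Im w) *\<^sub>R e2 + ((norm w)\<^sup>2 - 1) *\<^sub>R b) /\<^sub>R ((norm w)\<^sup>2 + 1)"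

lemma unstereo_inner:
 assumes "pos_frame b e1 e2"
 shows "unstereo b e1 e2 w \<bullet> e1 = 2 * Re w / ((norm w)\<^sup>2 + 1)" "unstereo b e1 e2 w \<bullet> e2 = - 2 * Im w / ((norm w)\<^sup>2 + 1)"
  "unstereo b e1 e2 w \<bullet> b = ((norm w)\<^sup>2 - 1) / ((norm w)\<^sup>2 + 1)"
proof -
 note f = frame_facts[OF assms]
 show "unstereo b e1 e2 w \<bullet> e1 = 2 * Re w / ((norm w)\<^sup>2 + 1)" "unstereo b e1 e2 w \<bullet> e2 = - 2 * Im w / ((norm w)\<^sup>2 + 1)"
  "unstereo b e1 e2 w \<bullet> b = ((norm w)\<^sup>2 - 1) / ((norm w)\<^sup>2 + 1)"
  using f by (simp_all add: unstereo_def inner_add_left inner_diff_left divide_inverse)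
qed

lemma stereo_homeomorphism:
 assumes f: "pos_frame b e1 e2"
 shows "homeomorphism (S2 - {b}) UNIV (stereo b e1 e2) (unstereo b e1 e2)"
proof -
 note ff = f[unfolded pos_frame_def S2_def]
 have bS: "b:S2" using f by (simp add: pos_frame_def)
 have bb: "b \<bullet> b = 1" using ff by (simp add: dot_square_norm)
 have pos: "(norm (w::complex))\<^sup>2 + 1 > 0" for w by (simp add: add_nonneg_pos)
 have inS: "unstereo b e1 e2 w:S2 - {b}" for w
 proof -
  let ?y = "unstereo b e1 e2 w" let ?N = "(norm w)\<^sup>2"
  have "?y \<bullet> ?y = (?y \<bullet> e1)\<^sup>2 + (?y \<bullet> e2)\<^sup>2 + (?y \<bullet> b)\<^sup>2"
   using arg_cong[OF frame_expansion[OF f, of ?y], of "%v. ?y \<bullet> v"] by (simp add: inner_add_right power2_eq_square)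
  also have "\<dots> = ((2 * Re w)\<^sup>2 + (2 * Im w)\<^sup>2 + (?N - 1)\<^sup>2) / (?N + 1)\<^sup>2"
   by (simp add: unstereo_inner[OF f] power_divide add_divide_distrib)
  also have "(2 * Re w)\<^sup>2 + (2 * Im w)\<^sup>2 + (?N - 1)\<^sup>2 = (?N + 1)\<^sup>2"
  proof -
   have "(2 * Re w)\<^sup>2 + (2 * Im w)\<^sup>2 = 4 * ?N" by (simp add: cmod_power2 power_mult_distrib)
   thus ?thesis by (simp add: power2_eq_square algebra_simps)
  qed
  finally have "?y \<bullet> ?y = 1" using pos[of w] by simp
  hence "norm ?y = 1" by (simp add: norm_eq_sqrt_inner)
  moreover have "?y \<bullet> b ~= 1" using pos[of w] by (simp add: unstereo_inner[OF f] divide_eq_1_iff)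
  ultimately show ?thesis using bb by (auto simp: S2_def)
 qed
 have un: "stereo b e1 e2 (unstereo b e1 e2 w) = w" for w
 proof -
  have "1 - unstereo b e1 e2 w \<bullet> b = 2 / ((norm w)\<^sup>2 + 1)"
   using pos[of w] by (simp add: unstereo_inner[OF f] field_simps)
  thus ?thesis using pos[of w] by (simp add: stereo_def unstereo_inner[OF f] complex_eq_iff Re_divide_of_real Im_divide_of_real)
 qed
 have nu: "unstereo b e1 e2 (stereo b e1 e2 y) = y" if y: "y:S2 - {b}" for y
 proof -
  define d where "d = 1 - y \<bullet> b"
  have d: "d > 0" using S2_inner_neq_1[of y b] y bS by (simp add: d_def)
  let ?w = "stereo b e1 e2 y"
  have R: "Re ?w = (y \<bullet> e1) / d" "Im ?w = - (y \<bullet> e2) / d"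
  proof -
   have "?w = Complex (y \<bullet> e1) (- (y \<bullet> e2)) / of_real d" by (simp add: stereo_def d_def)
   thus "Re ?w = (y \<bullet> e1) / d" "Im ?w = - (y \<bullet> e2) / d" by (simp_all add: Re_divide_of_real Im_divide_of_real)
  qed
  have N: "(norm ?w)\<^sup>2 = (1 + y \<bullet> b) / d"
  proof -
   have "(norm ?w)\<^sup>2 = ((y \<bullet> e1)\<^sup>2 + (y \<bullet> e2)\<^sup>2) / d\<^sup>2" by (simp add: cmod_power2 R power_divide add_divide_distrib)
   also have "(y \<bullet> e1)\<^sup>2 + (y \<bullet> e2)\<^sup>2 = d * (1 + y \<bullet> b)"
    using frame_sq[OF f, of y] y by (simp add: d_def power2_eq_square algebra_simps)
   finally show ?thesis using d by (simp add: power2_eq_square)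
  qed
  have N1: "(norm ?w)\<^sup>2 + 1 = 2 / d" "(norm ?w)\<^sup>2 - 1 = 2 * (y \<bullet> b) / d"
   using d unfolding N by (auto simp: d_def field_simps)
  have "unstereo b e1 e2 ?w = (y \<bullet> e1) *\<^sub>R e1 + (y \<bullet> e2) *\<^sub>R e2 + (y \<bullet> b) *\<^sub>R b"
   unfolding unstereo_def N1 R using d by (simp add: algebra_simps)
  thus ?thesis using frame_expansion[OF f, of y] by simp
 qed
 show ?thesis
 proof (rule homeomorphismI)
  show "continuous_on (S2 - {b}) (stereo b e1 e2)"
  proof -
   have "complex_of_real (1 - x \<bullet> b) ~= 0" if "x:S2 - {b}" for x
    using S2_inner_neq_1[of x b] that bS by (metis Diff_iff insertI1 less_irrefl of_real_eq_0_iff)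
   thus ?thesis unfolding stereo_def Complex_eq by (intro continuous_intros) auto
  qed
  show "continuous_on UNIV (unstereo b e1 e2)" unfolding unstereo_def
   by (intro continuous_intros) (use pos in \<open>auto simp: less_le\<close>)
 qed (use inS un nu in auto)
qed

text \<open>A change of pole is a Moebius map of the plane coordinate, infinite at the image of
  \<open>b'\<close> and with value \<open>m\<close> at infinity, the image of \<open>b\<close>. The
  functional \<open>M\<close> of the second frame turns the cross product with \<open>b'\<close>
  into multiplication by the imaginary unit, which is where the orientation enters; with the unit
  length relations this leaves a polynomial identity.\<close>

lemma stereo_Moebius:
 assumes f: "pos_frame b e1 e2" and f': "pos_frame b' e1' e2'" and ne: "b ~= b'"
 obtains m c where "!!y. y:S2 ==> y ~= b ==> y ~= b' ==>
   stereo b' e1' e2' y * (stereo b e1 e2 y - stereo b e1 e2 b') = m * stereo b e1 e2 y + c"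
   "stereo b' e1' e2' b = m"
proof -
 have S: "b:S2" "b':S2" using f f' by (auto simp: pos_frame_def)
 note ff = f[unfolded pos_frame_def S2_def]
 note ff' = f'[unfolded pos_frame_def S2_def]
 have bb: "b \<bullet> b = 1" "b' \<bullet> b' = 1" using ff ff' by (auto simp: dot_square_norm)
 define n1 n2 n3 where "n1 = b' \<bullet> e1" and "n2 = b' \<bullet> e2" and "n3 = b' \<bullet> b"
 define M where "M v = Complex (v \<bullet> e1') (- (v \<bullet> e2'))" for v
 have n3: "1 - n3 > 0" using S2_inner_neq_1[of b' b] S ne by (auto simp: n3_def)
 have Mlin: "M (u + v) = M u + M v" "M (r *\<^sub>R u) = of_real r * M u" for u v r
  by (auto simp: M_def inner_add_left complex_eq_iff)
 define m1 m2 m3 where "m1 = M e1" and "m2 = M e2" and "m3 = M b"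
 have expM: "M v = of_real (v \<bullet> e1) * m1 + of_real (v \<bullet> e2) * m2 + of_real (v \<bullet> b) * m3" for v
  using arg_cong[OF frame_expansion[OF f, of v], of M] by (simp add: Mlin m1_def m2_def m3_def)
 have crossb: "cross3 b' e1' = e2'" "cross3 b' e2' = - e1'"
  using frame_facts[OF f'] cross_skew[of b' e2'] by auto
 have Mcross: "M (cross3 v b') = \<i> * M v" for v
 proof -
  have "cross3 v b' \<bullet> e1' = v \<bullet> e2'" "cross3 v b' \<bullet> e2' = - (v \<bullet> e1')"
   using crossb by (metis cross_triple inner_commute inner_minus_right)+
  thus ?thesis by (simp add: M_def complex_eq_iff)
 qed
 note crossf = frame_facts(10-12)[OF f]
 have b'exp: "b' = n1 *\<^sub>R e1 + n2 *\<^sub>R e2 + n3 *\<^sub>R b" unfolding n1_def n2_def n3_def by (rule frame_expansion[OF f])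
 have "cross3 e1 b' = n2 *\<^sub>R b + (- n3) *\<^sub>R e2"
  unfolding b'exp using crossf by (simp add: cross_add_right cross_mult_right cross_refl cross_skew[of e1 b])
 hence r1: "\<i> * m1 = of_real n2 * m3 - of_real n3 * m2"
  using Mcross[of e1] by (simp add: Mlin m1_def m2_def m3_def del: scaleR_minus_left)
 have "cross3 e2 b' = (- n1) *\<^sub>R b + n3 *\<^sub>R e1"
  unfolding b'exp using crossf by (simp add: cross_add_right cross_mult_right cross_refl cross_skew[of e2 e1])
 hence r2: "\<i> * m2 = of_real n3 * m1 - of_real n1 * m3"
  using Mcross[of e2] by (simp add: Mlin m1_def m2_def m3_def del: scaleR_minus_left)
 have "M b' = 0" using ff' by (simp add: M_def inner_commute complex_eq_iff)
 hence r3: "of_real n1 * m1 + of_real n2 * m2 + of_real n3 * m3 = 0" using expM[of b'] by (simp add: n1_def n2_def n3_def)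
 have nn: "n1\<^sup>2 + n2\<^sup>2 + n3\<^sup>2 = 1" using frame_sq[OF f S(2)] by (simp add: n1_def n2_def n3_def)
 have r4: "of_real n1 * m2 - of_real n2 * m1 = \<i> * m3"
 proof -
  have "cross3 b b' = n1 *\<^sub>R e2 + (- n2) *\<^sub>R e1"
   unfolding b'exp using crossf by (simp add: cross_add_right cross_mult_right cross_refl cross_skew[of b e2])
  thus ?thesis using Mcross[of b] by (simp add: Mlin m1_def m2_def m3_def del: scaleR_minus_left)
 qed
 define c where "c = m1 - \<i> * m2"
 have key: "stereo b' e1' e2' y * (stereo b e1 e2 y - stereo b e1 e2 b') = (m3 / of_real (1 - n3)) * stereo b e1 e2 y + c / of_real (1 - n3)"
  if y: "y:S2" "y ~= b" "y ~= b'" for y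
 proof -
  define y1 y2 y3 where "y1 = complex_of_real (y \<bullet> e1)" and "y2 = complex_of_real (y \<bullet> e2)" and "y3 = complex_of_real (y \<bullet> b)"
  define N1 N2 N3 where "N1 = complex_of_real n1" and "N2 = complex_of_real n2" and "N3 = complex_of_real n3"
  have yy: "y1\<^sup>2 + y2\<^sup>2 + y3\<^sup>2 = 1" using arg_cong[OF frame_sq[OF f y(1)], of complex_of_real] by (simp add: y1_def y2_def y3_def)
  have NN: "N1\<^sup>2 + N2\<^sup>2 + N3\<^sup>2 = 1" using arg_cong[OF nn, of complex_of_real] by (simp add: N1_def N2_def N3_def)
  have R: "\<i> * m1 = N2 * m3 - N3 * m2" "\<i> * m2 = N3 * m1 - N1 * m3" "N1 * m1 + N2 * m2 + N3 * m3 = 0" "N1 * m2 - N2 * m1 = \<i> * m3"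
   using r1 r2 r3 r4 by (auto simp: N1_def N2_def N3_def)
  have d3: "1 - y3 ~= 0" using S2_inner_neq_1[of y b] y S unfolding y3_def by (metis less_irrefl of_real_1 of_real_diff of_real_eq_0_iff)
  have dn: "1 - N3 ~= 0" using n3 unfolding N3_def by (metis less_irrefl of_real_1 of_real_diff of_real_eq_0_iff)
  define D where "D = 1 - (N1 * y1 + N2 * y2 + N3 * y3)"
  have yb': "y \<bullet> b' = n1 * (y \<bullet> e1) + n2 * (y \<bullet> e2) + n3 * (y \<bullet> b)"
   by (subst b'exp) (simp add: inner_add_right)
  have Deq: "D = complex_of_real (1 - y \<bullet> b')" by (simp add: D_def yb' N1_def N2_def N3_def y1_def y2_def y3_def)
  have D0: "D ~= 0" using S2_inner_neq_1[of y b'] y S unfolding Deq by (metis less_irrefl of_real_eq_0_iff)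
  have sy: "stereo b e1 e2 y = (y1 - \<i> * y2) / (1 - y3)"
   by (simp add: stereo_def y1_def y2_def y3_def Complex_eq)
  have sb: "stereo b e1 e2 b' = (N1 - \<i> * N2) / (1 - N3)"
   by (simp add: stereo_def N1_def N2_def N3_def n1_def n2_def n3_def Complex_eq)
  have s': "stereo b' e1' e2' y = (y1 * m1 + y2 * m2 + y3 * m3) / D"
   using expM[of y] unfolding stereo_def Deq M_def by (simp add: y1_def y2_def y3_def)
  have ii: "\<i> * \<i> = -1" by simp
  have "(y1 * m1 + y2 * m2 + y3 * m3) * ((1 - N3) * (y1 - \<i> * y2) - (N1 - \<i> * N2) * (1 - y3)) = (m3 * (y1 - \<i> * y2) + c * (1 - y3)) * D"
   unfolding D_def c_def using yy NN R ii by algebra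
  thus ?thesis unfolding sy sb s' using d3 dn D0
   by (simp add: N3_def[symmetric] divide_simps) (simp add: algebra_simps)
 qed
 have "stereo b' e1' e2' b = m3 / of_real (1 - n3)"
  by (simp add: stereo_def m3_def M_def n3_def inner_commute)
 thus thesis using that key by blast
qed

lemma stereo_rotate:
 assumes f: "pos_frame b e1 e2" and f': "pos_frame b e1' e2'"
 obtains k where "k ~= 0" "!!y. stereo b e1' e2' y = k * stereo b e1 e2 y"
proof -
 define M where "M v = Complex (v \<bullet> e1') (- (v \<bullet> e2'))" for v
 have Mlin: "M (u + v) = M u + M v" "M (r *\<^sub>R u) = of_real r * M u" for u v r
  by (auto simp: M_def inner_add_left complex_eq_iff)
 have expM: "M v = of_real (v \<bullet> e1) * M e1 + of_real (v \<bullet> e2) * M e2 + of_real (v \<bullet> b) * M b" for v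
  using arg_cong[OF frame_expansion[OF f, of v], of M] by (simp add: Mlin)
 have Mb: "M b = 0" using frame_facts[OF f'] by (simp add: M_def complex_eq_iff)
 have "e2 \<bullet> e1' = - (e1 \<bullet> e2')" "e2 \<bullet> e2' = e1 \<bullet> e1'"
 proof -
  have "e2 \<bullet> e1' = cross3 b e1 \<bullet> e1'" using frame_facts(12)[OF f] by simp
  also have "\<dots> = - (e1 \<bullet> cross3 b e1')" by (metis cross_triple cross_skew inner_commute inner_minus_right)
  finally show "e2 \<bullet> e1' = - (e1 \<bullet> e2')" using frame_facts(12)[OF f'] by simp
  have "e2 \<bullet> e2' = cross3 b e1 \<bullet> e2'" using frame_facts(12)[OF f] by simp
  also have "\<dots> = e1 \<bullet> cross3 e2' b" by (metis cross_triple inner_commute)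
  finally show "e2 \<bullet> e2' = e1 \<bullet> e1'" using frame_facts(11)[OF f'] by simp
 qed
 hence M2: "M e2 = - \<i> * M e1" by (simp add: M_def complex_eq_iff)
 have My: "M y = M e1 * Complex (y \<bullet> e1) (- (y \<bullet> e2))" for y
  using expM[of y] by (simp add: Mb M2 Complex_eq algebra_simps)
 have "M e1' = 1" using frame_facts[OF f'] by (simp add: M_def complex_eq_iff)
 hence "M e1 ~= 0" using My[of e1'] by auto
 moreover have "stereo b e1' e2' y = M e1 * stereo b e1 e2 y" for y
  using My[of y] by (simp add: stereo_def M_def)
 ultimately show thesis using that by blast
qed

definition frame_of :: "real^3 => (real^3) \<times> (real^3)" where
 "frame_of b = (SOME e. pos_frame b (fst e) (snd e))"
definition chart :: "real^3 => real^3 => complex" where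
 "chart b = stereo b (fst (frame_of b)) (snd (frame_of b))"
definition unchart :: "real^3 => complex => real^3" where
 "unchart b = unstereo b (fst (frame_of b)) (snd (frame_of b))"

lemma frame_of: "b:S2 ==> pos_frame b (fst (frame_of b)) (snd (frame_of b))"
 unfolding frame_of_def by (rule someI_ex) (metis fst_conv pos_frame_exists snd_conv)

lemma chart_homeomorphism: "b:S2 ==> homeomorphism (S2 - {b}) UNIV (chart b) (unchart b)"
 unfolding chart_def unchart_def by (rule stereo_homeomorphism[OF frame_of])

lemma chart_simps:
 assumes "b:S2"
 shows "chart b (unchart b w) = w" "unchart b w:S2" "unchart b w ~= b" "y:S2 ==> y ~= b ==> unchart b (chart b y) = y"
  "continuous_on (S2 - {b}) (chart b)" "continuous_on UNIV (unchart b)"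
  "x:S2 ==> y:S2 ==> x ~= b ==> y ~= b ==> chart b x = chart b y \<longleftrightarrow> x = y"
proof -
 note h = chart_homeomorphism[OF assms]
 show "chart b (unchart b w) = w" using homeomorphism_apply2[OF h] by simp
 have "unchart b w:S2 - {b}" using homeomorphism_image2[OF h] by blast
 thus "unchart b w:S2" "unchart b w ~= b" by auto
 show un: "y:S2 ==> y ~= b ==> unchart b (chart b y) = y" for y using homeomorphism_apply1[OF h] by simp
 show "continuous_on (S2 - {b}) (chart b)" "continuous_on UNIV (unchart b)" using h by (auto simp: homeomorphism_def)
 show "x:S2 ==> y:S2 ==> x ~= b ==> y ~= b ==> chart b x = chart b y \<longleftrightarrow> x = y" using un[of x] un[of y] by metis
qed

section \<open>Winding numbers on the sphere and their change with the pole\<close>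

lemma offset_path:
 fixes p :: "real => complex"
 shows "path p ==> path (%t. p t - z)" "z ~: pim p ==> 0 ~: pim (%t. p t - z)"
 by (auto simp: path_def pim_def intro!: continuous_intros)

lemma winding_number_const_1: "winding_number (%t. 1) 0 = 0"
 using winding_number_trivial[of 0 "1::complex"] by (simp add: linepath_refl)

lemma winding_number_quotient:
 assumes p: "path p" "0 ~: pim p" and q: "path q" "0 ~: pim q" and K: "K ~= 0"
  and g: "!!t. t:{0..1} ==> g t = K * p t / q t"
 shows "winding_number g 0 = winding_number p 0 - winding_number q 0"
proof -
 obtain P where P: "path P" "pfn P - pst P = 2 * of_real pi * \<i> * winding_number p 0" "!!t. t:{0..1} ==> p t = 0 + exp (P t)"
  using winding_number_as_continuous_log[OF p] by metis
 obtain Q where Q: "path Q" "pfn Q - pst Q = 2 * of_real pi * \<i> * winding_number q 0" "!!t. t:{0..1} ==> q t = 0 + exp (Q t)"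
  using winding_number_as_continuous_log[OF q] by metis
 define H where "H t = Ln K + P t - Q t" for t
 have pH: "path H" using P(1) Q(1) unfolding path_def H_def by (intro continuous_intros)
 have "winding_number g 0 = winding_number (exp o H) 0"
  by (rule winding_number_cong) (use g P Q K in \<open>auto simp: H_def exp_add exp_diff\<close>)
 also have "\<dots> = (pfn H - pst H) / (2 * of_real pi * \<i>)" by (rule winding_number_compose_exp[OF pH])
 also have "pfn H - pst H = (pfn P - pst P) - (pfn Q - pst Q)"
  by (simp add: H_def pst_def pfn_def)
 finally show ?thesis unfolding P(2) Q(2) by (simp add: diff_divide_distrib)
qed

text \<open>The winding number as seen from the pole \<open>b\<close>; its values are complex
  because it is applied to open arcs as well. The value 0 at \<open>x = b\<close> is that of the
  point at infinity and lets \<open>wnum_change\<close> hold for every position of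
  \<open>x\<close>.\<close>

definition wnum :: "real^3 => (real => real^3) => real^3 => complex" where
 "wnum b J x = (if x = b then 0 else winding_number (chart b o J) (chart b x))"

lemma path_chart:
 assumes "b:S2" "path J" "pim J<=S2" "b ~: pim J"
 shows "path (chart b o J)" "pim (chart b o J) = chart b ` pim J"
  "x:S2 ==> x ~= b ==> x ~: pim J ==> chart b x ~: pim (chart b o J)"
proof -
 show "path (chart b o J)"
  by (rule path_continuous_image[OF assms(2) continuous_on_subset[OF chart_simps(5)[OF assms(1)]]]) (use assms in auto)
 show im: "pim (chart b o J) = chart b ` pim J" by (simp add: path_image_compose)
 show "chart b x ~: pim (chart b o J)" if "x:S2" "x ~= b" "x ~: pim J"
 proof
  assume "chart b x:pim (chart b o J)"
  then obtain y where y: "y:pim J" "chart b x = chart b y" using im by auto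
  hence "x = y" using chart_simps(7)[OF assms(1), of x y] that assms by auto
  thus False using y that by blast
 qed
qed

text \<open>In the chart \<open>w\<close> at \<open>b\<close> the coordinate from \<open>b'\<close>
  is \<open>m + K / (w - bt)\<close>. Its difference at \<open>w\<close> and \<open>w0\<close> is a
  constant times \<open>(w - w0) / (w - bt)\<close>, and winding numbers of quotients
  subtract.\<close>

lemma wnum_change:
 assumes b: "b:S2" "b':S2" and J: "path J" "pim J<=S2" "b ~: pim J" "b' ~: pim J"
  and x: "x:S2" "x ~: pim J"
 shows "wnum b' J x = wnum b J x - wnum b J b'"
proof (cases "b = b'")
 case True thus ?thesis by (simp add: wnum_def)
next
 case ne: False
 obtain m k where mk: "!!y. y:S2 ==> y ~= b ==> y ~= b' ==> chart b' y * (chart b y - chart b b') = m * chart b y + k"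
   "chart b' b = m"
  using stereo_Moebius[OF frame_of[OF b(1)] frame_of[OF b(2)] ne] unfolding chart_def by metis
 define bt where "bt = chart b b'"
 define K where "K = m * bt + k"
 have JS: "J t:S2" "J t ~= b" "J t ~= b'" "J t ~= x" if "t:{0..1}" for t using J x imageI[OF that, of J] by (auto simp: pim_def)
 have wbt: "chart b y ~= bt" if "y:S2" "y ~= b" "y ~= b'" for y
  using chart_simps(7)[OF b(1) that(1) b(2) that(2)] ne that by (auto simp: bt_def)
 have T: "chart b' y = m + K / (chart b y - bt)" if "y:S2" "y ~= b" "y ~= b'" for y
  using mk(1)[OF that] wbt[OF that] by (simp add: bt_def[symmetric] K_def field_simps)
 have K0: "K ~= 0"
 proof
  assume "K = 0"
  hence "chart b' (J 0) = chart b' b" using T[of "J 0"] JS[of 0] mk(2) by simp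
  thus False using chart_simps(7)[OF b(2), of "J 0" b] JS[of 0] b ne by auto
 qed
 note pJ = path_chart[OF b(1) J(1,2,3)]
 have pq: "path (%t. chart b (J t) - bt)" "0 ~: pim (%t. chart b (J t) - bt)"
  using pJ(1) wbt JS by (auto simp: path_def o_def pim_def intro!: continuous_intros)
 have wq: "winding_number (%t. chart b (J t) - bt) 0 = wnum b J b'"
  using ne by (simp add: wnum_def bt_def winding_number_offset[of _ "chart b b'"] o_def)
 show ?thesis
 proof (cases "x = b'")
  case True thus ?thesis by (simp add: wnum_def)
 next
  case xb': False
  show ?thesis
  proof (cases "x = b")
   case True
   have "wnum b' J x = winding_number (%t. chart b' (J t) - m) 0"
    using True ne mk(2) by (simp add: wnum_def winding_number_offset[of _ m] o_def)
   also have "\<dots> = winding_number (%t. 1) 0 - winding_number (%t. chart b (J t) - bt) 0"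
    by (rule winding_number_quotient[OF _ _ pq K0]) (use T JS in \<open>auto simp: path_def pim_def\<close>)
   also have "winding_number (%t. 1) 0 = 0" by (rule winding_number_const_1)
   finally show ?thesis using True wq by (simp add: wnum_def)
  next
   case xb: False
   define w0 where "w0 = chart b x"
   have pp: "path (%t. chart b (J t) - w0)" "0 ~: pim (%t. chart b (J t) - w0)"
    using offset_path[where p = "chart b o J" and z = w0] pJ(1) pJ(3)[OF x(1) xb x(2)] by (simp_all add: o_def w0_def)
   have "wnum b' J x = winding_number (%t. chart b' (J t) - chart b' x) 0"
    using xb' by (simp add: wnum_def winding_number_offset[of _ "chart b' x"] o_def)
   also have "\<dots> = winding_number (%t. chart b (J t) - w0) 0 - winding_number (%t. chart b (J t) - bt) 0"
   proof (rule winding_number_quotient[OF pp pq])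
    show "- K / (w0 - bt) ~= 0" using K0 wbt[OF x(1) xb xb'] by (simp add: w0_def)
    fix t :: real assume t: "t:{0..1}"
    have a: "chart b (J t) - bt ~= 0" "w0 - bt ~= 0" using wbt JS[OF t] x xb xb' by (auto simp: w0_def)
    have "chart b' (J t) - chart b' x = K / (chart b (J t) - bt) - K / (w0 - bt)"
     using T[OF JS(1-3)[OF t]] T[OF x(1) xb xb'] by (simp add: w0_def)
    also have "\<dots> = - K / (w0 - bt) * (chart b (J t) - w0) / (chart b (J t) - bt)"
     using a by (simp add: divide_simps) (simp add: algebra_simps)
    finally show "chart b' (J t) - chart b' x = - K / (w0 - bt) * (chart b (J t) - w0) / (chart b (J t) - bt)" .
   qed
   also have "winding_number (%t. chart b (J t) - w0) 0 = wnum b J x"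
    using xb by (simp add: wnum_def w0_def winding_number_offset[of _ "chart b x"] o_def)
   finally show ?thesis using wq by simp
  qed
 qed
qed

text \<open>The choice of the frame at a pole does not matter: another positive frame multiplies the
  chart by a constant.\<close>

lemma left_region_iff:
 assumes J: "path J" "pim J<=S2"
 shows "left_region J x \<longleftrightarrow> x:S2 & x ~: pim J & (EX b:S2. b ~: pim J & wnum b J x = 1)"
proof -
 have eq: "winding_number (stereo b e1 e2 o J) (stereo b e1 e2 x) = wnum b J x"
  if f: "pos_frame b e1 e2" and b: "b ~: pim J" "b ~= x" and x: "x:S2" "x ~: pim J" for b e1 e2
 proof -
  have bS: "b:S2" using f by (simp add: pos_frame_def)
  obtain k where k: "k ~= 0" "!!y. stereo b e1 e2 y = k * chart b y"
   using stereo_rotate[OF frame_of[OF bS] f] unfolding chart_def by metis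
  note pJ = path_chart[OF bS J b(1)]
  have "winding_number (stereo b e1 e2 o J) (stereo b e1 e2 x) = winding_number (%t. k * chart b (J t) - k * chart b x) 0"
   by (subst winding_number_offset) (simp add: o_def k(2))
  also have "\<dots> = winding_number (%t. chart b (J t) - chart b x) 0 - winding_number (%t. 1) 0"
  proof (rule winding_number_quotient[OF _ _ _ _ k(1)])
   show "path (%t. chart b (J t) - chart b x)" "0 ~: pim (%t. chart b (J t) - chart b x)"
    using offset_path[where p = "chart b o J" and z = "chart b x"] pJ(1) pJ(3)[OF x(1) _ x(2)] b by (simp_all add: o_def)
  qed (auto simp: path_def pim_def right_diff_distrib)
  also have "winding_number (%t. 1) 0 = 0" by (rule winding_number_const_1)
  also have "winding_number (%t. chart b (J t) - chart b x) 0 = wnum b J x"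
   using b by (simp add: wnum_def winding_number_offset[of _ "chart b x"] o_def)
  finally show ?thesis by (simp only: diff_zero)
 qed
 show ?thesis
 proof
  assume "left_region J x"
  then obtain b e1 e2 where *: "x:S2" "x ~: pim J" "pos_frame b e1 e2" "b ~: pim J" "b ~= x"
   "winding_number (stereo b e1 e2 o J) (stereo b e1 e2 x) = 1" unfolding left_region_def by blast
  thus "x:S2 & x ~: pim J & (EX b:S2. b ~: pim J & wnum b J x = 1)"
   using eq[of b e1 e2] by (auto simp: pos_frame_def)
 next
  assume a: "x:S2 & x ~: pim J & (EX b:S2. b ~: pim J & wnum b J x = 1)"
  then obtain b where b: "b:S2" "b ~: pim J" "wnum b J x = 1" by blast
  hence "b ~= x" by (auto simp: wnum_def)
  thus "left_region J x" unfolding left_region_def using a b frame_of[OF b(1)] eq by metis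
 qed
qed

section \<open>Left and right sides of Jordan curves on the sphere\<close>

text \<open>Of three points of \<open>C\<close>, the middle one along the arc separates
  \<open>C\<close>.\<close>

lemma arc_no_noncut_points:
 fixes g :: "real => 'a::real_normed_vector"
 assumes g: "arc g" and C: "C<=pim g" "!!a. a:C ==> connected (C - {a})" "infinite C"
 shows False
proof -
 obtain F where F: "F<=C" "finite F" "card F = 3" using C(3) by (meson infinite_arbitrarily_large)
 define T where "T = {t\<in>{0..1}. g t:F}"
 have gT: "g ` T = F" using F C(1) by (auto simp: T_def pim_def)
 have injg: "inj_on g {0..1}" using g by (simp add: arc_def)
 have "inj_on g T" by (rule inj_on_subset[OF injg]) (auto simp: T_def)
 hence "card T = 3" using gT F card_image by metis
 then obtain x y z where xyz: "T = {x,y,z}" "x ~= y" "y ~= z" "x ~= z" by (metis card_3_iff)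
 obtain t1 t2 t3 where t: "t1 < t2" "t2 < t3" "t1:T" "t2:T" "t3:T"
  using xyz by (smt (verit, best) insert_iff linorder_neqE_linordered_idom)
 have tt: "t1:{0..1}" "t2:{0..1}" "t3:{0..1}" "g t1:C" "g t2:C" "g t3:C" using t F by (auto simp: T_def)
 have contg: "continuous_on {0..1} g" using g by (simp add: arc_def path_def)
 have cl: "closed (g ` {0..t2})" "closed (g ` {t2..1})"
  using tt by (auto intro!: compact_imp_closed compact_continuous_image continuous_on_subset[OF contg])
 have "g ` {0..t2} Int g ` {t2..1}<={g t2}"
  using inj_on_image_Int[OF injg, of "{0..t2}" "{t2..1}"] tt by auto
 moreover have "C - {g t2}<=g ` {0..t2} Un g ` {t2..1}"
 proof -
  have "{0..1} = {0..t2} Un {t2..1}" using tt by auto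
  thus ?thesis using C(1) unfolding pim_def by (metis Diff_subset image_Un order_trans)
 qed
 ultimately have "g ` {0..t2} Int (C - {g t2}) = {} \<or> g ` {t2..1} Int (C - {g t2}) = {}"
  using connected_closedD[OF C(2)[OF tt(5)], of "g ` {0..t2}" "g ` {t2..1}"] cl by blast
 moreover have "g t1:g ` {0..t2} Int (C - {g t2})" using t tt inj_onD[OF injg, of t1 t2] by auto
 moreover have "g t3:g ` {t2..1} Int (C - {g t2})" using t tt inj_onD[OF injg, of t3 t2] by auto
 ultimately show False by blast
qed

text \<open>A round disk in a chart has no cut points, so it cannot lie in an arc.\<close>

lemma S2_open_not_in_arc:
 assumes g: "arc g" and U: "open U" "U Int S2 ~= {}"
 shows "~ U Int S2<=pim g"
proof
 assume sub: "U Int S2<=pim g"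
 obtain x where x: "x:U" "x:S2" using U by blast
 define b where "b = - x"
 have "x ~= 0" using x by (auto simp: S2_def)
 hence "x ~= - x" by (metis add_eq_0_iff scaleR_2 scaleR_eq_0_iff zero_neq_numeral)
 hence b: "b:S2" "x ~= b" using x by (auto simp: b_def S2_def)
 have "open (unchart b -` U)" using open_vimage[OF U(1) chart_simps(6)[OF b(1)]] .
 moreover have "chart b x:unchart b -` U" using chart_simps(4)[OF b(1)] x b by simp
 ultimately obtain e where e: "e > 0" "ball (chart b x) e<=unchart b -` U" using open_contains_ball by blast
 define B where "B = ball (chart b x) e"
 have inj: "inj (unchart b)" by (metis chart_simps(1)[OF b(1)] injI)
 show False
 proof (rule arc_no_noncut_points[OF g, of "unchart b ` B"])
  show "unchart b ` B<=pim g" using e sub chart_simps(2)[OF b(1)] by (auto simp: B_def)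
  show "connected (unchart b ` B - {a})" if "a:unchart b ` B" for a
  proof -
   obtain w where w: "w:B" "a = unchart b w" using \<open>a:_\<close> by blast
   have "unchart b ` B - {a} = unchart b ` (B - {w})" using w inj by (auto simp: inj_def)
   moreover have "connected (B - {w})" unfolding B_def by (rule connected_open_delete) auto
   ultimately show ?thesis
    using connected_continuous_image[OF continuous_on_subset[OF chart_simps(6)[OF b(1)]]] by (metis subset_UNIV)
  qed
  have "infinite B" using e uncountable_ball[of e "chart b x"] countable_finite by (auto simp: B_def)
  thus "infinite (unchart b ` B)" using inj by (metis finite_imageD inj_on_subset subset_UNIV)
 qed
qed

lemma S2_avoid_arcs:
 assumes "finite A" "!!g. g:A ==> arc g" "open U" "U Int S2 ~= {}"
 obtains x where "x:U" "x:S2" "!!g. g:A ==> x ~: pim g"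
proof -
 have "EX x:U Int S2. ALL g:A. x ~: pim g" using assms
 proof (induction A arbitrary: U rule: finite_induct)
  case empty thus ?case by blast
 next
  case (insert g A)
  have "open (U - pim g)" using insert.prems by (intro open_Diff closed_arc_image) auto
  moreover have "(U - pim g) Int S2 ~= {}" using S2_open_not_in_arc[of g U] insert.prems by auto
  ultimately obtain x where "x:(U - pim g) Int S2" "ALL g:A. x ~: pim g"
   using insert.IH[of "U - pim g"] insert.prems by auto
  thus ?case by auto
 qed
 thus thesis using that by blast
qed

definition loop_in :: "(real => real^3) => bool" where
 "loop_in J \<longleftrightarrow> simple_path J & pfn J = pst J & pim J<=S2"

definition Lr :: "(real => real^3) => (real^3) set" where "Lr J = {x. left_region J x}"

lemma loop_in_reversepath: "loop_in J ==> loop_in (rvp J)"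
 by (auto simp: loop_in_def simple_path_reversepath)

lemma wnum_reversepath:
 assumes "b:S2" "path J" "pim J<=S2" "b ~: pim J" "x:S2" "x ~: pim J"
 shows "wnum b (rvp J) x = - wnum b J x"
proof (cases "x = b")
 case False
 have "chart b o rvp J = rvp (chart b o J)" by (simp add: reversepath_def o_def)
 thus ?thesis using False path_chart[OF assms(1-4)] assms by (simp add: wnum_def winding_number_reversepath)
qed (simp add: wnum_def)

lemma loop_not_S2:
 assumes J: "loop_in J" obtains b where "b:S2" "b ~: pim J"
proof -
 obtain a c where ac: "a:pim J" "c:pim J" "a ~= c"
 proof -
  have "J 0 ~= J (1/2)" using J unfolding loop_in_def simple_path_def loop_free_def by fastforce
  thus thesis using that[of "J 0" "J (1/2)"] by (auto simp: pim_def)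
 qed
 obtain u d where "arc u" "arc d" "pim u Un pim d = pim J"
  using exists_double_arc[of J a c] J ac unfolding loop_in_def by metis
 moreover have "UNIV Int S2 ~= {}" by (auto simp: S2_def)
 ultimately show thesis using S2_avoid_arcs[of "{u,d}" UNIV] that by (metis UnE finite.emptyI finite.insertI insert_iff open_UNIV singletonD)
qed

lemma chart_loop:
 assumes J: "loop_in J" and b: "b:S2" "b ~: pim J"
 shows "simple_path (chart b o J)" "pfn (chart b o J) = pst (chart b o J)"
  "pim (chart b o J) = chart b ` pim J"
proof -
 have JS: "simple_path J" "path J" "pim J<=S2" "pfn J = pst J" using J simple_path_imp_path by (auto simp: loop_in_def)
 have Jt: "J t:S2" "J t ~= b" if "t:{0..1}" for t using JS b imageI[OF that, of J] by (auto simp: pim_def)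
 show "pim (chart b o J) = chart b ` pim J" by (simp add: path_image_compose)
 show "pfn (chart b o J) = pst (chart b o J)" using JS by (simp add: pathfinish_compose pathstart_compose)
 show "simple_path (chart b o J)"
  using JS(1) path_chart(1)[OF b(1) JS(2,3) b(2)] chart_simps(7)[OF b(1)] Jt
  unfolding simple_path_def loop_free_def by (metis o_apply)
qed

text \<open>Changing the pole to \<open>b'\<close> subtracts the winding number about
  \<open>b'\<close>, which is 0 or 1, from values that are 0 or 1. So the value 1 demanded by
  \<open>left_region\<close> occurs exactly for the points inside the curve in the chart at
  \<open>b\<close>.\<close>

lemma loop_sides_aux:
 assumes J: "loop_in J" and b: "b:S2" "b ~: pim J"
  and pos: "ALL z:inside (pim (chart b o J)). winding_number (chart b o J) z = 1"
 shows "Lr J = unchart b ` inside (pim (chart b o J))" "Lr (rvp J) = S2 - pim J - Lr J"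
  "b:Lr (rvp J)" "Lr J ~= {}" "ALL z:S2 - pim J. wnum b J z = (if z:Lr J then 1 else 0)"
proof -
 note c = chart_loop[OF J b]
 have JS: "path J" "pim J<=S2" using J simple_path_imp_path by (auto simp: loop_in_def)
 have w: "wnum b J z = (if z ~= b & chart b z:inside (pim (chart b o J)) then 1 else 0)" if z: "z:S2 - pim J" for z
 proof (cases "z = b")
  case False
  have "chart b z ~: pim (chart b o J)" using path_chart(3)[OF b(1) JS b(2)] z False by blast
  hence "chart b z:inside (pim (chart b o J)) \<or> chart b z:outside (pim (chart b o J))"
   using inside_Un_outside[of "pim (chart b o J)"] by blast
  moreover have "winding_number (chart b o J) (chart b z) = 0" if "chart b z:outside (pim (chart b o J))"
   by (rule winding_number_zero_in_outside) (use c that simple_path_imp_path in auto)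
  moreover have "chart b z ~: inside (pim (chart b o J)) \<or> chart b z ~: outside (pim (chart b o J))"
   using inside_Int_outside by blast
  ultimately show ?thesis using pos False by (auto simp: wnum_def)
 qed (simp add: wnum_def)
 have ch: "wnum b' J z = wnum b J z - wnum b J b'" if "z:S2 - pim J" "b':S2 - pim J" for z b'
  using wnum_change[OF b(1) _ JS b(2), of b' z] that by auto
 have bS: "b:S2 - pim J" "wnum b J b = 0" using b by (auto simp: wnum_def)
 have L: "z:Lr J \<longleftrightarrow> z:S2 - pim J & wnum b J z = 1" for z
 proof
  assume "z:Lr J"
  then obtain b' where z: "z:S2 - pim J" "b':S2 - pim J" "wnum b' J z = 1"
   unfolding Lr_def mem_Collect_eq left_region_iff[OF JS] by blast
  have "wnum b J z - wnum b J b' = 1" using ch[OF z(1,2)] z(3) by simp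
  thus "z:S2 - pim J & wnum b J z = 1" using w[OF z(1)] w[OF z(2)] z(1) by (auto split: if_splits)
 next
  assume "z:S2 - pim J & wnum b J z = 1"
  thus "z:Lr J" unfolding Lr_def mem_Collect_eq left_region_iff[OF JS] using b by blast
 qed
 show 1: "Lr J = unchart b ` inside (pim (chart b o J))"
 proof (intro equalityI subsetI)
  fix z assume "z:Lr J"
  hence z: "z:S2 - pim J" "wnum b J z = 1" using L by auto
  hence "z ~= b" "chart b z:inside (pim (chart b o J))" using w[OF z(1)] by (auto split: if_splits)
  thus "z:unchart b ` inside (pim (chart b o J))" using chart_simps(4)[OF b(1)] z by (metis DiffD1 imageI)
 next
  fix z assume "z:unchart b ` inside (pim (chart b o J))"
  then obtain y where y: "y:inside (pim (chart b o J))" "z = unchart b y" by blast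
  have "y ~: pim (chart b o J)" using y inside_no_overlap[of "pim (chart b o J)"] by blast
  hence "z ~: pim J" using c(3) y chart_simps(1)[OF b(1)] by (metis imageI)
  hence z: "z:S2 - pim J" "z ~= b" "chart b z = y" using y chart_simps[OF b(1)] by auto
  thus "z:Lr J" using L w y by simp
 qed
 have 5: "wnum b J z = (if z:Lr J then 1 else 0)" if "z:S2 - pim J" for z
  using L w[OF that] that by (auto split: if_splits)
 thus "ALL z:S2 - pim J. wnum b J z = (if z:Lr J then 1 else 0)" by blast
 have "inside (pim (chart b o J)) ~= {}" using Jordan_inside_outside[OF c(1,2)] by blast
 thus 4: "Lr J ~= {}" using 1 by blast
 then obtain a where a: "a:Lr J" by blast
 hence aS: "a:S2 - pim J" using L by blast
 have JR: "path (rvp J)" "pim (rvp J)<=S2" using JS by auto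
 show 2: "Lr (rvp J) = S2 - pim J - Lr J"
 proof (intro equalityI subsetI)
  fix z assume "z:Lr (rvp J)"
  then obtain b' where z: "z:S2 - pim J" "b':S2 - pim J" "wnum b' (rvp J) z = 1"
   unfolding Lr_def mem_Collect_eq left_region_iff[OF JR] by auto
  have "wnum b' (rvp J) z = - wnum b' J z" using wnum_reversepath[of b' J z] z JS by auto
  hence "wnum b J b' - wnum b J z = 1" using ch[OF z(1,2)] z(3) by simp
  hence "z ~: Lr J" using 5[OF z(1)] 5[OF z(2)] by (auto split: if_splits)
  thus "z:S2 - pim J - Lr J" using z by blast
 next
  fix z assume z: "z:S2 - pim J - Lr J"
  have "wnum a (rvp J) z = - wnum a J z" using wnum_reversepath[of a J z] z aS JS by auto
  also have "wnum a J z = wnum b J z - wnum b J a" using ch z aS by blast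
  also have "\<dots> = - 1" using 5[of z] 5[OF aS] z a by simp
  finally show "z:Lr (rvp J)" unfolding Lr_def mem_Collect_eq left_region_iff[OF JR] using z aS by auto
 qed
 show "b:Lr (rvp J)" unfolding 2 using 5[OF bS(1)] bS by (auto split: if_splits)
qed

lemma loop_dichotomy:
 assumes J: "loop_in J" and b: "b:S2" "b ~: pim J"
 obtains "ALL z:inside (pim (chart b o J)). winding_number (chart b o J) z = 1"
 | "ALL z:inside (pim (chart b o rvp J)). winding_number (chart b o rvp J) z = 1"
proof -
 note c = chart_loop[OF J b]
 have rv: "chart b o rvp J = rvp (chart b o J)" by (simp add: reversepath_def o_def)
 show thesis
 proof (rule simple_closed_path_winding_number_inside[OF c(1)])
  assume a: "!!z. z:inside (pim (chart b o J)) ==> winding_number (chart b o J) z = - 1"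
  have "winding_number (chart b o rvp J) z = 1" if "z:inside (pim (chart b o rvp J))" for z
  proof -
   have z: "z:inside (pim (chart b o J))" using that by (simp add: rv)
   hence "z ~: pim (chart b o J)" using inside_no_overlap by blast
   thus ?thesis unfolding rv using a[OF z] winding_number_reversepath[OF simple_path_imp_path[OF c(1)]] by simp
  qed
  thus thesis using that by blast
 qed (use that in blast)
qed

lemma loop_sides:
 assumes J: "loop_in J"
 shows "Lr J ~= {}" "Lr J Int Lr (rvp J) = {}" "Lr J Un Lr (rvp J) = S2 - pim J"
proof -
 obtain b where b: "b:S2" "b ~: pim J" using loop_not_S2[OF J] .
 have r: "loop_in (rvp J)" by (rule loop_in_reversepath[OF J])
 have b': "b ~: pim (rvp J)" using b by simp
 have "Lr J ~= {} & Lr J Int Lr (rvp J) = {} & Lr J Un Lr (rvp J) = S2 - pim J"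
 proof (rule loop_dichotomy[OF J b])
  assume "ALL z:inside (pim (chart b o J)). winding_number (chart b o J) z = 1"
  note * = loop_sides_aux[OF J b this]
  have "Lr J<=S2 - pim J" by (auto simp: Lr_def left_region_def)
  thus ?thesis using * by blast
 next
  assume "ALL z:inside (pim (chart b o rvp J)). winding_number (chart b o rvp J) z = 1"
  note * = loop_sides_aux[OF r b(1) b' this, unfolded reversepath_reversepath path_image_reversepath]
  have "Lr (rvp J)<=S2 - pim J" by (auto simp: Lr_def left_region_def)
  thus ?thesis using * by blast
 qed
 thus "Lr J ~= {}" "Lr J Int Lr (rvp J) = {}" "Lr J Un Lr (rvp J) = S2 - pim J" by auto
qed

lemma Lr_chart:
 assumes J: "loop_in J" and b: "b:Lr (rvp J)"
 shows "Lr J = unchart b ` inside (pim (chart b o J))" "b:S2" "b ~: pim J"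
proof -
 show bb: "b:S2" "b ~: pim J" using b by (auto simp: Lr_def left_region_def)
 have b': "b ~: pim (rvp J)" using bb by simp
 show "Lr J = unchart b ` inside (pim (chart b o J))"
 proof (rule loop_dichotomy[OF J bb])
  assume "ALL z:inside (pim (chart b o J)). winding_number (chart b o J) z = 1"
  thus ?thesis using loop_sides_aux(1)[OF J bb] by blast
 next
  assume "ALL z:inside (pim (chart b o rvp J)). winding_number (chart b o rvp J) z = 1"
  from loop_sides_aux(3)[OF loop_in_reversepath[OF J] bb(1) b' this] have "b:Lr J" by simp
  thus ?thesis using b loop_sides(2)[OF J] by blast
 qed
qed

text \<open>\<open>M\<close> is 1 for a pole on the right of the curve and 0 for a pole on the left;
  what is used later is the jump by 1 across the curve, the same for every pole.\<close>

lemma wnum_Lr: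
 assumes J: "loop_in J" and b: "b:S2" "b ~: pim J"
 obtains M where "!!z. z:Lr J ==> wnum b J z = M" "!!z. z:Lr (rvp J) ==> wnum b J z = M - 1"
proof -
 have r: "loop_in (rvp J)" by (rule loop_in_reversepath[OF J])
 have b': "b ~: pim (rvp J)" using b by simp
 have JS: "path J" "pim J<=S2" using J simple_path_imp_path by (auto simp: loop_in_def)
 have sub: "Lr J<=S2 - pim J" "Lr (rvp J)<=S2 - pim J" "Lr J Int Lr (rvp J) = {}"
  using loop_sides[OF J] by auto
 show thesis
 proof (rule loop_dichotomy[OF J b])
  assume "ALL z:inside (pim (chart b o J)). winding_number (chart b o J) z = 1"
  note * = loop_sides_aux(5)[OF J b this]
  have "wnum b J z = 1" if "z:Lr J" for z using * sub(1) that by auto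
  moreover have "wnum b J z = 1 - 1" if "z:Lr (rvp J)" for z
  proof -
   have "z:S2 - pim J" "z ~: Lr J" using sub that by blast+
   thus ?thesis using * by simp
  qed
  ultimately show thesis using that by blast
 next
  assume "ALL z:inside (pim (chart b o rvp J)). winding_number (chart b o rvp J) z = 1"
  note * = loop_sides_aux(5)[OF r b(1) b' this, unfolded path_image_reversepath]
  have **: "wnum b J z = (if z:Lr (rvp J) then -1 else 0)" if "z:S2 - pim J" for z
   using *[rule_format, OF that] wnum_reversepath[OF b(1) JS b(2), of z] that by (auto split: if_splits) (metis minus_minus)
  have "wnum b J z = 0" if "z:Lr J" for z
  proof -
   have "z:S2 - pim J" "z ~: Lr (rvp J)" using sub that by blast+
   thus ?thesis using ** by simp
  qed
  moreover have "wnum b J z = 0 - 1" if "z:Lr (rvp J)" for z using **[of z] sub that by auto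
  ultimately show thesis using that by blast
 qed
qed

text \<open>Seen from a pole on the right, the left side is the inside of a plane Jordan curve, to
  which the Jordan-Schoenflies theorem applies.\<close>

lemma Lr_topology:
 assumes J: "loop_in J"
 shows "connected (Lr J)" "closure (Lr J) = Lr J Un pim J" "compact (closure (Lr J))" "closed_disk (closure (Lr J))"
proof -
 obtain b where b: "b:Lr (rvp J)" using loop_sides(1)[OF loop_in_reversepath[OF J]] by blast
 note L = Lr_chart[OF J b]
 note c = chart_loop[OF J L(2,3)]
 note U = chart_simps(6)[OF L(2)]
 define C where "C = pim (chart b o J)"
 note jo = Jordan_inside_outside[OF c(1,2), folded C_def]
 have Jim: "pim J = unchart b ` C"
 proof -
  have "unchart b (chart b y) = y" if "y:pim J" for y using that J L chart_simps(4)[OF L(2)] by (auto simp: loop_in_def)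
  thus ?thesis unfolding C_def c(3) by (force simp: image_image)
 qed
 have cl: "closure (inside C) = inside C Un C" using jo closure_Un_frontier by metis
 show "connected (Lr J)" unfolding L(1) C_def[symmetric]
  by (intro connected_continuous_image continuous_on_subset[OF U]) (use jo in auto)
 have un: "Lr J Un pim J = unchart b ` closure (inside C)" unfolding L(1) Jim C_def[symmetric] cl by blast
 have comp: "compact (unchart b ` closure (inside C))"
  by (intro compact_continuous_image continuous_on_subset[OF U]) (use jo in \<open>auto simp: compact_closure\<close>)
 have "unchart b ` closure (inside C)<=closure (unchart b ` inside C)"
  by (rule continuous_image_closure_subset[OF U]) auto
 thus eq: "closure (Lr J) = Lr J Un pim J"
  using un comp L(1) by (metis C_def closure_minimal compact_imp_closed subset_antisym sup_ge1)
 thus "compact (closure (Lr J))" using un comp by simp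
 have inj: "inj_on (unchart b) X" for X by (metis chart_simps(1)[OF L(2)] inj_onI)
 have "closure (inside C) homeomorphic unchart b ` closure (inside C)"
  by (rule homeomorphic_compact[OF _ continuous_on_subset[OF U] refl inj]) (use jo in \<open>auto simp: compact_closure\<close>)
 moreover have "closure (inside C) homeomorphic cball (0::complex) 1"
  using Jordan_Schoenflies[OF c(1,2)] unfolding C_def[symmetric] cl by (simp add: Un_commute)
 ultimately show "closed_disk (closure (Lr J))" unfolding closed_disk_def eq un
  by (meson homeomorphic_sym homeomorphic_trans)
qed

section \<open>Arcs closed up to Jordan curves, and the local side of an arc\<close>

lemma arc_reparam:
 fixes p q :: "real => 'a::t2_space"
 assumes "arc p" "arc q" "pim q = pim p" "pst q = pst p" "pfn q = pfn p"
 obtains f where "continuous_on {0..1} f" "f:{0..1} \<rightarrow> {0..1}" "f 0 = 0" "f 1 = 1" "!!t. t:{0..1} ==> q t = p (f t)"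
proof -
 have cp: "continuous_on {0..1} p" and ip: "inj_on p {0..1}" and cq: "continuous_on {0..1} q"
  using assms by (auto simp: arc_def path_def)
 obtain h where h: "homeomorphism {0..1} (pim p) p h"
  using homeomorphism_compact[OF compact_Icc cp _ ip] unfolding pim_def by blast
 have ch: "continuous_on (pim p) h" using h by (simp add: homeomorphism_def)
 show thesis
 proof (rule that[of "h o q"])
  show "continuous_on {0..1} (h o q)"
   by (rule continuous_on_compose[OF cq continuous_on_subset[OF ch]]) (use assms in \<open>simp add: pim_def\<close>)
  have qim: "q t:pim p" if "t:{0..1}" for t using assms(3) that by (auto simp: pim_def)
  have him: "h ` pim p = {0..1}" using h by (simp add: homeomorphism_def)
  show "h o q:{0..1} \<rightarrow> {0..1}" using qim him by auto
  show "q t = p ((h o q) t)" if "t:{0..1}" for t using homeomorphism_apply2[OF h qim[OF that]] by simp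
  show "(h o q) 0 = 0" "(h o q) 1 = 1"
   using assms(4,5) homeomorphism_apply1[OF h, of 0] homeomorphism_apply1[OF h, of 1] by (auto simp: pst_def pfn_def)
 qed
qed

lemma arc_winding_eq:
 fixes p q :: "real => complex"
 assumes "arc p" "arc q" "pim q = pim p" "pst q = pst p" "pfn q = pfn p" "z ~: pim p"
 shows "winding_number p z = winding_number q z"
proof -
 obtain f where f: "continuous_on {0..1} f" "f:{0..1} \<rightarrow> {0..1}" "f 0 = 0" "f 1 = 1" "!!t. t:{0..1} ==> q t = p (f t)"
  using arc_reparam[OF assms(1-5)] by blast
 have "homotopic_paths (- {z}) p q"
  by (rule homotopic_paths_reparametrize[OF arc_imp_path[OF assms(1)] _ f]) (use assms(6) in auto)
 thus ?thesis by (rule winding_number_homotopic_paths)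
qed

lemma wnum_join:
 assumes "b:S2" "path p" "path q" "pim p<=S2" "pim q<=S2" "b ~: pim p" "b ~: pim q"
  "pfn p = pst q" "x:S2" "x ~: pim p" "x ~: pim q"
 shows "wnum b (p +++ q) x = wnum b p x + wnum b q x"
proof (cases "x = b")
 case False
 have "chart b o (p +++ q) = (chart b o p) +++ (chart b o q)" by (rule path_compose_join)
 thus ?thesis
  using False path_chart[OF assms(1,2,4,6)] path_chart[OF assms(1,3,5,7)] assms
  by (simp add: wnum_def winding_number_join pathfinish_compose pathstart_compose)
qed (simp add: wnum_def)

lemma arc_chart:
 assumes "b:S2" "arc p" "pim p<=S2" "b ~: pim p"
 shows "arc (chart b o p)"
proof -
 have "p t:S2 & p t ~= b" if "t:{0..1}" for t using assms imageI[OF that, of p] by (auto simp: pim_def)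
 thus ?thesis
  using path_chart(1)[OF assms(1) arc_imp_path[OF assms(2)] assms(3,4)] assms(2) chart_simps(7)[OF assms(1)]
  unfolding arc_def inj_on_def by (metis o_apply)
qed

lemma wnum_arc_eq:
 assumes "b:S2" "arc p" "arc q" "pim q = pim p" "pst q = pst p" "pfn q = pfn p"
  "pim p<=S2" "b ~: pim p" "x:S2" "x ~: pim p"
 shows "wnum b p x = wnum b q x"
proof (cases "x = b")
 case False
 have "winding_number (chart b o p) (chart b x) = winding_number (chart b o q) (chart b x)"
  by (rule arc_winding_eq) (use assms False arc_chart[OF assms(1)] path_chart[OF assms(1) arc_imp_path[OF assms(2)] assms(7,8)] in
    \<open>auto simp: path_image_compose pathstart_compose pathfinish_compose\<close>)
 thus ?thesis by (simp add: wnum_def)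
qed (simp add: wnum_def)

lemma Lr_cong:
 assumes "path J" "path J'" "pim J<=S2" "pim J' = pim J"
  "!!b x. b:S2 ==> x:S2 ==> b ~: pim J ==> x ~: pim J ==> wnum b J x = wnum b J' x"
 shows "Lr J = Lr J'"
proof -
 have s: "pim J'<=S2" using assms by simp
 have "left_region J x \<longleftrightarrow> left_region J' x" for x
  unfolding left_region_iff[OF assms(1,3)] left_region_iff[OF assms(2) s] assms(4) using assms(5)[of _ x] by metis
 thus ?thesis by (simp add: Lr_def)
qed

definition closes :: "(real => real^3) => (real => real^3) => bool" where
 "closes p q \<longleftrightarrow> arc p & arc q & pst q = pfn p & pfn q = pst p &
   pim q Int pim p = {pst p, pfn p} & pim p<=S2 & pim q<=S2"

lemma closes_loop: "closes p q ==> loop_in (p +++ q)"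
 unfolding closes_def loop_in_def by (auto simp: simple_path_join_loop_eq path_image_join)

lemma closes_image: "closes p q ==> pim (p +++ q) = pim p Un pim q"
 unfolding closes_def by (simp add: path_image_join)

lemma closes_sym: "closes p q ==> closes q p"
 unfolding closes_def by auto

lemma closes_reverse: "closes p q ==> closes (rvp p) (rvp q)"
 unfolding closes_def by (auto simp: arc_reversepath)

lemma wnum_closes:
 assumes "closes p q" "b:S2" "x:S2" "b ~: pim p Un pim q" "x ~: pim p Un pim q"
 shows "wnum b (p +++ q) x = wnum b p x + wnum b q x"
 using assms by (intro wnum_join) (auto simp: closes_def arc_imp_path)

lemma Lr_closes_sym: "closes p q ==> Lr (p +++ q) = Lr (q +++ p)"
proof -
 assume c: "closes p q"
 note c' = closes_sym[OF c]
 show ?thesis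
  by (rule Lr_cong) (use c c' closes_loop[OF c] closes_loop[OF c'] wnum_closes[OF c] wnum_closes[OF c'] in
    \<open>auto simp: closes_image loop_in_def simple_path_imp_path\<close>)
qed

lemma Lr_closes_eq:
 assumes c: "closes p q" and p': "arc p'" "pim p' = pim p" "pst p' = pst p" "pfn p' = pfn p"
 shows "closes p' q" "Lr (p' +++ q) = Lr (p +++ q)"
proof -
 show c': "closes p' q" using c p' by (simp add: closes_def)
 show "Lr (p' +++ q) = Lr (p +++ q)"
 proof (rule Lr_cong)
  fix b x assume *: "b:S2" "x:S2" "b ~: pim (p' +++ q)" "x ~: pim (p' +++ q)"
  hence "wnum b p' x = wnum b p x" using c p' by (intro wnum_arc_eq) (auto simp: closes_def closes_image[OF c'])
  thus "wnum b (p' +++ q) x = wnum b (p +++ q) x"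
   using wnum_closes[OF c, of b x] wnum_closes[OF c', of b x] * p' by (simp add: closes_image[OF c'])
 qed (use c c' closes_loop[OF c] closes_loop[OF c'] p' in \<open>auto simp: closes_image loop_in_def simple_path_imp_path\<close>)
qed

lemma reversepath_closes: "closes p q ==> Lr (rvp (p +++ q)) = Lr (rvp p +++ rvp q)"
proof -
 assume c: "closes p q"
 have "rvp (p +++ q) = rvp q +++ rvp p"
  using c by (intro reversepath_joinpaths) (simp add: closes_def)
 thus ?thesis using Lr_closes_sym[OF closes_reverse[OF c]] by simp
qed

text \<open>The two closing arcs form a loop \<open>K\<close> missing \<open>g t0\<close>, and the
  winding numbers of the two Jordan curves differ by that of \<open>K\<close>, which is constant
  near \<open>g t0\<close>. Both sides accumulate at \<open>g t0\<close>, so the jump by 1 matches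
  left with left.\<close>

lemma left_local:
 assumes c1: "closes g s" and c2: "closes g s'" and t0: "0 < t0" "t0 < 1"
 obtains d where "d > 0" "!!z. z:S2 ==> dist z (g t0) < d ==> z ~: pim g ==> z:Lr (g +++ s) \<longleftrightarrow> z:Lr (g +++ s')"
proof -
 have arcs: "arc g" "arc s" "arc s'" and S: "pim g<=S2" "pim s<=S2" "pim s'<=S2"
  using c1 c2 by (auto simp: closes_def)
 define c where "c = g t0"
 have cS: "c:S2" "c:pim g" using S t0 by (auto simp: c_def pim_def)
 have cne: "c ~= pst g" "c ~= pfn g"
  using arcs(1) t0 unfolding arc_def inj_on_def c_def pst_def pfn_def
  by (metis atLeastAtMost_iff less_irrefl less_imp_le order_refl zero_le_one)+
 hence cn: "c ~: pim s" "c ~: pim s'" using c1 c2 cS by (auto simp: closes_def)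
 have SU: "UNIV Int S2 ~= {}" using cS by blast
 obtain b where b: "b:S2" "b ~: pim g" "b ~: pim s" "b ~: pim s'"
  using S2_avoid_arcs[of "{g,s,s'}" UNIV] arcs SU by (metis finite.emptyI finite.insertI insert_iff open_UNIV singletonD)
 have cb: "c ~= b" using cS b by auto
 define K where "K = (chart b o s) +++ rvp (chart b o s')"
 note ps = path_chart[OF b(1) arc_imp_path[OF arcs(2)] S(2) b(3)]
 note ps' = path_chart[OF b(1) arc_imp_path[OF arcs(3)] S(3) b(4)]
 have ends: "pfn (chart b o s) = pst (rvp (chart b o s'))" "pst (chart b o s) = pfn (rvp (chart b o s'))"
  using c1 c2 by (auto simp: closes_def pathstart_compose pathfinish_compose)
 have pK: "path K" "pfn K = pst K" unfolding K_def using ps ps' ends by auto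
 have imK: "pim K = chart b ` pim s Un chart b ` pim s'"
  unfolding K_def using ends ps(2) ps'(2) by (simp add: path_image_join)
 have K: "wnum b s z - wnum b s' z = winding_number K (chart b z)" if "z:S2" "z ~= b" "z ~: pim s" "z ~: pim s'" for z
  unfolding K_def using that ps ps' ends by (simp add: wnum_def winding_number_join winding_number_reversepath)
 have "chart b c ~: pim K" unfolding imK using ps(3)[OF cS(1) cb cn(1)] ps'(3)[OF cS(1) cb cn(2)] ps(2) ps'(2) by blast
 then obtain e where e: "e > 0" "ball (chart b c) e <= - pim K"
  using closed_path_image[OF pK(1)] open_contains_ball by (metis ComplI open_Compl)
 have const: "winding_number K w = winding_number K (chart b c)" if "w:ball (chart b c) e" for w
  by (rule winding_number_eq[OF pK that, of "chart b c"]) (use e connected_ball in \<open>auto simp: centre_in_ball\<close>)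
 have "EX d>0. ALL z:S2 - {b}. dist z c < d --> dist (chart b z) (chart b c) < e"
  using chart_simps(5)[OF b(1)] cS cb e(1) unfolding continuous_on_iff by blast
 then obtain d1 where d1: "d1 > 0" "!!z. z:S2 ==> z ~= b ==> dist z c < d1 ==> chart b z:ball (chart b c) e"
  by (auto simp: dist_commute)
 have "open (- (pim s Un pim s' Un {b}))" using arcs by (intro open_Compl closed_Un closed_arc_image) auto
 then obtain d2 where d2: "d2 > 0" "ball c d2 <= - (pim s Un pim s' Un {b})"
  using cn cb open_contains_ball by (metis ComplI Un_iff singletonD)
 define d where "d = min d1 d2"
 define k where "k = winding_number K (chart b c)"
 have near: "wnum b (g +++ s) z = wnum b (g +++ s') z + k" "z ~: pim (g +++ s)" "z ~: pim (g +++ s')"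
  if z: "z:S2" "dist z c < d" "z ~: pim g" for z
 proof -
  have zn: "z ~: pim s" "z ~: pim s'" "z ~= b" using d2 z by (auto simp: d_def dist_commute subset_iff)
  show "z ~: pim (g +++ s)" "z ~: pim (g +++ s')" using z zn closes_image[OF c1] closes_image[OF c2] by auto
  have "winding_number K (chart b z) = k" unfolding k_def using const d1 z zn by (simp add: d_def)
  thus "wnum b (g +++ s) z = wnum b (g +++ s') z + k"
   using K[of z] z zn wnum_closes[OF c1 b(1) z(1)] wnum_closes[OF c2 b(1) z(1)] b by (simp add: algebra_simps)
 qed
 have bn: "b ~: pim (g +++ s)" "b ~: pim (g +++ s')" using b closes_image[OF c1] closes_image[OF c2] by auto
 note l1 = closes_loop[OF c1] and l2 = closes_loop[OF c2]
 obtain M where M: "!!z. z:Lr (g +++ s) ==> wnum b (g +++ s) z = M" "!!z. z:Lr (rvp (g +++ s)) ==> wnum b (g +++ s) z = M - 1"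
  using wnum_Lr[OF l1 b(1) bn(1)] by metis
 obtain M' where M': "!!z. z:Lr (g +++ s') ==> wnum b (g +++ s') z = M'" "!!z. z:Lr (rvp (g +++ s')) ==> wnum b (g +++ s') z = M' - 1"
  using wnum_Lr[OF l2 b(1) bn(2)] by metis
 have d: "d > 0" using d1 d2 by (simp add: d_def)
 have ccl: "c:closure (Lr (g +++ s))" "c:closure (Lr (rvp (g +++ s)))"
  using Lr_topology(2)[OF l1] Lr_topology(2)[OF loop_in_reversepath[OF l1]] cS closes_image[OF c1] by auto
 obtain zl where zl: "zl:Lr (g +++ s)" "dist zl c < d" using ccl(1) d by (metis closure_approachable)
 obtain zr where zr: "zr:Lr (rvp (g +++ s))" "dist zr c < d" using ccl(2) d by (metis closure_approachable)
 have zlS: "zl:S2" "zl ~: pim g" and zrS: "zr:S2" "zr ~: pim g"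
  using loop_sides(3)[OF l1] zl zr closes_image[OF c1] by blast+
 have inS2: "z:Lr (g +++ s') \<or> z:Lr (rvp (g +++ s'))" if "z:S2" "z ~: pim (g +++ s')" for z
  using loop_sides(3)[OF l2] that by blast
 have inS1: "z:Lr (g +++ s) \<or> z:Lr (rvp (g +++ s))" if "z:S2" "z ~: pim (g +++ s)" for z
  using loop_sides(3)[OF l1] that by blast
 have wl: "wnum b (g +++ s') zl = M - k" "wnum b (g +++ s') zr = M - 1 - k"
  using near(1)[OF zlS(1) zl(2) zlS(2)] near(1)[OF zrS(1) zr(2) zrS(2)] M zl zr by (auto simp: algebra_simps)
 have Mk: "M' = M - k"
  using inS2[OF zlS(1) near(3)[OF zlS(1) zl(2) zlS(2)]] inS2[OF zrS(1) near(3)[OF zrS(1) zr(2) zrS(2)]] M' wl by auto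
 show thesis
 proof (rule that[OF d])
  fix z assume z: "z:S2" "dist z (g t0) < d" "z ~: pim g"
  have z': "dist z c < d" using z by (simp add: c_def)
  note n = near[OF z(1) z' z(3)]
  show "z:Lr (g +++ s) \<longleftrightarrow> z:Lr (g +++ s')"
   using inS1[OF z(1) n(2)] inS2[OF z(1) n(3)] M[of z] M'[of z] n(1) Mk by auto
 qed
qed

section \<open>Absence of Jordan curves and uniqueness of arcs in a zipper\<close>

lemma gap_around:
 fixes S :: "real set"
 assumes S: "closed S" "a:S" "b:S" and t: "a < t" "t < b" "t ~: S"
 obtains s1 s2 where "s1:S" "s2:S" "a<=s1" "s1 < t" "t < s2" "s2<=b" "!!s. s1 < s ==> s < s2 ==> s ~: S"
proof -
 have "compact ({a..t} Int S)" "a:{a..t} Int S" using S t by (auto intro: compact_Int_closed)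
 then obtain s1 where s1: "s1:{a..t} Int S" "!!s. s:{a..t} Int S ==> s<=s1" using compact_attains_sup by (metis empty_iff)
 have "compact ({t..b} Int S)" "b:{t..b} Int S" using S t by (auto intro: compact_Int_closed)
 then obtain s2 where s2: "s2:{t..b} Int S" "!!s. s:{t..b} Int S ==> s2<=s" using compact_attains_inf by (metis empty_iff)
 show thesis
 proof (rule that[of s1 s2])
  show "s1 < t" using s1 t by (metis IntE atLeastAtMost_iff order_le_less)
  show "t < s2" using s2 t by (metis IntE atLeastAtMost_iff order_le_less)
  show "s ~: S" if "s1 < s" "s < s2" for s
  proof
   assume "s:S"
   thus False using s1(2)[of s] s2(2)[of s] s1(1) s2(1) that by (cases "s<=t") auto
  qed
 qed (use s1 s2 in auto)
qed

text \<open>A maximal piece of \<open>p\<close> off \<open>q\<close>, closed by the piece of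
  \<open>q\<close> between its ends, would be a Jordan curve in \<open>Z\<close>.\<close>

lemma unique_arc_sub:
 fixes p q :: "real => 'a::real_normed_vector"
 assumes p: "arc p" "pim p<=Z" and q: "arc q" "pim q<=Z"
  and ends: "pst q = pst p" "pfn q = pfn p"
  and noloop: "!!c. simple_path c ==> pfn c = pst c ==> pim c<=Z ==> False"
 shows "pim p<=pim q"
proof
 fix x assume "x:pim p"
 then obtain t where t: "t:{0..1}" "x = p t" by (auto simp: pim_def)
 show "x:pim q"
 proof (rule ccontr)
  assume nx: "x ~: pim q"
  define S where "S = {0..1} Int p -` pim q"
  have cp: "continuous_on {0..1} p" and ip: "inj_on p {0..1}" using p by (auto simp: arc_def path_def)
  have "closed S" unfolding S_def by (rule continuous_closed_preimage[OF cp]) (use q closed_arc_image in auto)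
  moreover have "p 0:pim q" "p 1:pim q" using ends by (metis pst_def pfn_def pathstart_in_path_image pathfinish_in_path_image)+
  hence "0:S" "1:S" by (auto simp: S_def)
  moreover have "t ~: S" using nx t by (auto simp: S_def)
  moreover hence "0 < t" "t < 1" using t \<open>0:S\<close> \<open>1:S\<close> by (auto simp: less_le)
  ultimately obtain s1 s2 where s: "s1:S" "s2:S" "s1 < t" "t < s2" "!!s. s1 < s ==> s < s2 ==> s ~: S"
   using gap_around[of S 0 1 t] by metis
  have s01: "s1:{0..1}" "s2:{0..1}" using s by (auto simp: S_def)
  obtain r1 r2 where r: "r1:{0..1}" "r2:{0..1}" "p s1 = q r1" "p s2 = q r2" using s(1,2) by (auto simp: S_def pim_def)
  have ne: "p s1 ~= p s2" using inj_onD[OF ip _ s01] s by auto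
  hence r12: "r1 ~= r2" using r by auto
  define a where "a = subpath s1 s2 p"
  define b where "b = subpath r2 r1 q"
  have ab: "arc a" "arc b" unfolding a_def b_def using p q s s01 r r12 by (auto intro: arc_subpath_arc)
  have ima: "pim a = p ` {s1..s2}" unfolding a_def using s by (simp add: path_image_subpath)
  have imb: "pim b<=pim q" unfolding b_def using r by (intro path_image_subpath_subset) auto
  have "simple_path (a +++ b)"
  proof (rule simple_path_join_loop[OF ab])
   show "pfn a = pst b" "pfn b = pst a" using r by (auto simp: a_def b_def)
   show "pim a Int pim b<={pst a, pst b}"
   proof
    fix y assume y: "y:pim a Int pim b"
    then obtain s' where s': "s':{s1..s2}" "y = p s'" using ima by auto
    have "s':S" using s' y imb s01 by (auto simp: S_def)
    hence "s' = s1 \<or> s' = s2" using s(5)[of s'] s' by force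
    thus "y:{pst a, pst b}" using s' r by (auto simp: a_def b_def)
   qed
  qed
  moreover have "pfn (a +++ b) = pst (a +++ b)" using r by (simp add: a_def b_def)
  moreover have "pim (a +++ b)<=Z"
  proof -
   have "pim a<=pim p" unfolding a_def using s01 by (intro path_image_subpath_subset) auto
   thus ?thesis using imb p q path_image_join_subset[of a b] by blast
  qed
  ultimately show False by (rule noloop)
 qed
qed

text \<open>A dense set meets both sides of a Jordan curve, and a connected set missing the curve
  lies on one side.\<close>

lemma no_loop_disjoint_dense:
 assumes J: "simple_path J" "pfn J = pst J" "pim J<=S2"
  and W: "connected W" "W<=S2" "S2<=closure W" "W Int pim J = {}"
 shows False
proof -
 have l: "loop_in J" using J by (simp add: loop_in_def)
 note l' = loop_in_reversepath[OF l]
 have meet: "W Int Lr K ~= {}" if K: "loop_in K" "pim K = pim J" "Lr K = S2 - closure (Lr (rvp K))" for K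
 proof -
  obtain x where x: "x:Lr K" using loop_sides(1)[OF K(1)] by blast
  hence "x:closure W" "x:- closure (Lr (rvp K))" using W(3) K(3) by auto
  hence "W Int - closure (Lr (rvp K)) ~= {}"
   using open_Int_closure_eq_empty[of "- closure (Lr (rvp K))" W] by (auto simp: open_Compl)
  thus ?thesis using W(2) K(3) by blast
 qed
 have e1: "Lr J = S2 - closure (Lr (rvp J))" using loop_sides[OF l] Lr_topology(2)[OF l'] by auto
 have e2: "Lr (rvp J) = S2 - closure (Lr J)" using loop_sides[OF l] Lr_topology(2)[OF l] by auto
 have m: "W Int Lr J ~= {}" "W Int Lr (rvp J) ~= {}" using meet[OF l _ e1] meet[OF l'] e2 by auto
 have "closure (Lr J) Int closure (Lr (rvp J)) Int W = {}"
  using Lr_topology(2)[OF l] Lr_topology(2)[OF l'] loop_sides(2)[OF l] W(4) by auto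
 moreover have "W<=closure (Lr J) Un closure (Lr (rvp J))"
  using loop_sides(3)[OF l] W Lr_topology(2)[OF l] Lr_topology(2)[OF l'] by blast
 ultimately show False
  using connected_closedD[OF W(1), of "closure (Lr J)" "closure (Lr (rvp J))"] m closure_subset by blast
qed

lemma finite_Union_path_connected:
 assumes "finite A" "!!a. a:A ==> path_connected a & closed a" "connected (\<Union>A)"
 shows "path_connected (\<Union>A)"
 unfolding path_connected_component
proof (intro ballI)
 fix x y assume xy: "x : \<Union>A" "y : \<Union>A"
 define P where "P = {a\<in>A. a<=path_component_set (\<Union>A) x}"
 have dich: "a<=path_component_set (\<Union>A) x" if a: "a:A" "a Int path_component_set (\<Union>A) x ~= {}" for a
 proof
  fix z assume z: "z:a"
  obtain w where w: "w:a" "path_component (\<Union>A) x w" using a by auto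
  have "path_component a w z" using assms(2)[OF a(1)] w z by (simp add: path_connected_component)
  hence "path_component (\<Union>A) w z" using a(1) path_component_of_subset by (metis Union_upper)
  thus "z:path_component_set (\<Union>A) x" using w path_component_trans by auto
 qed
 have "closed (\<Union>P)" "closed (\<Union>(A - P))" using assms by (auto simp: P_def intro!: closed_Union)
 moreover have "\<Union>P Int \<Union>(A - P) Int \<Union>A = {}" using dich by (auto simp: P_def)
 moreover have "\<Union>A <= \<Union>P Un \<Union>(A - P)" by blast
 moreover have "\<Union>P Int \<Union>A ~= {}"
 proof -
  obtain a where a: "a:A" "x:a" using xy by blast
  have "x:path_component_set (\<Union>A) x" using xy by (simp add: path_component_refl)
  hence "a:P" using dich a by (auto simp: P_def)
  thus ?thesis using a by blast
 qed
 ultimately have "\<Union>(A - P) Int \<Union>A = {}" using connected_closedD[OF assms(3), of "\<Union>P" "\<Union>(A - P)"] by blast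
 thus "path_component (\<Union>A) x y" using xy by (auto simp: P_def)
qed

locale zip =
 fixes Zp Zm :: "(real^3) set"
 assumes sub: "Zp<=S2" "Zm<=S2" and disj: "Zp Int Zm = {}"
  and dense: "S2<=closure Zp" "S2<=closure Zm"
  and pc: "path_connected Zp" "path_connected Zm"
begin

lemma swap: "zip Zm Zp"
 using sub disj dense pc by unfold_locales auto

text \<open>Asking the loop to avoid \<open>Zm\<close>, instead of lying in \<open>Zp\<close>,
  covers arcs that end at a landing point outside both sets.\<close>

lemma no_loop:
 assumes "simple_path c" "pfn c = pst c" "pim c<=S2 - Zm"
 shows False
 using no_loop_disjoint_dense[of c Zm] assms sub dense path_connected_imp_connected[OF pc(2)] by blast

lemma unique_arc:
 assumes "arc p" "arc q" "pim p<=S2 - Zm" "pim q<=S2 - Zm" "pst q = pst p" "pfn q = pfn p"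
 shows "pim q = pim p"
 using unique_arc_sub[OF assms(1,3,2,4)] unique_arc_sub[OF assms(2,4,1,3)] assms no_loop by (metis subset_antisym)

end

section \<open>Arcs changing over from \<open>Zp\<close> to \<open>Zm\<close>, their regions and the
  cyclic order\<close>

lemma one_minus_image:
 fixes a b :: real
 shows "(%x. 1 - x) ` {a..b} = {1 - b..1 - a}" "(%x. 1 - x) ` {a<..<b} = {1 - b<..<1 - a}"
  "(%x. 1 - x) ` {a..<b} = {1 - b<..1 - a}" "(%x. 1 - x) ` {a<..b} = {1 - b..<1 - a}"
proof -
 have "(%x. 1 - x) ` S = (%x. 1 - x) -` S" for S :: "real set"
 proof (intro set_eqI iffI)
  fix y assume "y:(%x. 1 - x) -` S"
  thus "y:(%x. 1 - x) ` S" by (intro image_eqI[of _ _ "1 - y"]) auto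
 qed auto
 note * = this
 show "(%x. 1 - x) ` {a..b} = {1 - b..1 - a}" "(%x. 1 - x) ` {a<..<b} = {1 - b<..<1 - a}"
  "(%x. 1 - x) ` {a..<b} = {1 - b<..1 - a}" "(%x. 1 - x) ` {a<..b} = {1 - b..<1 - a}"
  unfolding * by auto
qed

locale zip_based = zip +
 fixes op om :: "real^3"
 assumes op: "op:Zp" and om: "om:Zm"
begin

text \<open>The point \<open>g t\<close> itself is unrestricted: it may lie in \<open>Zp\<close>, in
  \<open>Zm\<close> or in neither, corresponding to the three types of landing.\<close>

definition elt :: "(real => real^3) => real => bool" where
 "elt g t \<longleftrightarrow> arc g & g 0 = op & g 1 = om & pim g<=S2 & 0<=t & t<=1 & g ` {0..<t}<=Zp & g ` {t<..1}<=Zm"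

definition E where "E = {g. EX t. elt g t}"
definition tau where "tau g = (SOME t. elt g t)"
definition X where "X g = g (tau g)"

lemma elt_tau: "g:E ==> elt g (tau g)"
 unfolding tau_def by (rule someI_ex) (simp add: E_def)

lemma elt_unique: "elt g t ==> elt g t' ==> t = t'"
proof (rule ccontr)
 assume a: "elt g t" "elt g t'" "t ~= t'"
 define s where "s = (t + t') / 2"
 have "g s:Zp & g s:Zm" using a unfolding elt_def s_def
  by (cases "t < t'") (auto simp: image_subset_iff field_simps)
 thus False using disj by blast
qed

lemma tau_eq: "elt g t ==> tau g = t"
 by (metis E_def elt_tau elt_unique mem_Collect_eq)

lemma E_facts:
 assumes "g:E"
 shows "arc g" "g 0 = op" "g 1 = om" "pim g<=S2" "0<=tau g" "tau g<=1"
  "!!s. 0<=s ==> s < tau g ==> g s:Zp" "!!s. tau g < s ==> s<=1 ==> g s:Zm"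
  "!!s. 0<=s ==> s<=1 ==> g s:S2"
 using elt_tau[OF assms] by (auto simp: elt_def image_subset_iff pim_def)

lemma E_time_Zp: "g:E ==> 0<=s ==> s<=1 ==> g s ~: Zm ==> s<=tau g"
 using E_facts(8)[of g s] by force

lemma E_time_Zm: "g:E ==> 0<=s ==> s<=1 ==> g s ~: Zp ==> tau g<=s"
 using E_facts(7)[of g s] by force

lemma E_inj: "g:E ==> s:{0..1} ==> t:{0..1} ==> g s = g t ==> s = t"
 using E_facts(1) by (auto simp: arc_def inj_on_def)

lemma zip_swap: "zip Zm Zp" by (rule swap)

text \<open>Up to a common point outside \<open>Zm\<close> both arcs run outside \<open>Zm\<close>,
  where arcs with the same ends are unique.\<close>

lemma prefix:
 assumes g: "g:E" "h:E" and s: "s:{0..1}" "r:{0..1}" "g s = h r" "g s ~: Zm"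
 shows "g ` {0..s} = h ` {0..r}"
proof (cases "s = 0 \<or> r = 0")
 case True
 have "s = 0 & r = 0"
 proof (cases "s = 0")
  case True
  hence "h r = h 0" using s E_facts(2)[OF g(1)] E_facts(2)[OF g(2)] by simp
  thus ?thesis using E_inj[OF g(2) s(2), of 0] True by simp
 next
  case False
  hence "r = 0" using True by simp
  hence "g s = g 0" using s E_facts(2)[OF g(1)] E_facts(2)[OF g(2)] by simp
  thus ?thesis using E_inj[OF g(1) s(1), of 0] \<open>r = 0\<close> by simp
 qed
 thus ?thesis using E_facts(2)[OF g(1)] E_facts(2)[OF g(2)] by simp
next
 case False
 have in_: "k ` {0..x}<=S2 - Zm" if k: "k:E" "x:{0..1}" "k x ~: Zm" for k x
 proof
  fix y assume "y:k ` {0..x}"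
  then obtain w where w: "0<=w" "w<=x" "y = k w" by auto
  have "x<=tau k" using E_time_Zp k by auto
  hence "w = x \<or> w < tau k" using w by auto
  hence "y ~: Zm" using w E_facts(7)[OF k(1), of w] disj k(3) by auto
  thus "y:S2 - Zm" using E_facts(9)[OF k(1)] w k by auto
 qed
 have a: "arc (subpath 0 s g)" "arc (subpath 0 r h)"
  using False s E_facts(1)[OF g(1)] E_facts(1)[OF g(2)] by (auto intro: arc_subpath_arc)
 have im: "pim (subpath 0 s g) = g ` {0..s}" "pim (subpath 0 r h) = h ` {0..r}"
  using s by (auto simp: path_image_subpath)
 have hr: "h r ~: Zm" using s by simp
 have "pim (subpath 0 r h) = pim (subpath 0 s g)"
  by (rule unique_arc[OF a]) (use im in_[OF g(1) s(1,4)] in_[OF g(2) s(2) hr] s E_facts(2)[OF g(1)] E_facts(2)[OF g(2)] in auto)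
 thus ?thesis using im by simp
qed

lemma sw_based: "zip_based Zm Zp om op"
 using zip_swap op om by (simp add: zip_based_def zip_based_axioms_def)

text \<open>The symmetry of the whole development: the exchange of \<open>Zp\<close> and
  \<open>Zm\<close> reverses arcs and sends the transition time \<open>t\<close> to
  \<open>1 - t\<close>. Statements on \<open>Zm\<close> are obtained from those on \<open>Zp\<close>
  in this way.\<close>

lemma sw_elt: "zip_based.elt Zm Zp om op g t \<longleftrightarrow> elt (rvp g) (1 - t)"
proof -
 interpret sw: zip_based Zm Zp om op by (rule sw_based)
 have i: "rvp g ` {0..<1 - t} = g ` {t<..1}" "rvp g ` {1 - t<..1} = g ` {0..<t}"
 proof -
  have "rvp g ` S = g ` ((%x. 1 - x) ` S)" for S by (simp add: reversepath_def image_image)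
  moreover have "(%x. 1 - x) ` {0..<1 - t} = {t<..1}" "(%x. 1 - x) ` {1 - t<..1} = {0..<t}" by (simp_all add: one_minus_image)
  ultimately show "rvp g ` {0..<1 - t} = g ` {t<..1}" "rvp g ` {1 - t<..1} = g ` {0..<t}" by simp_all
 qed
 have "arc (rvp g) = arc g" by (metis arc_reversepath reversepath_reversepath)
 thus ?thesis unfolding sw.elt_def elt_def i by (auto simp: reversepath_def path_image_reversepath[unfolded reversepath_def])
qed

lemma sw_E: "g:zip_based.E Zm Zp om op \<longleftrightarrow> rvp g:E"
proof -
 interpret sw: zip_based Zm Zp om op by (rule sw_based)
 have "(EX t. elt (rvp g) (1 - t)) = (EX t. elt (rvp g) t)" by (metis diff_diff_eq2 diff_add_cancel add_diff_cancel_left')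
 thus ?thesis by (simp add: sw.E_def E_def sw_elt)
qed

lemma suffix:
 assumes g: "g:E" "h:E" and s: "s:{0..1}" "r:{0..1}" "g s = h r" "g s ~: Zp"
 shows "g ` {s..1} = h ` {r..1}"
proof -
 interpret sw: zip_based Zm Zp om op by (rule sw_based)
 have im: "k ` {x..1} = rvp k ` {0..1 - x}" for k :: "real => real^3" and x

 proof -
  have "rvp k ` S = k ` ((%y. 1 - y) ` S)" for S by (simp add: reversepath_def image_image)
  thus ?thesis using one_minus_image(1)[of 0 "1 - x"] by simp
 qed
 have "rvp g:sw.E" "rvp h:sw.E" using g by (simp_all add: sw_E)
 from sw.prefix[OF this, of "1 - s" "1 - r"] have "rvp g ` {0..1 - s} = rvp h ` {0..1 - r}" using s by (simp add: reversepath_def)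
 thus ?thesis using im by simp
qed

text \<open>Parting data: \<open>s1\<close>, \<open>r1\<close> are the times at which the two arcs
  part, \<open>s2\<close>, \<open>r2\<close> those at which they rejoin.\<close>

definition pd :: "(real => real^3) => (real => real^3) => real => real => real => real => bool" where
 "pd g h s1 s2 r1 r2 \<longleftrightarrow> 0<=s1 & s1 < s2 & s2<=1 & 0<=r1 & r1 < r2 & r2<=1 & g s1 = h r1 & g s2 = h r2 &
   g s1:Zp & g s2:Zm & g ` {0..s1} = h ` {0..r1} & g ` {s2..1} = h ` {r2..1} &
   g ` {s1<..<s2} Int pim h = {} & h ` {r1<..<r2} Int pim g = {}"

lemma pd_sym: "pd g h s1 s2 r1 r2 ==> pd h g r1 r2 s1 s2"
 by (auto simp: pd_def)

text \<open>The extremal description makes the times of parting and rejoining functions of the pair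
  of arcs; \<open>pd_br\<close> identifies them with the parting data.\<close>

definition br1 where "br1 g h = Sup {s\<in>{0..1}. g ` {0..s}<=pim h}"
definition br2 where "br2 g h = Inf {s\<in>{0..1}. g ` {s..1}<=pim h}"
definition mid where "mid g h = subpath (br1 g h) (br2 g h) g"
text \<open>The loop runs forward along \<open>h\<close> and back along \<open>g\<close>. With this
  choice the left side \<open>R g h\<close> becomes the region swept by the wheel from the time of
  \<open>g\<close> to the time of \<open>h\<close>.\<close>

definition Jc where "Jc g h = mid h g +++ rvp (mid g h)"
definition R where "R g h = Lr (Jc g h)"
definition Jim where "Jim g h = pim (mid g h) Un pim (mid h g)"

lemma pd_br: assumes "pd g h s1 s2 r1 r2" shows "br1 g h = s1" "br2 g h = s2"
proof -
 note d = assms[unfolded pd_def]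
 have sub: "h ` {0..r1}<=pim h" "h ` {r2..1}<=pim h" using d by (auto simp: pim_def)
 have "{s\<in>{0..1}. g ` {0..s}<=pim h} = {0..s1}"
 proof (intro equalityI subsetI)
  fix s assume s: "s:{s\<in>{0..1}. g ` {0..s}<=pim h}"
  show "s:{0..s1}"
  proof (rule ccontr)
   assume "s ~: {0..s1}"
   hence ss: "s1 < s" using s by auto
   define x where "x = (s1 + min s s2) / 2"
   have "s1 < x" "x < s2" "x<=s" using ss d by (auto simp: x_def min_def field_simps)
   hence "g x:pim h" "g x:g ` {s1<..<s2}" using s d by auto
   thus False using d by blast
  qed
 next
  fix s assume s: "s:{0..s1}"
  have "g ` {0..s}<=g ` {0..s1}" using s by (intro image_mono) auto
  thus "s:{s\<in>{0..1}. g ` {0..s}<=pim h}" using s d sub by auto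
 qed
 thus "br1 g h = s1" using d by (simp add: br1_def)
 have "{s\<in>{0..1}. g ` {s..1}<=pim h} = {s2..1}"
 proof (intro equalityI subsetI)
  fix s assume s: "s:{s\<in>{0..1}. g ` {s..1}<=pim h}"
  show "s:{s2..1}"
  proof (rule ccontr)
   assume "s ~: {s2..1}"
   hence ss: "s < s2" using s by auto
   define x where "x = (s2 + max s s1) / 2"
   have "s1 < x" "x < s2" "s<=x" using ss d by (auto simp: x_def max_def field_simps)
   hence "g x:pim h" "g x:g ` {s1<..<s2}" using s d by auto
   thus False using d by blast
  qed
 next
  fix s assume s: "s:{s2..1}"
  have "g ` {s..1}<=g ` {s2..1}" using s by (intro image_mono) auto
  thus "s:{s\<in>{0..1}. g ` {s..1}<=pim h}" using s d sub by auto
 qed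
 thus "br2 g h = s2" using d by (simp add: br2_def)
qed

text \<open>The gap of \<open>g\<close> off \<open>h\<close> around \<open>t\<close> begins in
  \<open>Zp\<close> and ends in \<open>Zm\<close>: a common point in \<open>Zm\<close> before
  \<open>t\<close>, one in \<open>Zp\<close> after \<open>t\<close>, or one in neither set would
  force \<open>g t\<close> onto \<open>h\<close> by \<open>suffix\<close> and \<open>prefix\<close>.
  The common initial and final pieces leave no room for a second gap.\<close>

lemma pd_exists_aux:
 assumes g: "g:E" "h:E" and t: "t:{0..1}" "g t ~: pim h"
 shows "EX s1 s2 r1 r2. pd g h s1 s2 r1 r2"
proof -
 define S where "S = {0..1} Int g -` pim h"
 have cg: "continuous_on {0..1} g" using E_facts(1)[OF g(1)] by (simp add: arc_def path_def)
 have "closed S" unfolding S_def by (rule continuous_closed_preimage[OF cg]) (use E_facts(1)[OF g(2)] closed_arc_image in auto)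
 moreover have S01: "0:S" "1:S"
  using E_facts(2,3)[OF g(1)] E_facts(2,3)[OF g(2)] by (auto simp: S_def pim_def intro: rev_image_eqI[of 0] rev_image_eqI[of 1])
 moreover have tS: "t ~: S" using t by (auto simp: S_def)
 moreover have "0 < t" "t < 1" using t S01 tS by (auto simp: less_le)
 ultimately obtain s1 s2 where s: "s1:S" "s2:S" "s1 < t" "t < s2" "!!s. s1 < s ==> s < s2 ==> s ~: S"
  using gap_around[of S 0 1 t] by metis
 have s01: "s1:{0..1}" "s2:{0..1}" using s by (auto simp: S_def)
 obtain r1 r2 where r: "r1:{0..1}" "r2:{0..1}" "g s1 = h r1" "g s2 = h r2" using s(1,2) by (auto simp: S_def pim_def)
 have both: False if "s:{0..1}" "r:{0..1}" "g s = h r" "g s ~: Zp" "g s ~: Zm" for s r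
 proof -
  have "g ` {0..s} = h ` {0..r}" "g ` {s..1} = h ` {r..1}" using prefix[OF g that(1-3,5)] suffix[OF g that(1-4)] by auto
  hence "g t:h ` {0..r} Un h ` {r..1}" using t by (cases "t<=s") auto
  thus False using t that by (auto simp: pim_def)
 qed
 have notZm: "g s1 ~: Zm"
 proof
  assume "g s1:Zm"
  hence "g s1 ~: Zp" using disj by blast
  from suffix[OF g s01(1) r(1,3) this] have "g t:h ` {r1..1}" using s t by force
  thus False using t r by (auto simp: pim_def)
 qed
 hence g1: "g s1:Zp" using both[OF s01(1) r(1,3)] by blast
 have notZp: "g s2 ~: Zp"
 proof
  assume "g s2:Zp"
  hence "g s2 ~: Zm" using disj by blast
  from prefix[OF g s01(2) r(2,4) this] have "g t:h ` {0..r2}" using s t by force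
  thus False using t r by (auto simp: pim_def)
 qed
 hence g2: "g s2:Zm" using both[OF s01(2) r(2,4)] by blast
 have pre: "g ` {0..s1} = h ` {0..r1}" by (rule prefix[OF g s01(1) r(1,3) notZm])
 have suf: "g ` {s2..1} = h ` {r2..1}" by (rule suffix[OF g s01(2) r(2,4) notZp])
 have "r1<=tau h" using E_time_Zp[OF g(2), of r1] r notZm by auto
 moreover have "tau h<=r2" using E_time_Zm[OF g(2), of r2] r notZp by auto
 moreover have "r1 ~= r2" using r g1 g2 disj by auto
 ultimately have r12: "r1 < r2" by simp
 have gs2: "tau g<=s2" using E_time_Zm[OF g(1), of s2] s01 notZp by auto
 have gs1: "s1<=tau g" using E_time_Zp[OF g(1), of s1] s01 notZm by auto
 have no: "h r ~= g s" if r': "r1 < r" "r < r2" and s': "s:{0..1}" for r s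
 proof
  assume eq: "h r = g s"
  have "h r:pim h" using r' r by (auto simp: pim_def)
  hence "s:S" using s' eq by (simp add: S_def)
  then consider "s<=s1" | "s2<=s" using s(5)[of s] by force
  thus False
  proof cases
   case 1
   hence "h r:h ` {0..r1}" using eq s' pre by (metis atLeastAtMost_iff imageI)
   then obtain r' where "r':{0..r1}" "h r = h r'" by auto
   thus False using E_inj[OF g(2), of r r'] r' r by auto
  next
   case 2
   hence "h r:h ` {r2..1}" using eq s' suf by (metis atLeastAtMost_iff imageI)
   then obtain r' where "r':{r2..1}" "h r = h r'" by auto
   thus False using E_inj[OF g(2), of r r'] r' r by auto
  qed
 qed
 have "pd g h s1 s2 r1 r2"
  unfolding pd_def
 proof (intro conjI)
  show "g ` {s1<..<s2} Int pim h = {}"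
  proof -
   have "g x ~: pim h" if "x:{s1<..<s2}" for x using s(5)[of x] that s01 by (auto simp: S_def)
   thus ?thesis by blast
  qed
  show "h ` {r1<..<r2} Int pim g = {}" using no unfolding pim_def by fastforce
 qed (use s s01 r r12 g1 g2 pre suf in auto)
 thus ?thesis by blast
qed

lemma pd_exists:
 assumes g: "g:E" "h:E" "pim g ~= pim h"
 obtains s1 s2 r1 r2 where "pd g h s1 s2 r1 r2"
proof -
 consider t where "t:{0..1}" "g t ~: pim h" | t where "t:{0..1}" "h t ~: pim g"
  using g(3) unfolding pim_def by blast
 thus thesis
 proof cases
  case 1 thus thesis using pd_exists_aux[OF g(1,2)] that by blast
 next
  case 2 thus thesis using pd_exists_aux[OF g(2,1)] that pd_sym by blast
 qed
qed

end

lemma wnum_subpath_split: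
 assumes b: "b:S2" and g: "path g" "pim g<=S2" "b ~: pim g" and z: "z:S2" "z ~: pim g"
  and s: "0<=s1" "s1<=s2" "s2<=1"
 shows "wnum b g z = wnum b (subpath 0 s1 g) z + wnum b (subpath s1 s2 g) z + wnum b (subpath s2 1 g) z"
proof (cases "z = b")
 case False
 have c: "chart b o subpath u v g = subpath u v (chart b o g)" for u v by (simp add: subpath_def o_def)
 note p = path_chart[OF b g]
 have zz: "chart b z ~: pim (chart b o g)" using p(3) z False by blast
 have "winding_number (subpath 0 s1 (chart b o g)) (chart b z) + winding_number (subpath s1 s2 (chart b o g)) (chart b z)
   + winding_number (subpath s2 1 (chart b o g)) (chart b z) = winding_number (subpath 0 1 (chart b o g)) (chart b z)"
  using winding_number_subpath_combine[OF p(1) zz, of 0 s1 s2] winding_number_subpath_combine[OF p(1) zz, of 0 s2 1] s by simp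
 thus ?thesis using False by (simp add: wnum_def c)
qed (simp add: wnum_def)

lemma wnum_subpath_trivial:
 assumes b: "b:S2" and g: "path g" "pim g<=S2" "b ~: pim g" and z: "z:S2" "z ~: pim g" and u: "u:{0..1}"
 shows "wnum b (subpath u u g) z = 0"
proof (cases "z = b")
 case False
 have c: "chart b o subpath u u g = subpath u u (chart b o g)" by (simp add: subpath_def o_def)
 note p = path_chart[OF b g]
 have zz: "chart b z ~: pim (chart b o g)" using p(3) z False by blast
 have "(chart b o g) u ~= chart b z" using zz u unfolding pim_def by (metis imageI)
 thus ?thesis using False by (simp add: wnum_def c winding_number_subpath_trivial)
qed (simp add: wnum_def)

context zip_based
begin

lemma wnum_piece:
 assumes g: "g:E" "h:E" and u: "{u, v, u', v'}<={0..1}" "u ~= v" "u' ~= v'" "g u = h u'" "g v = h v'" "pim (subpath u v g) = pim (subpath u' v' h)"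
  and b: "b:S2" "b ~: pim g" and z: "z:S2" "z ~: pim g"
 shows "wnum b (subpath u v g) z = wnum b (subpath u' v' h) z"
proof (rule wnum_arc_eq[OF b(1)])
 have s: "pim (subpath u v g)<=pim g" using path_image_subpath_subset[of u v g] u(1) by simp
 show "arc (subpath u v g)" "arc (subpath u' v' h)"
  using arc_subpath_arc[OF E_facts(1)[OF g(1)], of u v] arc_subpath_arc[OF E_facts(1)[OF g(2)], of u' v'] u(1-3) by auto
 show "pim (subpath u v g)<=S2" "b ~: pim (subpath u v g)" "z ~: pim (subpath u v g)"
  using s E_facts(4)[OF g(1)] b(2) z(2) by blast+
qed (use u(4-6) z(1) in simp_all)

lemma wnum_ends:
 assumes g: "g:E" "h:E" and s: "s:{0..1}" "r:{0..1}" "g s = h r"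
  and b: "b:S2" "b ~: pim g" "b ~: pim h" and z: "z:S2" "z ~: pim g" "z ~: pim h"
 shows "g ` {0..s} = h ` {0..r} ==> wnum b (subpath 0 s g) z = wnum b (subpath 0 r h) z"
  "g ` {s..1} = h ` {r..1} ==> wnum b (subpath s 1 g) z = wnum b (subpath r 1 h) z"
proof -
 have triv: "wnum b (subpath x x g) z = 0" "wnum b (subpath x x h) z = 0" if "x:{0..1}" for x
  using wnum_subpath_trivial[OF b(1) _ _ b(2) z(1,2) that] wnum_subpath_trivial[OF b(1) _ _ b(3) z(1,3) that] E_facts(1,4) g arc_imp_path by metis+
 have e: "s = x \<longleftrightarrow> r = x" if "x = 0 \<or> x = 1" for x
  using E_inj[OF g(1) s(1), of x] E_inj[OF g(2) s(2), of x] s(3) that E_facts(2,3)[OF g(1)] E_facts(2,3)[OF g(2)] by auto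
 have o: "g 0 = h 0" "g 1 = h 1" using E_facts(2,3) g by auto
 show "wnum b (subpath 0 s g) z = wnum b (subpath 0 r h) z" if "g ` {0..s} = h ` {0..r}"
  using wnum_piece[OF g, of 0 s 0 r b z] triv[of 0] e[of 0] o s that b z by (cases "s = 0") (auto simp: path_image_subpath)
 show "wnum b (subpath s 1 g) z = wnum b (subpath r 1 h) z" if "g ` {s..1} = h ` {r..1}"
  using wnum_piece[OF g, of s 1 r 1 b z] triv[of 1] e[of 1] o s that b z by (cases "s = 1") (auto simp: path_image_subpath)
qed

definition neq where "neq g h \<longleftrightarrow> g:E & h:E & pim g ~= pim h"

lemma neq_sym: "neq g h ==> neq h g" by (auto simp: neq_def)

lemma pd_neq: "neq g h ==> pd g h (br1 g h) (br2 g h) (br1 h g) (br2 h g)"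
 unfolding neq_def by (metis pd_br pd_exists pd_sym)

lemma mid_facts:
 assumes n: "neq g h"
 shows "arc (mid g h)" "pim (mid g h) = g ` {br1 g h..br2 g h}" "pst (mid g h) = g (br1 g h)" "pfn (mid g h) = g (br2 g h)"
  "pim (mid g h)<=pim g" "pim (mid g h) Int pim h = {g (br1 g h), g (br2 g h)}"
  "pim g - pim h<=pim (mid g h)" "X g:pim (mid g h)"
  "br1 g h<=tau g" "tau g<=br2 g h"
proof -
 have E: "g:E" "h:E" using n by (auto simp: neq_def)
 note d = pd_neq[OF n, unfolded pd_def]
 show "arc (mid g h)" unfolding mid_def using d E_facts(1)[OF E(1)] by (auto intro: arc_subpath_arc)
 show im: "pim (mid g h) = g ` {br1 g h..br2 g h}" unfolding mid_def using d by (simp add: path_image_subpath)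
 show "pst (mid g h) = g (br1 g h)" "pfn (mid g h) = g (br2 g h)" by (auto simp: mid_def)
 show sub: "pim (mid g h)<=pim g" unfolding mid_def using d by (intro path_image_subpath_subset) auto
 have split: "{br1 g h..br2 g h} = {br1 g h, br2 g h} Un {br1 g h<..<br2 g h}" using d by auto
 have hin: "g (br1 g h):pim h" "g (br2 g h):pim h" using d by (auto simp: pim_def)
 show "pim (mid g h) Int pim h = {g (br1 g h), g (br2 g h)}"
  unfolding im split using d hin by auto
 show "pim g - pim h<=pim (mid g h)"
 proof
  fix y assume y: "y:pim g - pim h"
  then obtain s where s: "s:{0..1}" "y = g s" by (auto simp: pim_def)
  have "h ` {0..br1 h g}<=pim h" "h ` {br2 h g..1}<=pim h" using d by (auto simp: pim_def)
  moreover have "g ` {0..br1 g h} = h ` {0..br1 h g}" "g ` {br2 g h..1} = h ` {br2 h g..1}" using d by auto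
  ultimately have "s ~: {0..br1 g h}" "s ~: {br2 g h..1}" using y s(2) by (metis DiffD2 imageI subsetD)+
  thus "y:pim (mid g h)" using s im by auto
 qed
 show t1: "br1 g h<=tau g" using E_time_Zp[OF E(1), of "br1 g h"] d disj by force
 show t2: "tau g<=br2 g h" using E_time_Zm[OF E(1), of "br2 g h"] d disj by force
 show "X g:pim (mid g h)" unfolding X_def im using t1 t2 by auto
qed

lemma mid_pair:
 assumes n: "neq g h"
 shows "pst (mid h g) = pst (mid g h)" "pfn (mid h g) = pfn (mid g h)"
  "pst (mid g h):Zp" "pfn (mid g h):Zm"
  "pim (mid g h) Int pim (mid h g) = {pst (mid g h), pfn (mid g h)}"
  "closes (mid h g) (rvp (mid g h))" "loop_in (Jc g h)" "pim (Jc g h) = Jim g h"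
  "Jim g h<=pim g Un pim h" "R h g = Lr (rvp (Jc g h))" "Jim h g = Jim g h"
  "Jim g h<=S2" "X g:Jim g h" "X h:Jim g h"
proof -
 have n': "neq h g" using n by (rule neq_sym)
 have E: "g:E" "h:E" using n by (auto simp: neq_def)
 note d = pd_neq[OF n, unfolded pd_def]
 note f = mid_facts[OF n] and f' = mid_facts[OF n']
 show s: "pst (mid h g) = pst (mid g h)" "pfn (mid h g) = pfn (mid g h)"
  using f f' d by auto
 show "pst (mid g h):Zp" "pfn (mid g h):Zm" using f d by auto
 have "g (br1 g h):pim (mid h g)" "g (br2 g h):pim (mid h g)"
  using f'(2) d by auto
 thus i: "pim (mid g h) Int pim (mid h g) = {pst (mid g h), pfn (mid g h)}"
  using f(3,4,6) f'(5) by auto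
 have S: "pim (mid g h)<=S2" "pim (mid h g)<=S2"
  using f(5) f'(5) E_facts(4)[OF E(1)] E_facts(4)[OF E(2)] by auto
 show c: "closes (mid h g) (rvp (mid g h))"
  unfolding closes_def using f(1) f'(1) s i S by (auto simp: arc_reversepath)
 show "loop_in (Jc g h)" unfolding Jc_def by (rule closes_loop[OF c])
 show "pim (Jc g h) = Jim g h" unfolding Jc_def Jim_def using closes_image[OF c] by auto
 show "Jim g h<=pim g Un pim h" using f(5) f'(5) by (auto simp: Jim_def)
 show "Jim h g = Jim g h" by (auto simp: Jim_def)
 show "Jim g h<=S2" using S by (auto simp: Jim_def)
 show "X g:Jim g h" "X h:Jim g h" using f(8) f'(8) by (auto simp: Jim_def)
 have "rvp (Jc g h) = Jc h g" unfolding Jc_def using s by (simp add: reversepath_joinpaths)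
 thus "R h g = Lr (rvp (Jc g h))" by (simp add: R_def)
qed

text \<open>The common initial and final pieces contribute equally to both arcs and cancel in the
  difference.\<close>

lemma wnum_Jc:
 assumes n: "neq g h" and b: "b:S2" "b ~: pim g" "b ~: pim h" and z: "z:S2" "z ~: pim g" "z ~: pim h"
 shows "wnum b (Jc g h) z = wnum b h z - wnum b g z"
proof -
 have n': "neq h g" using n by (rule neq_sym)
 have E: "g:E" "h:E" using n by (auto simp: neq_def)
 note d = pd_neq[OF n, unfolded pd_def]
 note f = mid_facts[OF n] and f' = mid_facts[OF n'] and m = mid_pair[OF n]
 have pg: "path g" "pim g<=S2" and ph: "path h" "pim h<=S2"
  using E_facts(1,4)[OF E(1)] E_facts(1,4)[OF E(2)] arc_imp_path by auto
 have nm: "b ~: pim (mid g h)" "z ~: pim (mid g h)" "b ~: pim (mid h g)" "z ~: pim (mid h g)"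
  using f(5) f'(5) b z by auto
 have "wnum b (Jc g h) z = wnum b (mid h g) z + wnum b (rvp (mid g h)) z"
  unfolding Jc_def by (rule wnum_closes[OF m(6)]) (use b z nm in auto)
 also have "wnum b (rvp (mid g h)) z = - wnum b (mid g h) z"
  by (rule wnum_reversepath) (use b z nm f(1,5) pg arc_imp_path in auto)
 finally have J: "wnum b (Jc g h) z = wnum b (mid h g) z - wnum b (mid g h) z" by simp
 have sg: "wnum b g z = wnum b (subpath 0 (br1 g h) g) z + wnum b (mid g h) z + wnum b (subpath (br2 g h) 1 g) z"
  unfolding mid_def by (rule wnum_subpath_split[OF b(1) pg b(2) z(1,2)]) (use d in auto)
 have sh: "wnum b h z = wnum b (subpath 0 (br1 h g) h) z + wnum b (mid h g) z + wnum b (subpath (br2 h g) 1 h) z"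
  unfolding mid_def by (rule wnum_subpath_split[OF b(1) ph b(3) z(1,3)]) (use d in auto)
 have "wnum b (subpath 0 (br1 g h) g) z = wnum b (subpath 0 (br1 h g) h) z"
  by (rule wnum_ends(1)[OF E _ _ _ b z]) (use d in auto)
 moreover have "wnum b (subpath (br2 g h) 1 g) z = wnum b (subpath (br2 h g) 1 h) z"
  by (rule wnum_ends(2)[OF E _ _ _ b z]) (use d in auto)
 ultimately show ?thesis using J sg sh by simp
qed

lemma R_facts:
 assumes n: "neq g h"
 shows "R g h ~= {}" "R g h Int R h g = {}" "R g h Un R h g = S2 - Jim g h" "connected (R g h)" "closure (R g h) = R g h Un Jim g h"
  "compact (closure (R g h))" "closed_disk (closure (R g h))" "R g h = S2 - closure (R h g)" "R g h<=S2" "closure (R g h)<=S2"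
proof -
 note m = mid_pair[OF n]
 note s = loop_sides[OF m(7), folded R_def m(10), unfolded m(8)] and t = Lr_topology[OF m(7), folded R_def, unfolded m(8)]
 note t' = Lr_topology[OF loop_in_reversepath[OF m(7)], folded m(10), unfolded path_image_reversepath m(8)]
 show "R g h ~= {}" "R g h Int R h g = {}" "R g h Un R h g = S2 - Jim g h" using s by auto
 show "connected (R g h)" "closure (R g h) = R g h Un Jim g h" "compact (closure (R g h))" "closed_disk (closure (R g h))" using t by auto
 show "R g h = S2 - closure (R h g)" using s t' by auto
 show S: "R g h<=S2" using s by auto
 thus "closure (R g h)<=S2" using t m(12) by auto
qed

text \<open>\<open>R g h\<close> is relatively open, being the complement in the sphere of the
  opposite closed cell. The alternative \<open>~ Y<=S2\<close> appears because neighbourhoods are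
  taken in space.\<close>

lemma R_open_meets:
 assumes n: "neq g h" and x: "x:R g h" and y: "x:closure Y" shows "R g h Int Y ~= {} \<or> ~ Y<=S2"
proof -
 have "x:- closure (R h g)" using x R_facts(8)[OF n] by blast
 hence "Y Int - closure (R h g) ~= {}"
  using y open_Int_closure_eq_empty[of "- closure (R h g)" Y] by (auto simp: open_Compl)
 thus ?thesis using R_facts(8)[OF n] by blast
qed

lemma R_offcurves:
 assumes n: "neq g h" and V: "open V" "V Int R g h ~= {}" and F: "finite F" "F<=E"
 obtains z where "z:V" "z:R g h" "!!k. k:F ==> z ~: pim k"
proof -
 have "open (V - closure (R h g))" using V by auto
 moreover have "(V - closure (R h g)) Int S2 ~= {}" using V R_facts(8,9)[OF n] by blast
 ultimately obtain z where "z:V - closure (R h g)" "z:S2" "!!k. k:F ==> z ~: pim k"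
  using S2_avoid_arcs[OF F(1), of "V - closure (R h g)"] F(2) E_facts(1) by blast
 thus thesis using that R_facts(8)[OF n] by blast
qed

lemma R_off:
 assumes n: "neq g h" and F: "finite F" "F<=E"
 shows "EX z:R g h. z:S2 & (ALL k:F. z ~: pim k)"
proof -
 have "UNIV Int R g h ~= {}" using R_facts(1)[OF n] by blast
 then obtain z where "z:R g h" "!!k. k:F ==> z ~: pim k" using R_offcurves[OF n open_UNIV _ F] by metis
 thus ?thesis using R_facts(9)[OF n] by blast
qed

text \<open>In the cyclic order \<open>a\<close>, \<open>b\<close>, \<open>c\<close> the three
  regions tile the sphere up to the arcs; in the opposite order they cover generic points
  twice.\<close>

definition cyc where
 "cyc a b c \<longleftrightarrow> neq a b & neq b c & neq c a &
   (ALL z:S2. z ~: pim a Un pim b Un pim c -->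
    of_bool (z:R a b) + of_bool (z:R b c) + of_bool (z:R c a) = (1::nat))"

lemma cyc_rotate: "cyc a b c ==> cyc b c a"
 unfolding cyc_def by (auto simp: add.commute add.left_commute)

text \<open>The three differences of winding numbers add up to 0, and each is a constant plus the
  indicator of its region, so the number \<open>S z\<close> of regions containing a generic point is
  constant. A point of \<open>R a b\<close> shows that it is at least 1, a point of
  \<open>R b a\<close> that it is at most 2; passing to the opposite regions turns 2 into 1.\<close>

lemma cyc_cases:
 assumes n: "neq a b" "neq b c" "neq c a"
 shows "cyc a b c \<or> cyc a c b"
proof -
 have E: "a:E" "b:E" "c:E" using n by (auto simp: neq_def)
 have "UNIV Int S2 ~= {}" using op sub by blast
 then obtain bt where bt: "bt:S2" "bt ~: pim a" "bt ~: pim b" "bt ~: pim c"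
  using S2_avoid_arcs[of "{a,b,c}" UNIV] E_facts(1) E by (metis finite.emptyI finite.insertI insert_iff open_UNIV singletonD)
 have val: "EX M. ALL z:S2. z ~: pim g --> z ~: pim h --> wnum bt h z - wnum bt g z = M + of_nat (of_bool (z:R g h))"
  if n: "neq g h" and b: "bt ~: pim g" "bt ~: pim h" for g h
 proof -
  have bJ: "bt ~: pim (Jc g h)" using mid_pair(8,9)[OF n] b by auto
  obtain M where M: "!!z. z:R g h ==> wnum bt (Jc g h) z = M" "!!z. z:R h g ==> wnum bt (Jc g h) z = M - 1"
   using wnum_Lr[OF mid_pair(7)[OF n] bt(1) bJ] mid_pair(10)[OF n] unfolding R_def by metis
  have "wnum bt h z - wnum bt g z = (M - 1) + of_nat (of_bool (z:R g h))" if z: "z:S2" "z ~: pim g" "z ~: pim h" for z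
  proof -
   have "z:R g h \<or> z:R h g" using R_facts(3)[OF n] mid_pair(9)[OF n] z by blast
   moreover have "~ (z:R g h & z:R h g)" using R_facts(2)[OF n] by blast
   ultimately show ?thesis using M wnum_Jc[OF n bt(1) b z] by auto
  qed
  thus ?thesis by blast
 qed
 obtain M1 where M1: "!!z. z:S2 ==> z ~: pim a ==> z ~: pim b ==> wnum bt b z - wnum bt a z = M1 + of_nat (of_bool (z:R a b))"
  using val[OF n(1) bt(2,3)] by blast
 obtain M2 where M2: "!!z. z:S2 ==> z ~: pim b ==> z ~: pim c ==> wnum bt c z - wnum bt b z = M2 + of_nat (of_bool (z:R b c))"
  using val[OF n(2) bt(3,4)] by blast
 obtain M3 where M3: "!!z. z:S2 ==> z ~: pim c ==> z ~: pim a ==> wnum bt a z - wnum bt c z = M3 + of_nat (of_bool (z:R c a))"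
  using val[OF n(3) bt(4,2)] by blast
 define S where "S z = (of_bool (z:R a b) + of_bool (z:R b c) + of_bool (z:R c a) :: nat)" for z
 define off where "off z \<longleftrightarrow> z:S2 & z ~: pim a Un pim b Un pim c" for z
 have const: "(of_nat (S z) :: complex) = - (M1 + M2 + M3)" if "off z" for z
 proof -
  have e1: "wnum bt b z - wnum bt a z = M1 + of_nat (of_bool (z:R a b))" using M1 that by (auto simp: off_def)
  have e2: "wnum bt c z - wnum bt b z = M2 + of_nat (of_bool (z:R b c))" using M2 that by (auto simp: off_def)
  have e3: "wnum bt a z - wnum bt c z = M3 + of_nat (of_bool (z:R c a))" using M3 that by (auto simp: off_def)
  have "(M1 + of_nat (of_bool (z:R a b))) + (M2 + of_nat (of_bool (z:R b c))) + (M3 + of_nat (of_bool (z:R c a))) = 0"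
   unfolding e1[symmetric] e2[symmetric] e3[symmetric] by simp
  hence "of_nat (S z) + (M1 + M2 + M3) = 0" unfolding S_def of_nat_add by (simp only: ac_simps)
  thus ?thesis by (simp only: eq_neg_iff_add_eq_0)
 qed
 obtain z1 where z1: "off z1" "z1:R a b"
  using R_off[OF n(1), of "{a,b,c}"] E unfolding off_def by auto
 obtain z2 where z2: "off z2" "z2:R b a"
  using R_off[OF neq_sym[OF n(1)], of "{a,b,c}"] E unfolding off_def by auto
 have same: "S z = S z1" if "off z" for z using const[OF that] const[OF z1(1)] by (metis of_nat_eq_iff)
 have "S z1 >= 1" using z1 by (simp add: S_def)
 moreover have "S z2<=2" using z2 R_facts(2)[OF n(1)] by (auto simp: S_def)
 ultimately have "S z1 = 1 \<or> S z1 = 2" using same[OF z2(1)] by linarith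
 thus ?thesis
 proof
  assume "S z1 = 1"
  hence "cyc a b c" unfolding cyc_def using n same unfolding S_def off_def by auto
  thus ?thesis by blast
 next
  assume two: "S z1 = 2"
  have flip: "of_bool (z:R h g) = (1::nat) - of_bool (z:R g h)" if "neq g h" "z:S2" "z ~: pim g" "z ~: pim h" for g h z
   using R_facts(2,3)[OF that(1)] mid_pair(9)[OF that(1)] that by auto
  have "of_bool (z:R a c) + of_bool (z:R c b) + of_bool (z:R b a) = (1::nat)" if "off z" for z
   using flip[OF n(1), of z] flip[OF n(2), of z] flip[OF n(3), of z] same[OF that] two that unfolding S_def off_def
   by (auto split: if_splits simp: of_bool_def)
  hence "cyc a c b" unfolding cyc_def off_def using n neq_sym by auto
  thus ?thesis by blast
 qed
qed

lemma cyc_disjoint: assumes "cyc a b c" shows "R a b Int R b c = {}"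
proof (rule ccontr)
 assume "R a b Int R b c ~= {}"
 then obtain x where x: "x:R a b" "x:R b c" by blast
 have n: "neq a b" "neq b c" "neq c a" using assms by (auto simp: cyc_def)
 have "open (- closure (R c b))" "- closure (R c b) Int R a b ~= {}" using x R_facts(8)[OF n(2)] by auto
 then obtain z where z: "z:- closure (R c b)" "z:R a b" "!!k. k:{a,b,c} ==> z ~: pim k"
  using R_offcurves[OF n(1), of "- closure (R c b)" "{a,b,c}"] n unfolding neq_def by blast
 have "z:R b c" "z:S2" using z R_facts(8)[OF n(2)] R_facts(9)[OF n(1)] by auto
 thus False using assms z unfolding cyc_def by auto
qed

lemma cyc_not: "cyc a b c ==> ~ cyc a c b"
proof
 assume c: "cyc a b c" "cyc a c b"
 have n: "neq a b" "neq b c" "neq c a" using c by (auto simp: cyc_def)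
 obtain z where z: "z:R a b" "!!k. k:{a,b,c} ==> z ~: pim k"
  using R_off[OF n(1), of "{a,b,c}"] n unfolding neq_def by auto
 have zS: "z:S2" using z R_facts(9)[OF n(1)] by auto
 have "z ~: R b c" "z ~: R c a" using c(1) z zS unfolding cyc_def by auto
 hence "z:R c b" "z:R a c"
  using R_facts(3)[OF n(2)] R_facts(3)[OF n(3)] mid_pair(9)[OF n(2)] mid_pair(9)[OF n(3)] z zS by blast+
 thus False using c(2) z zS unfolding cyc_def by auto
qed

lemma cyc_sub: assumes "cyc a b c" shows "R a b<=R a c" "R b c<=R a c"
proof -
 have n: "neq a c" using assms neq_sym by (auto simp: cyc_def)
 have "R c a Int R a b = {}" "R b c Int R c a = {}" using cyc_disjoint cyc_rotate assms by blast+
 moreover have "Y<=R a c" if Y: "Y = R g h" "neq g h" "Y Int R c a = {}" for Y g h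
 proof
  fix x assume x: "x:Y"
  show "x:R a c"
  proof (rule ccontr)
   assume "x ~: R a c"
   moreover have "x:S2" using x Y R_facts(9) by blast
   ultimately have "x:closure (R c a)" using R_facts(8)[OF n] by blast
   thus False using R_open_meets[OF Y(2), of x "R c a"] x Y R_facts(9)[OF neq_sym[OF n]] by blast
  qed
 qed
 ultimately show "R a b<=R a c" "R b c<=R a c" using assms unfolding cyc_def by (metis Int_commute)+
qed

end

lemma wnum_invariant_Lr:
 assumes J: "loop_in J" "loop_in J'" "pim J' = pim J"
  and w: "!!b x. b:S2 ==> x:S2 ==> b ~: pim J ==> x ~: pim J ==> wnum b J x = wnum b J' x"
 shows "Lr J = Lr J'"
 by (rule Lr_cong) (use J w in \<open>auto simp: loop_in_def simple_path_imp_path\<close>)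

lemma split_loop:
 assumes g: "loop_in g" and uv: "0<=u" "u < v" "v<=1" "~ (u = 0 & v = 1)"
 obtains bt where "closes (subpath u v g) bt" "Lr (subpath u v g +++ bt) = Lr g" "pim bt = g ` ({0..u} Un {v..1})"
  "pim (subpath u v g) = g ` {u..v}" "pim g = g ` {u..v} Un pim bt"
proof -
 have s: "simple_path g" "pfn g = pst g" "pim g<=S2" "path g" using g simple_path_imp_path by (auto simp: loop_in_def)
 have g01: "g 1 = g 0" using s(2) by (simp add: pst_def pfn_def)
 have inj: "x = y \<or> (x = 0 & y = 1) \<or> (x = 1 & y = 0)" if "x:{0..1}" "y:{0..1}" "g x = g y" for x y
  using s(1) that by (auto simp: simple_path_def loop_free_def)
 have arcs: "arc (subpath x y g)" if "x:{0..1}" "y:{0..1}" "x ~= y" "{x, y} ~= {0, 1}" for x y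
  using arc_simple_path_subpath[OF s(1) that(1,2)] inj[OF that(1,2)] that by (metis insert_commute)
 have im: "pim (subpath x y g) = g ` {x..y}" if "x<=y" for x y using that by (simp add: path_image_subpath)
 \<comment> \<open>The complementary arc runs through the base point of the loop; the cases
   \<open>u = 0\<close> and \<open>v = 1\<close> keep out a constant piece, which would spoil
   injectivity.\<close>
 define bt where "bt = (if u = 0 then subpath v 1 g else if v = 1 then subpath 0 u g else subpath v 1 g +++ subpath 0 u g)"
 have jn: "pfn (subpath v 1 g) = pst (subpath 0 u g)" using g01 by simp
 have imb: "pim bt = g ` ({0..u} Un {v..1})"
 proof -
  have "pim (subpath v 1 g +++ subpath 0 u g) = g ` ({0..u} Un {v..1})" using im[of 0 u] im[of v 1] uv jn by (auto simp: path_image_join)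
  moreover have "g ` {0}<=g ` {v..1}" if "v<=1" using g01 that by (metis atLeastAtMost_iff empty_subsetI image_insert image_is_empty imageI insert_subset order_refl)
  moreover have "g ` {1}<=g ` {0..u}" using g01 uv by (metis atLeastAtMost_iff empty_subsetI image_insert image_is_empty imageI insert_subset order_refl)
  ultimately show ?thesis using im[of 0 u] im[of v 1] uv unfolding bt_def by (auto simp: image_Un)
 qed
 have dis: "g ` {0..u} Int g ` {v..1}<={g 0}"
 proof
  fix w assume "w:g ` {0..u} Int g ` {v..1}"
  then obtain x y where "x:{0..u}" "y:{v..1}" "w = g x" "g x = g y" by auto
  thus "w:{g 0}" using inj[of x y] uv by auto
 qed
 have a1: "arc (subpath v 1 g)" if "v ~= 1" using arcs[of v 1] uv that by (simp add: doubleton_eq_iff)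
 have a2: "arc (subpath 0 u g)" if "u ~= 0" using arcs[of 0 u] uv that by (simp add: doubleton_eq_iff)
 have arcb: "arc bt"
 proof -
  have "arc (subpath v 1 g +++ subpath 0 u g)" if "u ~= 0" "v ~= 1"

  proof (rule arc_join)
   show "pim (subpath v 1 g) Int pim (subpath 0 u g)<={pst (subpath 0 u g)}" using dis im[of 0 u] im[of v 1] uv by auto
  qed (use a1 a2 that jn in auto)
  thus ?thesis using a1 a2 uv unfolding bt_def by (cases "u = 0"; cases "v = 1") auto
 qed
 have ends: "pst bt = g v" "pfn bt = g u" using g01 unfolding bt_def by auto
 have img: "pim g = g ` {u..v} Un pim bt"
 proof -
  have "{0..1} = {u..v} Un ({0..u} Un {v..1})" using uv by auto
  thus ?thesis unfolding imb by (simp only: pim_def image_Un)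
 qed
 have cl: "closes (subpath u v g) bt" unfolding closes_def
 proof (intro conjI)
  show "arc (subpath u v g)" using arcs[of u v] uv by force
  show "pim bt Int pim (subpath u v g) = {pst (subpath u v g), pfn (subpath u v g)}"
  proof
   show "pim bt Int pim (subpath u v g)<={pst (subpath u v g), pfn (subpath u v g)}"
   proof
    fix w assume "w:pim bt Int pim (subpath u v g)"
    then obtain x y where "x:{0..u} Un {v..1}" "y:{u..v}" "w = g x" "g x = g y" using imb im[of u v] uv by force
    thus "w:{pst (subpath u v g), pfn (subpath u v g)}" using inj[of x y] uv by auto
   qed
   show "{pst (subpath u v g), pfn (subpath u v g)}<=pim bt Int pim (subpath u v g)"
    using imb im[of u v] uv by auto
  qed
 qed (use arcb ends img s(3) im[of u v] uv in auto)
 have "Lr (subpath u v g +++ bt) = Lr g"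
 proof (rule wnum_invariant_Lr[OF closes_loop[OF cl] g])
  show imJ: "pim g = pim (subpath u v g +++ bt)" using closes_image[OF cl] img im[of u v] uv by simp
  fix b x assume "b:S2" "x:S2" "b ~: pim (subpath u v g +++ bt)" "x ~: pim (subpath u v g +++ bt)"
  hence b: "b:S2" "x:S2" "b ~: pim g" "x ~: pim g" using imJ by auto
  have pc: "pim (subpath p q g)<=pim g" if "p:{0..1}" "q:{0..1}" for p q using path_image_subpath_subset[OF that] .
  have "wnum b bt x = wnum b (subpath v 1 g) x + wnum b (subpath 0 u g) x"
  proof -
   have t: "wnum b (subpath q q g) x = 0" if "q:{0..1}" for q using wnum_subpath_trivial[OF b(1) s(4,3) b(3,2,4) that] .
   have "wnum b (subpath v 1 g +++ subpath 0 u g) x = wnum b (subpath v 1 g) x + wnum b (subpath 0 u g) x"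
    by (rule wnum_join) (use b s uv pc[of v 1] pc[of 0 u] jn in \<open>auto simp: path_subpath\<close>)
   thus ?thesis using t[of 0] t[of 1] unfolding bt_def by auto
  qed
  moreover have "wnum b g x = wnum b (subpath 0 u g) x + wnum b (subpath u v g) x + wnum b (subpath v 1 g) x"
   by (rule wnum_subpath_split[OF b(1) s(4,3) b(3,2,4)]) (use uv in auto)
  moreover have "wnum b (subpath u v g +++ bt) x = wnum b (subpath u v g) x + wnum b bt x"
   by (rule wnum_closes[OF cl b(1,2)]) (use b img im[of u v] uv in auto)
  ultimately show "wnum b (subpath u v g +++ bt) x = wnum b g x" by simp
 qed
 thus thesis using that[OF cl] imb img im[of u v] uv by simp
qed

context zip_based begin

text \<open>The loop starts at the parting point, which is in \<open>Zp\<close>. From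
  \<open>X c\<close> over this point to \<open>X d\<close> it only meets points at or before the
  transition times, and it keeps \<open>R c d\<close> on its left.\<close>

lemma arc_Zp:
 assumes n: "neq c d" and X: "X c:Zp" "X d:Zp" "X c ~= X d"
 obtains Q S where "closes Q S" "Lr (Q +++ S) = R c d" "pim Q<=Zp" "pst Q = X c" "pfn Q = X d" "pim Q Un pim S = Jim c d"
proof -
 define g where "g = Jc c d"
 note nd = neq_sym[OF n]
 have E: "c:E" "d:E" using n by (auto simp: neq_def)
 note p = pd_neq[OF n, unfolded pd_def] and fc = mid_facts[OF n] and fd = mid_facts[OF nd]
 have lg: "loop_in g" "pim g = Jim c d" "Lr g = R c d" using mid_pair(7,8)[OF n] by (auto simp: g_def R_def)
 have bc: "br1 c d < br2 c d" "br1 d c < br2 d c" "0<=br1 c d" "0<=br1 d c" "c (br1 c d) = d (br1 d c)" using p by auto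
 \<comment> \<open>The transition times on the two middle pieces, rescaled to the unit interval; the
   join of the two halves, the second reversed, puts them at \<open>mb / 2\<close> and
   \<open>1 - nf / 2\<close>.\<close>
 define mb where "mb = (tau d - br1 d c) / (br2 d c - br1 d c)"
 define nf where "nf = (tau c - br1 c d) / (br2 c d - br1 c d)"
 have mn: "mb:{0..1}" "nf:{0..1}" using fc(9,10) fd(9,10) bc by (auto simp: mb_def nf_def field_simps)
 have me: "(br2 d c - br1 d c) * mb + br1 d c = tau d" "(br2 c d - br1 c d) * nf + br1 c d = tau c" using bc by (auto simp: mb_def nf_def)
 define u v where "u = mb / 2" and "v = 1 - nf / 2"
 have gl: "g x = d ((br2 d c - br1 d c) * (2 * x) + br1 d c)" if "x<=1 / 2" for x
  using that by (simp add: g_def Jc_def joinpaths_def mid_def subpath_def)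
 have mids: "pfn (mid d c) = pst (rvp (mid c d))" using mid_pair(2)[OF n] by simp
 have gr: "g x = c ((br2 c d - br1 c d) * (2 - 2 * x) + br1 c d)" if "x >= 1 / 2" for x
 proof (cases "x = 1 / 2")
  case True
  hence "g x = mid d c 1" unfolding g_def Jc_def joinpaths_def by (simp add: field_simps)
  also have "\<dots> = mid c d 1" using mid_pair(2)[OF n] by (simp add: pfn_def)
  also have "\<dots> = c (br2 c d)" by (simp add: mid_def subpath_def)
  also have "br2 c d = (br2 c d - br1 c d) * (2 - 2 * x) + br1 c d" using True by (simp add: field_simps)
  finally show ?thesis .
 next
  case False
  hence "~ x<=1 / 2" using that by simp
  thus ?thesis by (simp add: g_def Jc_def joinpaths_def reversepath_def mid_def subpath_def)
 qed
 have gu: "g u = X d" and gv: "g v = X c" using gl[of u] gr[of v] mn me by (auto simp: u_def v_def X_def)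
 have uv: "0<=u" "u < v" "v<=1" "~ (u = 0 & v = 1)"
 proof -
  show "0<=u" "v<=1" using mn by (auto simp: u_def v_def)
  have "u<=1 / 2" "1 / 2<=v" using mn by (auto simp: u_def v_def)
  moreover have "u ~= v" using gu gv X by auto
  ultimately show "u < v" by simp
  have "g 0 = g 1" using lg(1) by (simp add: loop_in_def pst_def pfn_def)
  thus "~ (u = 0 & v = 1)" using gu gv X by auto
 qed
 obtain bt where bt: "closes (subpath u v g) bt" "Lr (subpath u v g +++ bt) = Lr g" "pim bt = g ` ({0..u} Un {v..1})"
  "pim (subpath u v g) = g ` {u..v}" "pim g = g ` {u..v} Un pim bt" using split_loop[OF lg(1) uv] by metis
 have inZp: "k s:Zp" if "k:E" "0<=s" "s<=tau k" "X k:Zp" for k s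
  using E_facts(7)[OF that(1,2)] that by (cases "s = tau k") (auto simp: X_def)
 have "g x:Zp" if x: "x:{0..u} Un {v..1}" for x
 proof (cases "x<=u")
  case True
  have "x<=1 / 2" using True mn by (auto simp: u_def)
  moreover have "0<=x" using x uv by auto
  moreover have "(br2 d c - br1 d c) * (2 * x)<=(br2 d c - br1 d c) * mb" using True bc by (intro mult_left_mono) (auto simp: u_def)
  moreover have "0<=(br2 d c - br1 d c) * (2 * x)" using bc \<open>0<=x\<close> by simp
  ultimately show ?thesis unfolding gl[OF \<open>x<=1 / 2\<close>] using me(1) bc(4) by (intro inZp[OF E(2) _ _ X(2)]) linarith+
 next
  case False
  hence xv: "v<=x" "x<=1" using x by auto
  hence h: "1 / 2<=x" using mn by (auto simp: v_def)
  have "(br2 c d - br1 c d) * (2 - 2 * x)<=(br2 c d - br1 c d) * nf" using xv bc by (intro mult_left_mono) (auto simp: v_def)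
  moreover have "0<=(br2 c d - br1 c d) * (2 - 2 * x)" using bc xv by simp
  ultimately show ?thesis unfolding gr[OF h] using me(2) bc(3) by (intro inZp[OF E(1) _ _ X(1)]) linarith+
 qed
 hence "pim bt<=Zp" unfolding bt(3) by blast
 moreover have "pst bt = X c" "pfn bt = X d" using bt(1) gu gv by (auto simp: closes_def)
 moreover have "Lr (bt +++ subpath u v g) = R c d" using Lr_closes_sym[OF bt(1)] bt(2) lg(3) by simp
 ultimately show thesis using that[OF closes_sym[OF bt(1)]] bt(4,5) lg(2) by auto
qed

end

lemma directed_Inter:
 fixes F :: "'a::euclidean_space set set"
 assumes ne: "F ~= {}" and comp: "!!X. X:F ==> compact X & connected X & X ~= {}"
  and dir: "!!X Y. X:F ==> Y:F ==> EX Z:F. Z<=X Int Y"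
 shows "compact (\<Inter>F)" "connected (\<Inter>F)" "\<Inter>F ~= {}" "!!U. open U ==> \<Inter>F<=U ==> EX X:F. X<=U"
proof -
 have fin: "EX Z:F. Z <= \<Inter>G" if "finite G" "G<=F" "G ~= {}" for G
  using that(1,3,2)
 proof (induction G rule: finite_ne_induct)
  case (singleton X) thus ?case by auto
 next
  case (insert X G)
  then obtain Z where Z: "Z:F" "Z <= \<Inter>G" by auto
  then obtain W where "W:F" "W<=X Int Z" using dir[of X Z] insert.prems by auto
  thus ?case using Z(2) by blast
 qed
 obtain X0 where X0: "X0:F" using ne by blast
 show c: "compact (\<Inter>F)" by (rule compact_Inter) (use comp ne in auto)
 show U: "EX X:F. X<=U" if U: "open U" "\<Inter>F<=U" for U
 proof (rule ccontr)
  assume no: "~ ?thesis"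
  have "(X0 - U) Int (\<Inter>F) ~= {}"
  proof (rule compact_imp_fip)
   show "compact (X0 - U)" using comp[OF X0] U(1) by (simp add: compact_diff)
   show "closed T" if "T:F" for T using comp[OF that] compact_imp_closed by blast
   fix G assume G: "finite G" "G<=F"
   obtain Z where Z: "Z:F" "Z <= \<Inter>(insert X0 G)" using fin[of "insert X0 G"] G X0 by auto
   hence "~ Z<=U" using no by blast
   thus "(X0 - U) Int \<Inter>G ~= {}" using Z by blast
  qed
  thus False using U(2) by blast
 qed
 show "\<Inter>F ~= {}" using U[of "{}"] comp by auto
 show "connected (\<Inter>F)"
 proof (rule ccontr)
  assume "~ connected (\<Inter>F)"
  then obtain A B where AB: "closed A" "closed B" "\<Inter>F<=A Un B" "A Int B Int \<Inter>F = {}" "A Int \<Inter>F ~= {}" "B Int \<Inter>F ~= {}"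
   unfolding connected_closed by blast
  define P Q where "P = A Int \<Inter>F" and "Q = B Int \<Inter>F"
  have "compact P" "compact Q" "P Int Q = {}" using AB c by (auto simp: P_def Q_def intro: closed_Int_compact)
  then obtain U V where UV: "open U" "open V" "P<=U" "Q<=V" "U Int V = {}"
   using separation_normal_compact[of P Q] compact_imp_closed by metis
  have "\<Inter>F<=U Un V" using UV AB by (auto simp: P_def Q_def)
  then obtain X where X: "X:F" "X<=U Un V" using U[of "U Un V"] UV by auto
  have "U Int X ~= {}" "V Int X ~= {}" using X UV AB by (auto simp: P_def Q_def)
  thus False using connectedD[of X U V] comp[OF X(1)] UV X by auto
 qed
qed

lemma connected_S2: "connected S2" and compact_S2: "compact S2" and S2_nonempty: "S2 ~= {}"
 unfolding S2_def by (auto intro!: connected_sphere)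

section \<open>Every point is a transition point; one representative for each arc\<close>

locale zip_land = zip_based +
 assumes land_p: "!!y. y:S2 ==> EX v. arc v & pim v<=S2 & v 1 = y & v ` {0..<1}<=Zp"
  and land_m: "!!y. y:S2 ==> EX v. arc v & pim v<=S2 & v 1 = y & v ` {0..<1}<=Zm"
begin

text \<open>An arc is not constant, so the base point itself needs the separate case with the
  trivial image \<open>{op}\<close>.\<close>

definition reachp where "reachp y U \<longleftrightarrow> (y = op & U = {op}) \<or> (EX u. arc u & pst u = op & pfn u = y & pim u = U & U<=insert y Zp)"
definition reachm where "reachm y U \<longleftrightarrow> (y = om & U = {om}) \<or> (EX u. arc u & pst u = y & pfn u = om & pim u = U & U<=insert y Zm)"

text \<open>The two pieces can be chosen independently: as \<open>Zp\<close> and \<open>Zm\<close>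
  are disjoint, they meet only in \<open>y\<close>.\<close>

lemma reach_E:
 assumes p: "reachp y U" and m: "reachm y V" and y: "y:S2"
 obtains g where "g:E" "X g = y" "pim g = U Un V" "g ` {0..tau g} = U" "g ` {tau g..1} = V"
proof -
 note concl = that
 have US: "U<=S2" "V<=S2" using p m y sub op om by (auto simp: reachp_def reachm_def)
 have opm: "op ~= om" using op om disj by blast
 have main: thesis if g: "elt g t" "g t = y" "pim g = U Un V" "g ` {0..t} = U" "g ` {t..1} = V" for g t
 proof -
  have "g:E" "tau g = t" using g tau_eq by (auto simp: E_def)
  thus thesis using concl[of g] g by (auto simp: X_def)
 qed
 consider (1) "y = op" | (2) "y = om" | (3) "y ~= op" "y ~= om" by blast
 thus thesis
 proof cases
  case 1
  hence "~ (EX u. arc u & pst u = op & pfn u = y & pim u = U & U<=insert y Zp)"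
   using arc_distinct_ends by metis
  hence U: "U = {op}" using p by (auto simp: reachp_def)
  obtain v where v: "arc v" "pst v = y" "pfn v = om" "pim v = V" "V<=insert y Zm"
   using m 1 opm by (auto simp: reachm_def)
  have inj: "inj_on v {0..1}" using v by (simp add: arc_def)
  have "v s ~= y" if "s:{0<..1}" for s using inj_onD[OF inj, of s 0] v that by (auto simp: pst_def)
  hence "v s:Zm" if "s:{0<..1}" for s
   using v(4,5) imageI[of s "{0..1}" v] that by (auto simp: pim_def)
  hence "v ` {0<..1}<=Zm" by blast
  thus thesis using main[of v 0] v 1 U US by (auto simp: elt_def pst_def pfn_def pim_def)
 next
  case 2
  hence "~ (EX u. arc u & pst u = y & pfn u = om & pim u = V & V<=insert y Zm)"
   using arc_distinct_ends by metis
  hence V: "V = {om}" using m by (auto simp: reachm_def)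
  obtain v where v: "arc v" "pst v = op" "pfn v = y" "pim v = U" "U<=insert y Zp"
   using p 2 opm by (auto simp: reachp_def)
  have inj: "inj_on v {0..1}" using v by (simp add: arc_def)
  have "v s ~= y" if "s:{0..<1}" for s using inj_onD[OF inj, of s 1] v that by (auto simp: pfn_def)
  hence "v s:Zp" if "s:{0..<1}" for s
   using v(4,5) imageI[of s "{0..1}" v] that by (auto simp: pim_def)
  hence "v ` {0..<1}<=Zp" by blast
  thus thesis using main[of v 1] v 2 V US by (auto simp: elt_def pst_def pfn_def pim_def)
 next
  case 3
  obtain u where u: "arc u" "pst u = op" "pfn u = y" "pim u = U" "U<=insert y Zp" using p 3 by (auto simp: reachp_def)
  obtain v where v: "arc v" "pst v = y" "pfn v = om" "pim v = V" "V<=insert y Zm" using m 3 by (auto simp: reachm_def)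
  have UV: "U Int V<={y}" using u(5) v(5) disj by blast
  define g where "g = u +++ v"
  have ag: "arc g" unfolding g_def by (rule arc_join) (use u v UV in auto)
  have injg: "inj_on g {0..1}" using ag by (simp add: arc_def)
  have gy: "g (1/2) = y" using u by (simp add: g_def joinpaths_def pfn_def)
  have g0: "g 0 = op" "g 1 = om" using u v by (auto simp: g_def joinpaths_def pst_def pfn_def)
  have g1: "g ` {0..1/2} = U"
  proof -
   have "g ` {0..1/2} = u ` ((%x. 2 * x) ` {0..1/2})" unfolding image_image g_def joinpaths_def by (rule image_cong) auto
   also have "(%x. 2 * x) ` {0..1/2} = {0..1::real}" by (auto simp: image_iff intro!: bexI[of _ "_/2"])
   finally show ?thesis using u(4) by (simp add: pim_def)
  qed
  have imV: "pim g = U Un V" using u v by (simp add: g_def path_image_join)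
  have g2: "g ` {1/2..1} = V"
  proof -
   have "g x = v (2 * x - 1)" if "x:{1/2..1}" for x
   proof (cases "x = 1/2")
    case True
    hence "2 * x - 1 = 0" by simp
    thus ?thesis using True gy v(2) unfolding pst_def by metis
   next
    case False thus ?thesis using that by (simp add: g_def joinpaths_def)
   qed
   hence "g ` {1/2..1} = v ` ((%x. 2 * x - 1) ` {1/2..1})" unfolding image_image by (rule image_cong[OF refl])
   also have "(%x. 2 * x - 1) ` {1/2..1} = {0..1::real}"
   proof (intro equalityI subsetI)
    fix x :: real assume "x:{0..1}"
    hence "x = 2 * ((x+1)/2) - 1" "(x+1)/2:{1/2..1}" by (auto simp: field_simps)
    thus "x:(%x. 2 * x - 1) ` {1/2..1}" by (rule image_eqI)
   qed auto
   finally show ?thesis using v(4) by (simp add: pim_def)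
  qed
  have ny: "g s ~= y" if "s:{0..1}" "s ~= 1/2" for s using inj_onD[OF injg, of s "1/2"] that gy by auto
  have z1: "g ` {0..<1/2}<=Zp"
  proof
   fix x assume "x:g ` {0..<1/2}"
   then obtain s where s: "s:{0..<1/2}" "x = g s" by blast
   hence "x:U" using g1 by force
   thus "x:Zp" using u(5) ny[of s] s by auto
  qed
  have z2: "g ` {1/2<..1}<=Zm"
  proof
   fix x assume "x:g ` {1/2<..1}"
   then obtain s where s: "s:{1/2<..1}" "x = g s" by blast
   hence "x:V" using g2 by force
   thus "x:Zm" using v(5) ny[of s] s by auto
  qed
  show thesis by (rule main[of g "1/2"]) (use ag g0 imV US z1 z2 gy g1 g2 in \<open>auto simp: elt_def\<close>)
 qed
qed

lemma reachp_exists: assumes "y:S2" obtains U where "reachp y U"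
proof (cases "y = op")
 case True thus thesis using that by (auto simp: reachp_def)
next
 case False
 obtain v where v: "arc v" "pim v<=S2" "v 1 = y" "v ` {0..<1}<=Zp" using land_p[OF assms] by blast
 have "v 0:Zp" using v(4) by auto
 then obtain q where q: "path q" "pim q<=Zp" "pst q = op" "pfn q = v 0" using pc(1) op unfolding path_connected_def by blast
 have imv: "pim v<=insert y Zp"
 proof -
  have "{0..1} = insert 1 {0..<1::real}" by auto
  thus ?thesis using v by (auto simp: pim_def)
 qed
 have pv: "pst v = v 0" "pfn v = y" using v by (auto simp: pst_def pfn_def)
 have "path (q +++ v)" "pst (q +++ v) = op" "pfn (q +++ v) = y" using q v pv by (auto simp: arc_imp_path intro!: path_join_imp)
 then obtain u where "arc u" "pim u<=pim (q +++ v)" "pst u = op" "pfn u = y"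
  using path_contains_arc[of "q +++ v" op y] False by metis
 moreover have "pim (q +++ v)<=insert y Zp" using path_image_join_subset[of q v] q imv by blast
 ultimately show thesis using that[of "pim u"] by (auto simp: reachp_def)
qed

lemma sw_land: "zip_land Zm Zp om op"
 using sw_based land_p land_m by (simp add: zip_land_def zip_land_axioms_def)

lemma reachm_exists: assumes "y:S2" obtains U where "reachm y U"
proof -
 interpret sw: zip_land Zm Zp om op by (rule sw_land)
 obtain U where "sw.reachp y U" using sw.reachp_exists[OF assms] .
 hence "reachm y U" unfolding sw.reachp_def reachm_def by (metis arc_reversepath path_image_reversepath pathfinish_reversepath pathstart_reversepath)
 thus thesis by (rule that)
qed

text \<open>Parametrised arcs with equal images are the same point of the circle; \<open>Ec\<close> picks one of each.\<close>

definition rep where "rep g = (SOME h. h:E & pim h = pim g)"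
definition Ec where "Ec = rep ` E"

text \<open>If the transition point of \<open>g\<close> sat on \<open>h\<close> at a parameter other
  than \<open>tau h\<close>, a point of \<open>h\<close> strictly between the two parameters would,
  by \<open>prefix\<close> or \<open>suffix\<close>, also lie on the piece of \<open>h\<close> cut
  off at that parameter, against injectivity.\<close>

lemma X_image:
 assumes E: "g:E" "h:E" and im: "pim g = pim h" shows "X h = X g"
proof -
 have t: "tau g:{0..1}" using E_facts(5,6)[OF E(1)] by auto
 hence "X g:pim h" using im by (auto simp: X_def pim_def)
 then obtain s where s: "s:{0..1}" "g (tau g) = h s" unfolding pim_def X_def by blast
 have "s = tau h"
 proof (rule ccontr)
  assume ne: "s ~= tau h"
  define q where "q = (s + tau h) / 2"
  have q: "q:{0..1}" using s E_facts(5,6)[OF E(2)] by (auto simp: q_def)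
  hence "h q:pim g" using im by (auto simp: pim_def)
  then obtain r where r: "r:{0..1}" "h q = g r" unfolding pim_def by blast
  consider "h s ~: Zm" | "h s ~: Zp" using disj by blast
  thus False
  proof cases
   case 1
   hence "s < tau h" using E_time_Zp[OF E(2), of s] s ne by auto
   hence lt: "s < q" "q < tau h" by (auto simp: q_def)
   hence "h q:Zp" using E_facts(7)[OF E(2), of q] q by auto
   hence "r<=tau g" using E_time_Zp[OF E(1), of r] r disj by auto
   hence "h q:h ` {0..s}" using prefix[OF E t s] 1 s r by auto
   then obtain x where "x:{0..s}" "h q = h x" by blast
   thus False using E_inj[OF E(2) q, of x] lt s by auto
  next
   case 2
   hence "tau h < s" using E_time_Zm[OF E(2), of s] s ne by auto
   hence lt: "tau h < q" "q < s" by (auto simp: q_def)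
   hence "h q:Zm" using E_facts(8)[OF E(2), of q] q by auto
   hence "tau g<=r" using E_time_Zm[OF E(1), of r] r disj by auto
   hence "h q:h ` {s..1}" using suffix[OF E t s] 2 s r by auto
   then obtain x where "x:{s..1}" "h q = h x" by blast
   thus False using E_inj[OF E(2) q, of x] lt s by auto
  qed
 qed
 thus ?thesis using s by (simp add: X_def)
qed

lemma rep: assumes "g:E" shows "rep g:E" "pim (rep g) = pim g" "X (rep g) = X g"
proof -
 have "rep g:E & pim (rep g) = pim g" unfolding rep_def by (rule someI[where x = g]) (use assms in simp)
 thus "rep g:E" "pim (rep g) = pim g" "X (rep g) = X g" using X_image[OF assms] by auto
qed

lemma Ec_E: "g:Ec ==> g:E" using rep(1) by (auto simp: Ec_def)

lemma Ec_neq: "g:Ec ==> h:Ec ==> g ~= h ==> neq g h"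
proof -
 assume a: "g:Ec" "h:Ec" "g ~= h"
 then obtain g' h' where g': "g = rep g'" "h = rep h'" "g':E" "h':E" by (auto simp: Ec_def)
 have "pim g ~= pim h"
 proof
  assume "pim g = pim h"
  hence "pim g' = pim h'" using rep(2) g' by simp
  hence "rep g' = rep h'" by (simp add: rep_def)
  thus False using a g' by simp
 qed
 thus ?thesis using Ec_E a by (simp add: neq_def)
qed

lemma Ec_at: assumes y: "y:S2" obtains g where "g:Ec" "X g = y"
proof -
 obtain U V where "reachp y U" "reachm y V" using reachp_exists[OF y] reachm_exists[OF y] by metis
 then obtain g where g: "g:E" "X g = y" using reach_E[OF _ _ y] by metis
 thus thesis using that[of "rep g"] rep(3) by (auto simp: Ec_def)
qed

lemma X_S2: "g:E ==> X g:S2" using E_facts(5,6,9) by (auto simp: X_def)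

end

section \<open>The cyclic order opened at a base arc; cuts and their cells\<close>

locale zip_order = zip_land +
 fixes l0
 assumes l0: "l0:Ec"
begin

definition "L = Ec - {l0}"
definition lt where "lt a b \<longleftrightarrow> a:L & b:L & cyc l0 a b"

lemma L_neq: "a:L ==> neq l0 a" "a:L ==> neq a l0" "a:L ==> b:L ==> a ~= b ==> neq a b" "a:L ==> a:Ec" "a:L ==> a ~= l0"
 using Ec_neq l0 by (auto simp: L_def)

lemma lt_total: "a:L ==> b:L ==> a ~= b ==> lt a b \<or> lt b a"
 using cyc_cases[of l0 a b] L_neq unfolding lt_def by blast

lemma lt_neq: "lt a b ==> a ~= b" "lt a b ==> neq a b"
 unfolding lt_def cyc_def neq_def by auto

lemma lt_asym: "lt a b ==> ~ lt b a"
 using cyc_not unfolding lt_def by blast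

lemma lt_sub: "lt a b ==> R l0 a<=R l0 b" "lt a b ==> R a b<=R l0 b" "lt a b ==> R l0 a Int R a b = {}"
 using cyc_sub cyc_disjoint unfolding lt_def by blast+

text \<open>The regions from \<open>l0\<close> grow with the order, and \<open>R a b\<close> lies in
  \<open>R l0 b\<close> but off \<open>R l0 a\<close>; a cycle would make it empty.\<close>

lemma lt_trans: assumes "lt a b" "lt b c" shows "lt a c"
proof -
 have L: "a:L" "b:L" "c:L" using assms by (auto simp: lt_def)
 have "a ~= c" using assms lt_asym by blast
 moreover have "~ lt c a"
 proof
  assume "lt c a"
  hence "R l0 b<=R l0 a" using lt_sub(1) assms by blast
  hence "R a b = {}" using lt_sub(2,3)[OF assms(1)] by blast
  thus False using R_facts(1)[OF lt_neq(2)[OF assms(1)]] by blast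
 qed
 ultimately show ?thesis using lt_total L by blast
qed

text \<open>Were the cyclic order \<open>a\<close>, \<open>c\<close>, \<open>b\<close>, a generic
  point of \<open>R b c\<close> would lie in none of the regions \<open>R l0 a\<close>,
  \<open>R a c\<close>, \<open>R c l0\<close>, although these cover all generic points.\<close>

lemma lt_cyc: assumes "lt a b" "lt b c" shows "cyc a b c"
proof -
 have ac: "lt a c" using lt_trans assms by blast
 note n = lt_neq(2)[OF assms(1)] lt_neq(2)[OF assms(2)] lt_neq(2)[OF ac]
 have L: "a:L" "b:L" "c:L" using assms by (auto simp: lt_def)
 have "~ cyc a c b"
 proof
  assume c: "cyc a c b"
  have E: "{a,b,c,l0}<=E" using L L_neq(4) Ec_E l0 by auto
  obtain z where z: "z:R b c" "z:S2" "ALL k:{a,b,c,l0}. z ~: pim k" using R_off[OF n(2), of "{a,b,c,l0}"] E by auto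
  have nb: "z ~: R l0 b" using lt_sub(3)[OF assms(2)] z by blast
  hence na: "z ~: R l0 a" using lt_sub(1)[OF assms(1)] by blast
  have "z ~: R a b" using nb lt_sub(2)[OF assms(1)] by blast
  hence "z:R b a" using R_facts(3)[OF n(1)] mid_pair(9)[OF n(1)] z by blast
  hence "z ~: R a c" using c z unfolding cyc_def by auto
  moreover have "z ~: R c l0" using lt_sub(2)[OF assms(2)] z R_facts(2)[OF L_neq(1)[OF L(3)]] by blast
  ultimately show False using ac na z unfolding lt_def cyc_def by auto
 qed
 thus ?thesis using cyc_cases[OF n(1,2) neq_sym[OF n(3)]] by blast
qed

text \<open>The link from position of points to order: in the other cyclic order the open region
  \<open>R a b\<close> is disjoint from \<open>R b c\<close>, whose closure contains
  \<open>X c\<close>.\<close>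

lemma X_in_R_cyc:
 assumes n: "neq a b" "neq c a" "neq c b" and x: "X c:R a b"
 shows "cyc a c b"
proof (rule ccontr)
 assume "~ cyc a c b"
 hence "cyc a b c" using cyc_cases[of a b c] n neq_sym by blast
 hence d: "R a b Int R b c = {}" by (rule cyc_disjoint)
 have nb: "neq b c" using n neq_sym by blast
 have "X c:closure (R b c)" using mid_pair(14)[OF nb] R_facts(5)[OF nb] by blast
 thus False using R_open_meets[OF n(1) x, of "R b c"] d R_facts(9)[OF nb] by blast
qed

lemma cyc_X:
 assumes "cyc a b c" shows "X b:closure (R a b)" "X b:closure (R b c)" "X a:closure (R a b)" "X a:closure (R c a)"
 using assms mid_pair(13,14) R_facts(5) unfolding cyc_def by blast+

lemma disjoint_closure:
 assumes "neq a b" "neq c d" "R a b Int R c d = {}" shows "R a b Int closure (R c d) = {}"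
 using R_open_meets[OF assms(1), of _ "R c d"] assms(3) R_facts(9)[OF assms(2)] by blast

text \<open>Equal arguments stand for a full turn; in \<open>K\<close> this occurs only for
  \<open>l0\<close>, as the first and the last arc at once.\<close>

definition D where "D a b = (if a = b then S2 else closure (R a b))"

definition cut where "cut A \<longleftrightarrow> A<=L & (ALL a b. lt a b --> b:A --> a:A)"
definition K where "K A = (\<Inter>a\<in>insert l0 A. \<Inter>b\<in>insert l0 (L - A). D a b)"

lemma cut_lt: "cut A ==> a:A ==> b:L - A ==> lt a b"
 using lt_total unfolding cut_def by blast

lemma D_facts: "a:Ec ==> b:Ec ==> compact (D a b) & connected (D a b) & D a b ~= {} & D a b<=S2"
proof (cases "a = b")
 case True thus ?thesis using connected_S2 compact_S2 S2_nonempty by (simp add: D_def)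
next
 case False
 assume "a:Ec" "b:Ec"
 hence n: "neq a b" using Ec_neq False by blast
 have "connected (closure (R a b))" using connected_imp_connected_closure[OF R_facts(4)[OF n]] .
 thus ?thesis using False R_facts(1,6,10)[OF n] by (simp add: D_def)
qed

lemma D_mono1:
 assumes c: "cut A" and a: "a:insert l0 A" "a':insert l0 A" "a' = a \<or> a = l0 \<or> lt a a'" and b: "b:insert l0 (L - A)"
 shows "D a' b<=D a b"
proof -
 have AL: "A<=L" using c by (simp add: cut_def)
 consider "a' = a" | "a = l0" "a':A" | "lt a a'" "a:A" "a':A" using a lt_def L_neq(5) AL by blast
 thus ?thesis
 proof cases
  case 1 thus ?thesis by simp
 next
  case 2
  have Ec: "a':Ec" "b:Ec" using 2 AL b L_neq(4) l0 by auto
  show ?thesis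
  proof (cases "b = l0")
   case True thus ?thesis using 2 D_facts[OF Ec] by (auto simp: D_def)
  next
   case False
   hence "lt a' b" using cut_lt[OF c] 2 b by blast
   hence "closure (R a' b)<=closure (R l0 b)" "a' ~= b" using closure_mono[OF lt_sub(2)] lt_neq(1) by auto
   thus ?thesis using 2 False by (simp add: D_def)
  qed
 next
  case 3
  have ab: "a ~= b" "a' ~= b" using 3 b AL L_neq(5) by auto
  have "cyc a a' b"
  proof (cases "b = l0")
   case True thus ?thesis using 3 cyc_rotate unfolding lt_def by blast
  next
   case False
   hence "lt a' b" using cut_lt[OF c] 3 b by blast
   thus ?thesis using 3 lt_cyc by blast
  qed
  hence "closure (R a' b)<=closure (R a b)" by (intro closure_mono cyc_sub(2))
  thus ?thesis using ab by (simp add: D_def)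
 qed
qed

lemma D_mono2:
 assumes c: "cut A" and a: "a:insert l0 A" and b: "b:insert l0 (L - A)" "b':insert l0 (L - A)" "b' = b \<or> b = l0 \<or> lt b' b"
 shows "D a b'<=D a b"
proof -
 have AL: "A<=L" using c by (simp add: cut_def)
 consider "b' = b" | "b = l0" "b':L - A" | "lt b' b" "b:L - A" "b':L - A" using b lt_def L_neq(5) by blast
 thus ?thesis
 proof cases
  case 1 thus ?thesis by simp
 next
  case 2
  have Ec: "a:Ec" "b':Ec" using 2 AL a L_neq(4) l0 by auto
  show ?thesis
  proof (cases "a = l0")
   case True thus ?thesis using 2 D_facts[OF Ec] by (auto simp: D_def)
  next
   case False
   hence "lt a b'" using cut_lt[OF c] 2 a by blast
   hence "cyc a b' l0" using cyc_rotate unfolding lt_def by blast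
   hence "closure (R a b')<=closure (R a l0)" by (intro closure_mono cyc_sub(1))
   moreover have "a ~= b'" using \<open>lt a b'\<close> lt_neq(1) by blast
   ultimately show ?thesis using 2 False by (simp add: D_def)
  qed
 next
  case 3
  have ab: "a ~= b" "a ~= b'" using 3 a L_neq(5) by auto
  have "cyc a b' b"
  proof (cases "a = l0")
   case True thus ?thesis using 3 unfolding lt_def by blast
  next
   case False
   hence "lt a b'" using cut_lt[OF c] 3 a by blast
   thus ?thesis using 3 lt_cyc by blast
  qed
  hence "closure (R a b')<=closure (R a b)" by (intro closure_mono cyc_sub(1))
  thus ?thesis using ab by (simp add: D_def)
 qed
qed

lemma K_directed:
 assumes c: "cut A"
 shows "compact (K A)" "connected (K A)" "K A ~= {}" "K A<=S2"
  "!!U. open U ==> K A<=U ==> EX a:insert l0 A. EX b:insert l0 (L - A). D a b<=U"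
proof -
 have AL: "A<=L" using c by (simp add: cut_def)
 define F where "F = {D a b | a b. a:insert l0 A & b:insert l0 (L - A)}"
 have KF: "K A = \<Inter>F" by (auto simp: K_def F_def)
 have ne: "F ~= {}" by (auto simp: F_def)
 have comp: "compact T & connected T & T ~= {}" if "T:F" for T
  using that D_facts AL L_neq(4) l0 by (auto simp: F_def)
 have dir: "EX Z:F. Z<=S Int T" if ST: "S:F" "T:F" for S T
 proof -
  obtain a1 b1 a2 b2 where s: "S = D a1 b1" "T = D a2 b2" "a1:insert l0 A" "a2:insert l0 A" "b1:insert l0 (L - A)" "b2:insert l0 (L - A)"
   using ST unfolding F_def by blast
  obtain a where a: "a:insert l0 A" "a = a1 \<or> a1 = l0 \<or> lt a1 a" "a = a2 \<or> a2 = l0 \<or> lt a2 a"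
   using s(3,4) lt_total AL by blast
  obtain b where b: "b:insert l0 (L - A)" "b = b1 \<or> b1 = l0 \<or> lt b b1" "b = b2 \<or> b2 = l0 \<or> lt b b2"
   using s(5,6) lt_total by blast
  have "D a b<=D a1 b" by (rule D_mono1[OF c s(3) a(1,2) b(1)])
  also have "D a1 b<=D a1 b1" by (rule D_mono2[OF c s(3) s(5) b(1,2)])
  finally have 1: "D a b<=S" using s by simp
  have "D a b<=D a2 b" by (rule D_mono1[OF c s(4) a(1,3) b(1)])
  also have "D a2 b<=D a2 b2" by (rule D_mono2[OF c s(4) s(6) b(1,3)])
  finally have "D a b<=T" using s by simp
  moreover have "D a b:F" using a b by (auto simp: F_def)
  ultimately show ?thesis using 1 by blast
 qed
 show "compact (K A)" unfolding KF by (rule directed_Inter(1)[OF ne]) (use comp dir in auto)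
 show "connected (K A)" unfolding KF by (rule directed_Inter(2)[OF ne]) (use comp dir in auto)
 show "K A ~= {}" unfolding KF by (rule directed_Inter(3)[OF ne]) (use comp dir in auto)
 show "K A<=S2"
 proof -
  have "K A<=D l0 l0" by (auto simp: K_def)
  thus ?thesis by (simp add: D_def)
 qed
 show "EX a:insert l0 A. EX b:insert l0 (L - A). D a b<=U" if "open U" "K A<=U" for U
 proof -
  have "EX T:F. T<=U" by (rule directed_Inter(4)[OF ne]) (use comp dir that KF in auto)
  thus ?thesis by (auto simp: F_def)
 qed
qed

text \<open>The order of all arcs when the circle is opened at the cut instead of at
  \<open>l0\<close>: first the complement of \<open>A\<close>, then \<open>l0\<close>, then
  \<open>A\<close>.\<close>

definition bf where
 "bf A x y \<longleftrightarrow> (x:L - A & y:L - A & lt x y) \<or> (x:A & y:A & lt x y) \<or> (x:L - A & y:insert l0 A) \<or> (x = l0 & y:A)"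

lemma bf_total:
 assumes c: "cut A" and "x:Ec" "y:Ec" "x ~= y" shows "bf A x y \<or> bf A y x"
proof -
 have "x = l0 \<or> x:A \<or> x:L - A" "y = l0 \<or> y:A \<or> y:L - A" "A<=L" using assms by (auto simp: L_def cut_def)
 thus ?thesis using lt_total[of x y] assms(4) unfolding bf_def by blast
qed

text \<open>When \<open>b\<close> comes before \<open>a\<close> in the order opened at the cut, the
  cell from \<open>a\<close> to \<open>b\<close> passes over the cut.\<close>

lemma bf_K:
 assumes c: "cut A" and b: "bf A b a" shows "K A<=closure (R a b)"
proof -
 have AL: "A<=L" using c by (simp add: cut_def)
 have KD: "K A<=D x y" if "x:insert l0 A" "y:insert l0 (L - A)" for x y using that by (auto simp: K_def)
 have D1: "D l0 y = closure (R l0 y)" "D y l0 = closure (R y l0)" if "y:L" for y using that L_neq(5) by (auto simp: D_def)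
 consider "b:L - A" "a:L - A" "lt b a" | "b:A" "a:A" "lt b a" | "b:L - A" "a = l0" | "b:L - A" "a:A" | "b = l0" "a:A"
  using b unfolding bf_def by blast
 thus ?thesis
 proof cases
  case 1
  have "K A<=closure (R l0 b)" using KD[of l0 b] 1 D1 by auto
  moreover have "cyc a l0 b" using 1(3) cyc_rotate unfolding lt_def by blast
  ultimately show ?thesis using cyc_sub(2) closure_mono by blast
 next
  case 2
  have "K A<=closure (R a l0)" using KD[of a l0] 2 D1 AL by blast
  moreover have "cyc a l0 b" using 2(3) cyc_rotate unfolding lt_def by blast
  ultimately show ?thesis using cyc_sub(1) closure_mono by blast
 next
  case 3 thus ?thesis using KD[of l0 b] D1 by auto
 next
  case 4
  hence "a ~= b" by auto
  thus ?thesis using KD[of a b] 4 by (auto simp: D_def)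
 next
  case 5 thus ?thesis using KD[of a l0] D1 AL by blast
 qed
qed

definition rk where "rk A x = (if x = l0 then 1 else if x:A then 2 else 0::nat)"

lemma bf_rank:
 assumes c: "cut A" and x: "x:Ec" "y:Ec"
 shows "bf A x y \<longleftrightarrow> rk A x < rk A y \<or> (rk A x = rk A y & lt x y)"
proof -
 have AL: "A<=L" "l0 ~: A" "l0 ~: L" using c by (auto simp: cut_def L_def)
 have xy: "x = l0 \<or> x:L" "y = l0 \<or> y:L" using x by (auto simp: L_def)
 have l: "~ lt l0 y" "~ lt x l0" using AL by (auto simp: lt_def)
 show ?thesis unfolding bf_def rk_def using AL xy l by (cases "x = l0"; cases "y = l0"; cases "x:A"; cases "y:A") auto
qed

lemma bf_split:
 assumes c: "cut A" and b: "bf A z x" and "y:Ec" "y ~= x" "y ~= z" "x:Ec" "z:Ec"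
 shows "bf A y x \<or> bf A z y"
proof (rule ccontr)
 assume "~ ?thesis"
 hence "bf A x y" "bf A y z" using bf_total[OF c] assms by blast+
 hence 1: "rk A x < rk A y \<or> (rk A x = rk A y & lt x y)" "rk A y < rk A z \<or> (rk A y = rk A z & lt y z)"
  "rk A z < rk A x \<or> (rk A z = rk A x & lt z x)" using bf_rank[OF c] assms by simp_all
 hence "rk A x = rk A y" "rk A y = rk A z" by linarith+
 thus False using 1 lt_trans[of x y z] lt_asym[of x z] by auto
qed

text \<open>A point in neither set lies on an arc only as its transition point. For two such points
  of \<open>K A\<close> with arcs on the same side of the cut, one of them would lie in the closed
  cell over the cut and in the closed cell between the arcs, hence on an arc with a different
  transition point. So each side of the cut contributes at most one point, besides
  \<open>X l0\<close>.\<close>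

lemma K_type1_finite:
 assumes c: "cut A" shows "finite (K A - (Zp Un Zm))"
proof -
 have AL: "A<=L" using c by (simp add: cut_def)
 define T where "T = K A - (Zp Un Zm) - {X l0}"
 define e where "e x = (SOME g. g:Ec & X g = x)" for x
 have e: "e x:Ec & X (e x) = x" if xS: "x:S2" for x
 proof -
  obtain g where "g:Ec" "X g = x" using Ec_at[OF xS] by blast
  thus ?thesis unfolding e_def by (intro someI[of "%g. g:Ec & X g = x" g]) auto
 qed
 have TS: "T<=S2" using K_directed(4)[OF c] by (auto simp: T_def)
 have eL: "e x:L" if "x:T" for x using e[of x] that TS by (auto simp: L_def T_def)
 have on: "x = X g" if xg: "x:T" "g:Ec" "x:pim g" for x g
 proof -
  have gE: "g:E" using Ec_E xg by blast
  obtain s where s: "s:{0..1}" "x = g s" using xg(3) unfolding pim_def by blast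
  have "s = tau g" using E_time_Zp[OF gE, of s] E_time_Zm[OF gE, of s] xg s by (force simp: T_def)
  thus ?thesis using s by (simp add: X_def)
 qed
 have key: False if x: "x:T" "y:T" "lt (e x) (e y)" and AA: "e x:A & e y:A \<or> e x:L - A & e y:L - A" for x y
 proof -
  have xL: "e x:L" "e y:L" using eL x by auto
  have xX: "X (e x) = x" "X (e y) = y" using e x TS by auto
  have xy: "x ~= y" using x(3) lt_neq(1) by blast
  have xK: "x:K A" "y:K A" "x ~= X l0" "y ~= X l0" using x by (auto simp: T_def)
  have cy: "cyc l0 (e x) (e y)" using x(3) by (simp add: lt_def)
  from AA show False
  proof
   assume "e x:A & e y:A"
   hence "bf A l0 (e y)" by (simp add: bf_def)
   hence xc: "x:closure (R (e y) l0)" using bf_K[OF c] xK by blast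
   have n: "neq (e y) l0" "neq (e x) (e y)" using L_neq xL lt_neq(2)[OF x(3)] by auto
   have "R (e x) (e y) Int R (e y) l0 = {}" using cyc_disjoint[OF cyc_rotate[OF cy]] .
   hence "R (e y) l0 Int closure (R (e x) (e y)) = {}" using disjoint_closure[OF n] by blast
   moreover have "x:closure (R (e x) (e y))" using cyc_X(2)[OF cy] xX by simp
   ultimately have "x:Jim (e y) l0" using xc R_facts(5)[OF n(1)] by blast
   hence "x:pim (e y) \<or> x:pim l0" using mid_pair(9)[OF n(1)] by blast
   thus False using on[OF x(1)] L_neq(4)[OF xL(2)] l0 xX xy xK by auto
  next
   assume a: "e x:L - A & e y:L - A"
   hence "bf A (e x) l0" by (simp add: bf_def)
   hence yc: "y:closure (R l0 (e x))" using bf_K[OF c] xK by blast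
   have n: "neq l0 (e x)" "neq (e x) (e y)" using L_neq xL lt_neq(2)[OF x(3)] by auto
   have "R l0 (e x) Int R (e x) (e y) = {}" using cyc_disjoint[OF cy] .
   hence "R l0 (e x) Int closure (R (e x) (e y)) = {}" using disjoint_closure[OF n] by blast
   moreover have "y:closure (R (e x) (e y))" using mid_pair(14)[OF n(2)] R_facts(5)[OF n(2)] xX by auto
   ultimately have "y:Jim l0 (e x)" using yc R_facts(5)[OF n(1)] by blast
   hence "y:pim l0 \<or> y:pim (e x)" using mid_pair(9)[OF n(1)] by blast
   thus False using on[OF x(2)] L_neq(4)[OF xL(1)] l0 xX xy xK by auto
  qed
 qed
 have eq: "x = y" if "x:T" "y:T" "e x:A \<longleftrightarrow> e y:A" for x y
 proof (rule ccontr)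
  assume "x ~= y"
  hence "e x ~= e y" using e that TS by (metis subsetD)
  hence "lt (e x) (e y) \<or> lt (e y) (e x)" using lt_total eL that by blast
  thus False using key[of x y] key[of y x] that eL by blast
 qed
 have "inj_on (%x. e x:A) T" using eq by (auto simp: inj_on_def)
 hence "finite T" by (rule inj_on_finite[where B = UNIV]) auto
 thus ?thesis using finite_subset[of "K A - (Zp Un Zm)" "insert (X l0) T"] by (auto simp: T_def)
qed

end

section \<open>Hairs and the arcs through their tips\<close>

locale zip_hairp = zip_land +
 assumes hair_p: "!!gb sc. closes gb sc ==> pim gb<=Zp ==>
   (EX t r. 0 < t & t < 1 & arc r & pim r<=Zp & r 0 = gb t & r ` {0<..1}<=Lr (gb +++ sc))"
begin

text \<open>\<open>h\<close> follows \<open>y\<close> up to the foot of the hair, runs along the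
  hair to its tip and changes over to \<open>Zm\<close> there. It leaves \<open>y\<close> before
  \<open>X y\<close> and after \<open>X c0\<close>, so it misses \<open>X y\<close>, and the loop of
  \<open>h\<close> and \<open>y\<close> misses \<open>X c0\<close>.\<close>

lemma hair_elt:
 assumes n: "neq c0 y" and c0: "X c0 = y (br1 y c0)" "X c0:Zp" and yp: "X y:Zp"
  and t: "br1 y c0 < tc" "tc < tau y" and r: "arc r" "pim r<=Zp" "r 0 = y tc" "r ` {0<..1} Int Jim c0 y = {}"
 obtains h where "h:E" "X h = r 1" "X y ~: pim h" "X c0 ~: Jim h y"
proof -
 have E: "c0:E" "y:E" using n by (auto simp: neq_def)
 note ny = neq_sym[OF n]
 note d = pd_neq[OF ny, unfolded pd_def]
 have d1: "br1 y c0:{0..1}" "br1 y c0:{br1 y c0..br2 y c0}" "0<=br1 y c0" using d by auto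
 have tc: "0 < tc" "tc<=1" "tc:{0..1}" using t d E_facts(5,6)[OF E(2)] by auto
 have injr: "inj_on r {0..1}" using r by (simp add: arc_def)
 have Jy: "y ` {br1 y c0..br2 y c0}<=Jim c0 y" using mid_facts(2)[OF ny] by (auto simp: Jim_def)
 have tb: "tau y<=br2 y c0" using mid_facts(10)[OF ny] .
 have yZ: "y ` {0..tc}<=Zp" using E_facts(7)[OF E(2)] t by auto
 have ru: "r s ~: y ` {0..tc}" if s: "s:{0<..1}" for s
 proof
  assume "r s:y ` {0..tc}"
  then obtain w where w: "w:{0..tc}" "r s = y w" by auto
  have rJ: "r x ~: Jim c0 y" if "x:{0<..1}" for x using r(4) that by blast
  have wb: "w < br1 y c0"
  proof (rule ccontr)
   assume "~ w < br1 y c0"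
   hence "y w:Jim c0 y" using Jy w t tb by auto
   thus False using rJ[OF s] w by simp
  qed
  have "pim (subpath tc w y) = pim (subpath 0 s r)"
  proof (rule unique_arc)
   show "arc (subpath 0 s r)" using r(1) s by (auto intro: arc_subpath_arc)
   show "arc (subpath tc w y)" using E_facts(1)[OF E(2)] wb t w tc by (auto intro: arc_subpath_arc)
   have "pim (subpath 0 s r)<=Zp" using path_image_subpath_subset[of 0 s r] r(2) s by auto
   thus "pim (subpath 0 s r)<=S2 - Zm" using sub disj by blast
   have "pim (subpath tc w y) = y ` {w..tc}" using w by (auto simp: path_image_subpath_gen closed_segment_eq_real_ivl)
   also have "\<dots> <= Zp" using yZ w by auto
   finally show "pim (subpath tc w y)<=S2 - Zm" using sub disj by blast
  qed (use r(3) w in auto)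
  moreover have "pim (subpath tc w y) = y ` {w..tc}" using w by (auto simp: path_image_subpath_gen closed_segment_eq_real_ivl)
  moreover have "pim (subpath 0 s r) = r ` {0..s}" using s by (simp add: path_image_subpath)
  moreover have "y (br1 y c0):y ` {w..tc}" using wb t by auto
  ultimately obtain x where x: "x:{0..s}" "y (br1 y c0) = r x" by auto
  have "y (br1 y c0):Jim c0 y" using Jy d1(2) by blast
  hence "x = 0" using rJ[of x] x s by (cases "x = 0") auto
  hence "y (br1 y c0) = y tc" using x r(3) by simp
  thus False using E_inj[OF E(2), of "br1 y c0" tc] t d tc by auto
 qed
 define u where "u = subpath 0 tc y +++ r"
 have imp: "pim (subpath 0 tc y) = y ` {0..tc}" using tc by (simp add: path_image_subpath)
 have im01: "pim r = insert (r 0) (r ` {0<..1})"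
 proof -
  have "{0..1} = insert 0 {0<..1::real}" by auto
  thus ?thesis by (simp add: pim_def)
 qed
 have "arc u" unfolding u_def
 proof (rule arc_join)
  show "arc (subpath 0 tc y)" using E_facts(1)[OF E(2)] tc by (auto intro: arc_subpath_arc)
  show "pim (subpath 0 tc y) Int pim r<={pst r}" unfolding imp im01 pst_def using ru by force
 qed (use r in \<open>auto simp: pst_def\<close>)
 moreover have imu: "pim u = y ` {0..tc} Un pim r" unfolding u_def using imp r by (simp add: path_image_join pst_def)
 ultimately have rp: "reachp (r 1) (pim u)"
  unfolding reachp_def using yZ r(2) E_facts(2)[OF E(2)] by (auto simp: u_def pfn_def[of r] intro!: exI[of _ u])
 have r1: "r 1:Zp" using r(2) by (auto simp: pim_def)
 hence r1S: "r 1:S2" using sub by blast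
 obtain V where V: "reachm (r 1) V" using reachm_exists[OF r1S] by blast
 obtain h where h: "h:E" "X h = r 1" "pim h = pim u Un V" using reach_E[OF rp V r1S] by metis
 have VZ: "V<=insert (r 1) Zm" using V om by (auto simp: reachm_def)
 have Xu: "X y ~: pim u"
 proof -
  have "X y ~: y ` {0..tc}"
  proof
   assume "X y:y ` {0..tc}"
   then obtain w where "w:{0..tc}" "y (tau y) = y w" by (auto simp: X_def)
   thus False using E_inj[OF E(2), of "tau y" w] t tc E_facts(5,6)[OF E(2)] by auto
  qed
  moreover have "X y:Jim c0 y" using mid_pair(14)[OF n] .
  hence "X y ~: r ` {0<..1}" using r(4) by blast
  moreover have "r 0:y ` {0..tc}" using r(3) tc by auto
  ultimately show ?thesis using imu im01 by auto
 qed
 have "r 1:pim u" using imu by (auto simp: pim_def)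
 hence Xh: "X y ~: pim h" using h(3) Xu VZ yp disj by auto
 have nh: "neq h y"
 proof -
  have "X y:pim y" using E_facts(5,6)[OF E(2)] by (auto simp: X_def pim_def)
  thus ?thesis using Xh h(1) E(2) by (auto simp: neq_def)
 qed
 have "X c0 ~: Jim h y"
 proof
  assume a: "X c0:Jim h y"
  note nh' = neq_sym[OF nh]
  note f = mid_facts[OF nh] and f' = mid_facts[OF nh'] and m = mid_pair[OF nh]
  have cy: "X c0:pim y" using c0(1) d1(1) by (simp add: pim_def)
  have ch: "X c0:pim h" using h(3) imu c0(1) t(1) d1(3) by simp
  have "X c0:{pst (mid y h), pfn (mid y h)}"
   using a cy ch f(3,4,6) f'(3,4,6) m(1,2) by (auto simp: Jim_def)
  hence "X c0 = pst (mid y h)" using c0(2) m(2,4) disj by auto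
  hence "y (br1 y h) = y (br1 y c0)" using f'(3) c0(1) by simp
  note d' = pd_neq[OF nh', unfolded pd_def]
  have eq: "br1 y h = br1 y c0" using E_inj[OF E(2), of "br1 y h" "br1 y c0"] \<open>y (br1 y h) = _\<close> d d' by auto
  have "tc < br2 y h" using t f'(10) by simp
  hence "y tc:y ` {br1 y h<..<br2 y h}" using eq t by auto
  moreover have "y tc:pim h" using h(3) imu tc by auto
  ultimately show False using d' by blast
 qed
 thus thesis using that h Xh by blast
qed

text \<open>\<open>cm\<close> is the first point of \<open>gb\<close> on a path from the base point,
  and \<open>yp\<close> an end of \<open>gb\<close>; \<open>c0\<close> and \<open>y\<close> change
  over at these two points. Their loop contains the piece of \<open>gb\<close> in between, so the
  hairs on its two sides lead into the two regions of the loop.\<close>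

lemma hair_elements:
 assumes gb: "arc gb" "pim gb<=Zp"
 obtains c0 y h h' where "neq c0 y" "h:E" "h':E" "X c0:pim gb" "X y:pim gb" "X h:R c0 y" "X h':R y c0"
  "X y ~: pim c0" "X y ~: pim h" "X y ~: pim h'" "X c0 ~: Jim h y" "X c0 ~: Jim h' y"
proof -
 have "gb 0:Zp" using gb by (auto simp: pim_def)
 then obtain q where q: "path q" "pim q<=Zp" "pst q = op" "pfn q = gb 0"
  using pc(1) op unfolding path_connected_def by blast
 define S where "S = {0..1} Int q -` pim gb"
 have cq: "continuous_on {0..1} q" using q by (simp add: path_def)
 have "closed S" unfolding S_def by (rule continuous_closed_preimage[OF cq]) (use gb closed_arc_image in auto)
 hence "compact ({0..1} Int S)" by (intro compact_Int_closed) auto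
 hence "compact S" by (simp add: S_def)
 moreover have "1:S" using q by (auto simp: S_def pfn_def pim_def)
 ultimately obtain s where s: "s:S" "!!x. x:S ==> s<=x" using compact_attains_inf by (metis empty_iff)
 have s01: "s:{0..1}" using s by (auto simp: S_def)
 obtain t where t: "t:{0..1}" "q s = gb t" using s by (auto simp: S_def pim_def)
 \<comment> \<open>Any end of \<open>gb\<close> other than the point where the path arrives will
   do.\<close>
 define e where "e = (if t < 1 then 1 else 0::real)"
 have e: "e:{0..1}" "t ~= e" using t by (auto simp: e_def)
 define g1 where "g1 = subpath t e gb"
 have g1: "arc g1" "pim g1<=pim gb" "pst g1 = gb t" "pfn g1 = gb e"
  unfolding g1_def using gb t e arc_subpath_arc[of gb t e] path_image_subpath_subset[of t e gb] by (auto simp: path_image_subpath_subset)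
 define cm yp where "cm = gb t" and "yp = gb e"
 have injg: "inj_on gb {0..1}" using gb by (simp add: arc_def)
 have cy: "cm ~= yp" using inj_onD[OF injg, of t e] t e by (auto simp: cm_def yp_def)
 have inZ: "cm:Zp" "yp:Zp" "cm:pim gb" "yp:pim gb" using gb t e by (auto simp: cm_def yp_def pim_def)
 obtain U0 where U0: "reachp cm U0" "U0 Int pim gb = {cm}" "U0<=Zp"
 proof (cases "cm = op")
  case True thus thesis using that[of "{op}"] inZ op by (auto simp: reachp_def)
 next
  case False
  have "path (subpath 0 s q)" "pst (subpath 0 s q) = op" "pfn (subpath 0 s q) = cm"
   using q s01 t by (auto simp: path_subpath cm_def pst_def[of q])
  then obtain u0 where u0: "arc u0" "pim u0<=pim (subpath 0 s q)" "pst u0 = op" "pfn u0 = cm"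
   using path_contains_arc[of "subpath 0 s q" op cm] False by metis
  have im: "pim (subpath 0 s q) = q ` {0..s}" using s01 by (simp add: path_image_subpath)
  have "q ` {0..s} Int pim gb<={cm}"
  proof
   fix z assume "z:q ` {0..s} Int pim gb"
   then obtain x where x: "x:{0..s}" "z = q x" "q x:pim gb" by auto
   hence "x:S" using s01 by (auto simp: S_def)
   hence "x = s" using s x by force
   thus "z:{cm}" using x t by (simp add: cm_def)
  qed
  hence "pim u0 Int pim gb<={cm}" using u0(2) im by blast
  moreover have "cm:pim u0" using u0 by (metis pathfinish_in_path_image)
  moreover have "q ` {0..s}<=Zp" using q(2) s01 by (force simp: pim_def)
  hence "pim u0<=Zp" using u0(2) im by blast
  ultimately show thesis using that[of "pim u0"] u0 inZ by (auto simp: reachp_def)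
 qed
 have U1: "reachp yp (U0 Un pim g1)"
 proof (cases "cm = op")
  case True
  hence "U0 = {op}" using U0(1) arc_distinct_ends by (force simp: reachp_def)
  moreover have "op:pim g1" using True g1 by (metis cm_def pathstart_in_path_image)
  ultimately have "U0 Un pim g1 = pim g1" by auto
  thus ?thesis using g1 True gb(2) unfolding reachp_def by (auto simp: cm_def yp_def intro!: exI[of _ g1])
 next
  case False
  then obtain u0 where u0: "arc u0" "pst u0 = op" "pfn u0 = cm" "pim u0 = U0" using U0(1) by (auto simp: reachp_def)
  have "arc (u0 +++ g1)" by (rule arc_join) (use u0 g1 U0(2) in \<open>auto simp: cm_def\<close>)
  moreover have "pim (u0 +++ g1) = U0 Un pim g1" using u0 g1 by (simp add: path_image_join cm_def)
  ultimately show ?thesis unfolding reachp_def using u0 g1 U0(3) gb(2) by (intro disjI2 exI[of _ "u0 +++ g1"]) (auto simp: yp_def)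
 qed
 have S2s: "cm:S2" "yp:S2" using inZ sub by auto
 obtain V0 where V0: "reachm cm V0" using reachm_exists[OF S2s(1)] by blast
 obtain V1 where V1: "reachm yp V1" using reachm_exists[OF S2s(2)] by blast
 obtain c0 where c0: "c0:E" "X c0 = cm" "pim c0 = U0 Un V0" using reach_E[OF U0(1) V0 S2s(1)] by metis
 obtain y where y: "y:E" "X y = yp" "pim y = (U0 Un pim g1) Un V1" "y ` {0..tau y} = U0 Un pim g1"
  using reach_E[OF U1 V1 S2s(2)] by metis
 have V0Z: "V0<=insert cm Zm" using V0 om by (auto simp: reachm_def)
 have ync: "yp ~: pim c0" using c0(3) V0Z U0(2) inZ cy disj by auto
 have n: "neq c0 y"
 proof -
  have "X y:pim y" using E_facts(5,6)[OF y(1)] by (auto simp: X_def pim_def)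
  thus ?thesis using ync y c0 by (auto simp: neq_def)
 qed
 note ny = neq_sym[OF n]
 note d = pd_neq[OF ny, unfolded pd_def]
 note f = mid_facts[OF ny] and m = mid_pair[OF n] and m' = mid_pair[OF ny]
 have "pim g1 - {cm}<=pim y - pim c0"
  using y(3) c0(3) U0(2) V0Z g1(2) gb(2) disj by blast
 hence sub1: "pim g1 - {cm}<=pim (mid y c0)" using f(7) by blast
 have "cm:closure (pim g1 - {cm})"
 proof -
  have "connected (pim g1)" using g1(1) by (simp add: connected_arc_image)
  moreover have "cm:pim g1" "yp:pim g1" using g1 by (metis cm_def yp_def pathstart_in_path_image pathfinish_in_path_image)+
  ultimately have "cm islimpt pim g1" using connected_imp_perfect[of "pim g1" cm] cy by force
  thus ?thesis by (metis closure_def islimpt_punctured UnI2 mem_Collect_eq)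
 qed
 moreover have "closed (pim (mid y c0))" using f(1) closed_arc_image by blast
 ultimately have "cm:pim (mid y c0)" using sub1 closure_minimal by blast
 moreover have "cm:pim c0" using c0(2) E_facts(5,6)[OF c0(1)] by (auto simp: X_def pim_def)
 ultimately have "cm:{y (br1 y c0), y (br2 y c0)}" using f(6) by blast
 hence cmy: "cm = y (br1 y c0)" using inZ d disj by auto
 have ytau: "y (tau y) = yp" using y(2) by (simp add: X_def)
 have lt1: "br1 y c0 < tau y" using f(9) cmy ytau cy by (auto simp: less_le)
 have lt2: "tau y < br2 y c0" using f(10) ytau inZ d disj by (auto simp: less_le)
 have ay: "arc y" using E_facts(1)[OF y(1)] .
 have T: "br1 y c0:{0..1}" "tau y:{0..1}" "br1 y c0 ~= tau y" using d lt1 E_facts(5,6)[OF y(1)] by auto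
 define g2 where "g2 = subpath (br1 y c0) (tau y) y"
 have im2: "pim g2 = y ` {br1 y c0..tau y}" unfolding g2_def using lt1 by (simp add: path_image_subpath)
 have g2Z: "pim g2<=Zp"
 proof -
  have "pim g2<=y ` {0..tau y}" unfolding im2 using T by (intro image_mono) auto
  thus ?thesis using y(4) U0(3) g1(2) gb(2) by (metis (no_types) Un_least order_trans)
 qed
 obtain Q S where Q: "closes Q S" "Lr (Q +++ S) = R c0 y" "pim Q<=Zp" "pst Q = cm" "pfn Q = yp" "pim Q Un pim S = Jim c0 y"
  using arc_Zp[OF n] c0(2) y(2) inZ cy by metis
 have imQ: "pim Q = y ` {br1 y c0..tau y}" unfolding im2[symmetric]
  by (rule unique_arc) (use arc_subpath_arc[OF ay T] Q g2Z sub disj cmy ytau in \<open>auto simp: closes_def g2_def\<close>)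
 have XC: "X c0 = y (br1 y c0)" "X c0:Zp" "X y:Zp" using c0(2) cmy inZ y(2) by auto
 have hair: "EX h:E. X h:Lr (p +++ s) & X y ~: pim h & X c0 ~: Jim h y"
  if p: "closes p s" "pim p = pim Q" "{pst p, pfn p} = {cm, yp}" "Lr (p +++ s) Int Jim c0 y = {}" for p s
 proof -
  obtain t r where r: "0 < t" "t < 1" "arc r" "pim r<=Zp" "r 0 = p t" "r ` {0<..1}<=Lr (p +++ s)"
   using hair_p[OF p(1)] p(2) Q(3) by metis
  have "p t:pim p" using r by (auto simp: pim_def)
  then obtain tc where tc: "tc:{br1 y c0..tau y}" "p t = y tc" using p(2) imQ by auto
  have "p t ~= pst p" "p t ~= pfn p" using p(1) r by (auto simp: closes_def arc_def pst_def pfn_def dest: inj_onD)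
  hence "p t ~= cm" "p t ~= yp" using p(3) by auto
  hence "br1 y c0 < tc" "tc < tau y" using tc cmy ytau by (auto simp: less_le)
  moreover have "r ` {0<..1} Int Jim c0 y = {}" using r(6) p(4) by blast
  moreover have "r 1:Lr (p +++ s)" using r(6) by auto
  ultimately show ?thesis using hair_elt[OF n XC _ _ r(3,4)] r(5) tc(2) by metis
 qed
 have cy2: "Lr (rvp Q +++ rvp S) = R y c0"
  using loop_sides(2,3)[OF closes_loop[OF Q(1)]] R_facts(2,3)[OF n] closes_image[OF Q(1)] Q(2,6) reversepath_closes[OF Q(1)] by auto
 have offJ: "R c0 y Int Jim c0 y = {}" "R y c0 Int Jim c0 y = {}" using R_facts(3)[OF n] by blast+
 obtain h where h: "h:E" "X h:R c0 y" "X y ~: pim h" "X c0 ~: Jim h y" using hair[OF Q(1)] Q offJ by auto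
 obtain h' where h': "h':E" "X h':R y c0" "X y ~: pim h'" "X c0 ~: Jim h' y"
  using hair[OF closes_reverse[OF Q(1)]] Q cy2 offJ by (auto simp: path_image_reversepath)
 show thesis using that[OF n h(1) h'(1)] c0(2) y(2) inZ ync h h' by auto
qed

end

section \<open>Continua covered by countably many arcs and points\<close>

lemma connected_two_points_arc:
 fixes g :: "real => 'a::real_normed_vector"
 assumes g: "arc g" and C: "connected C" "C<=pim g" and x: "x:C" "y:C" "x ~= y"
 obtains gb where "arc gb" "pim gb<=C" "pst gb = x" "pfn gb = y"
proof -
 obtain k where k: "homeomorphism {0..1} (pim g) g k" using homeomorphism_arc[OF g] by blast
 have "connected (k ` C)" using C k by (meson connected_continuous_image continuous_on_subset homeomorphism_cont2)
 hence iv: "is_interval (k ` C)" by (simp add: is_interval_connected_1)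
 have kk: "k x:{0..1}" "k y:{0..1}" "g (k x) = x" "g (k y) = y" using k C x by (auto simp: homeomorphism_def intro!: imageI)
 have "closed_segment (k x) (k y)<=k ` C" using iv x by (meson closed_segment_subset imageI is_interval_convex_1)
 hence "g ` closed_segment (k x) (k y)<=g ` k ` C" by blast
 also have "\<dots> = C" using k C(2) by (force simp: homeomorphism_def image_image subset_iff)
 finally have "pim (subpath (k x) (k y) g)<=C" by (simp add: path_image_subpath_gen)
 moreover have "arc (subpath (k x) (k y) g)" using arc_subpath_arc[OF g kk(1,2)] kk x by metis
 ultimately show thesis using that kk by simp
qed

text \<open>By Baire one of the countably many closed pieces contains a neighbourhood in
  \<open>S\<close> of some point \<open>x\<close>. The component of \<open>x\<close> in a small ball
  reaches the bounding sphere, so it is a nondegenerate connected subset of that piece, which is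
  therefore an arc and not a point.\<close>

lemma continuum_contains_arc:
 fixes S :: "'a::euclidean_space set"
 assumes S: "compact S" "connected S" "p:S" "q:S" "p ~= q"
  and G: "countable G" "!!g. g:G ==> arc g" and C: "countable C" and cov: "S<=(\<Union>g\<in>G. pim g) Un C"
 obtains g gb where "g:G" "arc gb" "pim gb<=pim g" "pim gb<=S"
proof -
 define FF where "FF = pim ` G Un (%c. {c}) ` C"
 have clF: "closed F" if "F:FF" for F using that G(2) closed_arc_image by (auto simp: FF_def)
 have "EX F:FF. ~ S<=closure (S - F)"
 proof (rule ccontr)
  assume "~ ?thesis"
  hence d: "S<=closure (S - F)" if "F:FF" for F using that by blast
  have "S<=closure (\<Inter>((%F. S - F) ` FF))"
  proof (rule Baire)
   show "countable ((%F. S - F) ` FF)" unfolding FF_def using G(1) C by auto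
   fix T assume "T:(%F. S - F) ` FF"
   then obtain F where F: "F:FF" "T = S - F" by auto
   have "openin (top_of_set S) (S Int - F)" using clF[OF F(1)] by (intro openin_open_Int) auto
   thus "openin (top_of_set S) T & S<=closure T" using d F by (simp add: Diff_eq)
  qed (use S compact_imp_closed in auto)
  moreover have "\<Inter>((%F. S - F) ` FF) = {}"
  proof -
   have "x ~: \<Inter>((%F. S - F) ` FF)" for x
   proof
    assume a: "x : \<Inter>((%F. S - F) ` FF)"
    have "FF ~= {}" using cov S(3) by (auto simp: FF_def)
    hence "x:S" using a by auto
    hence "EX F:FF. x:F" using cov by (simp add: FF_def bex_Un) blast
    thus False using a by blast
   qed
   thus ?thesis by blast
  qed
  ultimately show False using S(3) by auto
 qed
 then obtain F x where F: "F:FF" "x:S" "x ~: closure (S - F)" by blast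
 define z where "z = (if x = p then q else p)"
 have z: "z:S" "z ~= x" using S by (auto simp: z_def)
 obtain e where e: "e > 0" "!!y. y:S - F ==> ~ dist y x < e" using F(3) by (auto simp: closure_approachable)
 define r where "r = min (e / 2) (dist z x / 2)"
 have r: "r > 0" "r < e" "r < dist z x" using e z by (auto simp: r_def min_def field_simps)
 define W where "W = S Int cball x r"
 have WF: "W<=F" using e(2) r by (force simp: W_def dist_commute)
 have xW: "x:W" using F r by (simp add: W_def)
 have cW: "compact W" using S by (auto simp: W_def intro: compact_Int_closed)
 define D where "D = connected_component_set W x"
 have D: "D:components W" using xW by (auto simp: D_def components_def)
 have cD: "compact D" "connected D" "x:D" "D<=W"
  using compact_components[OF cW D] xW connected_component_subset[of W x] by (auto simp: D_def connected_connected_component)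
 \<comment> \<open>Boundary bumping: by Sura-Bura, a component inside the open ball would have a
   compact relatively open neighbourhood there, and this would be open and closed in the connected
   set \<open>S\<close>.\<close>
 have "~ D<=ball x r"
 proof
  assume a: "D<=ball x r"
  obtain K where K: "openin (top_of_set W) K" "compact K" "D<=K" "K<=ball x r"
   using Sura_Bura_clopen_subset[OF closed_imp_locally_compact[OF compact_imp_closed[OF cW]] D cD(1) open_ball a] by blast
  obtain V where V: "open V" "K = W Int V" using K(1) by (auto simp: openin_open)
  have "K = S Int (V Int ball x r)" using V K(4) by (auto simp: W_def)
  hence "openin (top_of_set S) K" using V openin_open_Int[of "V Int ball x r" S] by (metis open_Int open_ball)
  moreover have "closedin (top_of_set S) K" using K(2) V by (auto intro: closed_subset compact_imp_closed simp: W_def)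
  ultimately have "K = {} \<or> K = S" using S(2) by (auto simp: connected_clopen)
  hence "z:ball x r" using K cD z by auto
  thus False using r by (simp add: dist_commute)
 qed
 then obtain y where y: "y:D" "y ~= x" using r by force
 have "F:pim ` G"
 proof (rule ccontr)
  assume "F ~: pim ` G"
  then obtain c where "F = {c}" using F by (auto simp: FF_def)
  thus False using y cD WF by blast
 qed
 then obtain g where g: "g:G" "F = pim g" by blast
 obtain gb where "arc gb" "pim gb<=D" using connected_two_points_arc[OF G(2)[OF g(1)] cD(2), of x y] cD WF g y by (metis order_trans)
 thus thesis using that[of g gb] g cD(4) WF by (auto simp: W_def)
qed

lemma arc_interior_dense:
 fixes p :: "real => 'a::real_normed_vector"
 assumes "arc p" shows "pim p = closure (pim p - {pst p, pfn p})"
proof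
 have ne: "pst p ~= pfn p" using assms arc_distinct_ends by metis
 have c: "closed (pim p)" using assms by (rule closed_arc_image)
 thus "closure (pim p - {pst p, pfn p})<=pim p" by (metis closure_minimal Diff_subset)
 have "x islimpt pim p" if "x:pim p" for x
 proof (rule connected_imp_perfect)
  show "connected (pim p)" using assms by (rule connected_arc_image)
  show "pim p ~= {y}" for y using ne by (metis pathstart_in_path_image pathfinish_in_path_image singletonD)
 qed (use that in auto)
 hence "x islimpt (pim p - {pst p, pfn p})" if "x:pim p" for x
  using islimpt_Un_finite[of "{pst p, pfn p}" x "pim p"] that
  by (metis Un_Diff_cancel finite.emptyI finite_insert islimpt_Un_finite)
 thus "pim p<=closure (pim p - {pst p, pfn p})" by (auto simp: closure_def)
qed

section \<open>Dependence on images only, and the exchange of the two sets\<close>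

context zip_based begin

lemma mid_cong:
 assumes n: "neq g h" and g': "g':E" "pim g' = pim g" and h': "h':E" "pim h' = pim h"
 shows "neq g' h'" "pim (mid g' h') = pim (mid g h)" "pst (mid g' h') = pst (mid g h)" "pfn (mid g' h') = pfn (mid g h)"
proof -
 show n': "neq g' h'" using n g' h' by (simp add: neq_def)
 have im: "pim (mid a b) - {pst (mid a b), pfn (mid a b)} = pim a - pim b" if "neq a b" for a b
  using mid_facts(3-7)[OF that] by auto
 have im': "pim (mid a b) = closure (pim a - pim b)" if "neq a b" for a b
  using arc_interior_dense[OF mid_facts(1)[OF that]] im[OF that] by simp
 show e: "pim (mid g' h') = pim (mid g h)" using im'[OF n] im'[OF n'] g' h' by simp
 have "{pst (mid g' h'), pfn (mid g' h')} = {pst (mid g h), pfn (mid g h)}"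
  using mid_facts(3,4,6)[OF n] mid_facts(3,4,6)[OF n'] e h' by metis
 moreover note mid_pair(3,4)[OF n] mid_pair(3,4)[OF n'] disj
 ultimately show "pst (mid g' h') = pst (mid g h)" "pfn (mid g' h') = pfn (mid g h)" by (metis IntI doubleton_eq_iff empty_iff)+
qed

lemma R_cong:
 assumes n: "neq g h" and g': "g':E" "pim g' = pim g" and h': "h':E" "pim h' = pim h"
 shows "R g' h' = R g h" "Jim g' h' = Jim g h"
proof -
 note m = mid_cong[OF assms] and m' = mid_cong[OF neq_sym[OF n] h' g']
 show "Jim g' h' = Jim g h" using m m' by (simp add: Jim_def)
 have a: "arc (mid g' h')" "arc (mid h' g')" using mid_facts(1) m(1) m'(1) by auto
 note c = mid_pair(6)[OF n]
 have c1: "closes (mid h' g') (rvp (mid g h))" and e1: "Lr (mid h' g' +++ rvp (mid g h)) = Lr (mid h g +++ rvp (mid g h))"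
  using Lr_closes_eq[OF c a(2)] m' by auto
 have "Lr (rvp (mid g' h') +++ mid h' g') = Lr (rvp (mid g h) +++ mid h' g')"
  by (rule Lr_closes_eq(2)[OF closes_sym[OF c1]]) (use a m in \<open>auto simp: arc_reversepath\<close>)
 thus "R g' h' = R g h" using e1 Lr_closes_sym[OF c1] Lr_closes_sym[OF mid_pair(6)[OF m(1)]] by (simp add: R_def Jc_def)
qed

lemma cyc_cong:
 assumes "cyc a b c" "a':E" "b':E" "c':E" "pim a' = pim a" "pim b' = pim b" "pim c' = pim c"
 shows "cyc a' b' c'"
proof -
 have n: "neq a b" "neq b c" "neq c a" using assms by (auto simp: cyc_def)
 have "R a' b' = R a b" "R b' c' = R b c" "R c' a' = R c a" using R_cong(1) n assms by metis+
 moreover have "neq a' b'" "neq b' c'" "neq c' a'" using n assms by (auto simp: neq_def)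
 ultimately show ?thesis using assms by (simp add: cyc_def)
qed

lemma sw_X: assumes "rvp g:E" shows "zip_based.tau Zm Zp om op g = 1 - tau (rvp g)" "zip_based.X Zm Zp om op g = X (rvp g)"
proof -
 interpret sw: zip_based Zm Zp om op by (rule sw_based)
 have "sw.elt g (1 - tau (rvp g))" using elt_tau[OF assms] by (simp add: sw_elt)
 thus t: "sw.tau g = 1 - tau (rvp g)" by (rule sw.tau_eq)
 show "sw.X g = X (rvp g)" by (simp add: sw.X_def X_def t reversepath_def)
qed

lemma sw_mid:
 assumes "neq (rvp g) (rvp h)"
 shows "zip_based.mid g h = rvp (mid (rvp g) (rvp h))"
proof -
 interpret sw: zip_based Zm Zp om op by (rule sw_based)
 let ?g = "rvp g" and ?h = "rvp h"
 note p = pd_neq[OF assms]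
 have im: "g ` {1 - b..1 - a} = rvp g ` {a..b}" "g ` {1 - b<..<1 - a} = rvp g ` {a<..<b}" for g :: "real => real^3" and a b
 proof -
  have *: "rvp g ` S = g ` ((%x. 1 - x) ` S)" for S by (simp add: reversepath_def image_image)
  have "(%x. 1 - x) ` {a..b} = {1 - b..1 - a}" "(%x. 1 - x) ` {a<..<b} = {1 - b<..<1 - a}" by (simp_all add: one_minus_image)
  thus "g ` {1 - b..1 - a} = rvp g ` {a..b}" "g ` {1 - b<..<1 - a} = rvp g ` {a<..<b}" using * by metis+
 qed
 have im0: "g ` {0..1 - a} = rvp g ` {a..1}" "g ` {1 - b..1} = rvp g ` {0..b}" for g :: "real => real^3" and a b using im(1)[of g 1 a] im(1)[of g b 0] by auto
 have rv: "g (1 - x) = rvp g x" for g :: "real => real^3" and x by (simp add: reversepath_def)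
 have "sw.pd g h (1 - br2 ?g ?h) (1 - br1 ?g ?h) (1 - br2 ?h ?g) (1 - br1 ?h ?g)"
  using p unfolding sw.pd_def pd_def im im0 path_image_reversepath rv by (intro conjI) auto
 hence "sw.br1 g h = 1 - br2 ?g ?h" "sw.br2 g h = 1 - br1 ?g ?h" using sw.pd_br by blast+
 hence "sw.mid g h = subpath (1 - br2 ?g ?h) (1 - br1 ?g ?h) g" by (simp add: sw.mid_def)
 also have "\<dots> = rvp (mid ?g ?h)" by (rule ext) (simp add: mid_def subpath_def reversepath_def algebra_simps)
 finally show ?thesis .
qed

lemma sw_neq: "zip_based.neq Zm Zp om op g h \<longleftrightarrow> neq (rvp g) (rvp h)"
proof -
 interpret sw: zip_based Zm Zp om op by (rule sw_based)
 show ?thesis by (simp add: sw.neq_def neq_def sw_E)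
qed

text \<open>The exchange reverses both middle pieces and thereby the direction of the loop, so left
  and right are swapped and the arguments of \<open>R\<close> change places.\<close>

lemma sw_R:
 assumes "neq (rvp g) (rvp h)"
 shows "zip_based.R g h = R (rvp h) (rvp g)" "zip_based.Jim g h = Jim (rvp g) (rvp h)"
proof -
 interpret sw: zip_based Zm Zp om op by (rule sw_based)
 note m = sw_mid[OF assms] sw_mid[OF neq_sym[OF assms]]
 show "sw.Jim g h = Jim (rvp g) (rvp h)" by (simp add: sw.Jim_def Jim_def m)
 have "sw.R g h = Lr (rvp (mid (rvp h) (rvp g)) +++ rvp (rvp (mid (rvp g) (rvp h))))"
  by (simp add: sw.R_def sw.Jc_def m)
 also have "\<dots> = Lr (rvp (Jc (rvp g) (rvp h)))"
  using reversepath_closes[OF mid_pair(6)[OF assms]] by (simp add: Jc_def)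
 also have "\<dots> = R (rvp h) (rvp g)" using mid_pair(10)[OF assms] by simp
 finally show "sw.R g h = R (rvp h) (rvp g)" .
qed

lemma sw_cyc:
 assumes "cyc (rvp a) (rvp b) (rvp c)" shows "zip_based.cyc Zm Zp om op a c b"
proof -
 interpret sw: zip_based Zm Zp om op by (rule sw_based)
 have n: "neq (rvp a) (rvp b)" "neq (rvp b) (rvp c)" "neq (rvp c) (rvp a)" using assms by (auto simp: cyc_def)
 have "sw.R a c = R (rvp c) (rvp a)" "sw.R c b = R (rvp b) (rvp c)" "sw.R b a = R (rvp a) (rvp b)"
  using sw_R(1) n neq_sym by blast+
 thus ?thesis using assms n neq_sym unfolding sw.cyc_def cyc_def by (auto simp: sw_neq path_image_reversepath add_ac)
qed

end

section \<open>Cells of cuts are single points\<close>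

locale zip_full = zip_order Zp Zm op om l0 + zip_hairp Zp Zm op om for Zp Zm op om l0 +
 assumes hair_m: "!!gb sc. closes gb sc ==> pim gb<=Zm ==>
   (EX t r. 0 < t & t < 1 & arc r & pim r<=Zm & r 0 = gb t & r ` {0<..1}<=Lr (gb +++ sc))"
  and cover: "EX G C. countable G & countable C & (ALL g:G. arc g & (pim g<=Zp \<or> pim g<=Zm)) & Zp Un Zm<=(\<Union>g\<in>G. pim g) Un C"
begin

lemma hair_elements_any:
 assumes gb: "arc gb" "pim gb<=Zp \<or> pim gb<=Zm"
 obtains c0 y h h' where "neq c0 y" "h:E" "h':E" "X c0:pim gb" "X y:pim gb" "X h:R c0 y" "X h':R y c0"
  "X y ~: pim c0" "X y ~: pim h" "X y ~: pim h'" "X c0 ~: Jim h y" "X c0 ~: Jim h' y"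
proof (cases "pim gb<=Zp")
 case True thus thesis using hair_elements[OF gb(1)] that by metis
next
 case False
 interpret sw: zip_land Zm Zp om op by (rule sw_land)
 interpret sw: zip_hairp Zm Zp om op by unfold_locales (use hair_m in blast)
 have "pim gb<=Zm" using False gb by blast
 from sw.hair_elements[OF gb(1) this] obtain c0 y h h' where e: "sw.neq c0 y" "h:sw.E" "h':sw.E" "sw.X c0:pim gb" "sw.X y:pim gb" "sw.X h:sw.R c0 y" "sw.X h':sw.R y c0"
  "sw.X y ~: pim c0" "sw.X y ~: pim h" "sw.X y ~: pim h'" "sw.X c0 ~: sw.Jim h y" "sw.X c0 ~: sw.Jim h' y" by metis
 let ?r = "rvp :: _ => real => real^3"
 have E: "?r c0:E" "?r y:E" "?r h:E" "?r h':E" using e by (auto simp: sw.neq_def sw_E)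
 note X = E[THEN sw_X(2)]
 have n: "neq (?r c0) (?r y)" using e(1) by (simp add: sw_neq)
 have "X (?r y):pim (?r y)" using E_facts(5,6)[OF E(2)] by (auto simp: X_def pim_def)
 hence n2: "neq (?r h) (?r y)" "neq (?r h') (?r y)" using e(9,10) E X by (auto simp: neq_def)
 note R = sw_R[OF n] sw_R[OF neq_sym[OF n]] sw_R[OF n2(1)] sw_R[OF n2(2)]
 show thesis using that[OF n E(4,3)] e X R by (simp add: path_image_reversepath)
qed

text \<open>Opened at the cut, the order puts one of \<open>c0\<close>, \<open>y\<close> first, and
  \<open>K A\<close> lies in the cell from the later to the earlier one. The hair arc inside this
  cell splits it, and \<open>K A\<close> lies in one of the halves. But \<open>X c0\<close> and
  \<open>X y\<close> are both in \<open>K A\<close>, and the one belonging to the other half would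
  have to lie on the loop bounding the half, which the choice of the hair excludes.\<close>

lemma K_no_arc:
 assumes c: "cut A" and gb: "arc gb" "pim gb<=Zp \<or> pim gb<=Zm" "pim gb<=K A"
 shows False
proof -
 obtain c0 y h h' where e0: "neq c0 y" "h:E" "h':E" "X c0:pim gb" "X y:pim gb" "X h:R c0 y" "X h':R y c0"
  "X y ~: pim c0" "X y ~: pim h" "X y ~: pim h'" "X c0 ~: Jim h y" "X c0 ~: Jim h' y"
  using hair_elements_any[OF gb(1,2)] by metis
 have E0: "c0:E" "y:E" using e0 by (auto simp: neq_def)
 define c0' y' k k' where "c0' = rep c0" and "y' = rep y" and "k = rep h" and "k' = rep h'"
 have Ec: "c0':Ec" "y':Ec" "k:Ec" "k':Ec" using E0 e0 by (auto simp: c0'_def y'_def k_def k'_def Ec_def)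
 note rp = rep(1-3)[OF E0(1), folded c0'_def] rep(1-3)[OF E0(2), folded y'_def] rep(1-3)[OF e0(2), folded k_def] rep(1-3)[OF e0(3), folded k'_def]
 have Xin: "X g:pim g" if "g:E" for g using E_facts(5,6)[OF that] by (auto simp: X_def pim_def)
 have nhy: "neq h y" "neq h' y" using e0 E0 Xin[OF E0(2)] by (auto simp: neq_def)
 have e: "neq c0' y'" "neq k y'" "neq k' y'" "X k:R c0' y'" "X k':R y' c0'" "X y' ~: pim c0'" "X y' ~: pim k" "X y' ~: pim k'"
  "X c0' ~: Jim k y'" "X c0' ~: Jim k' y'" "X c0':K A" "X y':K A"
  using e0 nhy rp R_cong[OF e0(1) rp(1,2,4,5)] R_cong[OF neq_sym[OF e0(1)] rp(4,5,1,2)] R_cong[OF nhy(1) rp(7,8,4,5)] R_cong[OF nhy(2) rp(10,11,4,5)] gb(3)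
  by (auto simp: neq_def)
 have ny: "neq y' c0'" "neq y' k" "neq y' k'" using e neq_sym by auto
 have nJ: "X g:Jim a b" if "neq a b" "g = a \<or> g = b" for g a b using mid_pair(13,14)[OF that(1)] that(2) by auto
 have offR: "Jim a b Int R a b = {}" "Jim a b Int R b a = {}" if "neq a b" for a b using R_facts(3)[OF that] by auto
 have kc: "k ~= c0'" "k ~= y'" "k' ~= c0'" "k' ~= y'" using e(4,5) nJ[OF e(1)] offR[OF e(1)] by blast+
 hence nk: "neq k c0'" "neq k' c0'" "neq c0' k" "neq c0' k'" using Ec Ec_neq by metis+
 have cy1: "cyc c0' k y'" using X_in_R_cyc[OF e(1) nk(1) e(2) e(4)] .
 have cy2: "cyc y' k' c0'" using X_in_R_cyc[OF ny(1) e(3) nk(2) e(5)] .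
 have inJ: "z:Jim a b" if "neq a b" "z:closure (R a b)" "z:closure (R b a)" for z a b
  using that R_facts(5,8)[OF that(1)] R_facts(5,2)[OF neq_sym[OF that(1)]] mid_pair(11)[OF that(1)] by blast
 have Jsub: "Jim a b<=pim a Un pim b" if "neq a b" for a b using mid_pair(9)[OF that] .
 have X1: "X y':closure (R k y')" "X y':closure (R y' c0')" "X c0':closure (R y' c0')" "X c0':closure (R c0' k)"
  using cyc_X[OF cyc_rotate[OF cy1]] cyc_X[OF cyc_rotate[OF cyc_rotate[OF cy1]]] by auto
 have X2: "X c0':closure (R k' c0')" "X c0':closure (R c0' y')" "X y':closure (R c0' y')" "X y':closure (R y' k')"
  using cyc_X[OF cyc_rotate[OF cy2]] cyc_X[OF cyc_rotate[OF cyc_rotate[OF cy2]]] by auto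
 have S1: "closure (R y' c0')<=closure (R y' k)" "closure (R y' c0')<=closure (R k c0')"
  using cyc_sub[OF cyc_rotate[OF cyc_rotate[OF cy1]]] cyc_sub[OF cyc_rotate[OF cy1]] by (auto intro!: closure_mono)
 have S2': "closure (R c0' y')<=closure (R c0' k')" "closure (R c0' y')<=closure (R k' y')"
  using cyc_sub[OF cyc_rotate[OF cyc_rotate[OF cy2]]] cyc_sub[OF cyc_rotate[OF cy2]] by (auto intro!: closure_mono)
 have "bf A y' c0' \<or> bf A c0' y'" using bf_total[OF c Ec(2,1)] e(1) by (auto simp: neq_def)
 thus False
 proof
  assume b: "bf A y' c0'"
  have "bf A k c0' \<or> bf A y' k" using bf_split[OF c b Ec(3)] kc Ec by auto
  thus False
  proof
   assume "bf A k c0'"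
   hence "X y':closure (R c0' k)" using bf_K[OF c] e(12) by blast
   hence "X y':Jim c0' k" using inJ[OF nk(3)] X1 S1 by blast
   thus False using Jsub[OF nk(3)] e by blast
  next
   assume "bf A y' k"
   hence "X c0':closure (R k y')" using bf_K[OF c] e(11) by blast
   hence "X c0':Jim k y'" using inJ[OF e(2)] X1 S1 by blast
   thus False using e by blast
  qed
 next
  assume b: "bf A c0' y'"
  have "bf A k' y' \<or> bf A c0' k'" using bf_split[OF c b Ec(4)] kc Ec by auto
  thus False
  proof
   assume "bf A k' y'"
   hence "X c0':closure (R y' k')" using bf_K[OF c] e(11) by blast
   hence "X c0':Jim k' y'" using inJ[OF e(3)] X2 S2' by blast
   thus False using e by blast
  next
   assume "bf A c0' k'"
   hence "X y':closure (R k' c0')" using bf_K[OF c] e(12) by blast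
   hence "X y':Jim k' c0'" using inJ[OF nk(2)] X2 S2' by blast
   thus False using Jsub[OF nk(2)] e by blast
  qed
 qed
qed

lemma K_singleton:
 assumes c: "cut A" obtains x where "K A = {x}" "x:S2"
proof -
 obtain x where x: "x:K A" using K_directed(3)[OF c] by blast
 have "y = x" if y: "y:K A" for y
 proof (rule ccontr)
  assume ne: "y ~= x"
  obtain G C where G: "countable G" "countable C" "ALL g:G. arc g & (pim g<=Zp \<or> pim g<=Zm)" "Zp Un Zm<=(\<Union>g\<in>G. pim g) Un C"
   using cover by blast
  have "countable (C Un (K A - (Zp Un Zm)))" using G(2) K_type1_finite[OF c] by (simp add: countable_finite)
  moreover have "K A<=(\<Union>g\<in>G. pim g) Un (C Un (K A - (Zp Un Zm)))" using G(4) by blast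
  ultimately obtain g gb where "g:G" "arc gb" "pim gb<=pim g" "pim gb<=K A"
   using continuum_contains_arc[OF K_directed(1,2)[OF c] y x ne G(1)] G(3) by metis
  thus False using K_no_arc[OF c] G(3) by (meson order_trans)
 qed
 thus thesis using that[of x] x K_directed(4)[OF c] by blast
qed

end

text \<open>The parameter is \<open>t / (1 - t)\<close>, so that the \<open>n\<close>-th path is run through on \<open>[n, n + 1]\<close>.\<close>
lemma infinite_concatenation:
 fixes p :: "nat => real => 'a::real_normed_vector"
 assumes p: "!!n. path (p n)" "!!n. pfn (p n) = pst (p (Suc n))"
  and lim: "!!e. e > 0 ==> EX N. ALL n>=N. pim (p n)<=ball x e"
 obtains q where "path q" "pst q = pst (p 0)" "pfn q = x" "pim q<=insert x (\<Union>n. pim (p n))"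
proof -
 define P where "P s = p (nat \<lfloor>s\<rfloor>) (s - real_of_int \<lfloor>s\<rfloor>)" for s :: real
 have Pn: "P s = p n (s - n)" if "s:{real n..real (Suc n)}" for s n
 proof (cases "s = real (Suc n)")
  case True
  thus ?thesis using p(2)[of n] by (simp add: P_def pfn_def pst_def nat_add_distrib)
 next
  case False
  hence "\<lfloor>s\<rfloor> = int n" using that by (intro floor_unique) auto
  thus ?thesis by (simp add: P_def)
 qed
 have cn: "continuous_on {real n..real (Suc n)} P" for n
 proof -
  have "continuous_on {real n..real (Suc n)} (%s. p n (s - n))"
   by (rule continuous_on_compose2[of "{0..1}" "p n"]) (use p(1)[of n] in \<open>auto simp: path_def intro!: continuous_intros\<close>)
  thus ?thesis by (rule continuous_on_eq) (use Pn in auto)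
 qed
 have c0: "continuous_on {0..real n} P" for n
 proof (induction n)
  case (Suc n)
  have "{0..real (Suc n)} = {0..real n} Un {real n..real (Suc n)}" by auto
  thus ?case using continuous_on_closed_Un[of "{0..real n}" "{real n..real (Suc n)}" P] Suc cn[of n] by simp
 qed auto
 define q where "q t = (if t = 1 then x else P (t / (1 - t)))" for t :: real
 have Pin: "EX n. s:{real n..real (Suc n)} & real n > s - 1 & P s:pim (p n)" if "s >= 0" for s
 proof (intro exI conjI)
  have f: "real (nat \<lfloor>s\<rfloor>) = \<lfloor>s\<rfloor>" using that by simp
  show m: "s:{real (nat \<lfloor>s\<rfloor>)..real (Suc (nat \<lfloor>s\<rfloor>))}" using f that by auto linarith
  show "real (nat \<lfloor>s\<rfloor>) > s - 1" using f by linarith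
  show "P s:pim (p (nat \<lfloor>s\<rfloor>))" unfolding Pn[OF m] pim_def using m by auto
 qed
 have contq: "continuous (at t within {0..1}) q" if t: "t:{0..1}" for t
 proof (cases "t = 1")
  case False
  hence t1: "t < 1" "0<=t" using t by auto
  define r where "r = (1 + t) / 2"
  have r: "t < r" "r < 1" "0<=r" using t1 by (auto simp: r_def)
  obtain n where n: "r / (1 - r)<=real n" using real_arch_simple by blast
  have mono: "s / (1 - s):{0..real n}" if s: "0<=s" "s<=r" for s
  proof -
   have "s / (1 - s)<=r / (1 - r)" using s r by (intro frac_le) auto
   thus ?thesis using n s r by auto
  qed
  have "continuous_on {0..r} (%t. P (t / (1 - t)))"
   by (rule continuous_on_compose2[OF c0[of n]]) (use r mono in \<open>auto intro!: continuous_intros\<close>)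
  hence "continuous_on {0..r} q" by (rule continuous_on_eq) (use r in \<open>auto simp: q_def\<close>)
  hence "continuous (at t within {0..r}) q" using t1 r by (simp add: continuous_on_eq_continuous_within)
  moreover have "at t within {0..1} = at t within {0..r}"
   by (rule at_within_nhd[of _ "{..<r}"]) (use r in auto)
  ultimately show ?thesis by simp
 next
  case True
  have "EX d>0. ALL s:{0..1}. dist s 1 < d --> dist (q s) (q 1) < e" if e: "e > 0" for e
  proof -
   obtain N where N: "!!n. n >= N ==> pim (p n)<=ball x e" using lim[OF e] by blast
   have "dist (q s) (q 1) < e" if s: "s:{0..1}" "dist s 1 < 1 / (real N + 2)" for s
   proof (cases "s = 1")
    case False
    hence s': "0<=s" "0 < 1 - s" "1 - s < 1 / (real N + 2)" using s by (auto simp: dist_real_def)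
    have "(1 - s) * (real N + 2) < 1" using s' by (simp add: field_simps)
    hence big: "real N + 1 < s / (1 - s)" using s' by (simp add: field_simps)
    then obtain n where n: "real n > s / (1 - s) - 1" "P (s / (1 - s)):pim (p n)" using Pin[of "s / (1 - s)"] s' by auto
    hence "n >= N" using big by linarith
    hence "P (s / (1 - s)):ball x e" using N n by blast
    thus ?thesis using False by (simp add: q_def dist_commute)
   qed (use e in auto)
   thus ?thesis by (intro exI[of _ "1 / (real N + 2)"]) auto
  qed
  thus ?thesis unfolding True continuous_within_eps_delta by blast
 qed
 hence "path q" by (simp add: path_def continuous_on_eq_continuous_within)
 moreover have "pst q = pst (p 0)" using Pn[of 0 0] by (simp add: q_def pst_def)
 moreover have "pim q<=insert x (\<Union>n. pim (p n))"
 proof -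
  have "q t:insert x (\<Union>n. pim (p n))" if "t:{0..1}" for t
   using Pin[of "t / (1 - t)"] that by (auto simp: q_def)
  thus ?thesis unfolding pim_def by blast
 qed
 ultimately show thesis using that by (simp add: q_def pfn_def)
qed

section \<open>The order has no gaps\<close>

context zip_based begin

lemma closure_R_boundary:
 assumes "neq a b" "connected T" "T Int closure (R a b) ~= {}" "~ T<=closure (R a b)" "T<=S2" shows "T Int Jim a b ~= {}"
proof
 assume a: "T Int Jim a b = {}"
 note f = R_facts[OF assms(1)] and f' = R_facts[OF neq_sym[OF assms(1)]]
 have J: "Jim b a = Jim a b" using mid_pair(11)[OF assms(1)] .
 have "T Int closure (R a b) Int closure (R b a) = {}" using f(5,8) f'(5,8) a J by blast
 moreover have "T<=closure (R a b) Un closure (R b a)" using f(3,5) f'(5) assms(5) J by blast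
 moreover have "T Int closure (R b a) ~= {}" using calculation(2) assms(4) by blast
 ultimately show False using connected_closedD[OF assms(2), of "closure (R a b)" "closure (R b a)"] assms(3) by blast
qed

lemma E_sub_eq: assumes "g:E" "h:E" "pim g<=pim h" shows "pim g = pim h"
proof (rule ccontr)
 assume "pim g ~= pim h"
 hence n: "neq g h" using assms by (simp add: neq_def)
 have "pim g Int g ` {br1 g h<..<br2 g h} = {}" using pd_neq[OF n] assms(3) by (auto simp: pd_def)
 moreover have "g ((br1 g h + br2 g h) / 2):pim g Int g ` {br1 g h<..<br2 g h}" using pd_neq[OF n] by (auto simp: pd_def pim_def)
 ultimately show False by blast
qed

text \<open>Just after \<open>X l\<close> the arc \<open>l\<close> bounds \<open>R l a\<close>,
  which is disjoint from \<open>R a b\<close>. If it ran in the closed cell there, it would run on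
  the boundary of the cell and off \<open>a\<close>, hence on \<open>b\<close>; by
  \<open>suffix\<close> and \<open>prefix\<close> all of \<open>l\<close> would lie on
  \<open>b\<close>.\<close>

lemma cyc_end_off_cell:
 assumes c: "cyc l a b" and X: "X l:Zp" and s: "s > tau l" "l ` {tau l<..<s}<=closure (R a b)"
 shows False
proof -
 have n: "neq l a" "neq a b" "neq b l" "neq l b" using c neq_sym by (auto simp: cyc_def)
 have E: "l:E" "b:E" using n by (auto simp: neq_def)
 note f = mid_facts[OF n(1)] and p = pd_neq[OF n(1), unfolded pd_def]
 have t2: "tau l < br2 l a" using f(10) X p disj by (auto simp: X_def less_le)
 define u where "u = min s (br2 l a)"
 have u: "u > tau l" "u<=s" "u<=br2 l a" "u<=1" using s t2 p by (auto simp: u_def)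
 have inb: "l v:pim b" if v: "v:{tau l<..<u}" for v
 proof -
  have v': "v:{br1 l a<..<br2 l a}" using v u f(9) by auto
  hence na: "l v ~: pim a" using p by blast
  have "l v:closure (R a b)" using s(2) v u by auto
  moreover have "l v:pim (mid l a)" using f(2) v' by auto
  hence "l v:closure (R l a)" using R_facts(5)[OF n(1)] by (auto simp: Jim_def)
  moreover have "R l a Int R a b = {}" using cyc_disjoint[OF c] .
  hence "R a b Int closure (R l a) = {}"
   using R_open_meets[OF n(2)] R_facts(9)[OF n(1)] by blast
  ultimately have "l v:Jim a b" using R_facts(5)[OF n(2)] by blast
  thus ?thesis using mid_pair(9)[OF n(2)] na by blast
 qed
 have Zm: "l v ~: Zp" if "v:{tau l<..1}" for v using E_facts(8)[OF E(1)] that disj by auto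
 have sub1: "l v:pim b" if v: "v:{tau l<..1}" for v
 proof -
  define w where "w = (tau l + min u v) / 2"
  have w: "w:{tau l<..<u}" "w < v" "w:{0..1}" using u v E_facts(5)[OF E(1)] by (auto simp: w_def min_def)
  obtain r where r: "r:{0..1}" "l w = b r" using inb[OF w(1)] by (auto simp: pim_def)
  have "l ` {w..1} = b ` {r..1}" by (rule suffix[OF E w(3) r]) (use Zm w u in auto)
  moreover have "l v:l ` {w..1}" using w v by auto
  ultimately show ?thesis using r by (force simp: pim_def)
 qed
 have tl: "tau l:{0..1}" using E_facts[OF E(1)] by auto
 have "l (tau l):closure (l ` {tau l<..<u})"
 proof -
  have "continuous_on {tau l..u} l" using E_facts(1)[OF E(1)] u tl by (auto simp: arc_def path_def intro: continuous_on_subset)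
  moreover have "{tau l..u} = closure {tau l<..<u}" using u by simp
  ultimately have "l ` {tau l..u}<=closure (l ` {tau l<..<u})" by (metis closed_closure closure_subset image_closure_subset)
  thus ?thesis using u by auto
 qed
 moreover have "closed (pim b)" using E_facts(1)[OF E(2)] closed_arc_image by blast
 ultimately have "l (tau l):pim b" using inb closure_minimal[of "l ` {tau l<..<u}" "pim b"] by blast
 then obtain r where r: "r:{0..1}" "l (tau l) = b r" by (auto simp: pim_def)
 have "l ` {0..tau l} = b ` {0..r}" by (rule prefix[OF E tl r]) (use X disj in \<open>auto simp: X_def\<close>)
 hence "l ` {0..tau l}<=pim b" using r by (auto simp: pim_def)
 moreover have "{0..1}<={0..tau l} Un {tau l<..1}" by auto
 hence "pim l<=l ` {0..tau l} Un l ` {tau l<..1}" unfolding pim_def by blast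
 ultimately have "pim l<=pim b" using sub1 by blast
 thus False using E_sub_eq[OF E] n by (simp add: neq_def)
qed

text \<open>The tails in \<open>Z\<^sup>-\<close> of the branch points of shrinking nested cells fit together to a path ending at the limit point.\<close>
lemma cell_tail:
 assumes n: "neq a b" "neq a' b'" and sub: "closure (R a' b')<=closure (R a b)" and om': "om ~: closure (R a b)"
 obtains p where "path p" "pst p = a (br2 a b)" "pfn p = a' (br2 a' b')" "pim p<=closure (R a b) Int Zm"
proof -
 have E: "a:E" "b:E" "a':E" "b':E" using n by (auto simp: neq_def)
 define q where "q = a' (br2 a' b')"
 note p = pd_neq[OF n(1), unfolded pd_def] and p' = pd_neq[OF n(2), unfolded pd_def]
 have qZ: "q:Zm" unfolding q_def using p' by blast
 have qJ: "q:closure (R a b)"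
 proof -
  have "q:pim (mid a' b')" using mid_facts(4)[OF n(2)] unfolding q_def by (metis pathfinish_in_path_image)
  thus ?thesis using sub R_facts(5)[OF n(2)] by (auto simp: Jim_def)
 qed
 have qin: "q:a' ` {br2 a' b'..u}" if "br2 a' b'<=u" for u using that unfolding q_def by (intro imageI) auto
 \<comment> \<open>The tail of \<open>a'\<close> ends in \<open>om\<close> and so must leave the
   cell. It stays in the cell up to its first time \<open>t\<close> on the loop, and from there the
   loop itself leads back through \<open>Zm\<close> to the branch point of \<open>a\<close> and
   \<open>b\<close>.\<close>
 define T where "T = {s:{br2 a' b'..1}. a' s:Jim a b}"
 have b01: "0<=br2 a' b'" "br2 a' b'<=1" using p' by auto
 have cont: "continuous_on {br2 a' b'..1} a'" using E_facts(1)[OF E(3)] b01 by (auto simp: arc_def path_def intro: continuous_on_subset)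
 have clJ: "closed (Jim a b)" using mid_facts(1)[OF n(1)] mid_facts(1)[OF neq_sym[OF n(1)]] closed_arc_image by (auto simp: Jim_def)
 have "T = {br2 a' b'..1} Int a' -` Jim a b" by (auto simp: T_def)
 hence clT: "compact T" using continuous_closed_preimage[OF cont _ clJ] by (metis closed_atLeastAtMost compact_Icc compact_Int_closed inf_left_idem)
 have sS: "a' ` {br2 a' b'..u}<=S2" if "u<=1" for u using E_facts(9)[OF E(3)] b01 that by auto
 have cona: "connected (a' ` {br2 a' b'..u})" if "u<=1" for u
  using cont that by (intro connected_continuous_image) (auto intro: continuous_on_subset)
 have "a' ` {br2 a' b'..1} Int Jim a b ~= {}"
 proof (rule closure_R_boundary[OF n(1) cona])
  show "a' ` {br2 a' b'..1} Int closure (R a b) ~= {}" using qJ qin[OF b01(2)] by blast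
  show "~ a' ` {br2 a' b'..1}<=closure (R a b)" using om' E_facts(3)[OF E(3)] b01 by (metis atLeastAtMost_iff image_subset_iff order_refl)
 qed (use sS in auto)
 hence "T ~= {}" by (auto simp: T_def)
 then obtain t where t: "t:T" "!!s. s:T ==> t<=s" using compact_attains_inf[OF clT] by blast
 have tt: "br2 a' b'<=t" "t<=1" "a' t:Jim a b" using t by (auto simp: T_def)
 have ZmT: "a' s:Zm" if "s:{br2 a' b'..1}" for s
 proof (cases "s = br2 a' b'")
  case False
  thus ?thesis using that mid_facts(10)[OF n(2)] E_facts(8)[OF E(3)] by auto
 qed (use qZ q_def in simp)
 have seg: "a' ` {br2 a' b'..t}<=closure (R a b)"
 proof (rule ccontr)
  assume na: "~ ?thesis"
  then obtain s where s: "s:{br2 a' b'..t}" "a' s ~: closure (R a b)" by blast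
  have "a' ` {br2 a' b'..s} Int Jim a b ~= {}"
  proof (rule closure_R_boundary[OF n(1) cona])
   show "a' ` {br2 a' b'..s} Int closure (R a b) ~= {}" using qJ qin[of s] s by auto
   show "~ a' ` {br2 a' b'..s}<=closure (R a b)" using s by force
  qed (use sS s tt in auto)
  then obtain w where w: "w:{br2 a' b'..s}" "a' w:Jim a b" by blast
  hence "w:T" using s tt by (auto simp: T_def)
  hence "w = t" using t(2) w s by force
  hence "s = t" using w s by auto
  thus False using s tt R_facts(5)[OF n(1)] by auto
 qed
 have "EX c d r. neq c d & Jim c d = Jim a b & c (br2 c d) = a (br2 a b) & r:{br1 c d..br2 c d} & a' t = c r"
 proof (cases "a' t:pim (mid a b)")
  case True
  thus ?thesis using mid_facts(2)[OF n(1)] n(1) by (intro exI[of _ a] exI[of _ b]) auto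
 next
  case False
  hence "a' t:pim (mid b a)" using tt by (auto simp: Jim_def)
  then obtain r where "r:{br1 b a..br2 b a}" "a' t = b r" using mid_facts(2)[OF neq_sym[OF n(1)]] by auto
  moreover have "b (br2 b a) = a (br2 a b)" using p by simp
  ultimately show ?thesis using neq_sym[OF n(1)] mid_pair(11)[OF n(1)] by metis
 qed
 then obtain c d r where c: "neq c d" "Jim c d = Jim a b" "c (br2 c d) = a (br2 a b)" "r:{br1 c d..br2 c d}" "a' t = c r" by blast
 have Ecd: "c:E" using c by (auto simp: neq_def)
 note pc = pd_neq[OF c(1), unfolded pd_def]
 have r01: "r:{0..1}" "r<=br2 c d" using c(4) pc by auto
 have "a' ` {t..1} = c ` {r..1}"
  by (rule suffix[OF E(3) Ecd]) (use tt b01 r01 c(5) ZmT[of t] disj in auto)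
 moreover have "a' ` {t..1}<=Zm" using ZmT tt by (intro image_subsetI) auto
 ultimately have "c ` {r..1}<=Zm" by simp
 hence cZ: "c ` {r..br2 c d}<=Zm" using pc by auto
 define P where "P = subpath (br2 c d) r c +++ subpath t (br2 a' b') a'"
 have pth: "path a'" "path c" using E_facts(1) E(3) Ecd arc_imp_path by auto
 have im1: "pim (subpath (br2 c d) r c) = c ` {r..br2 c d}" using r01 by (auto simp: path_image_subpath_gen closed_segment_eq_real_ivl)
 have im2: "pim (subpath t (br2 a' b') a') = a' ` {br2 a' b'..t}" using tt by (auto simp: path_image_subpath_gen closed_segment_eq_real_ivl)
 have "c ` {r..br2 c d}<=Jim a b" using mid_facts(2)[OF c(1)] c(2,4) by (auto simp: Jim_def)
 hence "c ` {r..br2 c d}<=closure (R a b)" using R_facts(5)[OF n(1)] by blast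
 moreover have "a' ` {br2 a' b'..t}<=Zm" using ZmT tt by auto
 moreover have "pim P = c ` {r..br2 c d} Un a' ` {br2 a' b'..t}" using im1 im2 c(5) by (simp add: P_def path_image_join)
 moreover have "path P" unfolding P_def using pth r01 pc tt b01 c(5) by (intro path_join_imp path_subpath) auto
 moreover have "pst P = a (br2 a b)" "pfn P = q" using c(3) by (auto simp: P_def q_def)
 ultimately show thesis using that[of P] seg cZ by (simp add: q_def)
qed

end

context zip_land begin

text \<open>The pieces from \<open>cell_tail\<close> concatenate to a path converging to
  \<open>x\<close>, in \<open>Zm\<close> except for its end. An arc \<open>l\<close> with its tail
  taken from this path enters each cell along the tail, so by \<open>cyc_end_off_cell\<close> it
  cannot lie outside the cell in the cyclic order.\<close>

lemma no_gap_core: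
 assumes ab: "!!n. neq (a n) (b n)" "!!n. closure (R (a (Suc n)) (b (Suc n)))<=closure (R (a n) (b n))"
  and x: "x:Zp" and lim: "!!e. e > 0 ==> EX N. closure (R (a N) (b N))<=ball x e" and om': "om ~: closure (R (a 0) (b 0))"
 obtains l where "l:E" "X l = x" "!!m. ~ cyc l (a m) (b m)"
proof -
 define D where "D n = closure (R (a n) (b n))" for n
 have mono: "D n<=D m" if "m<=n" for m n using lift_Suc_antimono_le[of D m n] ab(2) that by (auto simp: D_def)
 have omD: "om ~: D n" for n using om' mono[of 0 n] by (auto simp: D_def)
 define q where "q n = a n (br2 (a n) (b n))" for n
 have "EX p. path p & pst p = q n & pfn p = q (Suc n) & pim p<=D n Int Zm" for n
  using cell_tail[OF ab(1) ab(1) ab(2)[of n]] omD[of n] unfolding D_def q_def by metis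
 then obtain p where p: "!!n. path (p n)" "!!n. pst (p n) = q n" "!!n. pfn (p n) = q (Suc n)" "!!n. pim (p n)<=D n Int Zm" by metis
 have "EX N. ALL n>=N. pim (p n)<=ball x e" if "e > 0" for e
 proof -
  obtain N where N: "D N<=ball x e" using lim[OF \<open>e > 0\<close>] by (auto simp: D_def)
  have "pim (p n)<=ball x e" if "n >= N" for n using p(4)[of n] mono[OF that] N by blast
  thus ?thesis by blast
 qed
 note lim' = this
 obtain P where P: "path P" "pst P = q 0" "pfn P = x" "pim P<=insert x (\<Union>n. pim (p n))"
  using infinite_concatenation[of p x, OF p(1) _ lim'] p(2,3) by auto
 have q0: "q 0:Zm" using p(4)[of 0] p(2)[of 0] by (metis IntD2 pathstart_in_path_image subsetD)
 hence ne: "q 0 ~= x" using x disj by auto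
 obtain p0 where p0: "path p0" "pim p0<=Zm" "pst p0 = om" "pfn p0 = q 0"
  using pc(2) om q0 unfolding path_connected_def by blast
 have "path (rvp (p0 +++ P))" "pst (rvp (p0 +++ P)) = x" "pfn (rvp (p0 +++ P)) = om"
  using p0 P by auto
 moreover have "x ~= om" using x om disj by auto
 ultimately obtain v where v: "arc v" "pim v<=pim (rvp (p0 +++ P))" "pst v = x" "pfn v = om"
  using path_contains_arc[of "rvp (p0 +++ P)" x om] by metis
 have vsub: "pim v<=insert x (pim p0 Un (\<Union>n. pim (p n)))"
  using v(2) P(4) p0 P(2) by (auto simp: path_image_join)
 have vZ: "pim v<=insert x Zm" using vsub p0(2) p(4) by blast
 have rm: "reachm x (pim v)" unfolding reachm_def using v vZ by blast
 have xS: "x:S2" using x sub by auto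
 obtain U where U: "reachp x U" using reachp_exists[OF xS] by blast
 obtain l where l: "l:E" "X l = x" "l ` {tau l..1} = pim v" using reach_E[OF U rm xS] by metis
 have tl: "tau l:{0..1}" using E_facts[OF l(1)] by auto
 have "~ cyc l (a m) (b m)" for m
 proof
  assume c: "cyc l (a m) (b m)"
  \<comment> \<open>The finitely many pieces before stage \<open>m\<close> stay away from
    \<open>x\<close>, so close to \<open>x\<close> the tail of \<open>l\<close> runs in later
    pieces, hence in the cell of index \<open>m\<close>.\<close>
  define F where "F = pim p0 Un (\<Union>n<m. pim (p n))"
  have clF: "closed F" unfolding F_def using p(1) p0(1) by (intro closed_Un closed_UN) (auto simp: closed_path_image)
  have "F<=Zm" using p0(2) p(4) unfolding F_def by blast
  hence "x ~: F" using x disj by auto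
  then obtain e where e: "e > 0" "ball x e Int F = {}" using clF by (metis Compl_disjoint ComplI disjoint_eq_subset_Compl open_Compl openE compl_le_swap1 double_complement)
  have tl1: "tau l < 1"
  proof (rule ccontr)
   assume "~ ?thesis"
   hence "tau l = 1" using tl by auto
   hence "x = om" using l(2) E_facts(3)[OF l(1)] by (simp add: X_def)
   thus False using \<open>x ~= om\<close> by simp
  qed
  have "continuous_on {0..1} l" using E_facts(1)[OF l(1)] by (simp add: arc_def path_def)
  then obtain d where d: "d > 0" "!!s. s:{0..1} ==> dist s (tau l) < d ==> dist (l s) x < e"
   using tl e(1) l(2) unfolding continuous_on_iff X_def by metis
  define s where "s = min 1 (tau l + d)"
  have s: "s > tau l" using tl1 d by (auto simp: s_def)
  have "l ` {tau l<..<s}<=closure (R (a m) (b m))"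
  proof (rule image_subsetI)
   fix u assume u: "u:{tau l<..<s}"
   hence u': "u:{0..1}" "dist u (tau l) < d" "u:{tau l..1}" using tl by (auto simp: s_def dist_real_def)
   hence "l u:ball x e" using d(2) by (simp add: dist_commute)
   hence nF: "l u ~: F" using e by blast
   have "l u ~= x" using E_inj[OF l(1), of u "tau l"] u u' tl l(2) by (auto simp: X_def)
   moreover have "l u:pim v" using l(3) u' by blast
   ultimately obtain n where n: "l u:pim (p n)" using vsub nF by (auto simp: F_def)
   hence "n >= m" using nF by (auto simp: F_def not_le[symmetric])
   thus "l u:closure (R (a m) (b m))" using p(4)[of n] n mono[of m n] by (auto simp: D_def)
  qed
  thus False using cyc_end_off_cell[OF c _ s] l(2) x by simp
 qed
 thus thesis using that l by blast
qed

lemma no_gap_any: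
 assumes ab: "!!n. neq (a n) (b n)" "!!n. closure (R (a (Suc n)) (b (Suc n)))<=closure (R (a n) (b n))"
  and x: "x:Zp Un Zm" and lim: "!!e. e > 0 ==> EX N. closure (R (a N) (b N))<=ball x e" and ends: "x:Zp ==> om ~: closure (R (a 0) (b 0))" "x:Zm ==> op ~: closure (R (a 0) (b 0))"
 obtains l where "l:Ec" "X l = x" "!!m. ~ cyc l (a m) (b m)"
proof -
 have "EX l:E. X l = x & (ALL m. ~ cyc l (a m) (b m))"
 proof (cases "x:Zp")
  case True
  show ?thesis using no_gap_core[of a b x, OF ab True lim ends(1)[OF True]] by metis
 next
  case False
  hence xm: "x:Zm" using x by blast
  interpret sw: zip_land Zm Zp om op by (rule sw_land)
  define a' b' where "a' n = rvp (b n)" and "b' n = rvp (a n)" for n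
  have n': "neq (rvp (a' n)) (rvp (b' n))" for n using neq_sym[OF ab(1)] by (simp add: a'_def b'_def)
  hence nn: "sw.neq (a' n) (b' n)" for n by (simp add: sw_neq)
  have RR: "sw.R (a' n) (b' n) = R (a n) (b n)" for n using sw_R(1)[OF n'] by (simp add: a'_def b'_def)
  have RS: "closure (sw.R (a' (Suc n)) (b' (Suc n)))<=closure (sw.R (a' n) (b' n))" for n unfolding RR by (rule ab(2))
  have lim': "EX N. closure (sw.R (a' N) (b' N))<=ball x e" if "e > 0" for e unfolding RR by (rule lim[OF that])
  have o': "op ~: closure (sw.R (a' 0) (b' 0))" unfolding RR by (rule ends(2)[OF xm])
  obtain l where l: "l:sw.E" "sw.X l = x" "!!m. ~ sw.cyc l (a' m) (b' m)"
   using sw.no_gap_core[of a' b' x, OF nn RS xm lim' o'] by metis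
  have lE: "rvp l:E" using l(1) by (simp add: sw_E)
  have "~ cyc (rvp l) (a m) (b m)" for m
   using sw_cyc[of l "rvp (a m)" "rvp (b m)"] l(3)[of m] by (auto simp: a'_def b'_def)
  thus ?thesis using lE sw_X(2)[OF lE] l(2) by auto
 qed
 then obtain l where l: "l:E" "X l = x" "!!m. ~ cyc l (a m) (b m)" by blast
 have "~ cyc (rep l) (a m) (b m)" for m
  using cyc_cong[of "rep l" "a m" "b m" l "a m" "b m"] l rep[OF l(1)] ab(1)[of m] by (auto simp: neq_def)
 thus thesis using that[of "rep l"] l rep[OF l(1)] by (auto simp: Ec_def)
qed

end

lemma (in zip_land) type1_unique:
 assumes l: "l:Ec" "a:Ec" and X: "X l ~: Zp Un Zm" "X l:pim a" shows "l = a"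
proof (rule ccontr)
 assume "l ~= a"
 hence n: "neq l a" using Ec_neq l by blast
 have E: "l:E" "a:E" using l Ec_E by auto
 obtain r where r: "r:{0..1}" "X l = a r" using X(2) by (auto simp: pim_def)
 have ra: "r = tau a" using E_time_Zp[OF E(2), of r] E_time_Zm[OF E(2), of r] r X(1) by auto
 have t: "tau l:{0..1}" "tau a:{0..1}" "l (tau l) = a (tau a)" using E_facts(5,6) E r ra by (auto simp: X_def)
 have "l ` {0..tau l} = a ` {0..tau a}" by (rule prefix[OF E t]) (use X in \<open>auto simp: X_def\<close>)
 moreover have "l ` {tau l..1} = a ` {tau a..1}" by (rule suffix[OF E t]) (use X in \<open>auto simp: X_def\<close>)
 moreover have "{0..1} = {0..tau l} Un {tau l..1}" "{0..1} = {0..tau a} Un {tau a..1}" using t by auto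
 ultimately have "pim l = pim a" unfolding pim_def by (metis image_Un)
 thus False using n by (simp add: neq_def)
qed

context zip_order begin

lemma L_unbounded: assumes "a:L" obtains b c where "lt b a" "lt a c"
proof -
 have E: "a:E" "l0:E" using assms L_neq(4) Ec_E l0 by auto
 have *: "EX c:L. cyc p c q" if n: "neq p q" and p: "p = a & q = l0 \<or> p = l0 & q = a" for p q
 proof -
  obtain z where z: "z:R p q" "z:S2" "!!k. k:{a,l0} ==> z ~: pim k" using R_off[OF n, of "{a,l0}"] E by auto
  obtain c where c: "c:Ec" "X c = z" using Ec_at[OF z(2)] by blast
  have "z:pim c" using c E_facts(5,6)[OF Ec_E[OF c(1)]] by (auto simp: X_def pim_def)
  hence ne: "c ~= a" "c ~= l0" using z(3) by auto
  hence cL: "c:L" using c by (simp add: L_def)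
  have "neq c a" "neq c l0" using L_neq cL assms ne by auto
  thus ?thesis using X_in_R_cyc[OF n] p z c cL by blast
 qed
 note n = L_neq(1,2)[OF assms]
 obtain c where c: "c:L" "cyc a c l0" using *[OF n(2)] by blast
 obtain b where b: "b:L" "cyc l0 b a" using *[OF n(1)] by blast
 have "lt a c" "lt b a" using c b assms cyc_rotate by (auto simp: lt_def)
 thus thesis using that by blast
qed

end

context zip_full begin

lemma rebase: "l:Ec ==> zip_full Zp Zm op om l"
 using zip_full_axioms unfolding zip_full_def zip_order_def zip_order_axioms_def by auto

text \<open>The cell of such a cut is a point \<open>x\<close>. If \<open>x\<close> is in neither
  set, its only arc lies outside some cell across the gap, although \<open>x\<close> is in the
  closure of that cell. Otherwise cells across the gap shrink to \<open>x\<close>, and the arc from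
  \<open>no_gap_any\<close> is outside none of them. It belongs to one side of the cut, and the
  region between it and a further arc of that side would lie in all these cells.\<close>

lemma no_gap:
 assumes c: "cut A" and A: "A ~= {}" "!!a. a:A ==> EX a':A. lt a a'" and B: "L - A ~= {}" "!!b. b:L - A ==> EX b':L - A. lt b' b"
 shows False
proof -
 obtain x where x: "K A = {x}" "x:S2" using K_singleton[OF c] by blast
 have AL: "A<=L" using c by (simp add: cut_def)
 have KD: "x:closure (R a b)" if "a:A" "b:L - A" for a b
 proof -
  have "x:D a b" using x(1) that by (auto simp: K_def)
  moreover have "a ~= b" using that by auto
  ultimately show ?thesis by (simp add: D_def)
 qed
 show False
 proof (cases "x:Zp Un Zm")
  case False
  obtain l where l: "l:Ec" "X l = x" using Ec_at[OF x(2)] by blast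
  have "EX a:A. EX b:L - A. cyc l a b"
  proof (cases "l = l0")
   case True
   obtain a b where "a:A" "b:L - A" using A(1) B(1) by blast
   thus ?thesis using cut_lt[OF c] True by (auto simp: lt_def)
  next
   case nl: False
   hence lL: "l:L" using l by (simp add: L_def)
   show ?thesis
   proof (cases "l:A")
    case True
    obtain a where "a:A" "lt l a" using A(2) True by blast
    moreover obtain b where "b:L - A" using B(1) by blast
    ultimately show ?thesis using lt_cyc cut_lt[OF c] by blast
   next
    case False
    obtain b where "b:L - A" "lt b l" using B(2) False lL by blast
    moreover obtain a where "a:A" using A(1) by blast
    ultimately show ?thesis using lt_cyc cut_lt[OF c] cyc_rotate by metis
   qed
  qed
  then obtain a b where ab: "a:A" "b:L - A" "cyc l a b" by blast
  have n: "neq l a" "neq a b" using ab by (auto simp: cyc_def)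
  have "X l:closure (R l a)" using cyc_X[OF ab(3)] by auto
  moreover have "R a b Int closure (R l a) = {}" using disjoint_closure[OF n(2,1)] cyc_disjoint[OF ab(3)] by (simp add: Int_commute)
  moreover have "X l:closure (R a b)" using KD ab l by simp
  ultimately have "X l:Jim a b" using R_facts(5)[OF n(2)] by blast
  hence "X l:pim a \<or> X l:pim b" using mid_pair(9)[OF n(2)] by blast
  hence "l = a \<or> l = b" using type1_unique[OF l(1)] l False ab AL L_neq(4) by blast
  thus False using ab by (auto simp: cyc_def neq_def)
 next
  case True
  \<comment> \<open>The base point in the set not containing \<open>x\<close>; the cells have to
    avoid it to make \<open>no_gap_any\<close> applicable.\<close>
  define z where "z = (if x:Zp then om else op)"
  have zx: "z ~= x" using True op om disj by (auto simp: z_def)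
  define U where "U n = ball x (min (dist z x) (1 / (real n + 1)))" for n
  have UO: "open (U n)" "x:U n" "z ~: U n" for n using zx by (auto simp: U_def dist_commute)
  have step: "EX a:A. EX b:L - A. lt a0 a & lt b b0 & D a b<=U n" if a0: "a0:A" and b0: "b0:L - A" for a0 b0 n
  proof -
   obtain a1 b1 where ab1: "a1:insert l0 A" "b1:insert l0 (L - A)" "D a1 b1<=U n" using K_directed(5)[OF c UO(1)[of n]] x UO(2) by auto
   define a2 where "a2 = (if a1 = l0 \<or> lt a1 a0 then a0 else a1)"
   define b2 where "b2 = (if b1 = l0 \<or> lt b0 b1 then b0 else b1)"
   have a2: "a2:A" "a2 = a0 \<or> lt a0 a2" "a2 = a1 \<or> a1 = l0 \<or> lt a1 a2" using ab1 a0 lt_total[of a0 a1] AL by (auto simp: a2_def)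
   have b2: "b2:L - A" "b2 = b0 \<or> lt b2 b0" "b2 = b1 \<or> b1 = l0 \<or> lt b2 b1" using ab1 b0 lt_total[of b0 b1] by (auto simp: b2_def)
   obtain a where a: "a:A" "lt a2 a" using A(2) a2 by blast
   obtain b where b: "b:L - A" "lt b b2" using B(2) b2 by blast
   have "D a b<=D a1 b" by (rule D_mono1[OF c]) (use a b a2 ab1 lt_trans in auto)
   also have "\<dots> <= D a1 b1" by (rule D_mono2[OF c]) (use a b b2 ab1 lt_trans in auto)
   finally have "D a b<=U n" using ab1 by blast
   thus ?thesis using a b a2 b2 lt_trans by blast
  qed
  obtain a0 b0 where ab0: "a0:A" "b0:L - A" using A(1) B(1) by blast
  have "EX f. ALL n. (fst (f n):A & snd (f n):L - A & D (fst (f n)) (snd (f n))<=U n) & (lt (fst (f n)) (fst (f (Suc n))) & lt (snd (f (Suc n))) (snd (f n)))"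
  proof (rule dependent_nat_choice)
   show "EX y. fst y:A & snd y:L - A & D (fst y) (snd y)<=U 0" using step[OF ab0] by force
   fix y n assume "fst y:A & snd y:L - A & D (fst y) (snd y)<=U n"
   thus "EX y'. (fst y':A & snd y':L - A & D (fst y') (snd y')<=U (Suc n)) & lt (fst y) (fst y') & lt (snd y') (snd y)"
    using step[of "fst y" "snd y" "Suc n"] by force
  qed
  then obtain f where f: "!!n. fst (f n):A" "!!n. snd (f n):L - A" "!!n. D (fst (f n)) (snd (f n))<=U n"
    "!!n. lt (fst (f n)) (fst (f (Suc n)))" "!!n. lt (snd (f (Suc n))) (snd (f n))" by blast
  define a b where "a n = fst (f n)" and "b n = snd (f n)" for n
  have ab: "a n:A" "b n:L - A" "D (a n) (b n)<=U n" "lt (a n) (a (Suc n))" "lt (b (Suc n)) (b n)" for n using f by (auto simp: a_def b_def)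
  have ltab: "lt (a n) (b n)" for n using cut_lt[OF c] ab by blast
  have Dc: "D (a n) (b n) = closure (R (a n) (b n))" for n using lt_neq(1)[OF ltab[of n]] by (simp add: D_def)
  have mono: "D (a (Suc n)) (b (Suc n))<=D (a n) (b n)" for n
  proof -
   have "D (a (Suc n)) (b (Suc n))<=D (a n) (b (Suc n))" by (rule D_mono1[OF c]) (use ab in auto)
   also have "\<dots> <= D (a n) (b n)" by (rule D_mono2[OF c]) (use ab in auto)
   finally show ?thesis .
  qed
  have nn: "neq (a n) (b n)" for n using lt_neq(2)[OF ltab] .
  have lim: "EX N. closure (R (a N) (b N))<=ball x e" if "e > 0" for e
  proof -
   obtain N where "1 / (real N + 1) < e" using reals_Archimedean[OF \<open>e > 0\<close>] by (auto simp: inverse_eq_divide add.commute)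
   hence "U N<=ball x e" by (auto simp: U_def)
   thus ?thesis using ab(3)[of N] Dc[of N] by blast
  qed
  have z0: "z ~: closure (R (a 0) (b 0))" using ab(3)[of 0] Dc[of 0] UO(3) by blast
  obtain l where l: "l:Ec" "X l = x" "!!m. ~ cyc l (a m) (b m)"
  proof (rule no_gap_any[of a b x, OF nn _ True lim])
   show "closure (R (a (Suc n)) (b (Suc n)))<=closure (R (a n) (b n))" for n using mono Dc by simp
   show "x:Zp ==> om ~: closure (R (a 0) (b 0))" "x:Zm ==> op ~: closure (R (a 0) (b 0))" using z0 disj unfolding z_def by (metis, metis IntI emptyE)
  qed auto
  have small: False if p: "neq p q" "p:{l} Un UNIV" "l:{p, q}" "!!m. R p q<=R (a m) (b m)" for p q
  proof -
   have "l:E" using l Ec_E by auto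
   obtain w where w: "w:R p q" "w ~: pim l" using R_off[OF p(1), of "{l}"] \<open>l:E\<close> by auto
   have "x:pim l" using l E_facts(5,6)[OF \<open>l:E\<close>] by (auto simp: X_def pim_def)
   hence "dist x w > 0" using w by auto
   then obtain N where "closure (R (a N) (b N))<=ball x (dist x w)" using lim by blast
   hence "w:ball x (dist x w)" using p(4)[of N] w closure_subset by blast
   thus False by simp
  qed
  show False
  proof (cases "l = l0")
   case True thus False using l(3)[of 0] ltab[of 0] by (auto simp: lt_def)
  next
   case False
   hence lL: "l:L" using l by (simp add: L_def)
   show False
   proof (cases "l:A")
    case True
    obtain a' where a': "a':A" "lt l a'" using A(2) True by blast
    have "R l a'<=R (a m) (b m)" for m
    proof -
     have "~ lt l (a m)" using lt_cyc[OF _ ltab] l(3) by blast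
     hence "a m = l \<or> lt (a m) l" using lt_total[of l "a m"] lL ab AL by blast
     hence "lt (a m) a'" "R l a'<=R (a m) a'" using a' lt_trans cyc_sub(2)[OF lt_cyc, of "a m" l a'] by auto
     thus ?thesis using cyc_sub(1)[OF lt_cyc, of "a m" a' "b m"] cut_lt[OF c a'(1) ab(2)] by blast
    qed
    thus False using small[OF lt_neq(2)[OF a'(2)]] by blast
   next
    case False
    obtain b' where b': "b':L - A" "lt b' l" using B(2) False lL by blast
    have "R b' l<=R (a m) (b m)" for m
    proof -
     have "~ lt (b m) l" using lt_cyc[OF ltab] l(3) cyc_rotate by blast
     hence "b m = l \<or> lt l (b m)" using lt_total[of l "b m"] lL ab AL by blast
     moreover have "lt (a m) b'" using cut_lt[OF c] ab b' by blast
     ultimately show ?thesis using cyc_sub(2)[OF lt_cyc, of "a m" b' l] cyc_sub(1)[OF lt_cyc, of "a m" l "b m"] b' cut_lt[OF c ab(1)] lL False by blast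
    qed
    thus False using small[OF lt_neq(2)[OF b'(2)]] by blast
   qed
  qed
 qed
qed

text \<open>The empty and the full cut have the cell \<open>{X l0}\<close>, approached from the two
  sides of \<open>l0\<close>.\<close>

lemma shrink0:
 assumes U: "open U" "X l0:U"
 shows "EX b:L. closure (R l0 b)<=U" "EX a:L. closure (R a l0)<=U"
proof -
 have "L ~= {}"
 proof
  assume "L = {}"
  hence "Ec<={l0}" by (auto simp: L_def)
  hence "X l0 = y" if "y:S2" for y using Ec_at[OF that] by blast
  moreover have "op:S2" "om:S2" "op ~= om" using op om sub disj by auto
  ultimately show False by metis
 qed
 then obtain c where cL: "c:L" by blast
 have XJ: "X l0:closure (R l0 b)" "X l0:closure (R b l0)" if "b:L" for b
  using R_facts(5)[OF L_neq(1)[OF that]] R_facts(5)[OF L_neq(2)[OF that]] mid_pair(13,14)[OF L_neq(1)[OF that]] mid_pair(11)[OF L_neq(1)[OF that]] by auto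
 have XS: "X l0:S2" using X_S2 Ec_E l0 by blast
 have c1: "cut {}" and c2: "cut L" by (auto simp: cut_def lt_def)
 have "X l0:K {}" "X l0:K L" using XJ XS L_neq(5) by (auto simp: K_def D_def)
 hence k: "K {} = {X l0}" "K L = {X l0}" using K_singleton[OF c1] K_singleton[OF c2] by (metis singletonD)+
 obtain b where b: "b:insert l0 L" "D l0 b<=U" using K_directed(5)[OF c1 U(1)] k U by auto
 obtain a where a: "a:insert l0 L" "D a l0<=U" using K_directed(5)[OF c2 U(1)] k U by auto
 have S: "closure (R p q)<=S2" if "neq p q" for p q using R_facts(10)[OF that] .
 show "EX b:L. closure (R l0 b)<=U" using b cL S[OF L_neq(1)[OF cL]] L_neq(5) by (cases "b = l0") (force simp: D_def)+
 show "EX a:L. closure (R a l0)<=U" using a cL S[OF L_neq(2)[OF cL]] L_neq(5) by (cases "a = l0") (force simp: D_def)+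
qed

lemma shrink:
 assumes l: "l:Ec" and U: "open U" "X l:U"
 shows "EX b:Ec - {l}. closure (R l b)<=U" "EX a:Ec - {l}. closure (R a l)<=U"
proof -
 interpret z: zip_full Zp Zm op om l by (rule rebase[OF l])
 show "EX b:Ec - {l}. closure (R l b)<=U" "EX a:Ec - {l}. closure (R a l)<=U" using z.shrink0[OF U] by (auto simp: z.L_def)
qed

lemma shrink_lt:
 assumes l: "l:L" and U: "open U" "X l:U"
 shows "EX b. lt l b & closure (R l b)<=U" "EX a. lt a l & closure (R a l)<=U"
proof -
 obtain a' b' where ab: "lt a' l" "lt l b'" using L_unbounded[OF l] by blast
 have lE: "l:Ec" using l L_neq by auto
 obtain b where b: "b:Ec - {l}" "closure (R l b)<=U" using shrink(1)[OF lE U] by blast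
 obtain a where a: "a:Ec - {l}" "closure (R a l)<=U" using shrink(2)[OF lE U] by blast
 have "cyc l b' b" if "~ lt l b" "b ~= b'"
 proof (cases "b = l0")
  case True thus ?thesis using ab cyc_rotate by (auto simp: lt_def)
 next
  case False
  hence "lt b l" using lt_total[of b l] that b l by (auto simp: L_def)
  thus ?thesis using lt_cyc ab cyc_rotate by blast
 qed
 hence "b = b' \<or> lt l b \<or> closure (R l b')<=closure (R l b)" using cyc_sub(1) closure_mono by blast
 thus "EX b. lt l b & closure (R l b)<=U" using ab b by blast
 have "cyc a a' l" if "~ lt a l" "a ~= a'"
 proof (cases "a = l0")
  case True thus ?thesis using ab by (auto simp: lt_def)
 next
  case False
  hence "lt l a" using lt_total[of a l] that a l by (auto simp: L_def)
  thus ?thesis using lt_cyc ab cyc_rotate by blast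
 qed
 hence "a = a' \<or> lt a l \<or> closure (R a' l)<=closure (R a l)" using cyc_sub(2) closure_mono by blast
 thus "EX a. lt a l & closure (R a l)<=U" using ab a by blast
qed

end

section \<open>Parametrisation of the order by the circle\<close>

lemma S2_dist: "x:S2 ==> y:S2 ==> dist x y<=2"
 using dist_triangle2[of x y 0] by (simp add: S2_def dist_norm)

context zip_full begin

definition C where "C l = closure (R l0 l)"

lemma C_facts: assumes "l:L" shows "closed (C l) & C l ~= {} & C l<=S2 & X l:C l"
 using R_facts(1,5,10)[OF L_neq(1)[OF assms]] mid_pair(14)[OF L_neq(1)[OF assms]] closed_closure[of "R l0 l"] unfolding C_def by blast

lemma C_cover:
 assumes ab: "lt a b" shows "C b<=C a Un closure (R a b)"
proof (rule ccontr)
 assume "~ ?thesis"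
 then obtain y where y: "y:C b" "y ~: C a Un closure (R a b)" by blast
 have c: "cyc l0 a b" and L: "a:L" "b:L" using ab by (auto simp: lt_def)
 have E: "{l0, a, b}<=E" using L L_neq(4) l0 Ec_E by auto
 define V where "V = - (C a Un closure (R a b))"
 have V: "open V" "y:V" using y by (auto simp: V_def C_def)
 hence "V Int R l0 b ~= {}" using y(1) open_Int_closure_eq_empty[of V "R l0 b"] by (auto simp: C_def)
 then obtain z where z: "z:V" "z:R l0 b" "!!k. k:{l0, a, b} ==> z ~: pim k"
  using R_offcurves[OF L_neq(1)[OF L(2)] V(1) _ _ E] by auto
 have "z ~: R l0 a" "z ~: R a b" using z(1) closure_subset by (auto simp: V_def C_def)
 moreover have "z ~: R b l0" using z(2) R_facts(2)[OF L_neq(1)[OF L(2)]] by auto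
 moreover have "z:S2" using z(2) R_facts(9)[OF L_neq(1)[OF L(2)]] by auto
 ultimately show False using c z(3) by (auto simp: cyc_def)
qed

text \<open>\<open>C b\<close> exceeds \<open>C a\<close> only inside the ball of radius
  \<open>e\<close>, and this ball also contains the point \<open>X a\<close> of
  \<open>C a\<close>.\<close>

lemma infdist_C:
 assumes ab: "lt a b" and sm: "closure (R a b)<=ball w e"
 shows "infdist z (C b)<=infdist z (C a)" "infdist z (C a)<=infdist z (C b) + 2 * e"
proof -
 have L: "a:L" "b:L" using ab by (auto simp: lt_def)
 note fa = C_facts[OF L(1)] and fb = C_facts[OF L(2)]
 have "C a<=C b" unfolding C_def using lt_sub(1)[OF ab] by (rule closure_mono)
 thus "infdist z (C b)<=infdist z (C a)" using fa by (intro infdist_mono) auto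
 obtain y where y: "y:C b" "infdist z (C b) = dist z y" using infdist_attains_inf[of "C b" z] fb by metis
 have Xa: "X a:ball w e" using sm R_facts(5)[OF lt_neq(2)[OF ab]] mid_pair(13)[OF lt_neq(2)[OF ab]] by auto
 hence e: "e > 0" by (metis dist_self zero_less_dist_iff mem_ball le_less_trans zero_le_dist)
 show "infdist z (C a)<=infdist z (C b) + 2 * e"
 proof (cases "y:C a")
  case True thus ?thesis using infdist_le[OF True, of z] y e by simp
 next
  case False
  hence "y:ball w e" using C_cover[OF ab] y sm by blast
  hence "dist y (X a) < 2 * e" using Xa dist_triangle3[of y "X a" w] by simp
  hence "dist z (X a)<=dist z y + 2 * e" using dist_triangle[of z "X a" y] by simp
  thus ?thesis using infdist_le[of "X a" "C a" z] fa y by simp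
 qed
qed

text \<open>The sets \<open>C l\<close> grow strictly with \<open>l\<close>, so the weighted sum of
  their distances to a dense sequence decreases strictly and its negative \<open>h\<close> embeds
  the order into the reals. Shrinking cells make \<open>h\<close> continuous, \<open>no_gap\<close>
  then excludes holes in its range, and the range is an open interval, which is stretched to the
  parameters between 0 and \<open>2 * pi\<close>; the base arc gets the parameter 0.\<close>

lemma param:
 obtains e where "e 0 = l0" "bij_betw e {0..<2 * pi} Ec" "!!s t. 0 < s ==> s < t ==> t < 2 * pi ==> lt (e s) (e t)"
proof -
 obtain T where T: "countable T" "T<=S2" "S2<=closure T" using separable[of S2] by metis
 have Tne: "T ~= {}" using T(3) S2_nonempty by auto
 define z where "z = from_nat_into T"
 have rz: "range z = T" unfolding z_def using range_from_nat_into[OF Tne T(1)] .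
 hence zS: "z n:S2" for n using T(2) by blast
 define h where "h l = - (\<Sum>n. (1/2)^n * infdist (z n) (C l))" for l
 have bd: "0<=infdist (z n) (C l)" "infdist (z n) (C l)<=2" if "l:L" for l n
  using C_facts[OF that] infdist_le2[of "X l" "C l" "z n" 2] S2_dist[OF zS] by (auto intro: infdist_nonneg)
 have gs: "summable (%n. (1/2)^n * c)" for c :: real by (intro summable_mult2 summable_geometric) auto
 have gsum: "(\<Sum>n. (1/2)^n * c) = 2 * c" for c :: real using suminf_mult2[of "%n. (1/2)^n" c] suminf_geometric[of "1/2::real"] by (simp add: summable_geometric)
 have sm: "summable (%n. (1/2)^n * infdist (z n) (C l))" if "l:L" for l
  by (rule summable_comparison_test'[OF gs[of 2], of 0]) (use bd[OF that] in auto)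
 have mono: "h a < h b" if ab: "lt a b" for a b
 proof -
  have L: "a:L" "b:L" using ab by (auto simp: lt_def)
  note n = lt_neq(2)[OF ab]
  have le: "infdist (z n) (C b)<=infdist (z n) (C a)" for n

  proof (rule infdist_C(1)[OF ab, of 0 2])
   show "closure (R a b)<=ball 0 2" using R_facts(10)[OF n] by (auto simp: S2_def dist_norm)
  qed
  obtain y where y: "y:R a b" using R_facts(1)[OF n] by blast
  have "y:S2" using y R_facts(9)[OF n] by auto
  hence "y:closure T" using T(3) by blast
  hence "R a b Int T ~= {}" using R_open_meets[OF n y] T(2) by blast
  then obtain n0 where n0: "z n0:R a b" using rz by blast
  have zb: "infdist (z n0) (C b) = 0" using n0 lt_sub(2)[OF ab] closure_subset by (intro infdist_zero) (auto simp: C_def)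
  have "R a b Int C a = {}" unfolding C_def using disjoint_closure[OF n L_neq(1)[OF L(1)]] lt_sub(3)[OF ab] by (simp add: Int_commute)
  hence "infdist (z n0) (C a) ~= 0" using in_closed_iff_infdist_zero[of "C a" "z n0"] C_facts[OF L(1)] n0 by blast
  hence za: "infdist (z n0) (C a) > 0" using bd(1)[OF L(1), of n0] by simp
  have "0 < (\<Sum>n. (1/2)^n * infdist (z n) (C a) - (1/2)^n * infdist (z n) (C b))"
   by (rule suminf_pos2[of _ n0]) (use sm L le za zb in \<open>auto intro!: summable_diff mult_left_mono\<close>)
  thus ?thesis using suminf_diff[OF sm[OF L(1)] sm[OF L(2)]] by (simp add: h_def)
 qed
 \<comment> \<open>The bound \<open>2 * e\<close> of \<open>infdist_C\<close> times 2, the sum of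
   the weights.\<close>
 have lip: "h b<=h a + 4 * e" if ab: "lt a b" "closure (R a b)<=ball w e" for a b w e
 proof -
  have L: "a:L" "b:L" using ab by (auto simp: lt_def)
  have "(\<Sum>n. (1/2)^n * infdist (z n) (C a))<=(\<Sum>n. (1/2)^n * infdist (z n) (C b) + (1/2)^n * (2 * e))"
  proof (rule suminf_le[OF _ sm[OF L(1)]])
   show "(1/2)^n * infdist (z n) (C a)<=(1/2)^n * infdist (z n) (C b) + (1/2)^n * (2 * e)" for n
    using infdist_C(2)[OF ab, of "z n"] by (simp add: distrib_left[symmetric] mult_left_mono)
  qed (intro summable_add sm L gs)
  also have "\<dots> = (\<Sum>n. (1/2)^n * infdist (z n) (C b)) + 4 * e" using suminf_add[OF sm[OF L(2)] gs[of "2 * e"]] gsum[of "2 * e"] by simp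
  finally show ?thesis by (simp add: h_def)
 qed
 have inj: "h a < h b \<longleftrightarrow> lt a b" if "a:L" "b:L" for a b using mono lt_total[OF that] by (metis less_asym less_irrefl)
 have right: "EX b. lt a b & h b < h a + e" if "a:L" "e > 0" for a e
 proof -
  obtain b where b: "lt a b" "closure (R a b)<=ball (X a) (e / 8)" using shrink_lt(1)[OF \<open>a:L\<close>, of "ball (X a) (e / 8)"] \<open>e > 0\<close> by auto
  thus ?thesis using lip[OF b] that by auto
 qed
 have left: "EX a. lt a b & h b < h a + e" if "b:L" "e > 0" for b e
 proof -
  obtain a where a: "lt a b" "closure (R a b)<=ball (X b) (e / 8)" using shrink_lt(2)[OF \<open>b:L\<close>, of "ball (X b) (e / 8)"] \<open>e > 0\<close> by auto
  thus ?thesis using lip[OF a] that by auto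
 qed
 have ivt: "EX l:L. h l = t" if ab: "a:L" "b:L" "h a < t" "t < h b" for a b t
 proof (rule ccontr)
  assume no: "~ ?thesis"
  define A where "A = {l:L. h l < t}"
  have "cut A" using mono by (auto simp: cut_def A_def lt_def intro: less_trans)
  thus False
  proof (rule no_gap)
   fix a assume a: "a:A"
   then obtain b where b: "lt a b" "h b < h a + (t - h a)" using right[of a "t - h a"] by (auto simp: A_def)
   thus "EX a':A. lt a a'" by (auto simp: A_def lt_def)
  next
   fix b assume b: "b:L - A"
   hence "h b > t" using no by (auto simp: A_def)
   then obtain a where a: "lt a b" "h b < h a + (h b - t)" using left[of b "h b - t"] b by (auto simp: A_def)
   thus "EX b':L - A. lt b' b" by (auto simp: A_def lt_def)
  qed (use ab in \<open>auto simp: A_def\<close>)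
 qed
 have Lne: "L ~= {}" using shrink0(1)[of UNIV] by auto
 have hb: "- 4<=h l" "h l<=0" if "l:L" for l
 proof -
  have "(\<Sum>n. (1/2)^n * infdist (z n) (C l))<=(\<Sum>n. (1/2)^n * 2)" by (rule suminf_le[OF _ sm[OF that] gs]) (use bd[OF that] in auto)
  thus "- 4<=h l" using gsum[of 2] by (simp add: h_def)
  show "h l<=0" using suminf_nonneg[OF sm[OF that]] bd[OF that] by (simp add: h_def)
 qed
 define m M where "m = Inf (h ` L)" and "M = Sup (h ` L)"
 have bdd: "bdd_below (h ` L)" "bdd_above (h ` L)" using hb by (auto intro!: bdd_belowI2[of _ "-4"] bdd_aboveI2[of _ _ 0])
 have mM: "m < h l" "h l < M" if l: "l:L" for l
 proof -
  obtain b c where bc: "lt b l" "lt l c" using L_unbounded[OF l] by blast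
  have "m<=h b" "h c<=M" unfolding m_def M_def using bdd bc by (auto simp: lt_def intro!: cInf_lower cSup_upper)
  thus "m < h l" "h l < M" using mono[OF bc(1)] mono[OF bc(2)] by auto
 qed
 have onto: "EX l:L. h l = t" if t: "m < t" "t < M" for t
 proof -
  obtain a where "a:L" "h a < t" using t(1) cInf_lessD[of "h ` L" t] Lne by (auto simp: m_def)
  moreover obtain b where "b:L" "t < h b" using t(2) less_cSupD[of "h ` L" t] Lne by (auto simp: M_def)
  ultimately show ?thesis using ivt by blast
 qed
 have lm: "m < M" using Lne mM by (meson equals0I less_trans)
 define c where "c s = m + (M - m) * s / (2 * pi)" for s
 have cm: "c s < c t \<longleftrightarrow> s < t" for s t using lm by (simp add: c_def divide_less_cancel)
 have c0: "c 0 = m" "c (2 * pi) = M" by (auto simp: c_def)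
 have ci: "c (2 * pi * (t - m) / (M - m)) = t" for t using lm by (simp add: c_def)
 define e where "e s = (if s = 0 then l0 else (SOME l. l:L & h l = c s))" for s
 have e: "e s:L & h (e s) = c s" if s: "0 < s" "s < 2 * pi" for s
 proof -
  have "m < c s" "c s < M" using cm[of 0 s] cm[of s "2 * pi"] c0 s by auto
  hence "EX l. l:L & h l = c s" using onto by blast
  hence "(SOME l. l:L & h l = c s):L & h (SOME l. l:L & h l = c s) = c s" by (rule someI_ex)
  thus ?thesis using s by (simp add: e_def)
 qed
 have lt: "lt (e s) (e t)" if "0 < s" "s < t" "t < 2 * pi" for s t using e[of s] e[of t] inj[of "e s" "e t"] cm[of s t] that by simp
 have "inj_on e {0..<2 * pi}"
 proof (rule inj_onI)
  fix s t assume st: "s:{0..<2 * pi}" "t:{0..<2 * pi}" "e s = e t"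
  have z: "x = 0" if "e x = l0" "x:{0..<2 * pi}" for x using e[of x] that L_neq(5) by force
  have e0: "e 0 = l0" by (simp add: e_def)
  show "s = t"
  proof (rule ccontr)
   assume "s ~= t"
   hence "s > 0" "t > 0" using z[of s] z[of t] st e0 by (auto simp: less_le)
   thus False using lt[of s t] lt[of t s] st \<open>s ~= t\<close> lt_neq(1) by (metis atLeastLessThan_iff linorder_neqE_linordered_idom)
  qed
 qed
 moreover have "e ` {0..<2 * pi} = Ec"
 proof
  show "e ` {0..<2 * pi}<=Ec" using e l0 L_neq(4) by (force simp: e_def)
  have "l:e ` {0..<2 * pi}" if l: "l:Ec" for l
  proof (cases "l = l0")
   case True thus ?thesis by (intro image_eqI[of _ _ 0]) (auto simp: e_def)
  next
   case False
   hence lL: "l:L" using l by (simp add: L_def)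
   define s where "s = 2 * pi * (h l - m) / (M - m)"
   have cs: "c s = h l" using ci by (simp add: s_def)
   hence s: "0 < s" "s < 2 * pi" using cm[of 0 s] cm[of s "2 * pi"] c0 mM[OF lL] by auto
   hence "e s = l" using e[OF s] cs inj lL lt_total[of "e s" l] by (metis less_irrefl)
   thus ?thesis using s by force
  qed
  thus "Ec<=e ` {0..<2 * pi}" by blast
 qed
 ultimately have "bij_betw e {0..<2 * pi} Ec" by (simp add: bij_betw_def)
 thus thesis using that[of e] lt by (auto simp: e_def)
qed

end

section \<open>Intervals of the circle and their angular parameters\<close>

lemma cis_shift: "cis (t + 2 * pi * of_int k) = cis t"
 by (metis Ints_of_int cis_mult cis_multiple_2pi mult.right_neutral)

lemma cis_eqD: assumes "cis s = cis t" obtains k :: int where "t = s + 2 * pi * of_int k"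
proof -
 have "sin s = sin t & cos s = cos t" using assms by (simp add: complex_eq_iff)
 then obtain k :: int where "s = t + 2 * pi * of_int k" using sin_cos_eq_iff[of s t] by (auto simp: mult_ac)
 thus thesis using that[of "-k"] by simp
qed

lemma cis_inj: assumes "cis s = cis t" "\<bar>s - t\<bar> < 2 * pi" shows "s = t"
proof -
 obtain k :: int where k: "t = s + 2 * pi * of_int k" using cis_eqD[OF assms(1)] .
 hence "2 * pi * \<bar>of_int k\<bar> < 2 * pi * 1" using assms(2) by (simp add: abs_mult)
 hence "\<bar>real_of_int k\<bar> < 1" by (simp only: mult_less_cancel_left_pos[of "2 * pi"] pi_gt_zero mult_pos_pos zero_less_numeral)
 hence "k = 0" by linarith
 thus ?thesis using k by simp
qed

lemma two_pi_int: assumes "x < y + 2 * pi" "x = y + 2 * pi * real_of_int k" "k >= 1" shows False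
proof -
 have "2 * pi * real_of_int k >= 2 * pi * 1" using assms(3) by (intro mult_left_mono) auto
 thus False using assms by simp
qed

lemma ccw_param_unique_aux:
 assumes c: "ccw_param I a b" and d: "ccw_param I a' b'" and a': "a<=a'" "a'<=b" shows "a' = a" "b'<=b"
proof -
 have c': "a < b" "b < a + 2 * pi" "I = cis ` {a..b}" and d': "a' < b'" "b' < a' + 2 * pi" "I = cis ` {a'..b'}" using c d by (auto simp: ccw_param_def)
 show aa: "a' = a"
 proof (rule ccontr)
  assume "a' ~= a"
  hence lt: "a < a'" using a' by simp
  define t where "t = (max a (b' - 2 * pi) + a') / 2"
  have t: "a < t" "t < a'" "b' - 2 * pi < t" using lt d' by (auto simp: t_def max_def field_simps)
  have "cis t:cis ` {a'..b'}" using t a' c' d' by (metis atLeastAtMost_iff imageI less_imp_le order_trans)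
  then obtain s where s: "s:{a'..b'}" "cis t = cis s" by blast
  then obtain k :: int where k: "s = t + 2 * pi * of_int k" using cis_eqD by metis
  have "k >= 1"
  proof (rule ccontr)
   assume "~ 1<=k"
   hence "2 * pi * real_of_int k<=0" by (simp add: mult_le_0_iff)
   thus False using k s t by auto
  qed
  thus False using two_pi_int[of s t k] k s t by fastforce
 qed
 show "b'<=b"
 proof (rule ccontr)
  assume "~ b'<=b"
  hence "cis b':cis ` {a..b}" "b < b'" using c'(3) d' by auto
  then obtain s where s: "s:{a..b}" "cis b' = cis s" by blast
  thus False using cis_inj[of b' s] \<open>b < b'\<close> d' aa c' by auto
 qed
qed

lemma ccw_param_shift: "ccw_param I a b ==> ccw_param I (a + 2 * pi * of_int k) (b + 2 * pi * of_int k)"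
proof -
 assume a: "ccw_param I a b"
 have "{a + 2 * pi * of_int k..b + 2 * pi * of_int k} = (%t. t + 2 * pi * of_int k) ` {a..b}" by simp
 hence "cis ` {a + 2 * pi * of_int k..b + 2 * pi * of_int k} = cis ` {a..b}" by (simp only: image_image cis_shift)
 thus ?thesis using a by (simp add: ccw_param_def)
qed

lemma ccw_param_unique:
 assumes c: "ccw_param I a b" and d: "ccw_param I a' b'"
 obtains k :: int where "a' = a + 2 * pi * of_int k" "b' = b + 2 * pi * of_int k"
proof -
 have "cis a':cis ` {a..b}" using c d by (auto simp: ccw_param_def)
 then obtain t where t: "t:{a..b}" "cis a' = cis t" by blast
 then obtain k :: int where k: "t = a' + 2 * pi * of_int k" using cis_eqD by metis
 define a2 b2 where "a2 = a' + 2 * pi * of_int k" and "b2 = b' + 2 * pi * of_int k"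
 have d2: "ccw_param I a2 b2" unfolding a2_def b2_def by (rule ccw_param_shift[OF d])
 have e: "a2 = a" "b2<=b" using ccw_param_unique_aux[OF c d2] t k by (auto simp: a2_def)
 hence "b<=b2" using ccw_param_unique_aux(2)[OF d2 c] d2 by (auto simp: ccw_param_def)
 thus thesis using that[of "-k"] e by (simp add: a2_def b2_def)
qed

lemma iv_ends_eq: "ccw_param I a b ==> iv_ends I = {cis a, cis b}"
 unfolding iv_ends_def by (rule set_eqI) (simp, metis ccw_param_unique cis_shift)

lemma iv_le_eq: assumes c: "ccw_param I a b" shows "iv_le I s t \<longleftrightarrow> (EX u v. a<=u & u<=v & v<=b & s = cis u & t = cis v)"
proof
 assume "iv_le I s t"
 then obtain a' b' u v where h: "ccw_param I a' b'" "a'<=u" "u<=v" "v<=b'" "s = cis u" "t = cis v" by (auto simp: iv_le_def)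
 obtain k :: int where k: "a = a' + 2 * pi * of_int k" "b = b' + 2 * pi * of_int k" using ccw_param_unique[OF h(1) c] .
 show "EX u v. a<=u & u<=v & v<=b & s = cis u & t = cis v"
  using h k by (intro exI[of _ "u + 2 * pi * of_int k"] exI[of _ "v + 2 * pi * of_int k"]) (simp add: cis_shift)
qed (use c in \<open>auto simp: iv_le_def\<close>)

lemma Arg2pi_cis: "0<=t ==> t < 2 * pi ==> Arg2pi (cis t) = t"
 by (rule Arg2pi_unique[of 1]) (auto simp: cis_conv_exp)

lemma S1_lift:
 assumes z: "z:S1" shows "cis (Arg2pi (z / cis p) + p) = z"
proof -
 have "cmod (z / cis p) = 1" using z by (simp add: S1_def norm_divide)
 hence "z / cis p = cis (Arg2pi (z / cis p))" using Arg2pi_eq[of "z / cis p"] by (simp add: cis_conv_exp)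
 thus ?thesis by (simp add: cis_mult[symmetric])
qed

lemma S1_lift_cont:
 assumes "z0:S1" "z0 ~= cis p" shows "continuous (at z0) (%z. Arg2pi (z / cis p) + p)"
proof -
 have n: "cmod (z0 / cis p) = 1" using assms by (simp add: S1_def norm_divide)
 have "z0 / cis p ~: \<real>\<^sub>\<ge>\<^sub>0"
 proof
  assume a: "z0 / cis p : \<real>\<^sub>\<ge>\<^sub>0"
  hence "z0 / cis p = 1" using n by (auto simp: nonneg_Reals_def)
  thus False using assms by simp
 qed
 thus ?thesis by (intro continuous_intros continuous_at_compose[unfolded o_def, of _ "%z. z / cis p" Arg2pi] continuous_at_Arg2pi) auto
qed

lemma cis_homeo: assumes "b < a + 2 * pi" shows "EX k. homeomorphism {a..b} (cis ` {a..b}) cis k"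
proof (rule homeomorphism_compact)
 show "inj_on cis {a..b}" using assms by (intro inj_onI cis_inj) auto
qed (auto intro: continuous_intros)

text \<open>The circle has no cut points, so an interval misses some \<open>cis p\<close>; the
  branch of the argument cut at this point is continuous on the interval and maps it onto a compact
  interval of angles.\<close>

lemma closed_interval_ccw:
 assumes "closed_interval_S1 I" obtains a b where "ccw_param I a b"
proof -
 have I: "I<=S1" "I homeomorphic {0..1::real}" using assms by (auto simp: closed_interval_S1_def)
 then obtain h k where h: "homeomorphism {0..1::real} I h k" using homeomorphic_sym unfolding homeomorphic_def by blast
 have arch: "arc h" "pim h = I" using h by (auto simp: homeomorphism_def arc_def path_def pim_def intro: inj_on_inverseI)
 have "EX p. cis p ~: I"
 proof (rule ccontr)
  assume "~ ?thesis"
  hence sub: "range cis<=pim h" using arch by auto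
  show False
  proof (rule arc_no_noncut_points[OF arch(1) sub])
   fix w assume "w:range cis"
   then obtain p where p: "w = cis p" by auto
   have "range cis - {w} = cis ` {p<..<p + 2 * pi}"
   proof
    show "cis ` {p<..<p + 2 * pi}<=range cis - {w}"
    proof (rule image_subsetI)
     fix t assume "t:{p<..<p + 2 * pi}"
     thus "cis t:range cis - {w}" using p cis_inj[of p t] by auto
    qed
    show "range cis - {w}<=cis ` {p<..<p + 2 * pi}"
    proof
     fix z assume z: "z:range cis - {w}"
     hence "z:S1" by (auto simp: S1_def)
     hence e: "cis (Arg2pi (z / cis p) + p) = z" by (rule S1_lift)
     have "Arg2pi (z / cis p) ~= 0" using e z p by auto
     hence "Arg2pi (z / cis p) + p:{p<..<p + 2 * pi}" using Arg2pi_ge_0[of "z / cis p"] Arg2pi_lt_2pi[of "z / cis p"] by (auto simp: less_le)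
     thus "z:cis ` {p<..<p + 2 * pi}" using e by (metis imageI)
    qed
   qed
   thus "connected (range cis - {w})" by (simp add: connected_continuous_image continuous_on_cis)
  next
   have "inj_on cis {0..1}" using pi_gt3 by (intro inj_onI cis_inj) auto
   thus "infinite (range cis)" using finite_imageD[of cis "{0..1::real}"] by (metis finite_subset image_mono infinite_Icc subset_UNIV zero_less_one)
  qed
 qed
 then obtain p where p: "cis p ~: I" by blast
 define A where "A z = Arg2pi (z / cis p) + p" for z
 have cA: "continuous_on I A" using S1_lift_cont[of _ p] I p unfolding A_def by (intro continuous_at_imp_continuous_on) (metis subsetD)
 have eA: "cis (A z) = z" if "z:I" for z using S1_lift[of z p] that I by (auto simp: A_def)
 have ran: "p<=A z" "A z < p + 2 * pi" for z using Arg2pi_ge_0[of "z / cis p"] Arg2pi_lt_2pi[of "z / cis p"] by (auto simp: A_def)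
 have "connected I" "compact I" using arch by (auto simp: connected_arc_image compact_arc_image)
 hence "connected (A ` I)" "compact (A ` I)" using cA by (auto intro: connected_continuous_image compact_continuous_image)
 then obtain a b where ab: "A ` I = {a..b}" using connected_compact_interval_1 by metis
 have "I = cis ` A ` I" using eA by (auto simp: image_image)
 hence Ie: "I = cis ` {a..b}" using ab by simp
 have "a < b"
 proof (rule ccontr)
  assume "~ a < b"
  hence "{a..b}<={a}" by auto
  hence "I<={cis a}" using Ie by auto
  moreover have "h 0:I" "h 1:I" using arch(2) by (auto simp: pim_def)
  ultimately have "h 0 = h 1" by (metis singletonD subsetD)
  thus False using arch(1) by (auto simp: arc_def dest: inj_onD)
 qed
 moreover have "a:A ` I" "b:A ` I" using ab \<open>a < b\<close> by auto
 hence "b < a + 2 * pi" using ran by (smt (verit) imageE)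
 ultimately show thesis using that Ie by (simp add: ccw_param_def)
qed

lemma ccw_closed_interval: assumes "ccw_param I a b" shows "closed_interval_S1 I"
proof -
 have p: "a < b" "b < a + 2 * pi" "I = cis ` {a..b}" using assms by (auto simp: ccw_param_def)
 have "compact I" unfolding p(3) by (intro compact_continuous_image continuous_on_cis continuous_intros) auto
 moreover have "{a..b} homeomorphic I" using cis_homeo[OF p(2)] p(3) by (auto simp: homeomorphic_def)
 hence "I homeomorphic {0..1::real}" using homeomorphic_closed_intervals_real[OF p(1), of 0 1] by (meson homeomorphic_sym homeomorphic_trans zero_less_one)
 moreover have "I<=S1" unfolding p(3) S1_def by auto
 ultimately show ?thesis by (simp add: closed_interval_S1_def compact_imp_closed)
qed

section \<open>Closed disks on the sphere and their boundary loops\<close>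

lemma loop_shift:
 assumes J: "loop_in J" and a: "a:{0..1}"
 shows "loop_in (shiftpath a J)" "pim (shiftpath a J) = pim J" "Lr (shiftpath a J) = Lr J" "shiftpath a J 0 = J a"
proof -
 have j: "simple_path J" "pfn J = pst J" "pim J<=S2" using J by (auto simp: loop_in_def)
 show im: "pim (shiftpath a J) = pim J" using path_image_shiftpath[OF a j(2)] .
 show l: "loop_in (shiftpath a J)" unfolding loop_in_def using j a im simple_path_shiftpath[OF j(1,2)] closed_shiftpath[of J a] by auto
 show "shiftpath a J 0 = J a" using a by (simp add: shiftpath_def)
 show "Lr (shiftpath a J) = Lr J"
 proof (rule wnum_invariant_Lr[OF l J])
  fix b x assume b: "b:S2" "x:S2" "b ~: pim (shiftpath a J)" "x ~: pim (shiftpath a J)"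
  have c: "chart b o shiftpath a J = shiftpath a (chart b o J)" by (auto simp: shiftpath_def o_def)
  note p = path_chart[OF b(1) simple_path_imp_path[OF j(1)] j(3)]
  show "wnum b (shiftpath a J) x = wnum b J x"
  proof (cases "x = b")
   case False
   have "chart b x ~: pim (chart b o J)" using p(3) b im False by auto
   hence "winding_number (shiftpath a (chart b o J)) (chart b x) = winding_number (chart b o J) (chart b x)"
    using p(1) b im a j(2) by (intro winding_number_shiftpath) (auto simp: pathfinish_compose pathstart_compose)
   thus ?thesis using False c by (simp add: wnum_def)
  qed (simp add: wnum_def)
 qed (use im in auto)
qed

lemma disk_interior_open:
 assumes h: "continuous_on T h" "inj_on h T" "open (T::complex set)" "h ` T<=S2" and b: "b:S2" "b ~: h ` T"
 shows "open (chart b ` h ` T)"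
proof -
 have "continuous_on (h ` T) (chart b)" using chart_simps(5)[OF b(1)] h(4) b(2) by (auto intro: continuous_on_subset)
 hence "continuous_on T (chart b o h)" using h(1) by (intro continuous_on_compose)
 moreover have "inj_on (chart b o h) T"
 proof (rule comp_inj_on[OF h(2)], rule inj_onI)
  fix x y assume xy: "x:h ` T" "y:h ` T" "chart b x = chart b y"
  hence "x:S2" "y:S2" "x ~= b" "y ~= b" using h(4) b(2) by auto
  thus "x = y" using chart_simps(7)[OF b(1)] xy(3) by metis
 qed
 ultimately have "open ((chart b o h) ` T)" using invariance_of_domain h(3) by blast
 thus ?thesis by (simp add: image_comp)
qed

text \<open>The image of the open disk is connected and off the boundary curve, hence on one side,
  the left one after a suitable orientation. It is open there by invariance of domain and relatively
  closed, so it is the whole side.\<close>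

lemma disk_loop:
 assumes h: "homeomorphism (cball (0::complex) 1) D h k" and D: "D<=S2"
 obtains J where "loop_in J" "pim J = h ` sphere 0 1" "D = closure (Lr J)" "Lr J = h ` ball 0 1"
proof -
 note fin = that
 have hc: "continuous_on (cball 0 1) h" "h ` cball 0 1 = D" "inj_on h (cball 0 1)" using h by (auto simp: homeomorphism_def intro: inj_on_inverseI)
 define c where "c = circlepath 0 1"
 have c: "simple_path c" "pfn c = pst c" "pim c = sphere 0 1" by (auto simp: c_def simple_path_circlepath)
 define J0 where "J0 = h o c"
 have imJ0: "pim J0 = h ` sphere 0 1" using c(3) by (simp add: J0_def path_image_compose)
 have "simple_path J0" unfolding J0_def
  by (rule simple_path_continuous_image[OF c(1)]) (use hc c(3) in \<open>auto intro: continuous_on_subset inj_on_subset\<close>)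
 moreover have "pfn J0 = pst J0" using c(2) by (simp add: J0_def pathfinish_compose pathstart_compose)
 moreover have "h ` sphere 0 1<=D" using hc(2) sphere_cball[of 0 1] by blast
 ultimately have lJ0: "loop_in J0" using imJ0 D by (auto simp: loop_in_def)
 have hb: "h ` ball 0 1 = D - pim J0"
 proof -
  have "h ` (cball 0 1 - sphere 0 1) = h ` cball 0 1 - h ` sphere 0 1" using hc(3) sphere_cball[of 0 1] by (intro inj_on_image_set_diff) auto
  moreover have "cball (0::complex) 1 - sphere 0 1 = ball 0 1" by auto
  ultimately show ?thesis using hc(2) imJ0 by simp
 qed
 have conn: "connected (h ` ball 0 1)" using hc(1) ball_subset_cball[of 0 1] by (intro connected_continuous_image) (auto intro: continuous_on_subset)
 have key: thesis if J: "loop_in J" "pim J = pim J0" and sub: "h ` ball 0 1<=Lr J" for J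
 proof -
  have "Lr (rvp J) ~= {}" using loop_sides(1)[OF loop_in_reversepath[OF J(1)]] .
  then obtain b where b: "b:Lr (rvp J)" by blast
  note lc = Lr_chart[OF J(1) b]
  have bL: "b ~: Lr J" using b loop_sides(2)[OF J(1)] by blast
  have LS: "Lr J<=S2 - {b}" using loop_sides(3)[OF J(1)] bL by blast
  have op: "open (chart b ` h ` ball 0 1)"
   by (rule disk_interior_open) (use hc ball_subset_cball[of 0 1] sub LS lc(2) bL in \<open>auto intro: continuous_on_subset inj_on_subset\<close>)
  have "openin (top_of_set (Lr J)) (h ` ball 0 1)"
  proof -
   have "continuous_on (Lr J) (chart b)" using chart_simps(5)[OF lc(2)] LS by (rule continuous_on_subset)
   hence "openin (top_of_set (Lr J)) (Lr J Int chart b -` chart b ` h ` ball 0 1)" using op by (rule continuous_openin_preimage_gen)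
   moreover have "Lr J Int chart b -` chart b ` h ` ball 0 1 = h ` ball 0 1"
   proof
    show "Lr J Int chart b -` chart b ` h ` ball 0 1<=h ` ball 0 1"
    proof
     fix y assume "y:Lr J Int chart b -` chart b ` h ` ball 0 1"
     then obtain z where z: "y:Lr J" "z:h ` ball 0 1" "chart b y = chart b z" by auto
     thus "y:h ` ball 0 1" using chart_simps(7)[OF lc(2), of y z] LS sub by (metis DiffD1 DiffD2 insertI1 subsetD)
    qed
   qed (use sub in auto)
   ultimately show ?thesis by simp
  qed
  moreover have "closedin (top_of_set (Lr J)) (h ` ball 0 1)"
  proof -
   have "closed D" using hc compact_cball compact_continuous_image compact_imp_closed by metis
   moreover have "h ` ball 0 1 = Lr J Int D" using hb sub J(2) loop_sides(3)[OF J(1)] by blast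
   ultimately show ?thesis by (metis closedin_closed_Int)
  qed
  moreover have "h ` ball 0 1 ~= {}" by auto
  ultimately have eq: "h ` ball 0 1 = Lr J" using Lr_topology(1)[OF J(1)] unfolding connected_clopen by blast
  hence "D = closure (Lr J)" using Lr_topology(2)[OF J(1)] hb J(2) imJ0 \<open>h ` sphere 0 1<=D\<close> by auto
  thus thesis using fin[OF J(1)] eq J(2) imJ0 by metis
 qed
 have un: "h ` ball 0 1<=Lr J0 Un Lr (rvp J0)" using hb D loop_sides(3)[OF lJ0] by blast
 have "h ` ball 0 1<=Lr J0 \<or> h ` ball 0 1<=Lr (rvp J0)"
 proof (rule ccontr)
  assume n: "~ ?thesis"
  note t1 = Lr_topology(2)[OF lJ0] and t2 = Lr_topology(2)[OF loop_in_reversepath[OF lJ0]]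
  have off: "h ` ball 0 1 Int pim J0 = {}" using hb by blast
  have "h ` ball 0 1 Int closure (Lr J0) Int closure (Lr (rvp J0)) = {}" using off t1 t2 loop_sides(2)[OF lJ0] by auto
  moreover have "h ` ball 0 1<=closure (Lr J0) Un closure (Lr (rvp J0))" using un closure_subset by blast
  moreover have "h ` ball 0 1 Int closure (Lr J0) ~= {}" "h ` ball 0 1 Int closure (Lr (rvp J0)) ~= {}" using n un closure_subset by blast+
  ultimately show False using connected_closedD[OF conn _ _ closed_closure closed_closure, of "Lr J0" "Lr (rvp J0)"] by blast
 qed
 thus thesis using key[OF lJ0] key[OF loop_in_reversepath[OF lJ0]] by (auto simp: path_image_reversepath)
qed

lemma same_closure_loops:
 assumes "loop_in J" "loop_in J'" "closure (Lr J) = closure (Lr J')" shows "pim J = pim J'" "Lr J = Lr J'"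
proof -
 have *: "pim J<=pim J'" if J: "loop_in J" "loop_in J'" "closure (Lr J) = closure (Lr J')" for J J'
 proof -
  have rs: "Lr (rvp J) = Lr (rvp J')"
  proof -
   have "Lr (rvp J) = S2 - closure (Lr J)" if "loop_in J" for J using loop_sides(2,3)[OF that] Lr_topology(2)[OF that] by blast
   thus ?thesis using J by simp
  qed
  have "pim J = closure (Lr J) Int closure (Lr (rvp J))" if J: "loop_in J" for J
   using Lr_topology(2)[OF J] Lr_topology(2)[OF loop_in_reversepath[OF J]] loop_sides(2,3)[OF J] by (auto simp: path_image_reversepath)
  thus ?thesis using J rs by simp
 qed
 show e: "pim J = pim J'" using *[of J J'] *[of J' J] assms by auto
 have "Lr J = closure (Lr J) - pim J" if "loop_in J" for J using Lr_topology(2)[OF that] loop_sides(3)[OF that] by blast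
 thus "Lr J = Lr J'" using assms e by metis
qed

text \<open>\<open>disk_bdry\<close> selects an arbitrary homeomorphism; the outcome does not depend
  on it because a closed disk on the sphere determines its boundary curve.\<close>

lemma disk_bdry_loop: assumes J: "loop_in J" shows "disk_bdry (closure (Lr J)) = pim J"
proof -
 let ?P = "%B. EX h k. homeomorphism (cball (0::complex) 1) (closure (Lr J)) h k & B = h ` sphere 0 1"
 have DS: "closure (Lr J)<=S2" using Lr_topology(2)[OF J] loop_sides(3)[OF J] J by (auto simp: loop_in_def)
 have u: "B = pim J" if B: "?P B" for B
 proof -
  obtain h k where h: "homeomorphism (cball (0::complex) 1) (closure (Lr J)) h k" "B = h ` sphere 0 1" using B by blast
  obtain J' where "loop_in J'" "pim J' = h ` sphere 0 1" "closure (Lr J) = closure (Lr J')" using disk_loop[OF h(1) DS] by metis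
  thus ?thesis using same_closure_loops(1)[OF J, of J'] h by simp
 qed
 have "EX h k. homeomorphism (cball (0::complex) 1) (closure (Lr J)) h k" using Lr_topology(4)[OF J] unfolding closed_disk_def homeomorphic_def using homeomorphism_symD by blast
 hence "?P (disk_bdry (closure (Lr J)))" unfolding disk_bdry_def by (intro someI_ex[of ?P]) blast
 thus ?thesis by (rule u)
qed

lemma closed_disk_loop:
 assumes "closed_disk D" "D<=S2"
 obtains J where "loop_in J" "D = closure (Lr J)" "disk_bdry D = pim J"
proof -
 obtain h k where "homeomorphism D (cball (0::complex) 1) k h" using assms(1) unfolding closed_disk_def homeomorphic_def by blast
 hence "homeomorphism (cball 0 1) D h k" by (rule homeomorphism_symD)
 thus thesis using disk_loop[OF _ assms(2)] disk_bdry_loop that by metis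
qed

context zip_based begin

text \<open>Obtained by exchanging the two sets. The exchange reverses arcs, so with the region on
  the left this piece runs from \<open>X d\<close> to \<open>X c\<close>, opposite to
  \<open>arc_Zp\<close>; this is the origin of the two canonical orientations.\<close>

lemma arc_Zm:
 assumes n: "neq c d" and X: "X c:Zm" "X d:Zm" "X c ~= X d"
 obtains Q S where "closes Q S" "Lr (Q +++ S) = R c d" "pim Q<=Zm" "pst Q = X d" "pfn Q = X c" "pim Q Un pim S = Jim c d"
proof -
 interpret sw: zip_based Zm Zp om op by (rule sw_based)
 let ?r = "rvp :: _ => real => real^3"
 have nr: "neq (?r (?r d)) (?r (?r c))" using neq_sym[OF n] by simp
 hence ns: "sw.neq (?r d) (?r c)" by (simp add: sw_neq)
 have E: "c:E" "d:E" using n by (auto simp: neq_def)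
 have XX: "sw.X (?r c) = X c" "sw.X (?r d) = X d" using sw_X(2)[of "?r c"] sw_X(2)[of "?r d"] E by auto
 have RR: "sw.R (?r d) (?r c) = R c d" "sw.Jim (?r d) (?r c) = Jim c d" using sw_R[OF nr] mid_pair(11)[OF n] by auto
 obtain Q S where "closes Q S" "Lr (Q +++ S) = sw.R (?r d) (?r c)" "pim Q<=Zm" "pst Q = sw.X (?r d)" "pfn Q = sw.X (?r c)" "pim Q Un pim S = sw.Jim (?r d) (?r c)"
  using sw.arc_Zp[OF ns] X XX by metis
 thus thesis using that XX RR by metis
qed

text \<open>Two cells on opposite sides of a common boundary arc would both contain one side of the arc near an interior point.\<close>
lemma cells_opposite:
 assumes c1: "closes g s" and c2: "closes g' s'" and im: "pim g' = pim g" "pst g' = pfn g" "pfn g' = pst g"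
  and sub: "Lr (g +++ s)<=Lr (g' +++ s')"
 shows False
proof -
 have a: "arc g" "arc g'" using c1 c2 by (auto simp: closes_def)
 have cr: "closes (rvp g') (rvp s')" using closes_reverse[OF c2] .
 have cg: "closes g (rvp s')" "Lr (g +++ rvp s') = Lr (rvp g' +++ rvp s')"
  using Lr_closes_eq[OF cr a(1)] im by auto
 have eq: "Lr (g +++ rvp s') = Lr (rvp (g' +++ s'))" using cg(2) reversepath_closes[OF c2] by simp
 obtain d where d: "d > 0" "!!z. z:S2 ==> dist z (g (1/2)) < d ==> z ~: pim g ==> z:Lr (g +++ s) \<longleftrightarrow> z:Lr (g +++ rvp s')"
  using left_local[OF c1 cg(1), of "1/2"] by auto
 have "g (1/2):pim (g +++ s)" using closes_image[OF c1] by (auto simp: pim_def)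
 hence "g (1/2):closure (Lr (g +++ s))" using Lr_topology(2)[OF closes_loop[OF c1]] by blast
 then obtain z where z: "z:Lr (g +++ s)" "dist z (g (1/2)) < d" using d(1) by (auto simp: closure_approachable)
 have "z:S2" "z ~: pim g" using z(1) loop_sides(3)[OF closes_loop[OF c1]] closes_image[OF c1] by auto
 hence "z:Lr (rvp (g' +++ s'))" using d(2)[OF _ z(2)] z(1) eq by simp
 thus False using z(1) sub loop_sides(2)[OF closes_loop[OF c2]] by blast
qed

end

text \<open>A point of \<open>F\<close> between the two parameters, together with the base point of
  the loop, would divide the curve into two closed parts separating \<open>Y\<close>.\<close>

lemma loop_component_arc:
 assumes g: "loop_in g" and Y: "Y:components (pim g - F)" and F: "g 0:F" and uv: "0<=u" "u < v" "v<=1" "g u:Y" "g v:Y"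
 shows "g ` {u..v}<=Y" "0 < u" "v < 1"
proof -
 have s: "simple_path g" "pfn g = pst g" using g by (auto simp: loop_in_def)
 have g01: "g 1 = g 0" using s(2) by (simp add: pst_def pfn_def)
 have YF: "Y Int F = {}" "Y<=pim g" "connected Y" using Y in_components_subset in_components_connected by blast+
 show "0 < u" "v < 1" using uv YF F g01 by (metis disjoint_iff less_le)+
 have cont: "continuous_on {0..1} g" using s(1) simple_path_imp_path by (auto simp: path_def)
 have inj: "x = y \<or> (x = 0 & y = 1) \<or> (x = 1 & y = 0)" if "x:{0..1}" "y:{0..1}" "g x = g y" for x y
  using s(1) that by (auto simp: simple_path_def loop_free_def)
 have noF: "g w ~: F" if w: "w:{u..v}" for w
 proof
  assume wF: "g w:F"
  hence w': "u < w" "w < v" using w uv YF by (auto simp: less_le)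
  have cl: "closed (g ` {0..w})" "closed (g ` {w..1})"
   using cont uv w' by (auto intro!: compact_imp_closed compact_continuous_image intro: continuous_on_subset)
  have "Y<=g ` {0..w} Un g ` {w..1}"
  proof -
   have "{0..1} = {0..w} Un {w..1}" using w' uv by auto
   thus ?thesis using YF(2) unfolding pim_def by (metis image_Un)
  qed
  moreover have "Y Int g ` {0..w} Int g ` {w..1} = {}"
  proof -
   have "z:F" if z: "z:g ` {0..w} Int g ` {w..1}" for z
   proof -
    obtain x y where "x:{0..w}" "y:{w..1}" "z = g x" "g x = g y" using z by blast
    thus ?thesis using inj[of x y] w' uv F wF by auto
   qed
   thus ?thesis using YF by blast
  qed
  moreover have "g u:g ` {0..w}" "g v:g ` {w..1}" using uv w' by auto
  ultimately show False using connected_closedD[OF YF(3), of "g ` {0..w}" "g ` {w..1}"] cl uv by blast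
 qed
 have "connected (g ` {u..v})" using cont uv by (intro connected_continuous_image) (auto intro: continuous_on_subset)
 moreover have "g ` {u..v}<=pim g - F" using noF uv by (auto simp: pim_def)
 moreover have "g u:Y Int g ` {u..v}" using uv by auto
 ultimately show "g ` {u..v}<=Y" using components_maximal[OF Y] by blast
qed

lemma loop_component_two_points:
 assumes g: "loop_in g" and F: "finite F" and Y: "Y:components (pim g - F)"
 obtains x y where "x:Y" "y:Y" "x ~= y"
proof -
 obtain x where x: "x:Y" using in_components_nonempty[OF Y] by blast
 hence xF: "x:pim g" "x ~: F" using in_components_subset[OF Y] by auto
 then obtain u where u: "u:{0..1}" "g u = x" by (auto simp: pim_def)
 have cont: "continuous_on {0..1} g" using g simple_path_imp_path by (auto simp: loop_in_def path_def)
 have "open (- F)" using F by (simp add: finite_imp_closed open_Compl)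
 then obtain e where e: "e > 0" "ball x e <= - F" using xF by (meson ComplI openE)
 obtain d where d: "d > 0" "!!q. q:{0..1} ==> dist q u < d ==> dist (g q) (g u) < e" using cont u(1) e(1) unfolding continuous_on_iff by metis
 define db where "db = min (d / 2) (1 / 4)"
 have db: "0 < db" "db < d" "db<=1 / 4" using d by (auto simp: db_def)
 define q where "q = (if u<=1 / 2 then u + db else u - db)"
 have q: "q:{0..1}" "q ~= u" "\<bar>q - u\<bar> = db" using u db by (auto simp: q_def)
 have seg: "p:{0..1}" "dist p u < d" if "p:closed_segment u q" for p
  using that q u db by (auto simp: closed_segment_eq_real_ivl dist_real_def split: if_splits)
 have "connected (g ` closed_segment u q)" using cont seg by (intro connected_continuous_image) (auto intro: continuous_on_subset)
 moreover have "g ` closed_segment u q<=pim g - F"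
 proof (rule image_subsetI)
  fix p assume "p:closed_segment u q"
  note sp = seg[OF this]
  have "g p:ball x e" using d(2)[OF sp] u by (simp add: dist_commute)
  thus "g p:pim g - F" using sp e(2) by (auto simp: pim_def)
 qed
 moreover have "x:Y Int g ` closed_segment u q" using x u by auto
 ultimately have "g ` closed_segment u q<=Y" using components_maximal[OF Y] by blast
 hence "g q:Y" by auto
 moreover have "g q ~= x"
 proof
  assume "g q = x"
  hence "q = u \<or> q = 0 & u = 1 \<or> q = 1 & u = 0" using g u q(1) unfolding loop_in_def simple_path_def loop_free_def by blast
  thus False using q db by auto
 qed
 ultimately show thesis using that x by blast
qed

section \<open>The wheel of a zipper and its boundary arcs\<close>

locale zip_param = zip_full +
 fixes e
 assumes e0: "e 0 = l0" and e_bij: "bij_betw e {0..<2 * pi} Ec" and e_lt: "!!s t. 0 < s ==> s < t ==> t < 2 * pi ==> lt (e s) (e t)"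
begin

text \<open>The parametrisation made periodic, so that intervals across the base angle are ordinary
  real intervals.\<close>

definition ee where "ee t = e (Arg2pi (cis t))"
definition f where "f z = X (e (Arg2pi z))"

lemma f_cis: "f (cis t) = X (ee t)" by (simp add: f_def ee_def)

lemma ee_shift: "ee (t + 2 * pi * of_int k) = ee t" by (simp add: ee_def cis_shift)

lemma ee_Ec: "ee t:Ec"
 using e_bij Arg2pi_ge_0[of "cis t"] Arg2pi_lt_2pi[of "cis t"] by (auto simp: ee_def bij_betw_def)

lemma e_cyc: assumes "0<=x" "x < y" "y < z" "z < 2 * pi" shows "cyc (e x) (e y) (e z)"
proof (cases "x = 0")
 case True
 thus ?thesis using e_lt[of y z] assms e0 by (auto simp: lt_def)
next
 case False
 thus ?thesis using e_lt[of x y] e_lt[of y z] assms lt_cyc by auto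
qed

lemma ee_cyc: assumes "a < b" "b < c" "c < a + 2 * pi" shows "cyc (ee a) (ee b) (ee c)"
proof -
 have "cis (Arg2pi (cis a)) = cis a" using S1_lift[of "cis a" 0] by (simp add: S1_def)
 then obtain k :: int where k: "Arg2pi (cis a) = a + 2 * pi * of_int k" using cis_eqD by metis
 define a' b' c' where "a' = a + 2 * pi * of_int k" and "b' = b + 2 * pi * of_int k" and "c' = c + 2 * pi * of_int k"
 have ee': "ee a = ee a'" "ee b = ee b'" "ee c = ee c'" by (auto simp: a'_def b'_def c'_def ee_shift)
 have r: "0<=a'" "a' < 2 * pi" using k Arg2pi_ge_0[of "cis a"] Arg2pi_lt_2pi[of "cis a"] by (auto simp: a'_def)
 have o: "a' < b'" "b' < c'" "c' < a' + 2 * pi" using assms by (auto simp: a'_def b'_def c'_def)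
 have e1: "ee x = e x" if "0<=x" "x < 2 * pi" for x using that by (simp add: ee_def Arg2pi_cis)
 have e2: "ee x = e (x - 2 * pi)" if "2 * pi<=x" "x < 4 * pi" for x using e1[of "x - 2 * pi"] ee_shift[of "x" "-1"] that by simp
 consider "c' < 2 * pi" | "b' < 2 * pi" "2 * pi<=c'" | "2 * pi<=b'" by linarith
 thus ?thesis
 proof cases
  case 1
  thus ?thesis unfolding ee' using e1[of a'] e1[of b'] e1[of c'] e_cyc[of a' b' c'] r o by auto
 next
  case 2
  hence "cyc (e (c' - 2 * pi)) (e a') (e b')" using e_cyc r o by auto
  thus ?thesis unfolding ee' using e1[of a'] e1[of b'] e2[of c'] r o 2 cyc_rotate by auto
 next
  case 3
  hence "cyc (e (b' - 2 * pi)) (e (c' - 2 * pi)) (e a')" using e_cyc r o by auto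
  thus ?thesis unfolding ee' using e1[of a'] e2[of b'] e2[of c'] r o 3 cyc_rotate by auto
 qed
qed

lemma ee_onto: assumes "c:Ec" obtains t where "a<=t" "t < a + 2 * pi" "ee t = c"
proof -
 obtain s where s: "0<=s" "s < 2 * pi" "c = e s"
 proof -
  have "c:e ` {0..<2 * pi}" using assms bij_betw_imp_surj_on[OF e_bij] by simp
  thus thesis using that by auto
 qed
 have "cis (Arg2pi (cis s / cis a) + a) = cis s" by (rule S1_lift) (simp add: S1_def)
 hence "ee (Arg2pi (cis s / cis a) + a) = c" using s by (simp add: ee_def Arg2pi_cis)
 thus thesis using that[of "Arg2pi (cis s / cis a) + a"] Arg2pi_ge_0[of "cis s / cis a"] Arg2pi_lt_2pi[of "cis s / cis a"] by auto
qed

lemma ee_neq: assumes "a < b" "b < a + 2 * pi" shows "neq (ee a) (ee b)"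
 using ee_cyc[of a b "(b + a + 2 * pi) / 2"] assms by (auto simp: cyc_def)

text \<open>The small cells on the two sides of \<open>ee p\<close> end at arcs whose parameters lie
  strictly on the two sides of \<open>p\<close>; transition points of arcs in between stay in these
  cells.\<close>

lemma f_near: assumes U: "open U" "X (ee p):U" shows "EX d>0. ALL s. \<bar>s - p\<bar> < d --> X (ee s):U"
proof -
 obtain b where b: "b:Ec - {ee p}" "closure (R (ee p) b)<=U" using shrink(1)[OF ee_Ec U] by blast
 obtain a where a: "a:Ec - {ee p}" "closure (R a (ee p))<=U" using shrink(2)[OF ee_Ec U] by blast
 obtain tb where tb: "p<=tb" "tb < p + 2 * pi" "ee tb = b" using ee_onto[of b p] b by blast
 obtain ta where ta: "p - 2 * pi<=ta" "ta < p" "ee ta = a" using ee_onto[of a "p - 2 * pi"] a by auto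
 have ne: "p ~= tb" "p - 2 * pi ~= ta" using tb ta b a ee_shift[of p "-1"] by auto
 have "X (ee s):U" if s: "\<bar>s - p\<bar> < min (tb - p) (p - ta)" for s
 proof -
  consider "s = p" | "p < s" "s < tb" | "ta < s" "s < p" using s by fastforce
  thus ?thesis
  proof cases
   case 2
   have c: "cyc (ee p) (ee s) b" using ee_cyc[of p s tb] 2 tb by simp
   show ?thesis using cyc_X(1)[OF c] closure_mono[OF cyc_sub(1)[OF c]] b by blast
  next
   case 3
   have c: "cyc a (ee s) (ee p)" using ee_cyc[of ta s p] 3 ta ne by simp
   show ?thesis using cyc_X(2)[OF c] closure_mono[OF cyc_sub(2)[OF c]] a by blast
  qed (use U in simp)
 qed
 moreover have "min (tb - p) (p - ta) > 0" using tb ta ne by auto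
 ultimately show ?thesis by blast
qed

lemma f_cont: "continuous_on S1 f"
proof -
 have "continuous (at z0 within S1) f" if z0: "z0:S1" for z0
 proof -
  obtain p0 where p0: "z0 = cis p0" using S1_lift[OF z0, of 0] by metis
  define p where "p = p0 + pi"
  have cp: "cis p = - z0" by (simp add: p_def p0 cis_mult[symmetric])
  have "z0 ~= 0" using z0 by (auto simp: S1_def)
  hence "z0 ~= cis p" using cp by auto
  hence cA: "continuous (at z0) (%z. Arg2pi (z / cis p) + p)" using S1_lift_cont[OF z0] by blast
  have "isCont (%s. X (ee s)) s" for s
   unfolding continuous_at_open using f_near[of _ s] by (metis (no_types, lifting) dist_real_def mem_ball open_ball dist_commute centre_in_ball)
  hence "continuous (at z0) (%z. X (ee (Arg2pi (z / cis p) + p)))" using continuous_at_compose[OF cA, of "%s. X (ee s)"] by (simp add: o_def)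
  hence c: "continuous (at z0 within S1) (%z. X (ee (Arg2pi (z / cis p) + p)))" by (rule continuous_at_imp_continuous_at_within)
  have eq: "X (ee (Arg2pi (z / cis p) + p)) = f z" if "z:S1" for z using S1_lift[OF that, of p] by (simp add: f_cis[symmetric])
  show ?thesis by (rule continuous_transform_within[OF c, of 1]) (use eq z0 in auto)
 qed
 thus ?thesis by (simp add: continuous_on_eq_continuous_within)
qed

text \<open>Arcs between the two ends have their transition points in the closed cell by
  \<open>cyc_sub\<close>. Conversely, an arc with transition point in the open region has its
  parameter in the interval by \<open>X_in_R_cyc\<close>, and the image of the interval is
  closed.\<close>

lemma f_img: assumes ab: "a < b" "b < a + 2 * pi" shows "f ` cis ` {a..b} = closure (R (ee a) (ee b))"
proof
 note n = ee_neq[OF ab]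
 have ends: "X (ee a):closure (R (ee a) (ee b))" "X (ee b):closure (R (ee a) (ee b))" using R_facts(5)[OF n] mid_pair(13,14)[OF n] by auto
 have "X (ee s):closure (R (ee a) (ee b))" if s: "s:{a..b}" for s
 proof (cases "s = a \<or> s = b")
  case False
  hence c: "cyc (ee a) (ee s) (ee b)" using ee_cyc[of a s b] s ab by auto
  show ?thesis using cyc_X(1)[OF c] closure_mono[OF cyc_sub(1)[OF c]] by blast
 qed (use ends in auto)
 thus "f ` cis ` {a..b}<=closure (R (ee a) (ee b))" by (auto simp: f_cis)
 have "R (ee a) (ee b)<=f ` cis ` {a..b}"
 proof
  fix y assume y: "y:R (ee a) (ee b)"
  hence "y:S2" using R_facts(9)[OF n] by auto
  then obtain c where c: "c:Ec" "X c = y" using Ec_at by blast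
  obtain t where t: "a<=t" "t < a + 2 * pi" "ee t = c" using ee_onto[OF c(1), of a] by blast
  have "t<=b"
  proof (rule ccontr)
   assume "~ t<=b"
   hence cy: "cyc (ee a) (ee b) c" using ee_cyc[of a b t] t ab by auto
   hence "neq c (ee a)" "neq c (ee b)" using neq_sym by (auto simp: cyc_def)
   hence "cyc (ee a) c (ee b)" using X_in_R_cyc[OF n] c y by auto
   thus False using cy cyc_not by blast
  qed
  thus "y:f ` cis ` {a..b}" using t c f_cis[of t] by force
 qed
 moreover have "closed (f ` cis ` {a..b})"
 proof -
  have "continuous_on (cis ` {a..b}) f" using f_cont by (rule continuous_on_subset) (auto simp: S1_def)
  thus ?thesis by (intro compact_imp_closed compact_continuous_image continuous_on_cis continuous_intros) auto
 qed
 ultimately show "closure (R (ee a) (ee b))<=f ` cis ` {a..b}" by (rule closure_minimal)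
qed

lemma interval_data:
 assumes c: "ccw_param I s t"
 defines "a \<equiv> ee s" and "b \<equiv> ee t"
 shows "neq a b" "f ` I = closure (R a b)" "disk_bdry (f ` I) = Jim a b" "f ` iv_ends I = {X a, X b}"
proof -
 have p: "s < t" "t < s + 2 * pi" "I = cis ` {s..t}" using c by (auto simp: ccw_param_def)
 show n: "neq a b" unfolding a_def b_def by (rule ee_neq[OF p(1,2)])
 show i: "f ` I = closure (R a b)" unfolding p(3) a_def b_def by (rule f_img[OF p(1,2)])
 show "disk_bdry (f ` I) = Jim a b" unfolding i R_def using disk_bdry_loop[OF mid_pair(7)[OF n]] mid_pair(8)[OF n] by simp
 show "f ` iv_ends I = {X a, X b}" unfolding iv_ends_eq[OF c] by (simp add: f_cis a_def b_def)
qed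

lemma wheel: "catherine_wheel f"
 unfolding catherine_wheel_def
proof (intro conjI allI impI)
 show "f ` S1 = S2"
 proof
  show "f ` S1<=S2" using S1_lift[of _ 0] f_cis X_S2[OF Ec_E[OF ee_Ec]] by (metis image_subsetI)
  show "S2<=f ` S1"
  proof
   fix y assume "y:S2"
   then obtain c where c: "c:Ec" "X c = y" using Ec_at by blast
   obtain t where "ee t = c" using ee_onto[OF c(1)] by blast
   hence "y = f (cis t)" using c f_cis[of t] by simp
   thus "y:f ` S1" by (simp add: S1_def)
  qed
 qed
 fix I assume "closed_interval_S1 I"
 then obtain s t where c: "ccw_param I s t" using closed_interval_ccw by blast
 note d = interval_data[OF c]
 show "closed_disk (f ` I)" using R_facts(7)[OF d(1)] d(2) by simp
 show "f ` iv_ends I<=disk_bdry (f ` I)" using d(3,4) mid_pair(13,14)[OF d(1)] by simp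
qed (rule f_cont)

text \<open>Apart from the two transition points the boundary consists of a closed part in
  \<open>Zp\<close> and a closed part in \<open>Zm\<close>, which are disjoint there; a connected
  piece lies in one of them.\<close>

lemma component_type:
 assumes n: "neq a b" and Y: "Y:components (Jim a b - {X a, X b})"
 shows "Y<=Zp \<or> Y<=Zm"
proof -
 define P M where "P k h = k ` {br1 k h..tau k}" and "M k h = k ` {tau k..br2 k h}" for k h :: "real => real^3"
 have pm: "P k h Un M k h = pim (mid k h)" "P k h - {X k}<=Zp" "M k h - {X k}<=Zm" "closed (P k h)" "closed (M k h)" if n: "neq k h" for k h
 proof -
  note fk = mid_facts[OF n] and p = pd_neq[OF n, unfolded pd_def]
  have E: "k:E" using n by (auto simp: neq_def)
  have "{br1 k h..br2 k h} = {br1 k h..tau k} Un {tau k..br2 k h}" using fk(9,10) by auto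
  thus "P k h Un M k h = pim (mid k h)" unfolding fk(2) P_def M_def by (simp only: image_Un)
  have b: "0<=br1 k h" "br2 k h<=1" "tau k:{0..1}" using p E_facts(5,6)[OF E] by auto
  show "P k h - {X k}<=Zp"
  proof
   fix y assume "y:P k h - {X k}"
   then obtain s where s: "s:{br1 k h..tau k}" "y = k s" "s ~= tau k" unfolding P_def X_def by blast
   thus "y:Zp" using E_facts(7)[OF E, of s] b by auto
  qed
  show "M k h - {X k}<=Zm"
  proof
   fix y assume "y:M k h - {X k}"
   then obtain s where s: "s:{tau k..br2 k h}" "y = k s" "s ~= tau k" unfolding M_def X_def by blast
   thus "y:Zm" using E_facts(8)[OF E, of s] b by auto
  qed
  have "continuous_on {0..1} k" using E_facts(1)[OF E] by (simp add: arc_def path_def)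
  thus "closed (P k h)" "closed (M k h)" unfolding P_def M_def using b
   by (auto intro!: compact_imp_closed compact_continuous_image intro: continuous_on_subset)
 qed
 note pa = pm[OF n] and pb = pm[OF neq_sym[OF n]]
 have Yc: "connected Y" "Y<=Jim a b - {X a, X b}" using in_components_connected[OF Y] in_components_subset[OF Y] by auto
 have PZ: "Y Int (P a b Un P b a)<=Zp" "Y Int (M a b Un M b a)<=Zm" using pa(2,3) pb(2,3) Yc(2) by blast+
 have cov: "Y<=(P a b Un P b a) Un (M a b Un M b a)" using Yc(2) pa(1) pb(1) by (auto simp: Jim_def)
 have "(P a b Un P b a) Int Y = {} \<or> (M a b Un M b a) Int Y = {}"
 proof (rule connected_closedD[OF Yc(1) _ cov])
  show "(P a b Un P b a) Int (M a b Un M b a) Int Y = {}" using PZ disj by blast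
 qed (use pa pb in auto)
 thus ?thesis using PZ cov by blast
qed

text \<open>The smaller cell \<open>R k l\<close> between the two times has a boundary arc joining
  \<open>f s\<close> and \<open>f t\<close> in the same set, so by uniqueness of arcs it is the
  piece of the large boundary between these points. If the parameters were in the wrong order, the
  two cells would traverse this arc in opposite directions while one contains the other, which
  \<open>cells_opposite\<close> excludes.\<close>

lemma monotone_on_component:
 assumes c: "ccw_param I s0 t0" and g: "bdry_loop f I g" and Y: "Y:components (disk_bdry (f ` I) - f ` iv_ends I)"
  and st: "iv_le I s t" "f s:Y" "f t:Y" "u:{0..1}" "v:{0..1}" "g u = f s" "g v = f t"
 shows "Y<=Zp ==> u<=v" "Y<=Zm ==> v<=u"
proof -
 define a b where "a = ee s0" and "b = ee t0"
 note d = interval_data[OF c, folded a_def b_def]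
 have p: "s0 < t0" "t0 < s0 + 2 * pi" using c by (auto simp: ccw_param_def)
 have gl: "loop_in g" "pim g = Jim a b" "R a b<=Lr g" "g 0:{X a, X b}"
  using g d mid_pair(12)[OF d(1)] R_facts(3,5)[OF d(1)] by (auto simp: bdry_loop_def loop_in_def Lr_def)
 \<comment> \<open>By definition \<open>g\<close> has the open cell on its left; connectedness of
   its left side excludes that it also meets the opposite region.\<close>
 have gR: "Lr g = R a b"
 proof -
  have t: "Lr g<=S2 - Jim a b" "connected (Lr g)" using loop_sides(3)[OF gl(1)] gl(2) Lr_topology(1)[OF gl(1)] by auto
  have "Lr g Int R b a = {}"
  proof (rule ccontr)
   assume ne: "Lr g Int R b a ~= {}"
   have cl: "closure (R a b) Int closure (R b a) Int Lr g = {}" using t(1) R_facts(5)[OF d(1)] R_facts(5)[OF neq_sym[OF d(1)]] mid_pair(11)[OF d(1)] R_facts(2)[OF d(1)] by blast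
   have "Lr g<=closure (R a b) Un closure (R b a)" using t(1) R_facts(3)[OF d(1)] closure_subset by blast
   from connected_closedD[OF t(2) cl this] have "closure (R a b) Int Lr g = {} \<or> closure (R b a) Int Lr g = {}" by auto
   thus False using ne gl(3) R_facts(1)[OF d(1)] closure_subset by blast
  qed
  thus "Lr g = R a b" using t(1) R_facts(3)[OF d(1)] gl(3) by blast
 qed
 have Y': "Y:components (pim g - {X a, X b})" using Y d(3,4) gl(2) by simp
 obtain sc td where sc: "s0<=sc" "sc<=td" "td<=t0" "s = cis sc" "t = cis td" using st(1) iv_le_eq[OF c] by auto
 define k l where "k = ee sc" and "l = ee td"
 have X: "X k = f s" "X l = f t" using sc by (auto simp: k_def l_def f_cis)
 have Ygs: "Y Int {X a, X b} = {}" using in_components_subset[OF Y'] by blast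
 have g01: "g 1 = g 0" using gl(1) by (simp add: loop_in_def pst_def pfn_def)
 have uv01: "u ~= 0" "u ~= 1" "v ~= 0" "v ~= 1" using st g01 gl(4) Ygs by auto
 have injg: "u = v" if "f s = f t"
  using gl(1) st(4-7) uv01 that unfolding loop_in_def simple_path_def loop_free_def by metis
 have kl: "neq k l" "R k l<=R a b" if ne: "f s ~= f t"
 proof -
  have "sc ~= td" using ne sc by auto
  hence lt: "sc < td" "td < sc + 2 * pi" using sc p by auto
  show "neq k l" unfolding k_def l_def by (rule ee_neq[OF lt])
  have "R k l<=R a l"
  proof (cases "s0 = sc")
   case False
   thus ?thesis unfolding a_def k_def l_def using cyc_sub(2)[OF ee_cyc[of s0 sc td]] sc lt p by auto
  qed (simp add: a_def k_def)
  also have "R a l<=R a b"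
  proof (cases "td = t0")
   case False
   thus ?thesis unfolding a_def b_def l_def using cyc_sub(1)[OF ee_cyc[of s0 td t0]] sc lt p by auto
  qed (simp add: l_def b_def)
  finally show "R k l<=R a b" .
 qed
 have arcY: False if Z: "Y<=Z" "!!p q. arc p ==> arc q ==> pim p<=Z ==> pim q<=Z ==> pst q = pst p ==> pfn q = pfn p ==> pim q = pim p"
   and Q: "closes Q S" "Lr (Q +++ S)<=R a b" "pim Q<=Z" and w: "w1 < w2" "w1:{0..1}" "w2:{0..1}" "g w1:Y" "g w2:Y" "pst Q = g w2" "pfn Q = g w1" for Z Q S w1 w2
 proof -
  have sub: "g ` {w1..w2}<=Y" "0 < w1" "w2 < 1" using loop_component_arc[OF gl(1) Y', of w1 w2] gl(4) w by auto
  obtain bt where bt: "closes (subpath w1 w2 g) bt" "Lr (subpath w1 w2 g +++ bt) = Lr g" "pim (subpath w1 w2 g) = g ` {w1..w2}"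
   using split_loop[OF gl(1), of w1 w2] w sub by (metis atLeastAtMost_iff less_irrefl)
  have im: "pim (subpath w1 w2 g) = pim Q"
  proof -
   have "pim (rvp (subpath w1 w2 g)) = pim Q"
    by (rule Z(2)) (use Q bt sub Z(1) w in \<open>auto simp: closes_def arc_reversepath path_image_reversepath\<close>)
   thus ?thesis by (simp add: path_image_reversepath)
  qed
  show False by (rule cells_opposite[OF Q(1) bt(1) im]) (use w Q(2) bt(2) gR in auto)
 qed
 show "u<=v" if Yp: "Y<=Zp"
 proof (rule ccontr)
  assume n: "~ u<=v"
  hence ne: "f s ~= f t" using injg by auto
  obtain Q S where Q: "closes Q S" "Lr (Q +++ S) = R k l" "pim Q<=Zp" "pst Q = X k" "pfn Q = X l"
   using arc_Zp[OF kl(1)[OF ne]] st(2,3) X Yp ne by (metis subsetD)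
  have un: "pim q = pim p" if "arc p" "arc q" "pim p<=Zp" "pim q<=Zp" "pst q = pst p" "pfn q = pfn p" for p q
   by (rule unique_arc[OF that(1,2) _ _ that(5,6)]) (use that sub disj in auto)
  show False by (rule arcY[OF Yp un Q(1) _ Q(3), of v u]) (use n st Q X kl(2)[OF ne] in auto)
 qed
 show "v<=u" if Ym: "Y<=Zm"
 proof (rule ccontr)
  assume n: "~ v<=u"
  hence ne: "f s ~= f t" using injg by auto
  obtain Q S where Q: "closes Q S" "Lr (Q +++ S) = R k l" "pim Q<=Zm" "pst Q = X l" "pfn Q = X k"
   using arc_Zm[OF kl(1)[OF ne]] st(2,3) X Ym ne by (metis subsetD)
  interpret sw: zip Zm Zp by (rule zip_swap)
  have un: "pim q = pim p" if "arc p" "arc q" "pim p<=Zm" "pim q<=Zm" "pst q = pst p" "pfn q = pfn p" for p q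
   by (rule sw.unique_arc[OF that(1,2) _ _ that(5,6)]) (use that sub disj in auto)
  show False by (rule arcY[OF Ym un Q(1) _ Q(3), of u v]) (use n st Q X kl(2)[OF ne] in auto)
 qed
qed

lemma bdry_loop_exists: assumes c: "ccw_param I s t" obtains g where "bdry_loop f I g"
proof -
 note d = interval_data[OF c]
 define a b where "a = ee s" and "b = ee t"
 have n: "neq a b" using d(1) by (simp add: a_def b_def)
 obtain w where w: "w:{0..1}" "Jc a b w = X a" using mid_pair(8,13)[OF n] unfolding pim_def by (metis imageE)
 note l = loop_shift[OF mid_pair(7)[OF n] w(1)]
 have "left_region (shiftpath w (Jc a b)) x" if "x:f ` I - disk_bdry (f ` I)" for x
 proof -
  have "x:R a b" using that d(2,3) R_facts(5)[OF n] by (auto simp: a_def b_def)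
  thus ?thesis using l(3) by (auto simp: R_def Lr_def)
 qed
 hence "bdry_loop f I (shiftpath w (Jc a b))" unfolding bdry_loop_def using l w d mid_pair(8)[OF n] by (auto simp: loop_in_def a_def b_def)
 thus thesis by (rule that)
qed

text \<open>On a component of the other type the same loop would be monotone in both directions, so
  the component would have only one point.\<close>

lemma component_agrees:
 assumes c: "ccw_param I s t" and Y: "Y:components (disk_bdry (f ` I) - f ` iv_ends I)"
 shows "canon_agrees f I Y \<longleftrightarrow> Y<=Zp" "canon_disagrees f I Y \<longleftrightarrow> Y<=Zm"
proof -
 note d = interval_data[OF c]
 have imp: "Y<=Zp ==> canon_agrees f I Y" "Y<=Zm ==> canon_disagrees f I Y"
 proof -
  obtain g where g: "bdry_loop f I g" using bdry_loop_exists[OF c] by blast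
  show "Y<=Zp ==> canon_agrees f I Y" "Y<=Zm ==> canon_disagrees f I Y"
   unfolding canon_agrees_def canon_disagrees_def using monotone_on_component[OF c g Y] by (intro exI[of _ g] conjI g; blast)+
 qed
 have ty: "Y<=Zp \<or> Y<=Zm" using component_type[OF d(1)] Y d(3,4) by simp
 have no: False if g: "bdry_loop f I g" and h: "!!s t u v. s:I & t:I & f s:Y & f t:Y & iv_le I s t & u:{0..1} & v:{0..1} & g u = f s & g v = f t ==> u = v" for g
 proof -
  have gl: "loop_in g" "pim g = disk_bdry (f ` I)" using g d(3) mid_pair(12)[OF d(1)] by (auto simp: bdry_loop_def loop_in_def)
  obtain x y where xy: "x:Y" "y:Y" "x ~= y"
   using loop_component_two_points[OF gl(1), of "f ` iv_ends I" Y] Y gl(2) d(4) by auto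
  have "x:f ` I" "y:f ` I" using xy in_components_subset[OF Y] d(2,3) R_facts(5)[OF d(1)] by auto
  then obtain p q where p: "p:{s..t}" "q:{s..t}" "x = f (cis p)" "y = f (cis q)" using c by (auto simp: ccw_param_def)
  have I: "cis p:I" "cis q:I" using p c by (auto simp: ccw_param_def)
  have "x:g ` {0..1}" "y:g ` {0..1}" using xy in_components_subset[OF Y] gl(2) unfolding pim_def by blast+
  then obtain u v where u: "u:{0..1}" "v:{0..1}" "g u = x" "g v = y" by (elim imageE) simp
  have "iv_le I (cis p) (cis q) \<or> iv_le I (cis q) (cis p)" unfolding iv_le_eq[OF c] using p by (metis atLeastAtMost_iff linear)
  hence "u = v" using h[of "cis p" "cis q" u v] h[of "cis q" "cis p" v u] p I u xy by auto
  thus False using u xy by simp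
 qed
 show "canon_agrees f I Y \<longleftrightarrow> Y<=Zp"
 proof
  assume "canon_agrees f I Y"
  then obtain g where g: "bdry_loop f I g" "!!s t u v. s:I & t:I & f s:Y & f t:Y & iv_le I s t & u:{0..1} & v:{0..1} & g u = f s & g v = f t ==> u<=v"
   by (auto simp: canon_agrees_def)
  show "Y<=Zp"
  proof (rule ccontr)
   assume "~ Y<=Zp"
   hence Ym: "Y<=Zm" using ty by blast
   show False by (rule no[OF g(1)]) (meson g(2) monotone_on_component(2)[OF c g(1) Y _ _ _ _ _ _ _ Ym] order_antisym)
  qed
 qed (rule imp)
 show "canon_disagrees f I Y \<longleftrightarrow> Y<=Zm"
 proof
  assume "canon_disagrees f I Y"
  then obtain g where g: "bdry_loop f I g" "!!s t u v. s:I & t:I & f s:Y & f t:Y & iv_le I s t & u:{0..1} & v:{0..1} & g u = f s & g v = f t ==> v<=u"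
   by (auto simp: canon_disagrees_def)
  show "Y<=Zm"
  proof (rule ccontr)
   assume "~ Y<=Zm"
   hence Yp: "Y<=Zp" using ty by blast
   show False by (rule no[OF g(1)]) (meson g(2) monotone_on_component(1)[OF c g(1) Y _ _ _ _ _ _ _ Yp] order_antisym)
  qed
 qed (rule imp)
qed

lemma Z_of_interval:
 assumes c: "closed_interval_S1 I" shows "Zplus_of f I<=Zp" "Zminus_of f I<=Zm"
 using closed_interval_ccw[OF c] component_agrees unfolding Zplus_of_def Zminus_of_def by (metis (no_types, lifting) Sup_least mem_Collect_eq)+

lemma Z_of_point:
 assumes ab: "neq a b" "a:Ec" "b:Ec" and z: "z:Jim a b - {X a, X b}"
 obtains I where "closed_interval_S1 I" "z:Zp ==> z:Zplus_of f I" "z:Zm ==> z:Zminus_of f I"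
proof -
 obtain s where s: "ee s = a" using ee_onto[OF ab(2)] by blast
 obtain t where t: "s<=t" "t < s + 2 * pi" "ee t = b" using ee_onto[OF ab(3), of s] by blast
 have "s ~= t" using s t ab by (auto simp: neq_def)
 hence c: "ccw_param (cis ` {s..t}) s t" using t by (simp add: ccw_param_def)
 note d = interval_data[OF c, unfolded s t(3)]
 define Y where "Y = connected_component_set (disk_bdry (f ` cis ` {s..t}) - f ` iv_ends (cis ` {s..t})) z"
 have Y: "Y:components (disk_bdry (f ` cis ` {s..t}) - f ` iv_ends (cis ` {s..t}))" "z:Y" using z d by (auto simp: Y_def components_def)
 have "Y<=Zp \<or> Y<=Zm" using component_type[OF d(1)] Y(1) d(3,4) by simp
 hence "z:Zp ==> Y<=Zp" "z:Zm ==> Y<=Zm" using Y(2) disj by blast+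
 thus thesis using that[OF ccw_closed_interval[OF c]] component_agrees[OF c Y(1)] Y unfolding Zplus_of_def Zminus_of_def by blast
qed

text \<open>A cut point lies on the arc, within its set, between two points that it separates. This
  arc is part of the loop of two arcs changing over at those points, so the cut point is on the
  boundary of the image of an interval and is not an end. This is where the cut point property
  enters.\<close>

theorem Z_union:
 assumes cut: "!!z. z:Zp ==> path_cut_point Zp z" "!!z. z:Zm ==> path_cut_point Zm z"
 shows "Zp = (\<Union>I\<in>{I. closed_interval_S1 I}. Zplus_of f I)" "Zm = (\<Union>I\<in>{I. closed_interval_S1 I}. Zminus_of f I)"
proof -
 have "EX I. closed_interval_S1 I & (z:Zp --> z:Zplus_of f I) & (z:Zm --> z:Zminus_of f I)"
  if z: "path_cut_point Z z" "Z = Zp \<or> Z = Zm" for Z z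
 proof -
  obtain x y where xy: "x:Z - {z}" "y:Z - {z}" "~ (EX g. path g & pim g<=Z - {z} & pst g = x & pfn g = y)"
   using z(1) unfolding path_cut_point_def path_connected_def by blast
  have ne: "x ~= y" using xy(1,3) path_linepath[of x x] by (metis closed_segment_idem empty_subsetI insert_subset path_image_linepath pathfinish_linepath pathstart_linepath)
  have S: "x:S2" "y:S2" using xy z(2) sub by auto
  obtain a where a: "a:Ec" "X a = x" using Ec_at[OF S(1)] .
  obtain b where b: "b:Ec" "X b = y" using Ec_at[OF S(2)] .
  have n: "neq a b" using Ec_neq a b ne by blast
  have "EX Q. arc Q & pim Q<=Z & {pst Q, pfn Q} = {x, y} & pim Q<=Jim a b"
  proof (cases "Z = Zp")
   case True
   obtain Q S where "closes Q S" "pim Q<=Zp" "pst Q = x" "pfn Q = y" "pim Q Un pim S = Jim a b"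
    using arc_Zp[OF n] a b xy ne True by (metis DiffD1)
   thus ?thesis using True by (intro exI[of _ Q]) (auto simp: closes_def)
  next
   case False
   hence "Z = Zm" using z(2) by blast
   moreover from this obtain Q S where "closes Q S" "pim Q<=Zm" "pst Q = y" "pfn Q = x" "pim Q Un pim S = Jim a b"
    using arc_Zm[OF n] a b xy ne by (metis DiffD1)
   ultimately show ?thesis by (intro exI[of _ Q]) (auto simp: closes_def)
  qed
  then obtain Q where Q: "arc Q" "pim Q<=Z" "{pst Q, pfn Q} = {x, y}" "pim Q<=Jim a b" by blast
  have "z:pim Q"
  proof (rule ccontr)
   assume "z ~: pim Q"
   hence "pim Q<=Z - {z}" using Q(2) by blast
   thus False using xy(3) Q(1,3) arc_imp_path[OF Q(1)] by (metis doubleton_eq_iff path_image_reversepath path_reversepath pathfinish_reversepath pathstart_reversepath)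
  qed
  hence "z:Jim a b - {X a, X b}" using Q(4) a b xy by auto
  thus ?thesis using Z_of_point[OF n a(1) b(1)] by metis
 qed
 note key = this
 have "z:(\<Union>I\<in>{I. closed_interval_S1 I}. Zplus_of f I)" if "z:Zp" for z using key[OF cut(1)[OF that]] that by blast
 thus "Zp = (\<Union>I\<in>{I. closed_interval_S1 I}. Zplus_of f I)" using Z_of_interval(1) by blast
 have "z:(\<Union>I\<in>{I. closed_interval_S1 I}. Zminus_of f I)" if "z:Zm" for z using key[OF cut(2)[OF that]] that by blast
 thus "Zm = (\<Union>I\<in>{I. closed_interval_S1 I}. Zminus_of f I)" using Z_of_interval(2) by blast
qed

end

section \<open>From the zipper properties to the wheel\<close>

lemma finite_tree_path_connected: assumes "finite_tree T" shows "path_connected T"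
proof -
 consider x where "T = {x}" | A where "finite A" "T = \<Union>A" "ALL a:A. EX g. arc g & a = pim g" using assms by (auto simp: finite_tree_def)
 thus ?thesis
 proof cases
  case 2
  have "path_connected a & closed a" if "a:A" for a
   using 2(3) that path_connected_path_image closed_arc_image arc_imp_path by metis
  thus ?thesis using finite_Union_path_connected[OF 2(1)] 2(2) assms by (simp add: finite_tree_def)
 qed simp
qed

lemma zipper_zip: assumes z: "zipper Zp Zm" shows "zip Zp Zm"
proof -
 have pc: "path_connected Z" if Z: "Z:{Zp, Zm}" for Z
 proof -
  obtain T :: "nat => (real^3) set" where T: "!!n. finite_tree (T n)" "!!n. T n<=T (Suc n)" "Z = (\<Union>n. T n)" using z Z unfolding zipper_def by meson
  have mono: "T m<=T n" if "m<=n" for m n using lift_Suc_mono_le[of T] T(2) that by blast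
  show ?thesis unfolding path_connected_def
  proof (intro ballI)
   fix x y assume "x:Z" "y:Z"
   then obtain m n where "x:T m" "y:T n" using T(3) by blast
   hence "x:T (max m n)" "y:T (max m n)" using mono[of m "max m n"] mono[of n "max m n"] by auto
   then obtain g where "path g" "pim g<=T (max m n)" "pst g = x" "pfn g = y"
    using finite_tree_path_connected[OF T(1)] unfolding path_connected_def by blast
   thus "EX g. path g & pim g<=Z & pst g = x & pfn g = y" using T(3) by blast
  qed
 qed
 show ?thesis using z pc by unfold_locales (auto simp: zipper_def)
qed

lemma zipper_cover:
 assumes z: "zipper Zp Zm"
 shows "EX G C. countable G & countable C & (ALL g:G. arc g & (pim g<=Zp \<or> pim g<=Zm)) & Zp Un Zm<=(\<Union>g\<in>G. pim g) Un C"
proof -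
 have one: "EX G C. countable G & countable C & (ALL g:G. arc g & pim g<=Z) & Z<=(\<Union>g\<in>G. pim g) Un C" if Z: "Z:{Zp, Zm}" for Z
 proof -
  obtain T :: "nat => (real^3) set" where T: "!!n. finite_tree (T n)" "Z = (\<Union>n. T n)" using z Z unfolding zipper_def by meson
  have "EX G C. countable G & countable C & (ALL g:G. arc g & pim g<=T n) & T n<=(\<Union>g\<in>G. pim g) Un C" for n
  proof -
   consider x where "T n = {x}" | A where "finite A" "T n = \<Union>A" "ALL a:A. EX g. arc g & a = pim g" using T(1)[of n] by (auto simp: finite_tree_def)
   thus ?thesis
   proof cases
    case 1 thus ?thesis by (intro exI[of _ "{}"] exI[of _ "{x}"]) auto
   next
    case 2
    then obtain h where h: "ALL a:A. arc (h a) & a = pim (h a)" by metis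
    hence "ALL g:h ` A. arc g & pim g<=T n" "T n<=(\<Union>g\<in>h ` A. pim g)" using 2 by auto
    thus ?thesis using 2(1) by (intro exI[of _ "h ` A"] exI[of _ "{}"]) (auto simp: countable_finite)
   qed
  qed
  then obtain G C where G: "!!n. countable (G n)" "!!n. countable (C n)" "!!n. ALL g:G n. arc g & pim g<=T n" "!!n. T n<=(\<Union>g\<in>G n. pim g) Un C n" by metis
  have "countable (\<Union>n. G n)" "countable (\<Union>n. C n)" using G by auto
  moreover have "ALL g:(\<Union>n. G n). arc g & pim g<=Z" using G(3) T(2) by blast
  moreover have "Z<=(\<Union>g\<in>(\<Union>n. G n). pim g) Un (\<Union>n. C n)"
  proof
   fix x assume "x:Z"
   then obtain n where "x:T n" using T(2) by blast
   thus "x:(\<Union>g\<in>(\<Union>n. G n). pim g) Un (\<Union>n. C n)" using G(4)[of n] by force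
  qed
  ultimately show ?thesis by blast
 qed
 obtain G C where 1: "countable G" "countable C" "ALL g:G. arc g & pim g<=Zp" "Zp<=(\<Union>g\<in>G. pim g) Un C" using one[of Zp] by auto
 obtain G' C' where 2: "countable G'" "countable C'" "ALL g:G'. arc g & pim g<=Zm" "Zm<=(\<Union>g\<in>G'. pim g) Un C'" using one[of Zm] by auto
 show ?thesis by (rule exI[of _ "G Un G'"], rule exI[of _ "C Un C'"]) (use 1 2 in auto)
qed

text \<open>The definition of a ray to the left provides some closing arc \<open>sc'\<close> of its
  own. Near the foot of the ray the side does not depend on the closing arc by
  \<open>left_local\<close>, so a short initial piece of the ray is on the left for the prescribed
  \<open>sc\<close>.\<close>

lemma hairy_set_hair:
 assumes h: "hairy_set Z" and c: "closes gb sc" and gb: "pim gb<=Z" and ZS: "Z<=S2"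
 shows "EX t r. 0 < t & t < 1 & arc r & pim r<=Z & r 0 = gb t & r ` {0<..1}<=Lr (gb +++ sc)"
proof -
 have "arc gb" "pim gb<=S2" using c by (auto simp: closes_def)
 then obtain r where r: "emb_ray Z r" "ray_left_of gb r" using h gb by (auto simp: hairy_set_def)
 then obtain t0 sc' ep where t0: "0 < t0" "t0 < 1" "r 0 = gb t0" and off: "ALL s:{0<..<1}. r s ~: pim gb"
  and sc': "arc sc'" "pim sc'<=S2" "pst sc' = pfn gb" "pfn sc' = pst gb" "pim sc' Int pim gb = {pst gb, pfn gb}"
  and ep: "0 < ep" "ep < 1" "ALL s:{0<..ep}. left_region (gb +++ sc') (r s)" unfolding ray_left_of_def by blast
 have c': "closes gb sc'" using sc' \<open>arc gb\<close> \<open>pim gb<=S2\<close> by (simp add: closes_def)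
 obtain d where d: "d > 0" "!!z. z:S2 ==> dist z (gb t0) < d ==> z ~: pim gb ==> z:Lr (gb +++ sc') \<longleftrightarrow> z:Lr (gb +++ sc)"
  using left_local[OF c' c t0(1,2)] by metis
 obtain g where g: "homeomorphism {0..<1} (r ` {0..<1}) r g" and rZ: "r ` {0..<1}<=Z" using r(1) by (auto simp: emb_ray_def)
 have rc: "continuous_on {0..<1} r" "inj_on r {0..<1}" using g by (auto simp: homeomorphism_def intro: inj_on_inverseI)
 obtain db where db: "db > 0" "!!s. s:{0..<1} ==> dist s 0 < db ==> dist (r s) (r 0) < d"
  using rc(1) d(1) unfolding continuous_on_iff by (metis atLeastLessThan_iff order_refl zero_less_one)
 define et where "et = min ep (db / 2)"
 have et: "0 < et" "et<=ep" "et < db" "et < 1" using ep db by (auto simp: et_def)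
 define p where "p s = r (et * s)" for s
 have rg: "et * s:{0..<1}" "et * s<=et" if "s:{0..1}" for s
 proof -
  show "et * s<=et" using that et by (simp add: mult_left_le)
  hence "et * s < 1" using et(4) by linarith
  thus "et * s:{0..<1}" using that et by simp
 qed
 have "arc p" unfolding arc_def path_def
 proof
  show "continuous_on {0..1} p" unfolding p_def
   by (rule continuous_on_compose2[OF rc(1)]) (use rg in \<open>auto intro!: continuous_intros\<close>)
  show "inj_on p {0..1}"
  proof (rule inj_onI)
   fix x y assume xy: "x:{0..1}" "y:{0..1}" "p x = p y"
   hence "et * x = et * y" using inj_onD[OF rc(2) _ rg(1) rg(1), of x y] by (simp add: p_def)
   thus "x = y" using et by simp
  qed
 qed
 moreover have "pim p<=Z" using rg rZ by (auto simp: pim_def p_def)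
 moreover have "p ` {0<..1}<=Lr (gb +++ sc)"
 proof (rule image_subsetI)
  fix s :: real assume s: "s:{0<..1}"
  hence q: "et * s:{0..<1}" "et * s<=et" "0 < et * s" using rg[of s] et by auto
  have "p s:S2" using rZ ZS imageI[OF q(1), of r] unfolding p_def by blast
  moreover have "dist (p s) (gb t0) < d" using db(2)[OF q(1)] q et t0(3) by (simp add: p_def)
  moreover have "p s ~: pim gb" using off q by (auto simp: p_def)
  moreover have "p s:Lr (gb +++ sc')"
  proof -
   have "et * s:{0<..ep}" using q et by (meson greaterThanAtMost_iff order_trans)
   thus ?thesis using ep(3) by (simp add: p_def Lr_def)
  qed
  ultimately show "p s:Lr (gb +++ sc)" using d(2) by blast
 qed
 ultimately show ?thesis using t0 by (intro exI[of _ t0] exI[of _ p]) (simp add: p_def)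
qed

lemma landing_arcs:
 assumes "strong_landing_half Zp Zm" "y:S2"
 shows "EX v. arc v & pim v<=S2 & v 1 = y & v ` {0..<1}<=Zp"
proof -
 obtain r rb where r: "emb_ray Zp r" "good_landing Zp Zm r rb" "rb 1 = y" using assms by (auto simp: strong_landing_half_def)
 hence rb: "arc rb" "pim rb<=S2" "ALL s:{0..<1}. rb s = r s" by (auto simp: good_landing_def extends_ray_def)
 have "rb ` {0..<1} = r ` {0..<1}" using rb(3) by simp
 hence "rb ` {0..<1}<=Zp" using r(1) by (simp add: emb_ray_def)
 thus ?thesis using r(3) rb by (intro exI[of _ rb]) simp
qed

theorem wheel_of_zipper:
 assumes z: "zipper Zp Zm" and h: "hairy Zp Zm" and l: "strong_landing Zp Zm"
 shows "EX f. catherine_wheel f & Zp = (\<Union>I\<in>{I. closed_interval_S1 I}. Zplus_of f I) & Zm = (\<Union>I\<in>{I. closed_interval_S1 I}. Zminus_of f I)"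
proof -
 have zz: "zip Zp Zm" by (rule zipper_zip[OF z])
 obtain op om where o: "op:Zp" "om:Zm" using z unfolding zipper_def by blast
 have land: "zip_land Zp Zm op om"
  unfolding zip_land_def zip_based_def zip_based_axioms_def zip_land_axioms_def
  using zz o l landing_arcs by (auto simp: strong_landing_def)
 then interpret zip_land Zp Zm op om .
 have hp: "zip_hairp Zp Zm op om" unfolding zip_hairp_def zip_hairp_axioms_def using land hairy_set_hair h sub by (auto simp: hairy_def)
 have "op:S2" using op sub by auto
 then obtain l0 where l0: "l0:Ec" using Ec_at by blast
 have full: "zip_full Zp Zm op om l0"
  unfolding zip_full_def zip_full_axioms_def zip_order_def zip_order_axioms_def
  using land l0 hp hairy_set_hair h sub zipper_cover[OF z] by (auto simp: hairy_def)
 then interpret zip_full Zp Zm op om l0 .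
 obtain e where e: "e 0 = l0" "bij_betw e {0..<2 * pi} Ec" "!!s t. 0 < s ==> s < t ==> t < 2 * pi ==> lt (e s) (e t)" using param by blast
 interpret zip_param Zp Zm op om l0 e by unfold_locales (use e in auto)
 have "!!z. z:Zp ==> path_cut_point Zp z" "!!z. z:Zm ==> path_cut_point Zm z" using z by (auto simp: zipper_def)
 thus ?thesis using wheel Z_union by blast
qed

section \<open>From a wheel back to hairiness and landing\<close>

lemma arc_comp: "arc p ==> continuous_on (pim p) h ==> inj_on h (pim p) ==> arc (h o p)"
 by (simp add: arc_def path_continuous_image comp_inj_on pim_def)

text \<open>The image of a straight chord under a homeomorphism from the round disk.\<close>

lemma disk_chord:
 assumes J: "loop_in J" and x: "x:pim J" "y:pim J" "x ~= y"
 obtains c where "arc c" "pst c = x" "pfn c = y" "pim c<=insert x (insert y (Lr J))"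
proof -
 have DS: "closure (Lr J)<=S2" using Lr_topology(2)[OF J] loop_sides(3)[OF J] J by (auto simp: loop_in_def)
 obtain k h where "homeomorphism (closure (Lr J)) (cball (0::complex) 1) k h" using Lr_topology(4)[OF J] unfolding closed_disk_def homeomorphic_def by blast
 hence h: "homeomorphism (cball (0::complex) 1) (closure (Lr J)) h k" by (rule homeomorphism_symD)
 obtain J' where J': "loop_in J'" "pim J' = h ` sphere 0 1" "closure (Lr J) = closure (Lr J')" "Lr J' = h ` ball 0 1" using disk_loop[OF h DS] by metis
 have e: "pim J = h ` sphere 0 1" "Lr J = h ` ball 0 1" using same_closure_loops[OF J J'(1,3)] J' by auto
 obtain a b where ab: "a:sphere 0 1" "b:sphere 0 1" "x = h a" "y = h b" using x e(1) by auto
 have ne: "a ~= b" using ab x by auto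
 have seg: "open_segment a b<=ball 0 1" using open_segment_as_ball ab dist_decreases_open_segment[of _ a b 0]
  by (metis (no_types, opaque_lifting) dist_commute mem_ball mem_sphere subsetI)
 have cs: "closed_segment a b<=cball 0 1" using ab by (intro closed_segment_subset) auto
 have hc: "continuous_on (cball 0 1) h" "inj_on h (cball 0 1)" using h by (auto simp: homeomorphism_def intro: inj_on_inverseI)
 have "arc (h o linepath a b)"
  by (rule arc_comp) (use ne hc cs in \<open>auto intro: continuous_on_subset inj_on_subset\<close>)
 moreover have "pim (h o linepath a b)<=insert x (insert y (Lr J))"
  unfolding path_image_compose path_image_linepath e(2) ab(3,4) closed_segment_eq_open using seg by blast
 ultimately show thesis using that ab by (auto simp: pathstart_compose pathfinish_compose)
qed

locale wheel =
 fixes f :: "complex => real^3"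
 assumes wh: "catherine_wheel f"
begin

definition F where "F t = f (cis t)"

lemma F_period: "F (t + 2 * pi * of_int k) = F t" by (simp add: F_def cis_shift)

lemma F_cont: "continuous_on UNIV F"
 unfolding F_def by (rule continuous_on_compose2[of S1 f]) (use wh in \<open>auto simp: catherine_wheel_def S1_def intro!: continuous_intros continuous_on_cis\<close>)

lemma F_onto: assumes "y:S2" obtains t where "s<=t" "t < s + 2 * pi" "F t = y"
proof -
 obtain z where z: "z:S1" "y = f z" using assms wh unfolding catherine_wheel_def by (metis imageE)
 show thesis using that[of "Arg2pi (z / cis s) + s"] S1_lift[OF z(1), of s] z Arg2pi_ge_0[of "z / cis s"] Arg2pi_lt_2pi[of "z / cis s"] by (simp add: F_def)
qed

lemma F_S2: "F t:S2"
 using wh by (auto simp: catherine_wheel_def F_def S1_def)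

lemma F_disk:
 assumes "s < t" "t < s + 2 * pi"
 obtains J where "loop_in J" "F ` {s..t} = closure (Lr J)" "F s:pim J" "F t:pim J"
  "disk_bdry (f ` cis ` {s..t}) = pim J"
proof -
 have c: "ccw_param (cis ` {s..t}) s t" using assms by (simp add: ccw_param_def)
 have eq: "f ` cis ` {s..t} = F ` {s..t}" by (simp add: F_def image_image)
 have d: "closed_disk (F ` {s..t})" "f ` iv_ends (cis ` {s..t})<=disk_bdry (F ` {s..t})"
  using wh ccw_closed_interval[OF c] unfolding catherine_wheel_def eq[symmetric] by blast+
 have "F ` {s..t}<=S2" using F_S2 by auto
 then obtain J where "loop_in J" "F ` {s..t} = closure (Lr J)" "disk_bdry (F ` {s..t}) = pim J" using closed_disk_loop[OF d(1)] by metis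
 thus thesis using that d(2) eq iv_ends_eq[OF c] by (simp add: F_def)
qed

text \<open>Otherwise a short interval around \<open>p\<close> could be dropped and the remaining closed interval would still cover the sphere.\<close>
lemma F_outside:
 assumes J: "loop_in J" "F ` {t..u} = closure (Lr J)" and p: "t < u" "u < p" "p < t + 2 * pi" shows "F p ~: Lr J"
proof
 assume a: "F p:Lr J"
 define V where "V = - closure (Lr (rvp J))"
 have t2: "closure (Lr (rvp J)) = Lr (rvp J) Un pim J" using Lr_topology(2)[OF loop_in_reversepath[OF J(1)]] by (simp add: path_image_reversepath)
 have V: "open V" unfolding V_def by (intro open_Compl closed_closure)
 have V2: "F p:V" "V Int S2<=Lr J" using a t2 loop_sides(2,3)[OF J(1)] by (auto simp: V_def)
 have "open (F -` V)" using F_cont V by (simp add: continuous_on_open_vimage open_vimage)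
 then obtain d0 where d0: "d0 > 0" "!!x. dist x p < d0 ==> F x:V" using V2(1) by (auto simp: open_dist)
 define d where "d = min (d0 / 2) (min ((p - u) / 2) ((t + 2 * pi - p) / 2))"
 have d: "0 < d" "d < d0" "u < p - d" "p + d < t + 2 * pi" using d0 p by (auto simp: d_def min_def field_simps)
 have "S2<=F ` {p + d..p - d + 2 * pi}"
 proof
  fix y assume y: "y:S2"
  obtain x where x: "p - d<=x" "x < p - d + 2 * pi" "F x = y" using F_onto[OF y, of "p - d"] by blast
  show "y:F ` {p + d..p - d + 2 * pi}"
  proof (cases "x<=p + d")
   case True
   hence "F x:V" using d0(2)[of x] d x by (auto simp: dist_real_def abs_if)
   hence "y:F ` {t..u}" using V2(2) y x J(2) closure_subset by blast
   then obtain x' where x': "x':{t..u}" "y = F x'" by blast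
   hence "y = F (x' + 2 * pi)" using F_period[of x' 1] by simp
   thus ?thesis using x' d by (intro image_eqI[of _ _ "x' + 2 * pi"]) auto
  qed (use x in auto)
 qed
 moreover have "p + d < p - d + 2 * pi" "p - d + 2 * pi < p + d + 2 * pi" using d p by linarith+
 then obtain J' where J': "loop_in J'" "F ` {p + d..p - d + 2 * pi} = closure (Lr J')" using F_disk by metis
 ultimately have "Lr (rvp J') = {}" using Lr_topology(2)[OF J'(1)] loop_sides(2,3)[OF J'(1)] by blast
 thus False using loop_sides(1)[OF loop_in_reversepath[OF J'(1)]] by simp
qed

lemma Lr_sub:
 assumes "loop_in J" "loop_in J'" "closure (Lr J)<=closure (Lr J')" shows "Lr J<=Lr J'"
proof -
 have o: "Lr K = S2 - closure (Lr (rvp K))" if "loop_in K" for K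
  using loop_sides(2,3)[OF that] Lr_topology(2)[OF loop_in_reversepath[OF that]] by (auto simp: path_image_reversepath)
 have r: "Lr (rvp K) = S2 - closure (Lr K)" if "loop_in K" for K
  using o[OF loop_in_reversepath[OF that]] by simp
 have "Lr (rvp J')<=Lr (rvp J)" using r assms by auto
 thus ?thesis using o assms closure_mono by blast
qed

text \<open>The images of \<open>{s..p}\<close> and \<open>{q..t}\<close> are disks with disjoint
  interiors by \<open>F_outside\<close>. If \<open>v < u\<close>, chords of these disks from
  \<open>F s\<close> to \<open>F p\<close> and from \<open>F q\<close> to \<open>F t\<close> would
  be disjoint crosscuts with interlaced ends, against \<open>crosscuts_meet\<close>.\<close>

lemma arcs_monotone:
 assumes st: "s < t" "t < s + 2 * pi" and J: "loop_in J" "F ` {s..t} = closure (Lr J)" and g: "loop_in g" "pim g = pim J"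
  and w: "0 < w" "w < 1" "g 0 = F s" "g w = F t" and uv: "u:{0<..<w}" "v:{0<..<w}" and pq: "s<=p" "p<=q" "q<=t" "F p = g u" "F q = g v"
 shows "u<=v"
proof (rule ccontr)
 assume "~ u<=v"
 hence vu: "v < u" by simp
 have gs: "simple_path g" "pfn g = pst g" "pim g<=S2" using g(1) by (auto simp: loop_in_def)
 have g10: "g 1 = g 0" using gs(2) by (simp add: pst_def pfn_def)
 have inj: "x = y" if "x:{0..<1}" "y:{0..<1}" "g x = g y" for x y
  using gs(1) that unfolding simple_path_def loop_free_def by (metis atLeastLessThan_iff atLeastAtMost_iff less_irrefl less_imp_le)
 have dist: "F s ~= F p" "F s ~= F q" "F p ~= F q" "F p ~= F t" "F q ~= F t" "F s ~= F t"
  using inj[of 0 u] inj[of 0 v] inj[of u v] inj[of u w] inj[of v w] inj[of 0 w] uv w pq vu by auto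
 have o: "s < p" "p < q" "q < t" using dist pq by (metis less_le)+
 obtain J1 where J1: "loop_in J1" "F ` {s..p} = closure (Lr J1)" "F s:pim J1" "F p:pim J1" using F_disk[of s p] o st by force
 obtain J2 where J2: "loop_in J2" "F ` {q..t} = closure (Lr J2)" "F q:pim J2" "F t:pim J2" using F_disk[of q t] o st by force
 obtain c1 where c1: "arc c1" "pst c1 = F s" "pfn c1 = F p" "pim c1<=insert (F s) (insert (F p) (Lr J1))" using disk_chord[OF J1(1,3,4) dist(1)] .
 obtain c2 where c2: "arc c2" "pst c2 = F q" "pfn c2 = F t" "pim c2<=insert (F q) (insert (F t) (Lr J2))" using disk_chord[OF J2(1,3,4) dist(5)] .
 have L1: "Lr J1<=Lr J" by (rule Lr_sub[OF J1(1) J(1)]) (use J J1 o in \<open>auto simp del: J1(2) simp: J1(2)[symmetric] J(2)[symmetric]\<close>)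
 have L2: "Lr J2<=Lr J" by (rule Lr_sub[OF J2(1) J(1)]) (use J J2 o in \<open>auto simp: J2(2)[symmetric] J(2)[symmetric]\<close>)
 have "F x ~: Lr J1" if "x:{q..t}" for x using F_outside[OF J1(1,2)] that o st by auto
 moreover have "Lr J2<=F ` {q..t}" using J2(2) closure_subset by auto
 ultimately have d12: "Lr J1 Int Lr J2 = {}" "F q ~: Lr J1" "F t ~: Lr J1" using o by auto
 \<comment> \<open>\<open>F_outside\<close> speaks of times after the interval, so the earlier times
   are moved by a full turn.\<close>
 have "F (x + 2 * pi) ~: Lr J2" if "x:{s..p}" "x ~= t - 2 * pi" for x using F_outside[OF J2(1,2), of "x + 2 * pi"] that o st by auto
 hence d21: "F s ~: Lr J2" "F p ~: Lr J2" using F_period[of _ 1] o st by auto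
 have disj: "pim c1 Int pim c2 = {}" using c1(4) c2(4) d12 d21 dist by auto
 obtain b where b: "b:Lr (rvp J)" using loop_sides(1)[OF loop_in_reversepath[OF J(1)]] by blast
 note lc = Lr_chart[OF J(1) b]
 define h where "h = chart b"
 have bL: "b ~: Lr J" using b loop_sides(2)[OF J(1)] by blast
 have LS: "Lr J Un pim J<=S2 - {b}" using loop_sides(3)[OF J(1)] bL lc(3) gs(3) g(2) by auto
 have hcont: "continuous_on (S2 - {b}) h" and hinj: "inj_on h (S2 - {b})"
  using chart_simps(5)[OF lc(2)] chart_simps(7)[OF lc(2)] by (auto simp: h_def intro!: inj_onI)
 have ins: "inside (h ` pim g) = h ` Lr J"
 proof -
  have "pim (chart b o J) = h ` pim g" using g(2) by (simp add: path_image_compose h_def)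
  moreover have "h ` unchart b ` A = A" for A using chart_simps(1)[OF lc(2)] by (auto simp: h_def image_image)
  ultimately show ?thesis using lc(1) by simp
 qed
 define U D where "U = subpath 0 u g" and "D = subpath u 1 g"
 have u01: "0 < u" "u < 1" "u < w" using uv w by auto
 have imUD: "pim U = g ` {0..u}" "pim D = g ` {u..1}" using u01 by (auto simp: U_def D_def path_image_subpath)
 have "{0..1} = {0..u} Un {u..1}" using u01 by auto
 hence "pim g = g ` {0..u} Un g ` {u..1}" unfolding pim_def by (metis image_Un)
 hence UDg: "pim U Un pim D = pim g" using imUD by simp
 have hI: "h ` A Int h ` B = h ` (A Int B)" if "A<=S2 - {b}" "B<=S2 - {b}" for A B using inj_on_image_Int[OF hinj that] by simp
 have ends: "F s:pim g" "F p:pim g" "F q:pim U" "F t:pim D"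
  unfolding imUD unfolding pim_def w(3)[symmetric] w(4)[symmetric] pq(4,5) using w uv vu u01 by (intro imageI; simp)+
 have inS: "pim U<=S2 - {b}" "pim D<=S2 - {b}" "pim c1<=S2 - {b}" "pim c2<=S2 - {b}"
  using UDg LS g(2) c1(4) c2(4) L1 L2 ends by blast+
 have arcs: "arc U" "arc D"
 proof -
  have "g 0 ~= g u" "g u ~= g 1" using dist(1) w pq g10 by auto
  thus "arc U" "arc D" unfolding U_def D_def using u01 by (auto intro!: arc_simple_path_subpath[OF gs(1)])
 qed
 have int: "pim U Int pim D = {F s, F p}"
 proof
  show "pim U Int pim D<={F s, F p}"
  proof
   fix z assume "z:pim U Int pim D"
   then obtain x y where "x:{0..u}" "y:{u..1}" "z = g x" "g x = g y" unfolding imUD by blast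
   thus "z:{F s, F p}" using inj[of x y] u01 g10 w pq by (cases "y = 1") auto
  qed
  have "F s:g ` {0..u}" "F s:g ` {u..1}" "F p:g ` {0..u}" "F p:g ` {u..1}"
   unfolding pq(4) using u01 w(3) g10 image_eqI[of "F s" g 0 "{0..u}"] image_eqI[of "F s" g 1 "{u..1}"] by auto
  thus "{F s, F p}<=pim U Int pim D" unfolding imUD by blast
 qed
 have hc: "continuous_on A h" "inj_on h A" if "A<=S2 - {b}" for A using that hcont hinj continuous_on_subset inj_on_subset by blast+
 show False
 proof (rule crosscuts_meet[of "h o U" "h (F s)" "h (F p)" "h o D" "h o c1" "h ` pim c2"])
  show "arc (h o U)" "arc (h o D)" "arc (h o c1)" using arc_comp arcs c1(1) hc inS by metis+
  show "pim (h o U) Int pim (h o D) = {h (F s), h (F p)}" unfolding path_image_compose hI[OF inS(1,2)] int by simp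
  have un: "h ` pim U Un h ` pim D = h ` pim g" using UDg by (metis image_Un)
  show "pim (h o c1) - {h (F s), h (F p)}<=inside (pim (h o U) Un pim (h o D))"
   unfolding path_image_compose un ins using c1(4) L1 by auto
  show "connected (h ` pim c2)" using hc(1)[OF inS(4)] c2(1) connected_arc_image connected_continuous_image by blast
  have "pim c2<=Lr J Un pim U Un pim D" using c2(4) L2 ends by auto
  thus "h ` pim c2<=inside (pim (h o U) Un pim (h o D)) Un pim (h o U) Un pim (h o D)"
   unfolding path_image_compose un ins by blast
  show "h ` pim c2 Int pim (h o c1) = {}" unfolding path_image_compose hI[OF inS(4,3)] using disj by auto
  have "F q:pim c2" "F t:pim c2" using c2 by (metis pathstart_in_path_image pathfinish_in_path_image)+
  thus "h ` pim c2 Int pim (h o U) ~= {}" "h ` pim c2 Int pim (h o D) ~= {}" unfolding path_image_compose using ends by blast+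
 qed (use c1 w pq g10 in \<open>auto simp: U_def D_def pathstart_compose pathfinish_compose\<close>)
qed

text \<open>The boundary loop based at \<open>F s\<close> passes \<open>F t\<close> at the parameter
  \<open>w\<close>. Its piece up to \<open>w\<close> is visited increasingly by
  \<open>arcs_monotone\<close>; the rest is visited increasingly along the reversed loop, hence
  decreasingly along this one. So the two pieces belong to \<open>Zplus_of\<close> and
  \<open>Zminus_of\<close>.\<close>

lemma wheel_arcs:
 assumes st: "s < t" "t < s + 2 * pi" "F s ~= F t"
 obtains al bt where "closes al bt" "pst al = F s" "pfn al = F t" "F ` {s..t} = closure (Lr (al +++ bt))"
  "pim al<={F s, F t} Un (\<Union>I\<in>{I. closed_interval_S1 I}. Zplus_of f I)"
  "pim bt<={F s, F t} Un (\<Union>I\<in>{I. closed_interval_S1 I}. Zminus_of f I)"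
proof -
 define I where "I = cis ` {s..t}"
 have c: "ccw_param I s t" using st by (simp add: ccw_param_def I_def)
 have cI: "closed_interval_S1 I" by (rule ccw_closed_interval[OF c])
 have fI: "f ` I = F ` {s..t}" by (simp add: F_def image_image I_def)
 have en: "f ` iv_ends I = {F s, F t}" unfolding iv_ends_eq[OF c] by (simp add: F_def)
 obtain J where J: "loop_in J" "F ` {s..t} = closure (Lr J)" "F s:pim J" "F t:pim J" "disk_bdry (f ` I) = pim J"
  using F_disk[OF st(1,2)] by (metis I_def)
 obtain a where a: "a:{0..1}" "J a = F s" using J(3) unfolding pim_def by (metis imageE)
 define g where "g = shiftpath a J"
 have g: "loop_in g" "pim g = pim J" "Lr g = Lr J" "g 0 = F s" using loop_shift[OF J(1) a(1)] a by (auto simp: g_def)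
 obtain w where w: "w:{0..1}" "g w = F t" using J(4) g(2) unfolding pim_def by (metis imageE)
 have gs: "simple_path g" "pfn g = pst g" using g(1) by (auto simp: loop_in_def)
 have g10: "g 1 = g 0" using gs(2) by (simp add: pst_def pfn_def)
 have w01: "0 < w" "w < 1" using w g(4) g10 st(3) by (auto simp: less_le)
 have bl: "bdry_loop f I g" unfolding bdry_loop_def
 proof (intro conjI ballI)
  fix x assume "x:f ` I - disk_bdry (f ` I)"
  hence "x:Lr J" using J(2,5) fI Lr_topology(2)[OF J(1)] by auto
  thus "left_region g x" using g(3) by (auto simp: Lr_def)
 qed (use gs g J en in auto)
 define P where "P = disk_bdry (f ` I) - f ` iv_ends I"
 have Pg: "P = pim g - {F s, F t}" using J(5) g(2) en by (simp add: P_def)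
 have inj: "x = y \<or> x = 0 & y = 1 \<or> x = 1 & y = 0" if "x:{0..1}" "y:{0..1}" "g x = g y" for x y
  using gs(1) that unfolding simple_path_def loop_free_def by metis
 have gP: "g x:P" if "x:{0..1}" "x ~= 0" "x ~= w" "x ~= 1" for x
  using that inj[of x 0] inj[of x w] g(4) w w01 by (auto simp: Pg pim_def)
 have cont: "continuous_on {0..1} g" using gs(1) simple_path_imp_path by (auto simp: path_def)
 have comp: "EX Y:components P. g ` {x<..<y}<=Y & (ALL z:{0..1}. g z:Y --> z:{x<..<y})" if xy: "x = 0 & y = w \<or> x = w & y = 1" for x y
 proof -
  have x: "0<=x" "x < y" "y<=1" using xy w01 by auto
  define m where "m = (x + y) / 2"
  have m: "m:{x<..<y}" using x by (simp add: m_def)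
  have sub: "g ` {x<..<y}<=P"
  proof (rule image_subsetI)
   fix z assume "z:{x<..<y}"
   thus "g z:P" using xy x w01 by (intro gP) auto
  qed
  define Y where "Y = connected_component_set P (g m)"
  have gm: "g m:P" using sub m by blast
  have Y: "Y:components P" "g m:Y" using gm by (auto simp: Y_def components_def)
  have "connected (g ` {x<..<y})" using cont x by (intro connected_continuous_image) (auto intro: continuous_on_subset)
  hence 1: "g ` {x<..<y}<=Y" using components_maximal[OF Y(1) _ sub] Y(2) m by blast
  have "z:{x<..<y}" if z: "z:{0..1}" "g z:Y" for z
  proof (rule ccontr)
   assume nz: "z ~: {x<..<y}"
   have Yg: "Y:components (pim g - {F s, F t})" using Y(1) Pg by simp
   have zP: "g z ~= F s" "g z ~= F t" using z(2) in_components_subset[OF Y(1)] by (auto simp: Pg)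
   hence z01: "z ~= 0" "z ~= 1" "z ~= w" using g(4) g10 w by auto
   define p q where "p = min z m" and "q = max z m"
   have pq: "0<=p" "p < q" "q<=1" "g p:Y" "g q:Y" "w:{p..q}" using z m x nz Y(2) xy z01 by (auto simp: p_def q_def min_def max_def)
   have "g ` {p..q}<=Y" using loop_component_arc(1)[OF g(1) Yg _ pq(1-5)] g(4) by simp
   hence "g w:Y" using pq(6) by blast
   thus False using in_components_subset[OF Y(1)] w by (auto simp: Pg)
  qed
  thus ?thesis using Y(1) 1 by blast
 qed
 obtain Y1 where Y1: "Y1:components P" "g ` {0<..<w}<=Y1" "ALL z:{0..1}. g z:Y1 --> z:{0<..<w}" using comp[of 0 w] by blast
 obtain Y2 where Y2: "Y2:components P" "g ` {w<..<1}<=Y2" "ALL z:{0..1}. g z:Y2 --> z:{w<..<1}" using comp[of w 1] by blast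
 have agr: "canon_agrees f I Y1" unfolding canon_agrees_def
 proof (intro exI[of _ g] conjI bl allI impI)
  fix x y u v assume h: "x:I & y:I & f x:Y1 & f y:Y1 & iv_le I x y & u:{0..1} & v:{0..1} & g u = f x & g v = f y"
  then obtain p q where pq: "s<=p" "p<=q" "q<=t" "x = cis p" "y = cis q" using iv_le_eq[OF c] by blast
  show "u<=v" by (rule arcs_monotone[OF st(1,2) J(1,2) g(1,2) w01 g(4) w(2) _ _ pq(1-3)]) (use h Y1(3) pq in \<open>auto simp: F_def\<close>)
 qed
 have dis: "canon_disagrees f I Y2" unfolding canon_disagrees_def
 proof (intro exI[of _ g] conjI bl allI impI)
  fix x y u v assume h: "x:I & y:I & f x:Y2 & f y:Y2 & iv_le I x y & u:{0..1} & v:{0..1} & g u = f x & g v = f y"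
  then obtain p q where pq: "s<=p" "p<=q" "q<=t" "x = cis p" "y = cis q" using iv_le_eq[OF c] by blast
  have uv: "u:{w<..<1}" "v:{w<..<1}" using h Y2(3) by auto
  have "1 - u<=1 - v"
   by (rule arcs_monotone[OF st(1,2) J(1,2) loop_in_reversepath[OF g(1)], of "1 - w" "1 - u" "1 - v" p q])
    (use h uv w01 w g g10 pq in \<open>auto simp: F_def reversepath_def path_image_reversepath[unfolded reversepath_def]\<close>)
  thus "v<=u" by simp
 qed
 obtain bt where bt: "closes (subpath 0 w g) bt" "Lr (subpath 0 w g +++ bt) = Lr g" "pim bt = g ` ({0..0} Un {w..1})" "pim (subpath 0 w g) = g ` {0..w}"
  using split_loop[OF g(1), of 0 w] w01 by force
 have "g ` {0..w}<={F s, F t} Un Y1"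
 proof -
  have "{0..w} = {0, w} Un {0<..<w}" using w01 by auto
  thus ?thesis using Y1(2) g(4) w(2) by auto
 qed
 moreover have "Y1<=(\<Union>I\<in>{I. closed_interval_S1 I}. Zplus_of f I)" using agr Y1(1) cI unfolding Zplus_of_def P_def by blast
 moreover have "g ` ({0..0} Un {w..1})<={F s, F t} Un Y2"
 proof -
  have "{0..0} Un {w..1} = {0, w, 1} Un {w<..<1}" using w01 by auto
  thus ?thesis using Y2(2) g(4) w(2) g10 by auto
 qed
 moreover have "Y2<=(\<Union>I\<in>{I. closed_interval_S1 I}. Zminus_of f I)" using dis Y2(1) cI unfolding Zminus_of_def P_def by blast
 ultimately have "pim (subpath 0 w g)<={F s, F t} Un (\<Union>I\<in>{I. closed_interval_S1 I}. Zplus_of f I)"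
  "pim bt<={F s, F t} Un (\<Union>I\<in>{I. closed_interval_S1 I}. Zminus_of f I)" unfolding bt(3,4) by blast+
 thus thesis using that[OF bt(1)] bt(2) g(3,4) w(2) J(2) by simp
qed

end

lemma arc_emb_ray: assumes "arc a" "a ` {0..<1}<=Z" shows "emb_ray Z a"
proof -
 obtain k where k: "homeomorphism {0..1} (pim a) a k" using homeomorphism_arc[OF assms(1)] by blast
 have "homeomorphism {0..<1} (a ` {0..<1}) a k" by (rule homeomorphism_of_subsets[OF k]) (auto simp: pim_def)
 thus ?thesis using assms by (auto simp: emb_ray_def)
qed

text \<open>What the converse uses of a wheel, stated for its periodic lift to the line; in this
  form exchanging \<open>Zp\<close> and \<open>Zm\<close> is the reversal of time, see
  \<open>swap_sys\<close>.\<close>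

locale wheel_sys = zip Zp Zm for Zp Zm +
 fixes F :: "real => real^3"
 assumes Fc: "continuous_on UNIV F" and Fp: "!!t k. F (t + 2 * pi * of_int k) = F t" and Fr: "range F = S2"
  and Farc: "!!s t. s < t ==> t < s + 2 * pi ==> F s ~= F t ==> EX al bt. closes al bt & pst al = F s & pfn al = F t &
   F ` {s..t} = closure (Lr (al +++ bt)) & pim al<={F s, F t} Un Zp & pim bt<={F s, F t} Un Zm"
begin

lemma swap_sys: "wheel_sys Zm Zp (%t. F (- t))"
proof -
 interpret sw: zip Zm Zp by (rule swap)
 show ?thesis
 proof
  show "continuous_on UNIV (%t. F (- t))" by (rule continuous_on_compose2[OF Fc]) (auto intro: continuous_intros)
  show "F (- (t + 2 * pi * of_int k)) = F (- t)" for t k using Fp[of "- t" "- k"] by simp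
  have "range (%t. F (- t)) = F ` range uminus" by blast
  thus "range (%t. F (- t)) = S2" using Fr by simp
  fix s t :: real assume st: "s < t" "t < s + 2 * pi" "F (- s) ~= F (- t)"
  obtain al bt where a: "closes al bt" "pst al = F (- t)" "pfn al = F (- s)" "F ` {- t..- s} = closure (Lr (al +++ bt))"
    "pim al<={F (- t), F (- s)} Un Zp" "pim bt<={F (- t), F (- s)} Un Zm" using Farc[of "- t" "- s"] st by auto
  have "(%t. F (- t)) ` {s..t} = F ` uminus ` {s..t}" by (simp only: image_image)
  also have "\<dots> = F ` {- t..- s}" by simp
  finally have "(%t. F (- t)) ` {s..t} = closure (Lr (bt +++ al))" using a(4) Lr_closes_sym[OF a(1)] by simp
  moreover have "pst bt = F (- s)" "pfn bt = F (- t)" using a(1-3) by (auto simp: closes_def)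
  ultimately show "EX al bt. closes al bt & pst al = F (- s) & pfn al = F (- t) & (%t. F (- t)) ` {s..t} = closure (Lr (al +++ bt)) &
    pim al<={F (- s), F (- t)} Un Zm & pim bt<={F (- s), F (- t)} Un Zp"
   using closes_sym[OF a(1)] a(5,6) by (intro exI[of _ bt] exI[of _ al]) auto
 qed
qed

lemma time_exists: assumes "y:S2" obtains t where "s<=t" "t < s + 2 * pi" "F t = y"
proof -
 obtain x where x: "F x = y" using assms Fr by (metis imageE)
 define t where "t = Arg2pi (cis x / cis s) + s"
 have "cis t = cis x" unfolding t_def by (rule S1_lift) (simp add: S1_def)
 then obtain k :: int where "x = t + 2 * pi * of_int k" using cis_eqD by metis
 hence "F t = y" using x Fp by simp
 thus thesis using that[of t] Arg2pi_ge_0[of "cis x / cis s"] Arg2pi_lt_2pi[of "cis x / cis s"] by (auto simp: t_def)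
qed

lemma Zp_unique: "arc p ==> arc q ==> pim p<=Zp ==> pim q<=Zp ==> pst q = pst p ==> pfn q = pfn p ==> pim q = pim p"
 by (rule unique_arc) (use sub disj in auto)

text \<open>The boundary arc \<open>al\<close> of the image of the interval is an arc in
  \<open>Zp\<close> with the same ends, hence the same arc.\<close>

lemma arc_between:
 assumes st: "s < t" "t < s + 2 * pi" and g: "arc g" "pim g<=Zp" "pst g = F s" "pfn g = F t"
 shows "pim g<=F ` {s..t}"
proof -
 have ne: "F s ~= F t" using g arc_distinct_ends by metis
 obtain al bt where a: "closes al bt" "pst al = F s" "pfn al = F t" "F ` {s..t} = closure (Lr (al +++ bt))" "pim al<={F s, F t} Un Zp"
  using Farc[OF st ne] by blast
 have "{F s, F t}<=Zp" using g by (metis empty_subsetI insert_subset pathfinish_in_path_image pathstart_in_path_image subsetD)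
 hence "pim al = pim g" using Zp_unique[of g al] g a by (auto simp: closes_def)
 moreover have "pim al<=closure (Lr (al +++ bt))" using Lr_topology(2)[OF closes_loop[OF a(1)]] closes_image[OF a(1)] by auto
 ultimately show ?thesis using a(4) by simp
qed

lemma compact_times: "closed A ==> compact {r:{s..t}. F r:A}"
proof -
 assume A: "closed A"
 have "closed (F -` A)" using Fc A by (simp add: continuous_on_closed_vimage closed_vimage)
 moreover have "{r:{s..t}. F r:A} = {s..t} Int F -` A" by auto
 ultimately show ?thesis by (simp add: compact_Int_closed)
qed

text \<open>The times at which the boundary arc is visited do not exhaust the interval; on a gap between two such times the curve makes an excursion
 from a single point of the arc, and this excursion carries the hair.\<close>
lemma left_hair:
 assumes g: "arc gb" "pim gb<=Zp"
 shows "EX r. emb_ray Zp r & ray_left_of gb r"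
proof -
 define p q where "p = pst gb" and "q = pfn gb"
 have pq: "p ~= q" "p:pim gb" "q:pim gb" using arc_distinct_ends[OF g(1)] by (auto simp: p_def q_def)
 hence pS: "p:S2" "q:S2" "p:Zp" "q:Zp" using g sub by auto
 obtain s0 where s0: "F s0 = p" using time_exists[OF pS(1)] by blast
 obtain t0 where t0: "s0<=t0" "t0 < s0 + 2 * pi" "F t0 = q" using time_exists[OF pS(2), of s0] by blast
 \<comment> \<open>The last visit to \<open>p\<close>, followed by the first visit to
   \<open>q\<close>: strictly between these times neither end of \<open>gb\<close> is
   visited.\<close>
 obtain s where s: "s:{s0..t0}" "F s = p" "!!r. r:{s0..t0} ==> F r = p ==> r<=s"
 proof -
  have "{r:{s0..t0}. F r:{p}} ~= {}" using s0 t0 by auto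
  thus thesis using compact_attains_sup[OF compact_times[of "{p}" s0 t0]] that by auto
 qed
 obtain t where t: "t:{s..t0}" "F t = q" "!!r. r:{s..t0} ==> F r = q ==> t<=r"
 proof -
  have "{r:{s..t0}. F r:{q}} ~= {}" using s t0 by auto
  thus thesis using compact_attains_inf[OF compact_times[of "{q}" s t0]] that by auto
 qed
 have "F s ~= F t" using s(2) t(2) pq(1) by simp
 hence st: "s < t" "t < s + 2 * pi" "F s ~= F t" using s(1) t(1) t0(2) by (cases "s = t"; simp)+
 have inner: "F r ~= p" "F r ~= q" if "r:{s<..<t}" for r
 proof -
  have "r:{s0..t0}" "r:{s..t0}" using that s(1) t(1) by auto
  thus "F r ~= p" "F r ~= q" using s(3)[of r] t(3)[of r] that by force+
 qed
 obtain al bt where a: "closes al bt" "pst al = p" "pfn al = q" "F ` {s..t} = closure (Lr (al +++ bt))" "pim al<={p, q} Un Zp" "pim bt<={p, q} Un Zm"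
  using Farc[OF st] s t by auto
 have im: "pim gb = pim al" by (rule Zp_unique) (use a g pS in \<open>auto simp: closes_def p_def q_def\<close>)
 have c: "closes gb bt" "Lr (gb +++ bt) = Lr (al +++ bt)" using Lr_closes_eq[OF a(1) g(1) im] a by (auto simp: p_def q_def)
 have D: "F ` {s..t} = closure (Lr (gb +++ bt))" "loop_in (gb +++ bt)" using a(4) c closes_loop by auto
 define G where "G = {r:{s..t}. F r:pim gb}"
 have clG: "closed G" unfolding G_def using compact_times[OF closed_arc_image[OF g(1)]] compact_imp_closed by blast
 have sG: "s:G" "t:G" using s t st pq by (auto simp: G_def)
 have "EX u:{s..t}. u ~: G"
 proof (rule ccontr)
  assume "~ ?thesis"
  hence "F ` {s..t}<=pim gb" by (auto simp: G_def)
  hence L: "Lr (gb +++ bt)<=pim gb" using D(1) closure_subset by blast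
  have "Lr (gb +++ bt) Int pim gb = {}" using loop_sides(3)[OF D(2)] closes_image[OF c(1)] by auto
  thus False using L loop_sides(1)[OF D(2)] by blast
 qed
 then obtain u where u: "u:{s..t}" "u ~: G" by blast
 hence u': "s < u" "u < t" using sG by (auto simp: less_le)
 obtain s1 s2 where g12: "s1:G" "s2:G" "s<=s1" "s1 < u" "u < s2" "s2<=t" "!!r. s1 < r ==> r < s2 ==> r ~: G"
  using gap_around[OF clG sG u' u(2)] by metis
 have in1: "F s1:pim gb" "F s2:pim gb" using g12 by (auto simp: G_def)
 have only: "r = s1 \<or> r = s2" if "r:{s1..s2}" "F r:pim gb" for r
 proof (rule ccontr)
  assume "~ ?thesis"
  hence "s1 < r" "r < s2" using that by auto
  thus False using g12 that by (auto simp: G_def)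
 qed
 \<comment> \<open>If the gap began and ended at different points of \<open>gb\<close>, the piece of
   \<open>gb\<close> between them would by \<open>arc_between\<close> be visited during the
   gap.\<close>
 have eq: "F s1 = F s2"
 proof (rule ccontr)
  assume ne: "F s1 ~= F s2"
  obtain k where k: "arc k" "pim k<=pim gb" "pst k = F s1" "pfn k = F s2"
   using connected_two_points_arc[OF g(1) connected_arc_image[OF g(1)] order_refl in1 ne] by blast
  have "pim k<=F ` {s1..s2}" by (rule arc_between) (use g12 st k g(2) in auto)
  moreover have "k (1/2):pim k" by (auto simp: pim_def)
  ultimately obtain r where "r:{s1..s2}" "k (1/2) = F r" "F r:pim gb" using k(2) by force
  hence "k (1/2) = k 0 \<or> k (1/2) = k 1" using only k(3,4) by (auto simp: pst_def pfn_def)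
  thus False using k(1) by (auto simp: arc_def dest!: inj_onD)
 qed
 have nc: "F s1 ~= p" "F s1 ~= q"
  using inner[of s1] inner[of s2] eq g12 s(2) t(2) pq(1) u' by (metis greaterThanLessThan_iff less_le less_trans not_less)+
 obtain c0 where c0: "c0:{0..1}" "gb c0 = F s1" using in1 unfolding pim_def by (metis imageE)
 hence c01: "0 < c0" "c0 < 1" using nc by (auto simp: p_def q_def pst_def pfn_def less_le)
 have Fu: "F u ~: pim gb" using u by (auto simp: G_def)
 have su: "s1 < u" "u < s1 + 2 * pi" "F s1 ~= F u" using g12 st u' in1 Fu by auto
 obtain a' b' where a': "closes a' b'" "pst a' = F s1" "pfn a' = F u" "F ` {s1..u} = closure (Lr (a' +++ b'))" "pim a'<={F s1, F u} Un Zp"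
  using Farc[OF su] by blast
 have arc': "arc a'" using a'(1) by (simp add: closes_def)
 hence inj: "x = y" if "a' x = a' y" "x:{0..1}" "y:{0..1}" for x y using that by (auto simp: arc_def dest: inj_onD)
 have e': "a' 0 = F s1" "a' 1 = F u" using a' by (auto simp: pst_def pfn_def)
 have inD: "a' x:F ` {s1..u}" if "x:{0..1}" for x
 proof -
  have "a' x:pim (a' +++ b')" using that closes_image[OF a'(1)] by (auto simp: pim_def)
  thus ?thesis using a'(4) Lr_topology(2)[OF closes_loop[OF a'(1)]] by auto
 qed
 have off: "a' x ~: pim gb" if x: "x:{0<..1}" for x
 proof
  assume m: "a' x:pim gb"
  obtain r where r: "r:{s1..u}" "a' x = F r" using inD[of x] x by auto
  hence "r = s1" using only[of r] m g12 by auto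
  thus False using r e'(1) inj[of x 0] x by auto
 qed
 have inZ: "a' x:Zp" if x: "x:{0..<1}" for x
 proof -
  have "a' x ~= F u" using inj[of x 1] e' x by auto
  moreover have "a' x:pim a'" using x by (auto simp: pim_def)
  ultimately show ?thesis using a'(5) in1 g(2) by force
 qed
 have left: "left_region (gb +++ bt) (a' x)" if x: "x:{0<..1/2}" for x
 proof -
  have "a' x:F ` {s1..u}" using inD[of x] x by auto
  hence "a' x:F ` {s..t}" using g12 u' by (meson atLeastatMost_subset_iff image_mono less_imp_le subsetD)
  moreover have "a' x ~: pim gb" "a' x:Zp" using off[of x] inZ[of x] x by auto
  moreover from this have "a' x ~: pim bt" using a(6) pq disj by blast
  ultimately have "a' x:Lr (gb +++ bt)" using D(1) Lr_topology(2)[OF D(2)] closes_image[OF c(1)] by blast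
  thus ?thesis by (simp add: Lr_def)
 qed
 have "ray_left_of gb a'" unfolding ray_left_of_def
 proof (intro conjI)
  show "EX t0. 0 < t0 & t0 < 1 & a' 0 = gb t0" using c01 c0 e' by auto
  show "ALL s:{0<..<1}. a' s ~: pim gb" using off by auto
  show "EX sc. arc sc & pim sc<=S2 & pst sc = pfn gb & pfn sc = pst gb & pim sc Int pim gb = {pst gb, pfn gb} &
     (EX ep>0. ep < 1 & (ALL s:{0<..ep}. left_region (gb +++ sc) (a' s)))"
   using c(1) left unfolding closes_def by (intro exI[of _ bt] conjI exI[of _ "1/2"]) auto
 qed
 moreover have "emb_ray Zp a'" by (rule arc_emb_ray[OF arc']) (use inZ in auto)
 ultimately show ?thesis by blast
qed

lemma hairy_half: "hairy_set Zp"
 unfolding hairy_set_def ray_right_of_def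
 using left_hair by (metis arc_reversepath path_image_reversepath)

text \<open>The boundary arc in \<open>Zp\<close> of an interval ending at a time of
  \<open>x\<close>, and starting at a time of another point of \<open>Zp\<close>, lands at
  \<open>x\<close>.\<close>

lemma ray_to_point: assumes "x:S2" shows "EX r rb. emb_ray Zp r & extends_ray r rb & rb 1 = x"
proof -
 obtain t where t: "F t = x" using time_exists[OF assms] by blast
 obtain y where y: "y:Zp" "y ~= x"
 proof (rule ccontr)
  assume "~ thesis"
  hence "Zp<={x}" using that by blast
  hence "closure Zp<={x}" by (simp add: closure_minimal)
  hence "S2<={x}" using dense by blast
  thus False using S2_open_not_in_arc[of "linepath x (x + 1)" UNIV] S2_nonempty by (auto simp: arc_linepath)
 qed
 obtain s where s: "t - 2 * pi<=s" "s < t" "F s = y" using time_exists[of y "t - 2 * pi"] y sub by auto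
 have "s ~= t - 2 * pi" using Fp[of s 1] s y t by auto
 then obtain al bt where a: "closes al bt" "pst al = y" "pfn al = x" "pim al<={y, x} Un Zp"
  using Farc[of s t] s t y by auto
 have arc: "arc al" "pim al<=S2" using a(1) by (auto simp: closes_def)
 have inj: "u = 1" if "al u = x" "u:{0..1}" for u using that arc a(3) by (auto simp: arc_def pfn_def dest: inj_onD)
 have "al ` {0..<1}<=Zp"
 proof (rule image_subsetI)
  fix u :: real assume u: "u:{0..<1}"
  hence "al u:pim al" "al u ~= x" using inj[of u] by (auto simp: pim_def)
  thus "al u:Zp" using a(4) y by blast
 qed
 hence "emb_ray Zp al" by (rule arc_emb_ray[OF arc(1)])
 moreover have "extends_ray al al" using arc by (simp add: extends_ray_def)
 ultimately show ?thesis using a(3) by (auto simp: pfn_def)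
qed

text \<open>The intersection of the ray with the disk of a short interval is connected, since arcs in \<open>Z\<^sup>+\<close> are unique.
 Finitely many such disks cover the sphere, so the ray finally stays in one of them.\<close>
lemma ray_cauchy:
 assumes r: "emb_ray Zp r" and e: "e > 0"
 obtains T where "T:{0..<1}" "!!x y. x:{T..<1} ==> y:{T..<1} ==> dist (r x) (r y) < e"
proof -
 have rc: "continuous_on {0..<1} r" "inj_on r {0..<1}" "r ` {0..<1}<=Zp"
  using r by (auto simp: emb_ray_def homeomorphism_def intro: inj_on_inverseI)
 have "uniformly_continuous_on {0..4 * pi} F" using Fc by (intro compact_uniformly_continuous) (auto intro: continuous_on_subset)
 then obtain d where d: "d > 0" "!!a b. a:{0..4 * pi} ==> b:{0..4 * pi} ==> dist b a < d ==> dist (F b) (F a) < e"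
  using e unfolding uniformly_continuous_on_def by metis
 \<comment> \<open>Times at most \<open>w\<close> apart have images less than \<open>e\<close>
   apart, and \<open>w <= pi\<close> keeps each interval below a full turn, as
   \<open>arc_between\<close> requires.\<close>
 define w where "w = min (d / 2) pi"
 have w: "0 < w" "w < d" "w<=pi" using d by (auto simp: w_def)
 obtain N :: nat where N: "2 * pi / w<=real N" using real_arch_simple by blast
 define A where "A i = {x:{0..<1}. r x:F ` {real i * w..real i * w + w}}" for i :: nat
 have cov: "EX i. real i * w<=2 * pi & x:A i" if x: "x:{0..<1}" for x
 proof -
  have "r x:S2" using rc(3) x sub by blast
  then obtain t where t: "0<=t" "t < 2 * pi" "F t = r x" using time_exists[of "r x" 0] by auto
  define i where "i = nat \<lfloor>t / w\<rfloor>"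
  have "real i<=t / w" "t / w < real i + 1" using t w by (auto simp: i_def)
  hence it: "real i * w<=t" "t<=real i * w + w" using w by (auto simp: field_simps)
  hence "r x:F ` {real i * w..real i * w + w}" using t by (metis atLeastAtMost_iff imageI)
  thus ?thesis using it t x by (intro exI[of _ i]) (auto simp: A_def)
 qed
 have conv: "z:A i" if xy: "x:A i" "y:A i" "x<=z" "z<=y" for x y z i
 proof (cases "x = z \<or> z = y")
  case False
  hence o: "x < z" "z < y" "x:{0..<1}" "y:{0..<1}" using xy by (auto simp: A_def)
  obtain a b where ab: "a:{real i * w..real i * w + w}" "b:{real i * w..real i * w + w}" "r x = F a" "r y = F b" using xy by (auto simp: A_def)
  have ne: "F a ~= F b" using inj_onD[OF rc(2)] ab o by (metis less_irrefl less_trans)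
  define k where "k = (%xd. r ((y - x) * xd + x))"
  have rg: "(y - x) * xd + x:{x..y}" if "xd:{0..1}" for xd
  proof -
   have "(y - x) * xd<=(y - x) * 1" using that o by (intro mult_left_mono) auto
   moreover have "0<=(y - x) * xd" using that o by simp
   ultimately show ?thesis by simp
  qed
  have "arc k" unfolding arc_def path_def
  proof
   show "continuous_on {0..1} k" unfolding k_def
    by (rule continuous_on_compose2[OF rc(1)]) (use rg o in \<open>fastforce intro!: continuous_intros\<close>)+
   show "inj_on k {0..1}"
   proof (rule inj_onI)
    fix xd et assume h: "xd:{0..1}" "et:{0..1}" "k xd = k et"
    have "(y - x) * xd + x = (y - x) * et + x" by (rule inj_onD[OF rc(2)]) (use h rg[of xd] rg[of et] o in \<open>auto simp: k_def\<close>)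
    thus "xd = et" using o by simp
   qed
  qed
  have kZ: "pim k<=Zp"
  proof -
   have "k xd:Zp" if "xd:{0..1}" for xd
   proof -
    have "(y - x) * xd + x:{0..<1}" using rg[OF that] o by auto
    thus ?thesis using rc(3) unfolding k_def by blast
   qed
   thus ?thesis by (auto simp: pim_def)
  qed
  have ends: "pst k = F a" "pfn k = F b" using ab by (auto simp: k_def pst_def pfn_def)
  have in1: "pim k<=F ` {real i * w..real i * w + w}"
  proof (cases "a < b")
   case True
   have "pim k<=F ` {a..b}" by (rule arc_between) (use True ab w \<open>arc k\<close> kZ ends pi_gt_zero in auto)
   also have "\<dots> <= F ` {real i * w..real i * w + w}" using ab by (intro image_mono) auto
   finally show ?thesis .
  next
   case False
   hence ba: "b < a" using ne by (cases "a = b") auto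
   have "pim (rvp k)<=F ` {b..a}"
    by (rule arc_between) (use ba ab w \<open>arc k\<close> kZ ends pi_gt_zero in \<open>auto simp: arc_reversepath path_image_reversepath\<close>)
   also have "\<dots> <= F ` {real i * w..real i * w + w}" using ab by (intro image_mono) auto
   finally show ?thesis by (simp add: path_image_reversepath)
  qed
  define zt where "zt = (z - x) / (y - x)"
  have "zt:{0..1}" "(y - x) * zt + x = z" using o by (auto simp: zt_def field_simps)
  hence "r z:pim k" unfolding pim_def k_def by (metis (mono_tags, lifting) imageI)
  thus ?thesis using in1 o by (auto simp: A_def)
 qed (use xy in auto)
 define I where "I = {i :: nat. real i * w<=2 * pi}"
 have finI: "finite I"
 proof (rule finite_subset)
  show "I<={..N}"
  proof
   fix i assume "i:I"
   hence "real i<=2 * pi / w" using w by (simp add: I_def field_simps)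
   thus "i:{..N}" using N by simp
  qed
 qed simp
 have "EX i:I. ALL T:{0..<1}. EX x:A i. T<=x"
 proof (rule ccontr)
  assume "~ ?thesis"
  hence "ALL i:I. EX T:{0..<1}. ALL x:A i. x < T" by (meson not_le)
  then obtain T where T: "!!i. i:I ==> T i:{0..<1}" "!!i x. i:I ==> x:A i ==> x < T i" by metis
  define M where "M = Max (insert 0 (T ` I))"
  have M: "M:{0..<1}" "!!i. i:I ==> T i<=M" using finI T(1) by (auto simp: M_def)
  obtain i where "i:I" "M:A i" using cov[OF M(1)] by (auto simp: I_def)
  thus False using T(2)[of i M] M(2)[of i] by simp
 qed
 then obtain i where i: "i:I" "!!T. T:{0..<1} ==> EX x:A i. T<=x" by blast
 obtain T where T: "T:A i" using i(2)[of 0] by auto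
 have tail: "x:A i" if x: "x:{T..<1}" for x
 proof -
  have "x:{0..<1}" using x T by (auto simp: A_def)
  then obtain y where "y:A i" "x<=y" using i(2) by blast
  thus ?thesis using conv[OF T] x by auto
 qed
 show thesis
 proof (rule that[of T])
  show "T:{0..<1}" using T by (simp add: A_def)
  fix x y assume "x:{T..<1}" "y:{T..<1}"
  then obtain a b where ab: "a:{real i * w..real i * w + w}" "b:{real i * w..real i * w + w}" "r x = F a" "r y = F b"
   using tail[of x] tail[of y] by (auto simp: A_def)
  have iw: "0<=real i * w" "real i * w<=2 * pi" using i(1) w by (auto simp: I_def)
  have "a:{0..4 * pi}" "b:{0..4 * pi}" "dist a b < d" using ab(1,2) iw w pi_gt_zero unfolding dist_real_def atLeastAtMost_iff by linarith+
  hence "dist (F a) (F b) < e" using d(2) by blast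
  thus "dist (r x) (r y) < e" using ab by simp
 qed
qed

text \<open>The limit exists by \<open>ray_cauchy\<close> and is off the ray: otherwise the final
  piece of the ray would close up to a Jordan curve in \<open>Zp\<close>.\<close>

lemma ray_lands: assumes r: "emb_ray Zp r" shows "EX rb. extends_ray r rb"
proof -
 have rc: "continuous_on {0..<1} r" "inj_on r {0..<1}" "r ` {0..<1}<=Zp"
  using r by (auto simp: emb_ray_def homeomorphism_def intro: inj_on_inverseI)
 define sc where "sc n = 1 - 1 / (real n + 2)" for n :: nat
 have sc: "sc n:{0..<1}" for n by (auto simp: sc_def field_simps)
 have big: "EX N. ALL n>=N. sc n >= T" if "T < 1" for T
 proof -
  obtain N where N: "1 / (1 - T)<=real N" using real_arch_simple by blast
  have "T<=sc n" if "n >= N" for n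
  proof -
   have "1 / (1 - T)<=real n + 2" using N that by linarith
   hence "1<=(real n + 2) * (1 - T)" using \<open>T < 1\<close> by (simp add: field_simps)
   thus ?thesis by (simp add: sc_def field_simps)
  qed
  thus ?thesis by blast
 qed
 have "Cauchy (%n. r (sc n))"
 proof (rule metric_CauchyI)
  fix e :: real assume "e > 0"
  then obtain T where T: "T:{0..<1}" "!!x y. x:{T..<1} ==> y:{T..<1} ==> dist (r x) (r y) < e" using ray_cauchy[OF r] by metis
  obtain N where "ALL n>=N. sc n >= T" using big T(1) by auto
  thus "EX M. ALL m>=M. ALL n>=M. dist (r (sc m)) (r (sc n)) < e" using T(2) sc by (metis atLeastLessThan_iff)
 qed
 then obtain x where x: "(%n. r (sc n)) \<longlonglongrightarrow> x" using Cauchy_convergent convergent_def by blast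
 have lim: "EX T:{0..<1}. ALL y:{T..<1}. dist (r y) x < e" if "e > 0" for e
 proof -
  obtain T where T: "T:{0..<1}" "!!x y. x:{T..<1} ==> y:{T..<1} ==> dist (r x) (r y) < e / 2" using ray_cauchy[OF r, of "e / 2"] \<open>e > 0\<close> by (metis half_gt_zero)
  obtain N where N: "ALL n>=N. sc n >= T" using big T(1) by auto
  obtain M where M: "ALL n>=M. dist (r (sc n)) x < e / 2" using x \<open>e > 0\<close> unfolding lim_sequentially by (metis half_gt_zero)
  define n where "n = max M N"
  have "dist (r y) x < e" if "y:{T..<1}" for y

  proof -
   have "T<=sc n" "dist (r (sc n)) x < e / 2" using N M by (auto simp: n_def)
   thus ?thesis using T(2)[of y "sc n"] that sc[of n] dist_triangle[of "r y" x "r (sc n)"] by auto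
  qed
  thus ?thesis using T(1) by blast
 qed
 define rb where "rb t = (if t < 1 then r t else x)" for t
 have rb1: "rb t = r t" if "t < 1" for t using that by (simp add: rb_def)
 have cont: "continuous_on {0..1} rb" unfolding continuous_on_iff
 proof (intro ballI allI impI)
  fix t e :: real assume t: "t:{0..1}" and e: "0 < e"
  show "EX d>0. ALL t':{0..1}. dist t' t < d --> dist (rb t') (rb t) < e"
  proof (cases "t = 1")
   case True
   obtain T where T: "T:{0..<1}" "ALL y:{T..<1}. dist (r y) x < e" using lim[OF e] by blast
   have "dist (rb t') (rb t) < e" if "t':{0..1}" "dist t' t < 1 - T" for t'
    using T that True e by (cases "t' < 1") (auto simp: rb_def dist_real_def)
   thus ?thesis using T(1) by (intro exI[of _ "1 - T"]) auto
  next
   case False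
   hence t1: "t:{0..<1}" using t by auto
   then obtain d where d: "d > 0" "!!t'. t':{0..<1} ==> dist t' t < d ==> dist (r t') (r t) < e" using rc(1) e unfolding continuous_on_iff by metis
   have "dist (rb t') (rb t) < e" if "t':{0..1}" "dist t' t < min d (1 - t)" for t'
    using d(2)[of t'] that t1 by (auto simp: rb_def dist_real_def)
   thus ?thesis using d(1) t1 by (intro exI[of _ "min d (1 - t)"]) auto
  qed
 qed
 have ne: "x ~= r t" if t: "t:{0..<1}" for t
 proof
  assume xt: "x = r t"
  define c where "c = subpath t 1 rb"
  have pc: "path c" unfolding c_def using cont t by (intro path_subpath) (auto simp: path_def)
  have t01: "t:{0..1}" "(1 - t) * s + t:{t..1}" if "s:{0..1}" for s
  proof -
   show "t:{0..1}" using t by auto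
   have "(1 - t) * s<=(1 - t) * 1" using that t by (intro mult_left_mono) auto
   moreover have "0<=(1 - t) * s" using that t by simp
   ultimately show "(1 - t) * s + t:{t..1}" by simp
  qed
  have "loop_free c" unfolding loop_free_def
  proof (intro ballI impI)
   fix a b :: real assume ab: "a:{0..1}" "b:{0..1}" "c a = c b"
   define a' b' where "a' = (1 - t) * a + t" and "b' = (1 - t) * b + t"
   have ab': "a':{t..1}" "b':{t..1}" "rb a' = rb b'" using t01(2)[OF ab(1)] t01(2)[OF ab(2)] ab(3) by (auto simp: a'_def b'_def c_def subpath_def)
   have val: "a' = 1 \<longleftrightarrow> a = 1" "b' = 1 \<longleftrightarrow> b = 1" "a' = t \<longleftrightarrow> a = 0" "b' = t \<longleftrightarrow> b = 0" "a' = b' \<longleftrightarrow> a = b"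
   proof -
    have inj: "(1 - t) * u + t = (1 - t) * v + t \<longleftrightarrow> u = v" for u v using t by auto
    show "a' = 1 \<longleftrightarrow> a = 1" "b' = 1 \<longleftrightarrow> b = 1" "a' = t \<longleftrightarrow> a = 0" "b' = t \<longleftrightarrow> b = 0" "a' = b' \<longleftrightarrow> a = b"
     using inj[of a 1] inj[of b 1] inj[of a 0] inj[of b 0] inj[of a b] by (simp_all add: a'_def b'_def)
   qed
   have rr: "rb y = r t ==> y = t \<or> y = 1" if "y:{t..1}" for y
    using inj_onD[OF rc(2), of y t] that t by (auto simp: rb_def split: if_splits)
   show "a = b \<or> a = 0 & b = 1 \<or> a = 1 & b = 0"
   proof (cases "a' < 1 & b' < 1")
    case True
    hence "a' = b'" using ab' t inj_onD[OF rc(2), of a' b'] by (auto simp: rb1)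
    thus ?thesis using val by simp
   next
    case False
    hence "rb a' = r t" using ab' xt by (auto simp: rb_def)
    hence "a':{t, 1}" "b':{t, 1}" using rr[OF ab'(1)] rr[OF ab'(2)] ab'(3) by auto
    thus ?thesis using val False by auto
   qed
  qed
  hence "simple_path c" using pc by (simp add: simple_path_def)
  moreover have "pfn c = pst c" using xt t by (simp add: c_def rb_def)
  moreover have "pim c<=S2 - Zm"
  proof -
   have "rb y:Zp" if "y:{t..1}" for y using that t rc(3) xt by (cases "y < 1") (auto simp: rb_def)
   hence "pim c<=Zp" using t by (auto simp: c_def path_image_subpath)
   thus ?thesis using sub disj by blast
  qed
  ultimately show False by (rule no_loop)
 qed
 have "inj_on rb {0..1}"
 proof (rule inj_onI)
  fix a b :: real assume "a:{0..1}" "b:{0..1}" "rb a = rb b"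
  thus "a = b" using inj_onD[OF rc(2), of a b] ne[of a] ne[of b] by (auto simp: rb_def split: if_splits)
 qed
 hence "arc rb" using cont by (simp add: arc_def path_def)
 moreover have "pim rb<=S2"
 proof -
  have "closed S2" using compact_S2 compact_imp_closed by blast
  moreover have "r (sc n):S2" for n using sc rc(3) sub by blast
  ultimately have xS: "x:S2" using x closed_sequentially by metis
  have "rb u:S2" if "u:{0..1}" for u
  proof (cases "u < 1")
   case True
   hence "r u:r ` {0..<1}" using that by simp
   thus ?thesis using rc(3) sub True by (auto simp: rb_def)
  qed (simp add: rb_def xS)
  thus ?thesis by (auto simp: pim_def)
 qed
 ultimately show ?thesis unfolding extends_ray_def by (auto simp: rb1)
qed

end

theorem zipper_of_wheel:
 assumes z: "zipper Zp Zm" and w: "catherine_wheel f"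
  and Z: "Zp = (\<Union>I\<in>{I. closed_interval_S1 I}. Zplus_of f I)" "Zm = (\<Union>I\<in>{I. closed_interval_S1 I}. Zminus_of f I)"
 shows "hairy Zp Zm" "strong_landing Zp Zm"
proof -
 interpret wheel f by (rule wheel.intro[OF w])
 interpret zip Zp Zm by (rule zipper_zip[OF z])
 have sys: "wheel_sys Zp Zm F"
 proof
  show "range F = S2" using F_S2 F_onto by (metis image_subset_iff subsetI subset_antisym rangeI)
  fix s t assume "s < t" "t < s + 2 * pi" "F s ~= F t"
  thus "EX al bt. closes al bt & pst al = F s & pfn al = F t & F ` {s..t} = closure (Lr (al +++ bt)) &
    pim al<={F s, F t} Un Zp & pim bt<={F s, F t} Un Zm"
   using wheel_arcs[of s t] Z by metis
 qed (use F_cont F_period in auto)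
 interpret a: wheel_sys Zp Zm F by (rule sys)
 interpret b: wheel_sys Zm Zp "%t. F (- t)" by (rule a.swap_sys)
 show "hairy Zp Zm" using a.hairy_half b.hairy_half by (simp add: hairy_def)
 \<comment> \<open>A landing point in neither set needs a ray of the other set ending there, and
   every point of the sphere is the end of such a ray.\<close>
 have good: "good_landing A B r rb" if "extends_ray r rb" "!!x. x:S2 ==> EX s sb. emb_ray B s & extends_ray s sb & sb 1 = x" for A B r rb
 proof -
  have "rb 1:S2" using that(1) by (auto simp: extends_ray_def pim_def)
  thus ?thesis using that by (auto simp: good_landing_def)
 qed
 show "strong_landing Zp Zm" unfolding strong_landing_def strong_landing_half_def
  using a.ray_lands b.ray_lands a.ray_to_point b.ray_to_point good by meson
qed

theorem theorem3p14:
  fixes Zp Zm :: "(real^3) set"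
  assumes "zipper Zp Zm"
  shows "(\<exists>f. catherine_wheel f \<and>
            Zp = (\<Union>I\<in>{I. closed_interval_S1 I}. Zplus_of f I) \<and>
            Zm = (\<Union>I\<in>{I. closed_interval_S1 I}. Zminus_of f I))
         \<longleftrightarrow> hairy Zp Zm \<and> strong_landing Zp Zm"
  using zipper_of_wheel[OF assms] wheel_of_zipper[OF assms] by blast


end
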